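(* Let $1<p<\infty$, let $\phi:\mathbb{D}\to\mathbb{D}$ be analytic with $\phi\in W^{1,\infty}(\mathbb{D})$, and let $\nu\in W^{1,\infty}(\mathbb{D})$ be real-valued with $\|\nu\|_{L^\infty(\mathbb{D})}\le\kappa$ for some $\kappa\in(0,1)$. Then the composition operator $C_\phi:f\mapsto f\circ\phi$ is compact from $H^p_\nu(\mathbb{D})$ to $H^p_{\nu\circ\phi}(\mathbb{D})$ if and only if $C_\phi$ is compact from $H^p(\mathbb{D})$ to $H^p(\mathbb{D})$.
   Context: $\mathbb{D}$ is the open unit disc. $H^p_\nu(\mathbb{D})$ is the real Banach space of measurable $f:\mathbb{D}\to\mathbb{C}$ solving $\overline\partial f=\nu\,\overline{\partial f}$ in the sense of distributions on $\mathbb{D}$ with norm $\|f\|_{H^p_\nu(\mathbb{D})}=\left(\operatorname{ess\,sup}_{0<r<1}\frac1{2\pi}\int_0^{2\pi}|f(re^{it})|^p\,dt\right)^{1/p}<\infty$ (functions in this space are continuous after modification on a null set). $H^p(\mathbb{D})=H^p_0(\mathbb{D})$ is the classical analytic Hardy space. The function $\nu\circ\phi$ is real-valued, Lipschitz on $\mathbb{D}$ and bounded by $\kappa$. *)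

theory Defs
  imports "HOL-Analysis.Analysis" "HOL-Probability.Essential_Supremum"
begin

abbreviation disc :: "complex set" where
  "disc \<equiv> ball 0 1"

text \<open>Functions on the disc are functions on the whole plane of which only the values on
  \<open>disc\<close> matter. Elements of Lebesgue, Sobolev and Hardy spaces are measurable functions rather than
  classes modulo null sets, so norms below are seminorms on functions, and every notion is invariant
  under modification on a null subset of the disc. Where pointwise values are needed, namely in
  compositions, the continuous representative is used; it is unique on the disc when it exists.\<close>

definition cont_rep :: "(complex \<Rightarrow> 'a::real_normed_vector) \<Rightarrow> complex \<Rightarrow> 'a" where
  "cont_rep f = (SOME g. continuous_on disc g \<and> (AE z in lebesgue_on disc. g z = f z))"

subsection \<open>Distributional derivatives\<close>

definition partial :: "complex \<Rightarrow> (complex \<Rightarrow> complex) \<Rightarrow> complex \<Rightarrow> complex" where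
  "partial e f z = frechet_derivative f (at z) e"

definition dbar :: "(complex \<Rightarrow> complex) \<Rightarrow> complex \<Rightarrow> complex" where
  "dbar f z = (partial 1 f z + \<i> * partial \<i> f z) / 2"

primrec Ck :: "nat \<Rightarrow> (complex \<Rightarrow> complex) \<Rightarrow> bool" where
  "Ck 0 f \<longleftrightarrow> continuous_on UNIV f"
| "Ck (Suc k) f \<longleftrightarrow> (\<forall>z. f differentiable at z) \<and> Ck k (partial 1 f) \<and> Ck k (partial \<i> f)"

definition test_functions :: "(complex \<Rightarrow> complex) set" where
  "test_functions =
     {\<psi>. (\<forall>k. Ck k \<psi>) \<and> (\<exists>K. compact K \<and> K \<subseteq> disc \<and> (\<forall>z. z \<notin> K \<longrightarrow> \<psi> z = 0))}"

definition weak_partial :: "complex \<Rightarrow> (complex \<Rightarrow> complex) \<Rightarrow> (complex \<Rightarrow> complex) \<Rightarrow> bool" where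
  "weak_partial e u v \<longleftrightarrow>
     (\<forall>\<psi>\<in>test_functions.
        (LINT z|lebesgue_on disc. u z * partial e \<psi> z) = - (LINT z|lebesgue_on disc. v z * \<psi> z))"

definition weak_dbar :: "(complex \<Rightarrow> complex) \<Rightarrow> (complex \<Rightarrow> complex) \<Rightarrow> bool" where
  "weak_dbar u v \<longleftrightarrow>
     (\<forall>\<psi>\<in>test_functions.
        (LINT z|lebesgue_on disc. u z * dbar \<psi> z) = - (LINT z|lebesgue_on disc. v z * \<psi> z))"

definition Linf_norm :: "(complex \<Rightarrow> 'a::real_normed_vector) \<Rightarrow> ennreal" where
  "Linf_norm u = esssup (lebesgue_on disc) (\<lambda>z. ennreal (norm (u z)))"

definition Linf :: "(complex \<Rightarrow> complex) set" where
  "Linf = {u \<in> borel_measurable (lebesgue_on disc). Linf_norm u < \<infinity>}"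

definition W1inf :: "(complex \<Rightarrow> complex) set" where
  "W1inf = {u \<in> Linf. (\<exists>v\<in>Linf. weak_partial 1 u v) \<and> (\<exists>v\<in>Linf. weak_partial \<i> u v)}"

subsection \<open>The conjugate Beltrami equation and generalized Hardy spaces\<close>

text \<open>The equation \<open>dbar f = \<nu> * cnj (d f)\<close> in the sense of distributions, for \<open>f\<close> integrable and \<open>\<nu>\<close>
  real-valued in \<open>W\<^sup>1\<^sup>,\<^sup>\<infinity>\<close>. As \<open>cnj (d f) = dbar (cnj f)\<close>, its right-hand side is the distribution
  \<open>\<psi> \<mapsto> \<langle>dbar (cnj f), \<nu> \<psi>\<rangle> = - \<integral> cnj f * dbar (\<nu> \<psi>)\<close>,
  where \<open>dbar (\<nu> \<psi>) = \<nu> * dbar \<psi> + (dbar \<nu>) * \<psi>\<close> with \<open>N = dbar \<nu>\<close> the bounded weak derivative of \<open>\<nu>\<close>,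
  which is unique almost everywhere.\<close>

definition conj_beltrami :: "(complex \<Rightarrow> real) \<Rightarrow> (complex \<Rightarrow> complex) \<Rightarrow> bool" where
  "conj_beltrami \<nu> f \<longleftrightarrow>
     (\<exists>N\<in>Linf. weak_dbar (\<lambda>z. of_real (\<nu> z)) N \<and>
        (\<forall>\<psi>\<in>test_functions.
           (LINT z|lebesgue_on disc. f z * dbar \<psi> z) =
           (LINT z|lebesgue_on disc. cnj (f z) * (of_real (\<nu> z) * dbar \<psi> z + N z * \<psi> z))))"

definition circle_mean :: "real \<Rightarrow> (complex \<Rightarrow> complex) \<Rightarrow> real \<Rightarrow> ennreal" where
  "circle_mean p f r =
     ennreal (1 / (2 * pi)) *
     (\<integral>\<^sup>+t\<in>{0..2 * pi}. ennreal (cmod (f (of_real r * cis t)) powr p) \<partial>lebesgue)"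

definition hardy_sup :: "real \<Rightarrow> (complex \<Rightarrow> complex) \<Rightarrow> ennreal" where
  "hardy_sup p f = esssup (lebesgue_on {0<..<1}) (circle_mean p f)"

definition hardy_norm :: "real \<Rightarrow> (complex \<Rightarrow> complex) \<Rightarrow> real" where
  "hardy_norm p f = enn2real (hardy_sup p f) powr (1 / p)"

definition hardy_space :: "real \<Rightarrow> (complex \<Rightarrow> real) \<Rightarrow> (complex \<Rightarrow> complex) set" where
  "hardy_space p \<nu> =
     {f \<in> borel_measurable (lebesgue_on disc). conj_beltrami \<nu> f \<and> hardy_sup p f < \<infinity>}"

subsection \<open>Compactness of composition operators\<close>

text \<open>Here \<open>nX\<close> and \<open>nY\<close> are the seminorms of \<open>X\<close> and \<open>Y\<close>. Linearity is not required by the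
  definition; composition operators are linear modulo null sets.\<close>

definition compact_operator ::
    "'a set \<Rightarrow> ('a \<Rightarrow> real) \<Rightarrow> 'b::minus set \<Rightarrow> ('b \<Rightarrow> real) \<Rightarrow> ('a \<Rightarrow> 'b) \<Rightarrow> bool" where
  "compact_operator X nX Y nY T \<longleftrightarrow>
     (\<forall>x\<in>X. T x \<in> Y) \<and>
     (\<forall>x::nat \<Rightarrow> 'a. (\<forall>n. x n \<in> X) \<and> (\<exists>B. \<forall>n. nX (x n) \<le> B) \<longrightarrow>
        (\<exists>y\<in>Y. \<exists>r::nat \<Rightarrow> nat. strict_mono r \<and> (\<lambda>n. nY (T (x (r n)) - y)) \<longlonglongrightarrow> 0))"

definition comp_op ::
    "(complex \<Rightarrow> complex) \<Rightarrow> (complex \<Rightarrow> 'a::real_normed_vector) \<Rightarrow> complex \<Rightarrow> 'a" where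
  "comp_op \<phi> f = cont_rep f \<circ> \<phi>"

end

theory Submission
  imports Defs "HOL-Complex_Analysis.Complex_Analysis" "HOL-Real_Asymp.Real_Asymp"
begin

text \<open>Write the equation \<open>dbar f = \<nu> cnj (d f)\<close> in terms of \<open>g = f - \<nu> cnj f\<close>. It becomes
  \<open>dbar g = - N cnj f\<close> with \<open>N = dbar \<nu>\<close> bounded, and \<open>f\<close> is recovered from \<open>g\<close> pointwise because \<open>\<bar>\<nu>\<bar> \<le> \<kappa> < 1\<close>.
  With a Cauchy transform \<open>T\<close>, a right inverse of \<open>dbar\<close>, the function \<open>G = g - T (- N cnj f)\<close> is weakly holomorphic, hence
  holomorphic by Weyl's lemma. So the solution \<open>f\<close> has an analytic part \<open>G\<close>, and \<open>f\<close> and \<open>G\<close> bound each other up to the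
  term \<open>T (- N cnj f)\<close> (lemmas \<open>conj_beltrami_iff\<close>, \<open>hardy_space_imp_linked\<close>, \<open>norm_analytic_part_le\<close> and
  \<open>norm_le_analytic_part\<close>).

  That term is harmless for compactness. The transform maps bounded sets of functions with bounded circle means to bounded
  and equicontinuous sets of continuous functions on the closed disc (\<open>riesz_near_bound\<close>, \<open>T_equicontinuous\<close>). The point is
  that \<open>\<bar>h\<bar>\<^sup>p\<close> is integrated over circles, so the kernel need only be integrable in the radial direction, after an
  inequality of Young type. Given a bounded sequence of solutions, the Arzela-Ascoli theorem makes the transforms
  converge uniformly along a subsequence, and Montel's theorem makes the analytic parts converge locally uniformly
  (\<open>linked_subsequence\<close>). Composed with \<open>\<phi>\<close>, the solutions converge in norm if and only if the analytic parts do, because a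
  uniformly small error is small in norm and a norm limit must be the pointwise limit
  (\<open>compact_composition_iff_classical\<close>).

  To pass from generalized to classical Hardy spaces every bounded sequence of analytic functions has to be a
  bounded sequence of analytic parts. The equation for \<open>f\<close> with given \<open>G\<close> is a fixed point problem. It becomes a contraction when the Cauchy
  kernel is multiplied by an exponential \<open>exp (l cnj \<zeta> (z - \<zeta>))\<close> with large \<open>l\<close> and the sup norm is taken with the weight
  \<open>exp (- l \<bar>z\<bar>\<^sup>2 / 2)\<close> (\<open>T_weighted_small\<close>, \<open>solution_with_analytic_part\<close>).

  It remains to see that \<open>f \<circ> \<phi>\<close> solves the equation with coefficient \<open>\<nu> \<circ> \<phi>\<close>. Both \<open>\<nu>\<close> and \<open>f - \<nu> cnj f\<close> are sums of
  a holomorphic function and a Cauchy transform, and for these the chain rule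
  \<open>dbar (u \<circ> \<phi>) = (dbar u \<circ> \<phi>) cnj (deriv \<phi>)\<close> holds weakly: it is classical for polynomials in \<open>z\<close> and \<open>cnj z\<close>, and
  the general case follows by approximation, as a nonconstant holomorphic map pulls null sets back to null sets
  (\<open>weak_chain_rule\<close>, \<open>hardy_space_compose\<close>).\<close>

section \<open>Polar coordinates in the plane\<close>

lemma lborel_complex_eq:
  "(lborel :: complex measure) = distr (lborel \<Otimes>\<^sub>M lborel) borel (\<lambda>(x, y). Complex x y)"
proof (rule lborel_eqI)
  fix l u :: complex
  assume le: "\<And>b. b \<in> Basis \<Longrightarrow> l \<bullet> b \<le> u \<bullet> b"
  then have le': "Re l \<le> Re u" "Im l \<le> Im u"
    using le[of 1] le[of \<i>] by (auto simp: Basis_complex_def)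
  have eq: "(\<lambda>(x, y). Complex x y) -` box l u \<inter> space (lborel \<Otimes>\<^sub>M lborel)
      = {Re l<..<Re u} \<times> {Im l<..<Im u}"
    by (auto simp: box_def Basis_complex_def space_pair_measure)
  have [measurable]: "(\<lambda>(x, y). Complex x y) \<in> borel_measurable (lborel \<Otimes>\<^sub>M lborel)"
    by (simp add: Complex_eq split_beta)
  show "emeasure (distr (lborel \<Otimes>\<^sub>M lborel) borel (\<lambda>(x, y). Complex x y)) (box l u) =
      ennreal (\<Prod>b\<in>Basis. (u - l) \<bullet> b)"
    by (subst emeasure_distr)
       (use le' in \<open>auto simp: eq lborel.emeasure_pair_measure_Times Basis_complex_def ennreal_mult\<close>)
qed simp

lemma nn_integral_complex:
  assumes [measurable]: "F \<in> borel_measurable borel"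
  shows "(\<integral>\<^sup>+z. F z \<partial>lborel) = (\<integral>\<^sup>+x. \<integral>\<^sup>+y. F (Complex x y) \<partial>lborel \<partial>lborel)"
proof -
  have [measurable]: "(\<lambda>(x, y). Complex x y) \<in> borel_measurable (lborel \<Otimes>\<^sub>M lborel)"
    by (simp add: Complex_eq split_beta)
  show ?thesis
    by (subst lborel_complex_eq, subst nn_integral_distr)
       (auto simp: lborel.nn_integral_fst[symmetric] split_beta)
qed

lemma borel_measurable_tan [measurable]: "(tan :: real \<Rightarrow> real) \<in> borel_measurable borel"
proof -
  have [measurable]: "(sin :: real \<Rightarrow> real) \<in> borel_measurable borel" "(cos :: real \<Rightarrow> real) \<in> borel_measurable borel"
    by (intro borel_measurable_continuous_onI continuous_intros)+
  show ?thesis unfolding tan_def[abs_def] by measurable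
qed

lemma borel_measurable_cis [measurable]: "cis \<in> borel_measurable borel"
  by (intro borel_measurable_continuous_onI continuous_intros)

lemma borel_measurable_Complex [measurable]:
  assumes "f \<in> borel_measurable M" "g \<in> borel_measurable M"
  shows "(\<lambda>x. Complex (f x) (g x)) \<in> borel_measurable M"
  using assms by (simp add: Complex_eq)

lemma lborel_eq_distr_tan:
  "(lborel :: real measure) =
     distr (density lborel (\<lambda>t. ennreal ((1 + (tan t)\<^sup>2) * indicator {-pi/2<..<pi/2} t))) borel tan"
proof (rule lborel_eqI)
  fix l u :: real
  assume "\<And>b. b \<in> Basis \<Longrightarrow> l \<bullet> b \<le> u \<bullet> b"
  then have lu: "l \<le> u" by simp
  let ?d = "\<lambda>t. ennreal ((1 + (tan t)\<^sup>2) * indicator {-pi/2<..<pi/2} t)"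
  have sub: "x < pi/2 \<and> -pi/2 < x" if "arctan l \<le> x" "x \<le> arctan u" for x
    using that arctan_bounded[of l] arctan_bounded[of u] by auto
  have deriv: "(tan has_real_derivative 1 + (tan x)\<^sup>2) (at x)"
    if "arctan l \<le> x" "x \<le> arctan u" for x
  proof -
    have "cos x > 0" using sub[OF that] by (intro cos_gt_zero_pi) auto
    then show ?thesis
      by (auto intro!: derivative_eq_intros simp: tan_def field_simps power2_eq_square)
  qed
  have eq: "?d t * indicator {l<..<u} (tan t) =
      ennreal (1 + (tan t)\<^sup>2) * indicator {arctan l<..<arctan u} t" for t
  proof (cases "-pi/2 < t \<and> t < pi/2")
    case True
    then have "arctan (tan t) = t" by (intro arctan_tan) auto
    then have "l < tan t \<longleftrightarrow> arctan l < t" "tan t < u \<longleftrightarrow> t < arctan u"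
      by (metis arctan_less_iff)+
    then show ?thesis using True by (auto simp: indicator_def)
  next
    case False
    then have "t \<notin> {arctan l<..<arctan u}" using sub[of t] by auto
    with False show ?thesis by (auto simp: indicator_def)
  qed
  have "emeasure (distr (density lborel ?d) borel tan) (box l u)
      = (\<integral>\<^sup>+t. ?d t * indicator {l<..<u} (tan t) \<partial>lborel)"
  proof -
    have "emeasure (distr (density lborel ?d) borel tan) (box l u) =
        (\<integral>\<^sup>+t. indicator {l<..<u} t \<partial>distr (density lborel ?d) borel tan)" by (simp add: box_real)
    also have "\<dots> = (\<integral>\<^sup>+t. ?d t * indicator {l<..<u} (tan t) \<partial>lborel)"
      by (subst nn_integral_distr) (auto simp: nn_integral_density)
    finally show ?thesis .
  qed
  also have "\<dots> = (\<integral>\<^sup>+t. ennreal (1 + (tan t)\<^sup>2) * indicator {arctan l<..<arctan u} t \<partial>lborel)"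
    by (simp only: eq)
  also have "\<dots> = (\<integral>\<^sup>+t. ennreal (1 + (tan t)\<^sup>2) * indicator {arctan l..arctan u} t \<partial>lborel)"
  proof (intro nn_integral_cong_AE)
    have "AE t in lborel. t \<noteq> arctan l \<and> t \<noteq> arctan u"
      by (intro AE_conjI AE_lborel_singleton)
    then show "AE t in lborel. ennreal (1 + (tan t)\<^sup>2) * indicator {arctan l<..<arctan u} t =
        ennreal (1 + (tan t)\<^sup>2) * indicator {arctan l..arctan u} t"
      by eventually_elim (auto simp: indicator_def)
  qed
  also have "\<dots> = tan (arctan u) - tan (arctan l)"
    using lu by (intro nn_integral_FTC_Icc deriv) (auto simp: arctan_le_iff)
  finally show "emeasure (distr (density lborel ?d) borel tan) (box l u) = ennreal (\<Prod>b\<in>Basis. (u - l) \<bullet> b)"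
    by (simp add: tan_arctan)
qed simp

lemma nn_integral_right_half_plane:
  fixes F :: "complex \<Rightarrow> ennreal"
  assumes [measurable]: "F \<in> borel_measurable borel"
  shows "(\<integral>\<^sup>+x. \<integral>\<^sup>+y. F (Complex x y) * indicator {0<..} x \<partial>lborel \<partial>lborel) =
    (\<integral>\<^sup>+r. \<integral>\<^sup>+t. ennreal r * F (of_real r * cis t) * indicator {-pi/2<..<pi/2} t * indicator {0<..} r
        \<partial>lborel \<partial>lborel)" (is "?L = ?R")
proof -
  let ?d = "\<lambda>t. ennreal ((1 + (tan t)\<^sup>2) * indicator {-pi/2<..<pi/2} t)"
  have 1: "(\<integral>\<^sup>+y. F (Complex x y) * indicator {0<..} x \<partial>lborel) =
      (\<integral>\<^sup>+t. ?d t * (F (Complex x (x * tan t)) * (indicator {0<..} x * ennreal x)) \<partial>lborel)" for x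
  proof (cases "x > 0")
    case True
    have "(\<integral>\<^sup>+y. F (Complex x y) * indicator {0<..} x \<partial>lborel) =
        ennreal x * (\<integral>\<^sup>+s. F (Complex x (x * s)) * indicator {0<..} x \<partial>lborel)"
      using True by (subst nn_integral_real_affine[where c = x and t = 0]) auto
    also have "\<dots> = (\<integral>\<^sup>+s. F (Complex x (x * s)) * (indicator {0<..} x * ennreal x) \<partial>lborel)"
      by (subst nn_integral_cmult[symmetric]) (auto simp: mult_ac)
    also have "\<dots> = (\<integral>\<^sup>+t. ?d t * (F (Complex x (x * tan t)) * (indicator {0<..} x * ennreal x)) \<partial>lborel)"
      by (subst lborel_eq_distr_tan, subst nn_integral_distr) (auto simp: nn_integral_density)
    finally show ?thesis .
  qed simp
  have 2: "(\<integral>\<^sup>+x. ?d t * (F (Complex x (x * tan t)) * (indicator {0<..} x * ennreal x)) \<partial>lborel) =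
     (\<integral>\<^sup>+r. ennreal r * F (of_real r * cis t) * indicator {-pi/2<..<pi/2} t * indicator {0<..} r \<partial>lborel)" for t
  proof (cases "-pi/2 < t \<and> t < pi/2")
    case True
    then have c: "cos t > 0" by (intro cos_gt_zero_pi) auto
    then have d: "(1 + (tan t)\<^sup>2) * (cos t)\<^sup>2 = 1"
      by (simp add: tan_def field_simps)
    have e: "ennreal (cos t) * (?d t * (F (Complex (cos t * r) (cos t * r * tan t)) * (indicator {0<..} (cos t * r) * ennreal (cos t * r))))
       = ennreal r * F (of_real r * cis t) * indicator {-pi/2<..<pi/2} t * indicator {0<..} r" for r
    proof (cases "r > 0")
      case r: True
      have "Complex (cos t * r) (cos t * r * tan t) = of_real r * cis t"
        using c by (auto simp: complex_eq_iff tan_def)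
      moreover have "ennreal (cos t) * (?d t * ennreal (cos t * r)) = ennreal (cos t * ((1 + (tan t)\<^sup>2) * (cos t * r)))"
      proof -
        have "0 \<le> 1 + (tan t)\<^sup>2" "0 \<le> cos t * r" "0 \<le> cos t" using c r by auto
        moreover have "?d t = ennreal (1 + (tan t)\<^sup>2)" using True by (simp only: indicator_def) simp
        ultimately show ?thesis by (simp only: ennreal_mult mult_nonneg_nonneg)
      qed
      moreover have "cos t * ((1 + (tan t)\<^sup>2) * (cos t * r)) = r"
        using d by (metis (no_types, opaque_lifting) mult.assoc mult.commute mult_1 power2_eq_square)
      ultimately show ?thesis using r c True by (simp add: mult_ac zero_less_mult_iff) (metis mult.assoc mult.commute)
    qed (use c in \<open>auto simp: zero_less_mult_iff\<close>)
    have "(\<integral>\<^sup>+x. ?d t * (F (Complex x (x * tan t)) * (indicator {0<..} x * ennreal x)) \<partial>lborel) = 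
      ennreal (cos t) * (\<integral>\<^sup>+r. ?d t * (F (Complex (cos t * r) (cos t * r * tan t)) * (indicator {0<..} (cos t * r) * ennreal (cos t * r))) \<partial>lborel)"
      using c by (subst nn_integral_real_affine[where c = "cos t" and t = 0]) auto
    also have "\<dots> = (\<integral>\<^sup>+r. ennreal (cos t) * (?d t * (F (Complex (cos t * r) (cos t * r * tan t)) * (indicator {0<..} (cos t * r) * ennreal (cos t * r)))) \<partial>lborel)"
      by (subst nn_integral_cmult) auto
    finally show ?thesis by (simp only: e)
  qed simp
  have "?L = (\<integral>\<^sup>+x. \<integral>\<^sup>+t. ?d t * (F (Complex x (x * tan t)) * (indicator {0<..} x * ennreal x)) \<partial>lborel \<partial>lborel)"
    by (simp only: 1)
  also have "\<dots> = (\<integral>\<^sup>+t. \<integral>\<^sup>+x. ?d t * (F (Complex x (x * tan t)) * (indicator {0<..} x * ennreal x)) \<partial>lborel \<partial>lborel)"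
    by (intro lborel_pair.Fubini') measurable
  also have "\<dots> = (\<integral>\<^sup>+t. \<integral>\<^sup>+r. ennreal r * F (of_real r * cis t) * indicator {-pi/2<..<pi/2} t * indicator {0<..} r \<partial>lborel \<partial>lborel)"
    by (simp only: 2)
  also have "\<dots> = ?R"
    by (intro lborel_pair.Fubini') measurable
  finally show ?thesis .
qed

text \<open>The point reflection \<open>z \<mapsto> - z\<close> exchanges the half planes and shifts the angle by \<open>\<pi>\<close>.\<close>

lemma nn_integral_left_half_plane:
  fixes F :: "complex \<Rightarrow> ennreal"
  assumes [measurable]: "F \<in> borel_measurable borel"
  shows "(\<integral>\<^sup>+x. \<integral>\<^sup>+y. F (Complex x y) * indicator {..<0} x \<partial>lborel \<partial>lborel) =
    (\<integral>\<^sup>+r. \<integral>\<^sup>+t. ennreal r * F (of_real r * cis t) * indicator {pi/2<..<3*pi/2} t * indicator {0<..} r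
        \<partial>lborel \<partial>lborel)" (is "?L = ?R")
proof -
  have minus: "Complex (-x) (-y) = - Complex x y" for x y
    by (simp add: complex_eq_iff)
  have "?L = (\<integral>\<^sup>+x. \<integral>\<^sup>+y. F (Complex (-x) y) * indicator {0<..} x \<partial>lborel \<partial>lborel)"
    by (subst nn_integral_real_affine[where c = "-1" and t = 0]) (auto simp: indicator_def cong: nn_integral_cong)
  also have "\<dots> = (\<integral>\<^sup>+x. \<integral>\<^sup>+y. F (- Complex x y) * indicator {0<..} x \<partial>lborel \<partial>lborel)"
  proof (rule nn_integral_cong)
    fix x :: real
    show "(\<integral>\<^sup>+y. F (Complex (-x) y) * indicator {0<..} x \<partial>lborel) =
        (\<integral>\<^sup>+y. F (- Complex x y) * indicator {0<..} x \<partial>lborel)"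
    proof -
      have "(\<integral>\<^sup>+y. F (Complex (-x) y) * indicator {0<..} x \<partial>lborel) =
          ennreal \<bar>-1\<bar> * (\<integral>\<^sup>+y. F (Complex (-x) (0 + (-1) * y)) * indicator {0<..} x \<partial>lborel)"
        by (rule nn_integral_real_affine) auto
      also have "\<dots> = (\<integral>\<^sup>+y. F (Complex (-x) (-y)) * indicator {0<..} x \<partial>lborel)"
        by simp
      finally show ?thesis by (simp only: minus)
    qed
  qed
  also have "\<dots> = (\<integral>\<^sup>+r. \<integral>\<^sup>+t. ennreal r * F (- (of_real r * cis t)) * indicator {-pi/2<..<pi/2} t * indicator {0<..} r
        \<partial>lborel \<partial>lborel)"
    by (intro nn_integral_right_half_plane) measurable
  also have "\<dots> = ?R"
  proof (rule nn_integral_cong)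
    fix r :: real
    have 1: "cis (pi + t) = - cis t" for t
      by (auto simp: complex_eq_iff)
    have "(\<integral>\<^sup>+t. ennreal r * F (of_real r * cis t) * indicator {pi/2<..<3*pi/2} t * indicator {0<..} r \<partial>lborel)
      = (\<integral>\<^sup>+t. ennreal r * F (of_real r * cis (pi + t)) * indicator {pi/2<..<3*pi/2} (pi + t) * indicator {0<..} r \<partial>lborel)"
      by (subst nn_integral_real_affine[where c = "1" and t = pi]) auto
    also have "\<dots> = (\<integral>\<^sup>+t. ennreal r * F (- (of_real r * cis t)) * indicator {-pi/2<..<pi/2} t * indicator {0<..} r \<partial>lborel)"
      unfolding 1 by (intro nn_integral_cong) (auto simp: indicator_def)
    finally show "(\<integral>\<^sup>+t. ennreal r * F (- (of_real r * cis t)) * indicator {-pi/2<..<pi/2} t * indicator {0<..} r \<partial>lborel) =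
     (\<integral>\<^sup>+t. ennreal r * F (of_real r * cis t) * indicator {pi/2<..<3*pi/2} t * indicator {0<..} r \<partial>lborel)" ..
  qed
  finally show ?thesis .
qed

text \<open>Each half plane is parametrised through \<open>y = x tan t\<close>, \<open>x = r cos t\<close>, which are substitutions in one
  variable at a time; periodicity then moves the angles to \<open>[0, 2\<pi>]\<close>.\<close>

lemma nn_integral_polar:
  fixes F :: "complex \<Rightarrow> ennreal"
  assumes [measurable]: "F \<in> borel_measurable borel"
  shows "(\<integral>\<^sup>+z. F z \<partial>lborel) =
    (\<integral>\<^sup>+r. \<integral>\<^sup>+t. ennreal r * F (of_real r * cis t) * indicator {0..2*pi} t * indicator {0<..} r
        \<partial>lborel \<partial>lborel)" (is "_ = ?R")
proof -
  have "(\<integral>\<^sup>+z. F z \<partial>lborel) = (\<integral>\<^sup>+x. \<integral>\<^sup>+y. F (Complex x y) \<partial>lborel \<partial>lborel)"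
    by (rule nn_integral_complex) fact
  also have "\<dots> = (\<integral>\<^sup>+x. (\<integral>\<^sup>+y. F (Complex x y) * indicator {0<..} x \<partial>lborel) +
      (\<integral>\<^sup>+y. F (Complex x y) * indicator {..<0} x \<partial>lborel) \<partial>lborel)"
  proof (intro nn_integral_cong_AE)
    show "AE x in lborel. (\<integral>\<^sup>+y. F (Complex x y) \<partial>lborel) =
      (\<integral>\<^sup>+y. F (Complex x y) * indicator {0<..} x \<partial>lborel) +
      (\<integral>\<^sup>+y. F (Complex x y) * indicator {..<0} x \<partial>lborel)"
      using AE_lborel_singleton[of "0::real"]
      by eventually_elim (auto simp: indicator_def)
  qed
  also have "\<dots> = (\<integral>\<^sup>+r. \<integral>\<^sup>+t. ennreal r * F (of_real r * cis t) * indicator {-pi/2<..<pi/2} t * indicator {0<..} r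
        \<partial>lborel \<partial>lborel) +
     (\<integral>\<^sup>+r. \<integral>\<^sup>+t. ennreal r * F (of_real r * cis t) * indicator {pi/2<..<3*pi/2} t * indicator {0<..} r
        \<partial>lborel \<partial>lborel)"
    by (subst nn_integral_add) (auto simp: nn_integral_left_half_plane nn_integral_right_half_plane)
  also have "\<dots> = (\<integral>\<^sup>+r. (\<integral>\<^sup>+t. ennreal r * F (of_real r * cis t) * indicator {-pi/2<..<pi/2} t * indicator {0<..} r \<partial>lborel)
        + (\<integral>\<^sup>+t. ennreal r * F (of_real r * cis t) * indicator {pi/2<..<3*pi/2} t * indicator {0<..} r \<partial>lborel)
        \<partial>lborel)"
    by (subst nn_integral_add) auto
  also have "\<dots> = ?R"
  proof (rule nn_integral_cong)
    fix r :: real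
    let ?f = "\<lambda>t. ennreal r * F (of_real r * cis t) * indicator {0<..} r"
    have per: "cis (2*pi + t) = cis t" for t by (metis cis_2pi cis_mult mult_1)
    have ae: "AE t in lborel. t \<noteq> pi/2 \<and> t \<noteq> 3*pi/2 \<and> t \<noteq> 0 \<and> t \<noteq> 2*pi"
      by (intro AE_conjI AE_lborel_singleton)
    let ?I = "\<lambda>S. \<integral>\<^sup>+t. ?f t * indicator S t \<partial>lborel"
    have I_Un: "?I (A \<union> B) = ?I A + ?I B"
      if "A \<inter> B = {}" and [measurable]: "A \<in> sets borel" "B \<in> sets borel" for A B
    proof -
      have "?I (A \<union> B) = (\<integral>\<^sup>+t. ?f t * indicator A t + ?f t * indicator B t \<partial>lborel)"
        using that by (intro nn_integral_cong) (auto simp: indicator_def)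
      then show ?thesis by (simp add: nn_integral_add)
    qed
    have shift: "?I {3*pi/2<..<2*pi} = ?I {-pi/2<..<0}"
    proof -
      have "?I {3*pi/2<..<2*pi} =
          ennreal \<bar>1\<bar> * (\<integral>\<^sup>+t. ?f (2*pi + 1*t) * indicator {3*pi/2<..<2*pi} (2*pi + 1*t) \<partial>lborel)"
        by (rule nn_integral_real_affine) auto
      moreover have "(\<integral>\<^sup>+t. ?f (2*pi + 1*t) * indicator {3*pi/2<..<2*pi} (2*pi + 1*t) \<partial>lborel) = ?I {-pi/2<..<0}"
        unfolding mult_1 per
        by (rule nn_integral_cong) (auto simp: indicator_def)
      ultimately show ?thesis by simp
    qed
    have "{-pi/2<..<pi/2} = {-pi/2<..<0} \<union> {0..<pi/2}" by auto
    then have left: "?I {-pi/2<..<pi/2} = ?I {3*pi/2<..<2*pi} + ?I {0..<pi/2}"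
      by (simp only: shift, subst I_Un[symmetric]) auto
    have "?I {-pi/2<..<pi/2} + ?I {pi/2<..<3*pi/2} = ?I ({3*pi/2<..<2*pi} \<union> {0..<pi/2} \<union> {pi/2<..<3*pi/2})"
      unfolding left by (subst I_Un; (subst I_Un)?; auto)
    moreover have "?I ({3*pi/2<..<2*pi} \<union> {0..<pi/2} \<union> {pi/2<..<3*pi/2}) = ?I {0..2*pi}"
      by (intro nn_integral_cong_AE, use ae in eventually_elim) (auto simp: indicator_def)
    ultimately have "?I {-pi/2<..<pi/2} + ?I {pi/2<..<3*pi/2} = ?I {0..2*pi}" by (rule trans)
    then show "(\<integral>\<^sup>+t. ennreal r * F (of_real r * cis t) * indicator {-pi/2<..<pi/2} t * indicator {0<..} r \<partial>lborel)
        + (\<integral>\<^sup>+t. ennreal r * F (of_real r * cis t) * indicator {pi/2<..<3*pi/2} t * indicator {0<..} r \<partial>lborel)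
      = (\<integral>\<^sup>+t. ennreal r * F (of_real r * cis t) * indicator {0..2*pi} t * indicator {0<..} r \<partial>lborel)"
      by (simp only: mult.assoc mult.commute[of _ "indicator {0<..} r"] mult.left_commute[of _ "indicator {0<..} r"])
  qed
  finally show ?thesis .
qed

lemma lborel_complex_polar:
  "(lborel :: complex measure) = distr (density (lborel \<Otimes>\<^sub>M lborel)
      (\<lambda>(r, t). ennreal r * indicator {0<..} r * indicator {0..2*pi} t)) borel (\<lambda>(r, t). of_real r * cis t)"
    (is "_ = distr ?D borel ?g")
proof (rule measure_eqI)
  fix A :: "complex set"
  assume "A \<in> sets lborel"
  then have [measurable]: "A \<in> sets borel" by simp
  have [measurable]: "?g \<in> borel_measurable ?D"
    by (simp add: split_beta)
  have "emeasure (distr ?D borel ?g) A = (\<integral>\<^sup>+z. indicator A z \<partial>distr ?D borel ?g)" by simp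
  also have "\<dots> = (\<integral>\<^sup>+x. indicator A (?g x) \<partial>?D)"
    by (subst nn_integral_distr) auto
  also have "\<dots> = (\<integral>\<^sup>+x. (\<lambda>(r, t). ennreal r * indicator A (of_real r * cis t) * indicator {0..2*pi} t * indicator {0<..} r) x
     \<partial>(lborel \<Otimes>\<^sub>M lborel))"
    by (subst nn_integral_density) (auto intro!: nn_integral_cong simp: split_beta mult_ac)
  also have "\<dots> = (\<integral>\<^sup>+z. indicator A z \<partial>lborel)"
    by (subst nn_integral_polar) (auto simp: lborel.nn_integral_fst[symmetric] split_beta)
  finally show "emeasure lborel A = emeasure (distr ?D borel ?g) A" by simp
qed simp

section \<open>Lebesgue measure on the disc\<close>

abbreviation LD :: "complex measure" where
  "LD \<equiv> lebesgue_on disc"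

lemma finite_measure_LD: "finite_measure LD"
  by (rule finite_measure_lebesgue_on) simp

interpretation LD: finite_measure LD
  by (rule finite_measure_LD)

interpretation LD_pair: pair_sigma_finite LD LD ..

lemma borel_measurable_LD:
  "f \<in> borel_measurable borel \<Longrightarrow> f \<in> borel_measurable LD"
  by (intro measurable_restrict_space1 measurable_completion) simp

lemma measurable_ident_LD: "(\<lambda>x. x) \<in> LD \<rightarrow>\<^sub>M borel"
  by (rule borel_measurable_LD) simp

lemma continuous_imp_measurable_LD:
  fixes f :: "complex \<Rightarrow> 'a::euclidean_space"
  shows "continuous_on disc f \<Longrightarrow> f \<in> borel_measurable LD"
  by (rule continuous_imp_measurable_on_sets_lebesgue) auto

lemma nn_integral_LD: "(\<integral>\<^sup>+z. f z \<partial>LD) = (\<integral>\<^sup>+z. f z * indicator disc z \<partial>lborel)"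
  by (subst nn_integral_restrict_space) (auto simp: nn_integral_completion)

lemma integral_LD:
  fixes f :: "complex \<Rightarrow> 'a::{banach, second_countable_topology}"
  assumes [measurable]: "f \<in> borel_measurable borel"
  shows "(LINT z|LD. f z) = (LINT z|lborel. indicator disc z *\<^sub>R f z)"
  by (subst integral_restrict_space, simp) (rule integral_completion, use assms in \<open>auto intro!: borel_measurable_scaleR borel_measurable_indicator\<close>)

lemma integrable_LD_bounded:
  fixes f :: "complex \<Rightarrow> 'a::{banach, second_countable_topology}"
  assumes "f \<in> borel_measurable LD" "\<And>z. z \<in> disc \<Longrightarrow> norm (f z) \<le> B"
  shows "integrable LD f"
  by (rule LD.integrable_const_bound[where B = B]) (use assms in \<open>auto intro!: AE_I2\<close>)

lemma compact_support_bounded: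
  fixes f :: "complex \<Rightarrow> complex"
  assumes "continuous_on disc f" "compact K" "K \<subseteq> disc" "\<And>z. z \<in> disc \<Longrightarrow> z \<notin> K \<Longrightarrow> f z = 0"
  obtains B where "B > 0" "\<And>z. z \<in> disc \<Longrightarrow> cmod (f z) \<le> B"
proof -
  have "compact (f ` K)"
    by (intro compact_continuous_image continuous_on_subset[OF assms(1)] assms)
  then obtain B where "\<And>z. z \<in> K \<Longrightarrow> cmod (f z) \<le> B" "B > 0"
    unfolding bounded_pos by (metis bounded_pos compact_imp_bounded imageI)
  then show ?thesis
    using that[of B] assms(4) by (metis less_imp_le norm_zero)
qed

lemma integrable_LD_compact_support:
  fixes f :: "complex \<Rightarrow> complex"
  assumes "continuous_on disc f" "compact K" "K \<subseteq> disc" "\<And>z. z \<in> disc \<Longrightarrow> z \<notin> K \<Longrightarrow> f z = 0"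
  shows "integrable LD f"
  using compact_support_bounded[OF assms]
  by (metis continuous_imp_measurable_LD[OF assms(1)] integrable_LD_bounded)

text \<open>The set where two continuous functions differ is open, and a nonempty open set is not negligible.\<close>

lemma AE_LD_continuous_imp:
  fixes f g :: "complex \<Rightarrow> 'a::euclidean_space"
  assumes f: "continuous_on disc f" and g: "continuous_on disc g" and ae: "AE z in LD. f z = g z"
    and z: "z \<in> disc"
  shows "f z = g z"
proof (rule ccontr)
  let ?S = "{z \<in> disc. f z - g z \<noteq> 0}"
  assume "f z \<noteq> g z"
  then have "z \<in> ?S" using z by simp
  have "continuous_on disc (\<lambda>z. f z - g z)" by (intro continuous_intros f g)
  then have "open (disc \<inter> (\<lambda>z. f z - g z) -` (- {0}))"
    by (rule continuous_open_preimage) auto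
  then have op: "open ?S" by (auto simp: Int_def vimage_def)
  have "AE z in lebesgue. z \<in> disc \<longrightarrow> f z = g z"
    using ae by (subst (asm) AE_restrict_space_iff) auto
  then have "AE z in lebesgue. z \<notin> ?S" by eventually_elim auto
  then have "negligible ?S"
    using AE_iff_null_sets[of ?S lebesgue] op
    by (simp add: negligible_iff_null_sets sets_completionI_sets)
  with op \<open>z \<in> ?S\<close> show False
    using open_not_negligible by blast
qed

section \<open>Functions of class C1 and the Cauchy-Pompeiu formula\<close>

definition C1_disc :: "(complex \<Rightarrow> complex) \<Rightarrow> bool" where
  "C1_disc v \<longleftrightarrow> (\<forall>z\<in>disc. v differentiable at z) \<and>
     continuous_on disc (partial 1 v) \<and> continuous_on disc (partial \<i> v)"

text \<open>Test functions have this regularity, and so do their products with functions of class C1 on the disc, which is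
  what integration by parts requires.\<close>

definition C1c :: "(complex \<Rightarrow> complex) \<Rightarrow> bool" where
  "C1c \<eta> \<longleftrightarrow> (\<forall>z. \<eta> differentiable at z) \<and>
     continuous_on UNIV (partial 1 \<eta>) \<and> continuous_on UNIV (partial \<i> \<eta>) \<and>
     (\<exists>K. compact K \<and> K \<subseteq> disc \<and> (\<forall>z. z \<notin> K \<longrightarrow> \<eta> z = 0))"

lemma partial_eq: "(f has_derivative D) (at z) \<Longrightarrow> partial e f z = D e"
  by (metis partial_def frechet_derivative_at)

lemma has_derivative_partial:
  "f differentiable at z \<Longrightarrow> (f has_derivative (\<lambda>h. partial h f z)) (at z)"
  by (simp add: partial_def frechet_derivative_works flip: fun_eq_iff)

lemma partial_linear:
  assumes "f differentiable at z"
  shows "partial h f z = of_real (Re h) * partial 1 f z + of_real (Im h) * partial \<i> f z"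
proof -
  have lin: "linear (\<lambda>h. partial h f z)"
    using has_derivative_partial[OF assms] has_derivative_linear by blast
  have "partial (Re h *\<^sub>R 1 + Im h *\<^sub>R \<i>) f z = Re h *\<^sub>R partial 1 f z + Im h *\<^sub>R partial \<i> f z"
    by (simp only: linear_add[OF lin] linear_scale[OF lin])
  moreover have "Re h *\<^sub>R 1 + Im h *\<^sub>R \<i> = h" by (simp add: complex_eq_iff)
  ultimately show ?thesis by (simp add: scaleR_conv_of_real)
qed

lemma partial_mult:
  assumes "f differentiable at z" "g differentiable at z"
  shows "partial e (\<lambda>z. f z * g z) z = f z * partial e g z + partial e f z * g z"
  by (rule partial_eq has_derivative_mult has_derivative_partial assms)+

lemma dbar_mult:
  assumes "f differentiable at z" "g differentiable at z"
  shows "dbar (\<lambda>z. f z * g z) z = f z * dbar g z + dbar f z * g z"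
  by (simp add: dbar_def partial_mult assms field_simps)

lemma dbar_holomorphic:
  assumes "f field_differentiable at z"
  shows "dbar f z = 0"
proof -
  obtain d where "(f has_field_derivative d) (at z)"
    using assms by (auto simp: field_differentiable_def)
  then have "(f has_derivative (*) d) (at z)" by (simp add: has_field_derivative_def)
  from partial_eq[OF this] show ?thesis by (simp add: dbar_def algebra_simps)
qed

lemma C1_disc_holomorphic:
  assumes "f holomorphic_on disc"
  shows "C1_disc f"
proof -
  have d: "(f has_derivative (*) (deriv f z)) (at z)" if "z \<in> disc" for z
    using holomorphic_derivI[OF assms _ that] by (simp add: has_field_derivative_def)
  have p: "partial e f z = deriv f z * e" if "z \<in> disc" for z e
    by (rule partial_eq d that)+
  have "continuous_on disc (deriv f)"
    by (intro holomorphic_on_imp_continuous_on holomorphic_deriv assms) auto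
  then have "continuous_on disc (partial e f)" for e
    by (subst continuous_on_cong[OF refl p]) (auto intro!: continuous_intros)
  with d show ?thesis unfolding C1_disc_def differentiable_def by blast
qed

lemma C1_disc_continuous: "C1_disc f \<Longrightarrow> continuous_on disc f"
  by (auto simp: C1_disc_def intro!: continuous_at_imp_continuous_on differentiable_imp_continuous_within)

lemma C1_disc_dbar_continuous: "C1_disc f \<Longrightarrow> continuous_on disc (dbar f)"
  unfolding dbar_def[abs_def] C1_disc_def by (intro continuous_intros) auto

lemma C1c_imp_C1_disc: "C1c f \<Longrightarrow> C1_disc f"
  by (auto simp: C1c_def C1_disc_def intro: continuous_on_subset)

lemma C1c_dbar_continuous: "C1c f \<Longrightarrow> continuous_on UNIV (dbar f)"
  unfolding dbar_def[abs_def] C1c_def by (intro continuous_intros) auto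

lemma has_derivative_outside_support:
  fixes f :: "complex \<Rightarrow> complex"
  assumes "closed K" "\<And>z. z \<notin> K \<Longrightarrow> f z = 0" "z \<notin> K"
  shows "(f has_derivative (\<lambda>_. 0)) (at z)"
proof (rule has_derivative_transform_within_open[of "\<lambda>_. 0" "\<lambda>_. 0" z UNIV "-K"])
qed (use assms in auto)

lemma C1c_mult:
  assumes v: "C1_disc v" and \<eta>: "C1c \<eta>"
  shows "C1c (\<lambda>z. v z * \<eta> z)"
proof -
  obtain K where K: "compact K" "K \<subseteq> disc" "\<And>z. z \<notin> K \<Longrightarrow> \<eta> z = 0"
    using \<eta> by (auto simp: C1c_def)
  have out: "((\<lambda>z. v z * \<eta> z) has_derivative (\<lambda>_. 0)) (at z)" if "z \<notin> K" for z
    using K that by (intro has_derivative_outside_support) (auto intro: compact_imp_closed)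
  have dv: "v differentiable at z" "\<eta> differentiable at z" if "z \<in> disc" for z
    using v \<eta> that by (auto simp: C1c_def C1_disc_def)
  have cont: "continuous_on disc v" "continuous_on disc \<eta>" "continuous_on disc (partial e v)"
     "continuous_on disc (partial e \<eta>)" if "e = 1 \<or> e = \<i>" for e
    using C1_disc_continuous[OF v] C1_disc_continuous[OF C1c_imp_C1_disc[OF \<eta>]] v C1c_imp_C1_disc[OF \<eta>] that
    unfolding C1_disc_def by blast+
  have "(\<lambda>z. v z * \<eta> z) differentiable at z" for z
    using out[of z] dv[of z] K(2) by (metis differentiable_def differentiable_mult subsetD)
  moreover have "continuous_on UNIV (partial e (\<lambda>z. v z * \<eta> z))" if e: "e = 1 \<or> e = \<i>" for e
  proof -
    have eq: "partial e (\<lambda>z. v z * \<eta> z) z = v z * partial e \<eta> z + partial e v z * \<eta> z" if "z \<in> disc" for z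
      using dv[OF that] by (rule partial_mult)
    have "continuous_on disc (partial e (\<lambda>z. v z * \<eta> z))"
      by (subst continuous_on_cong[OF refl eq]) (auto intro!: continuous_intros cont[OF e])
    moreover have "continuous_on (-K) (partial e (\<lambda>z. v z * \<eta> z))"
      by (subst continuous_on_cong[OF refl, where g = "\<lambda>_. 0"]) (auto intro!: partial_eq out)
    ultimately have "continuous_on (disc \<union> -K) (partial e (\<lambda>z. v z * \<eta> z))"
      using K(1) by (intro continuous_on_open_Un) (auto simp: compact_imp_closed open_Compl)
    moreover have "disc \<union> -K = UNIV" using K(2) by auto
    ultimately show ?thesis by simp
  qed
  ultimately show ?thesis
    unfolding C1c_def using K by (metis mult_zero_right)
qed

lemma C1c_integrable:
  assumes "C1c \<eta>"
  shows "integrable LD (dbar \<eta>)" "continuous_on disc h \<Longrightarrow> integrable LD (\<lambda>z. h z * \<eta> z)"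
    "continuous_on disc h \<Longrightarrow> integrable LD (\<lambda>z. h z * dbar \<eta> z)"
    "integrable LD (partial 1 \<eta>)" "integrable LD (partial \<i> \<eta>)"
proof -
  obtain K where K: "compact K" "K \<subseteq> disc" "\<And>z. z \<notin> K \<Longrightarrow> \<eta> z = 0"
    using assms by (auto simp: C1c_def)
  have 0: "partial e \<eta> z = 0" if "z \<notin> K" for z e
    by (rule partial_eq, rule has_derivative_outside_support[OF compact_imp_closed[OF K(1)]]) (use K that in auto)
  then have 1: "dbar \<eta> z = 0" if "z \<notin> K" for z
    using that by (simp add: dbar_def)
  have c: "continuous_on disc \<eta>" "continuous_on disc (dbar \<eta>)"
    using C1c_imp_C1_disc[OF assms] by (auto intro: C1_disc_continuous C1_disc_dbar_continuous)
  have c': "continuous_on disc (partial 1 \<eta>)" "continuous_on disc (partial \<i> \<eta>)"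
    using assms by (auto simp: C1c_def intro: continuous_on_subset)
  show "integrable LD (dbar \<eta>)" "integrable LD (partial 1 \<eta>)" "integrable LD (partial \<i> \<eta>)"
    by (rule integrable_LD_compact_support[OF _ K(1,2)]; use c c' 0 1 in auto)+
  show "integrable LD (\<lambda>z. h z * \<eta> z)" "integrable LD (\<lambda>z. h z * dbar \<eta> z)" if "continuous_on disc h"
    by (rule integrable_LD_compact_support[OF _ K(1,2)]; use c K(3) 1 that in \<open>auto intro!: continuous_intros\<close>)+
qed

lemma test_functions_C1c:
  assumes "\<psi> \<in> test_functions"
  shows "C1c \<psi>"
proof -
  have "Ck (Suc 0) \<psi>" using assms by (auto simp: test_functions_def)
  then show ?thesis using assms by (auto simp: test_functions_def C1c_def)
qed

lemma integral_polar:
  fixes g :: "complex \<Rightarrow> 'a::{banach, second_countable_topology}"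
  assumes [measurable]: "g \<in> borel_measurable borel"
  shows "(LINT z|lborel. g z) =
     (LINT (r, t)|(lborel \<Otimes>\<^sub>M lborel). (r * indicator {0<..} r * indicator {0..2*pi} t) *\<^sub>R g (of_real r * cis t))"
proof -
  have 1: "(\<lambda>(r, t). ennreal r * indicator {0<..} r * indicator {0..2*pi} t) =
      (\<lambda>x. ennreal (case x of (r, t) \<Rightarrow> r * indicator {0<..} r * indicator {0..2*pi} t))"
    by (auto simp: fun_eq_iff indicator_def)
  show ?thesis
    unfolding lborel_complex_polar 1
    by (subst integral_distr, simp add: split_beta, simp, subst integral_density)
       (auto simp: split_beta indicator_def intro!: Bochner_Integration.integral_cong)
qed

text \<open>In polar coordinates about \<open>\<zeta>\<close> the integrand \<open>dbar \<eta> / (z - \<zeta>)\<close> becomes half the sum of the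
  radial derivative of \<open>\<eta>\<close>, which integrates to \<open>- \<eta> \<zeta>\<close> along each ray, and of \<open>\<i> / r\<close> times the angular
  derivative, which integrates to zero along each circle.\<close>

theorem Cauchy_Pompeiu:
  assumes \<eta>: "C1c \<eta>"
  shows "(LINT z|LD. dbar \<eta> z / (z - \<zeta>)) = - (of_real pi * \<eta> \<zeta>)"
proof -
  obtain K where K: "compact K" "K \<subseteq> disc" "\<And>z. z \<notin> K \<Longrightarrow> \<eta> z = 0"
    using \<eta> by (auto simp: C1c_def)
  have diff: "\<eta> differentiable at z" for z
    using \<eta> by (auto simp: C1c_def)
  have p0: "partial e \<eta> z = 0" if "z \<notin> disc" for z e
    by (rule partial_eq, rule has_derivative_outside_support[OF compact_imp_closed[OF K(1)]]) (use K that in auto)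
  have contp: "continuous_on UNIV (partial 1 \<eta>)" "continuous_on UNIV (partial \<i> \<eta>)"
    using \<eta> by (auto simp: C1c_def)
  have contd: "continuous_on UNIV (dbar \<eta>)"
    by (rule C1c_dbar_continuous) fact
  have [measurable]: "dbar \<eta> \<in> borel_measurable borel"
    by (intro borel_measurable_continuous_onI contd)
  define R where "R = cmod \<zeta> + 1"
  have R: "R \<ge> 1" by (simp add: R_def)
  have far: "\<zeta> + of_real r * cis t \<notin> disc" if "r \<ge> R" for r t
  proof -
    have "cmod (of_real r * cis t) \<le> cmod (\<zeta> + of_real r * cis t) + cmod \<zeta>"
      by (metis add_diff_cancel_left' norm_triangle_ineq4)
    then show ?thesis using that R by (auto simp: R_def norm_mult)
  qed
  define a where "a r t = of_real (cos t) * partial 1 \<eta> (\<zeta> + of_real r * cis t)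
     + of_real (sin t) * partial \<i> \<eta> (\<zeta> + of_real r * cis t)" for r t
  define b where "b r t = of_real (- sin t) * partial 1 \<eta> (\<zeta> + of_real r * cis t)
     + of_real (cos t) * partial \<i> \<eta> (\<zeta> + of_real r * cis t)" for r t
  have ab: "cis (-t) * dbar \<eta> (\<zeta> + of_real r * cis t) = (a r t + \<i> * b r t) / 2" for r t
    by (simp add: a_def b_def dbar_def cis.code complex_eq_iff algebra_simps)
  have radial: "((\<lambda>r. \<eta> (\<zeta> + of_real r * cis t)) has_vector_derivative a r t) (at r within S)" for r t S
  proof -
    have "((\<lambda>r. \<eta> (\<zeta> + of_real r * cis t)) has_derivative (\<lambda>h. partial (of_real h * cis t) \<eta> (\<zeta> + of_real r * cis t))) (at r within S)"
      by (rule has_derivative_compose[OF _ has_derivative_partial[OF diff]])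
         (auto intro!: derivative_eq_intros)
    then show ?thesis
      by (subst (asm) partial_linear[OF diff]) (simp add: has_vector_derivative_def a_def scaleR_conv_of_real algebra_simps)
  qed
  have angular: "((\<lambda>t. \<eta> (\<zeta> + of_real r * cis t)) has_vector_derivative r *\<^sub>R b r t) (at t within S)" for r t S
  proof -
    have "((\<lambda>t. of_real r * cis t) has_derivative (\<lambda>h. of_real h * (of_real r * \<i> * cis t))) (at t within S)"
      by (rule derivative_eq_intros refl)+ (auto simp: scaleR_conv_of_real fun_eq_iff)
    then have "((\<lambda>t. \<zeta> + of_real r * cis t) has_derivative (\<lambda>h. of_real h * (of_real r * \<i> * cis t))) (at t within S)"
      using has_derivative_add[OF has_derivative_const[of \<zeta>]] by fastforce
    then have "((\<lambda>t. \<eta> (\<zeta> + of_real r * cis t)) has_derivative (\<lambda>h. partial (of_real h * (of_real r * \<i> * cis t)) \<eta> (\<zeta> + of_real r * cis t))) (at t within S)"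
      by (rule has_derivative_compose[OF _ has_derivative_partial[OF diff]])
    then show ?thesis
      by (subst (asm) partial_linear[OF diff]) (simp add: has_vector_derivative_def b_def scaleR_conv_of_real algebra_simps)
  qed
  have cont2: "continuous_on S (\<lambda>x. a (fst x) (snd x))" "continuous_on S (\<lambda>x. b (fst x) (snd x))" for S
    unfolding a_def b_def
    by (intro continuous_intros continuous_on_compose2[OF contp(1)] continuous_on_compose2[OF contp(2)] subset_UNIV)+
  have conta: "continuous_on S (\<lambda>r. a r t)" for t S
    unfolding a_def
    by (intro continuous_intros continuous_on_compose2[OF contp(1)] continuous_on_compose2[OF contp(2)] subset_UNIV)
  have contb: "continuous_on S (\<lambda>t. r *\<^sub>R b r t)" for r S
    unfolding b_def
    by (intro continuous_intros continuous_on_compose2[OF contp(1)] continuous_on_compose2[OF contp(2)] subset_UNIV)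
  let ?I = "{0..R} \<times> {0..2*pi}"
  let ?ind = "\<lambda>r t. indicator {0..R} r * indicator {0..2*pi} t :: real"
  have int: "integrable (lborel \<Otimes>\<^sub>M lborel) (\<lambda>(r, t). ?ind r t *\<^sub>R a r t)"
            "integrable (lborel \<Otimes>\<^sub>M lborel) (\<lambda>(r, t). ?ind r t *\<^sub>R b r t)"
  proof -
    have "integrable lborel (\<lambda>x. indicator ?I x *\<^sub>R a (fst x) (snd x))"
         "integrable lborel (\<lambda>x. indicator ?I x *\<^sub>R b (fst x) (snd x))"
      by (intro borel_integrable_compact cont2 compact_Times compact_Icc)+
    then show "integrable (lborel \<Otimes>\<^sub>M lborel) (\<lambda>(r, t). ?ind r t *\<^sub>R a r t)"
       "integrable (lborel \<Otimes>\<^sub>M lborel) (\<lambda>(r, t). ?ind r t *\<^sub>R b r t)"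
      by (simp_all add: lborel_prod case_prod_unfold indicator_times)
  qed
  have A: "(LINT (r, t)|(lborel \<Otimes>\<^sub>M lborel). ?ind r t *\<^sub>R a r t) = - of_real (2 * pi) * \<eta> \<zeta>"
  proof -
    have "(LINT (r, t)|(lborel \<Otimes>\<^sub>M lborel). ?ind r t *\<^sub>R a r t) = (LINT t|lborel. LINT r|lborel. ?ind r t *\<^sub>R a r t)"
      using lborel_pair.integral_snd[OF int(1)] by simp
    also have "\<dots> = (LINT t|lborel. indicator {0..2*pi} t *\<^sub>R (- \<eta> \<zeta>))"
    proof (rule Bochner_Integration.integral_cong[OF refl])
      fix t :: real
      have "(LINT r|lborel. indicator {0..R} r *\<^sub>R a r t) = \<eta> (\<zeta> + of_real R * cis t) - \<eta> (\<zeta> + of_real 0 * cis t)"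
        using R by (intro integral_FTC_Icc radial conta) auto
      also have "\<eta> (\<zeta> + of_real R * cis t) = 0"
        using far[OF order_refl, of t] K(2,3) by blast
      finally have "(LINT r|lborel. indicator {0..R} r *\<^sub>R a r t) = - \<eta> \<zeta>" by simp
      then show "(LINT r|lborel. ?ind r t *\<^sub>R a r t) = indicator {0..2*pi} t *\<^sub>R (- \<eta> \<zeta>)"
        by (cases "t \<in> {0..2*pi}") auto
    qed
    also have "\<dots> = - of_real (2 * pi) * \<eta> \<zeta>"
      by (simp add: scaleR_conv_of_real)
    finally show ?thesis .
  qed
  have B: "(LINT (r, t)|(lborel \<Otimes>\<^sub>M lborel). ?ind r t *\<^sub>R b r t) = 0"
  proof -
    have "(LINT (r, t)|(lborel \<Otimes>\<^sub>M lborel). ?ind r t *\<^sub>R b r t) = (LINT r|lborel. LINT t|lborel. ?ind r t *\<^sub>R b r t)"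
      using lborel_pair.integral_fst[OF int(2)] by simp
    also have "\<dots> = 0"
    proof (rule integral_eq_zero_AE)
      show "AE r in lborel. (LINT t|lborel. ?ind r t *\<^sub>R b r t) = 0"
        using AE_lborel_singleton[of "0::real"]
      proof eventually_elim
        fix r :: real assume r: "r \<noteq> 0"
        have "(LINT t|lborel. indicator {0..2*pi} t *\<^sub>R (r *\<^sub>R b r t)) =
            \<eta> (\<zeta> + of_real r * cis (2*pi)) - \<eta> (\<zeta> + of_real r * cis 0)"
          using R by (intro integral_FTC_Icc angular contb) auto
        then have "r *\<^sub>R (LINT t|lborel. indicator {0..2*pi} t *\<^sub>R b r t) = 0"
          by (subst integral_scaleR_right[symmetric]) (simp add: mult.commute[of _ r] del: integral_scaleR_right)
        then have "(LINT t|lborel. indicator {0..2*pi} t *\<^sub>R b r t) = 0" using r by simp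
        then show "(LINT t|lborel. ?ind r t *\<^sub>R b r t) = 0"
          by (cases "r \<in> {0..R}") auto
      qed
    qed
    finally show ?thesis .
  qed
  have "(LINT z|LD. dbar \<eta> z / (z - \<zeta>)) = (LINT z|lborel. indicator disc z *\<^sub>R (dbar \<eta> z / (z - \<zeta>)))"
    by (rule integral_LD) measurable
  also have "\<dots> = (LINT z|lborel. dbar \<eta> z / (z - \<zeta>))"
    using p0 by (intro Bochner_Integration.integral_cong) (auto simp: indicator_def dbar_def)
  also have "\<dots> = (LINT w|lborel. dbar \<eta> (\<zeta> + w) / w)"
    by (subst lborel_distr_plus[of \<zeta>, symmetric], subst integral_distr) auto
  also have "\<dots> = (LINT (r, t)|(lborel \<Otimes>\<^sub>M lborel).
       (r * indicator {0<..} r * indicator {0..2*pi} t) *\<^sub>R (dbar \<eta> (\<zeta> + of_real r * cis t) / (of_real r * cis t)))"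
    by (rule integral_polar) measurable
  also have "\<dots> = (LINT (r, t)|(lborel \<Otimes>\<^sub>M lborel). (?ind r t *\<^sub>R a r t + \<i> * (?ind r t *\<^sub>R b r t)) / 2)"
  proof (rule Bochner_Integration.integral_cong_AE)
    have "AE x in lborel \<Otimes>\<^sub>M (lborel :: real measure). fst x \<noteq> (0::real)"
    proof (rule lborel_pair.AE_pair_measure)
      show "{x \<in> space (lborel \<Otimes>\<^sub>M (lborel :: real measure)). fst x \<noteq> (0::real)} \<in> sets (lborel \<Otimes>\<^sub>M lborel)"
        by measurable
      show "AE x in lborel. AE y in (lborel :: real measure). fst (x, y) \<noteq> (0::real)"
        using AE_lborel_singleton[of "0::real"] by eventually_elim auto
    qed
    then show "AE x in lborel \<Otimes>\<^sub>M lborel. (case x of (r, t) \<Rightarrow>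
        (r * indicator {0<..} r * indicator {0..2*pi} t) *\<^sub>R (dbar \<eta> (\<zeta> + of_real r * cis t) / (of_real r * cis t))) =
        (case x of (r, t) \<Rightarrow> (?ind r t *\<^sub>R a r t + \<i> * (?ind r t *\<^sub>R b r t)) / 2)"
    proof eventually_elim
      fix x :: "real \<times> real" assume "fst x \<noteq> 0"
      then obtain r t where x: "x = (r, t)" "r \<noteq> 0" by (cases x) auto
      have eq: "r *\<^sub>R (dbar \<eta> (\<zeta> + of_real r * cis t) / (of_real r * cis t)) = (a r t + \<i> * b r t) / 2"
        using x by (simp add: ab[symmetric] scaleR_conv_of_real cis_inverse[symmetric] field_simps)
      have "dbar \<eta> (\<zeta> + of_real r * cis t) = 0" if "r > R"
        using far[of r t] that p0 by (simp add: dbar_def)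
      then show "(case x of (r, t) \<Rightarrow>
        (r * indicator {0<..} r * indicator {0..2*pi} t) *\<^sub>R (dbar \<eta> (\<zeta> + of_real r * cis t) / (of_real r * cis t))) =
        (case x of (r, t) \<Rightarrow> (?ind r t *\<^sub>R a r t + \<i> * (?ind r t *\<^sub>R b r t)) / 2)"
        using eq x by (auto simp: indicator_def)
    qed
    show "(\<lambda>(r, t). (?ind r t *\<^sub>R a r t + \<i> * (?ind r t *\<^sub>R b r t)) / 2) \<in> borel_measurable (lborel \<Otimes>\<^sub>M lborel)"
      using int[THEN borel_measurable_integrable] unfolding case_prod_unfold
      by (intro borel_measurable_divide borel_measurable_add borel_measurable_times) auto
  qed (simp add: split_beta)
  also have "\<dots> = ((LINT (r, t)|(lborel \<Otimes>\<^sub>M lborel). ?ind r t *\<^sub>R a r t) +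
      \<i> * (LINT (r, t)|(lborel \<Otimes>\<^sub>M lborel). ?ind r t *\<^sub>R b r t)) / 2"
    using int unfolding case_prod_unfold
    by (simp del: mult_scaleR_right)
  also have "\<dots> = - (of_real pi * \<eta> \<zeta>)"
    unfolding A B by simp
  finally show ?thesis .
qed

text \<open>The Cauchy-Pompeiu formula for \<open>(z - 2) * \<eta> z\<close> at the point \<open>2\<close>, which lies outside the disc.\<close>

lemma integral_dbar_eq_0:
  assumes "C1c \<eta>"
  shows "(LINT z|LD. dbar \<eta> z) = 0"
proof -
  let ?h = "\<lambda>z. (z - 2) * \<eta> z"
  have h: "C1c ?h"
    by (intro C1c_mult assms C1_disc_holomorphic holomorphic_intros)
  have d: "dbar ?h z = (z - 2) * dbar \<eta> z" for z
  proof -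
    have "dbar (\<lambda>z. z - 2) z = 0"
      by (intro dbar_holomorphic derivative_intros)
    then show ?thesis
      using assms by (subst dbar_mult) (auto simp: C1c_def intro!: derivative_intros)
  qed
  have "(LINT z|LD. dbar \<eta> z) = (LINT z|LD. dbar ?h z / (z - 2))"
    by (intro Bochner_Integration.integral_cong) (auto simp: d)
  also have "\<dots> = 0" using Cauchy_Pompeiu[OF h, of 2] by simp
  finally show ?thesis .
qed

text \<open>The product \<open>v * \<psi>\<close> is again of class C1 with compact support, so the integral of its \<open>dbar\<close> vanishes;
  the Leibniz rule does the rest.\<close>

lemma weak_dbar_C1:
  assumes v: "C1_disc v"
  shows "weak_dbar v (dbar v)"
  unfolding weak_dbar_def
proof
  fix \<psi> assume "\<psi> \<in> test_functions"
  then have \<psi>: "C1c \<psi>" by (rule test_functions_C1c)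
  have i: "integrable LD (\<lambda>z. v z * dbar \<psi> z)" "integrable LD (\<lambda>z. dbar v z * \<psi> z)"
    using \<psi> v by (auto intro: C1c_integrable C1_disc_continuous C1_disc_dbar_continuous)
  have "(LINT z|LD. v z * dbar \<psi> z) + (LINT z|LD. dbar v z * \<psi> z) = (LINT z|LD. v z * dbar \<psi> z + dbar v z * \<psi> z)"
    using i by simp
  also have "\<dots> = (LINT z|LD. dbar (\<lambda>z. v z * \<psi> z) z)"
    using \<psi> v by (intro Bochner_Integration.integral_cong refl dbar_mult[symmetric]) (auto simp: C1_disc_def C1c_def)
  also have "\<dots> = 0"
    by (intro integral_dbar_eq_0 C1c_mult v \<psi>)
  finally show "(LINT z|LD. v z * dbar \<psi> z) = - (LINT z|LD. dbar v z * \<psi> z)"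
    by (simp add: add_eq_0_iff)
qed

section \<open>Smooth bump functions\<close>

text \<open>The functions \<open>exp (- 1 / x) / x\<^sup>j\<close>, extended by zero. All of them are bounded, and the derivative of one is a
  combination of two others, which makes \<open>flat 0\<close> smooth with explicit bounds on its derivatives.\<close>

definition flat :: "nat \<Rightarrow> real \<Rightarrow> real" where
  "flat j x = (if x > 0 then exp (- 1 / x) / x ^ j else 0)"

lemma flat_nonneg: "0 \<le> flat j x"
  by (simp add: flat_def)

lemma flat_bound: "flat j x \<le> fact j"
proof (cases "x > 0")
  case True
  define y where "y = 1 / x"
  have y: "y > 0" using True by (simp add: y_def)
  have "(\<Sum>n\<in>{j}. y ^ n /\<^sub>R fact n) \<le> (\<Sum>n. y ^ n /\<^sub>R fact n)"
    by (rule sum_le_suminf) (use y summable_exp_generic[of y] in auto)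
  then have "y ^ j / fact j \<le> exp y"
    by (simp add: exp_def divide_inverse mult.commute)
  then have "y ^ j \<le> fact j * exp y" by (simp add: field_simps)
  then have "y ^ j * exp (- y) \<le> fact j"
    by (simp add: exp_minus field_simps)
  then show ?thesis using True by (simp add: flat_def y_def field_simps)
qed (simp add: flat_def)

lemma flat_Suc: "flat j x = x * flat (Suc j) x"
  by (simp add: flat_def)

lemma has_derivative_quadratic:
  fixes f :: "'a::real_normed_vector \<Rightarrow> 'b::real_normed_vector"
  assumes D: "bounded_linear D" and C: "\<And>h. norm h \<le> e \<Longrightarrow> norm (f (w + h) - f w - D h) \<le> C * (norm h)\<^sup>2"
    and e: "e > 0"
  shows "(f has_derivative D) (at w)"
  unfolding has_derivative_at
proof
  show "(\<lambda>h. norm (f (w + h) - f w - D h) / norm h) \<midarrow>0\<rightarrow> 0"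
  proof (rule Lim_null_comparison)
    have "eventually (\<lambda>h. h \<in> ball 0 e \<and> h \<noteq> 0) (at (0::'a))"
      using e by (intro eventually_conj eventually_at_in_open' eventually_neq_at_within) auto
    then show "\<forall>\<^sub>F h in at 0. norm (norm (f (w + h) - f w - D h) / norm h) \<le> C * norm h"
    proof eventually_elim
      fix h :: 'a assume "h \<in> ball 0 e \<and> h \<noteq> 0"
      then show "norm (norm (f (w + h) - f w - D h) / norm h) \<le> C * norm h"
        using C[of h] by (simp add: divide_le_eq power2_eq_square mult.assoc)
    qed
    show "((\<lambda>h. C * norm h) \<longlongrightarrow> 0) (at (0::'a))"
      by (rule tendsto_eq_intros | simp)+
  qed
qed fact

lemma flat_deriv: "(flat j has_real_derivative (flat (j + 2) x - real j * flat (j + 1) x)) (at x)"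
proof -
  consider "x > 0" | "x < 0" | "x = 0" by linarith
  then show ?thesis
  proof cases
    case 1
    have "((\<lambda>x. exp (- 1 / x) / x ^ j) has_real_derivative (flat (j + 2) x - real j * flat (j + 1) x)) (at x)"
    proof (cases j)
      case 0
      then show ?thesis
        using 1 by (auto intro!: derivative_eq_intros simp: flat_def field_simps power2_eq_square)
    next
      case (Suc m)
      then show ?thesis
        using 1 by (auto intro!: derivative_eq_intros simp: flat_def field_simps power2_eq_square)
           (metis One_nat_def mult.commute neq0_conv power_minus_mult)
    qed
    then show ?thesis
      by (rule has_field_derivative_transform_within_open[where S = "{0<..}"]) (use 1 in \<open>auto simp: flat_def\<close>)
  next
    case 2
    have "((\<lambda>x. 0) has_real_derivative (flat (j + 2) x - real j * flat (j + 1) x)) (at x)"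
      using 2 by (simp add: flat_def)
    then show ?thesis
      by (rule has_field_derivative_transform_within_open[where S = "{..<0}"]) (use 2 in \<open>auto simp: flat_def\<close>)
  next
    case 3
    have "(flat j has_derivative (\<lambda>h. 0)) (at 0)"
    proof (rule has_derivative_quadratic[where C = "fact (j + 2)" and e = 1])
      fix h :: real
      have "flat j h = h\<^sup>2 * flat (j + 2) h"
        by (simp add: flat_Suc[of j] flat_Suc[of "Suc j"] power2_eq_square)
      also have "\<dots> \<le> h\<^sup>2 * fact (j + 2)"
        by (intro mult_left_mono flat_bound) auto
      finally show "norm (flat j (0 + h) - flat j 0 - 0) \<le> fact (j + 2) * (norm h)\<^sup>2"
        using flat_nonneg[of j h] by (simp add: flat_def[of j 0] mult.commute)
    qed auto
    then show ?thesis using 3 by (simp add: has_field_derivative_def flat_def lambda_zero)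
  qed
qed

lemma flat_0_deriv: "(flat 0 has_real_derivative flat 2 x) (at x)"
  using flat_deriv[of 0 x] by (simp add: numeral_2_eq_2)

lemma continuous_on_flat: "continuous_on S (flat j)"
  by (intro continuous_at_imp_continuous_on ballI DERIV_isCont[OF flat_deriv])

lemma flat_Lipschitz: "\<bar>flat 0 x - flat 0 y\<bar> \<le> 2 * \<bar>x - y\<bar>"
  using field_differentiable_bound[of UNIV "flat 0" "flat 2" 2 x y] flat_0_deriv flat_bound[of 2] flat_nonneg[of 2]
  by (auto simp: numeral_2_eq_2)

text \<open>The constant bounds the second derivative \<open>flat 4 - 2 * flat 3\<close>: it is \<open>4! + 2 * 3!\<close>.\<close>

lemma flat_Taylor: "\<bar>flat 0 x - flat 0 y - (x - y) * flat 2 y\<bar> \<le> 36 * (x - y)\<^sup>2"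
proof -
  have 2: "\<bar>flat 2 s - flat 2 t\<bar> \<le> 36 * \<bar>s - t\<bar>" for s t
  proof -
    have "norm (flat (2 + 2) x - real 2 * flat (2 + 1) x) \<le> 36" for x
      using flat_bound[of 4 x] flat_bound[of 3 x] flat_nonneg[of 4 x] flat_nonneg[of 3 x]
      by (simp add: fact_numeral)
    then show ?thesis
      using field_differentiable_bound[of UNIV "flat 2" "\<lambda>x. flat (2 + 2) x - real 2 * flat (2 + 1) x" 36 s t]
        flat_deriv[of 2] by auto
  qed
  let ?g = "\<lambda>t. flat 0 t - t * flat 2 y"
  have "norm (?g x - ?g y) \<le> 36 * \<bar>x - y\<bar> * norm (x - y)"
  proof (rule field_differentiable_bound[where S = "closed_segment x y"])
    fix t assume t: "t \<in> closed_segment x y"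
    show "(?g has_field_derivative (flat 2 t - flat 2 y)) (at t within closed_segment x y)"
      by (auto intro!: derivative_eq_intros DERIV_subset[OF flat_0_deriv])
    have "\<bar>t - y\<bar> \<le> \<bar>x - y\<bar>"
      using t by (auto simp: closed_segment_eq_real_ivl split: if_splits)
    then show "norm (flat 2 t - flat 2 y) \<le> 36 * \<bar>x - y\<bar>"
      using 2[of t y] by simp
  qed auto
  then have "\<bar>?g x - ?g y\<bar> \<le> 36 * \<bar>x - y\<bar>\<^sup>2" by (simp add: power2_eq_square)
  then show ?thesis by (simp add: algebra_simps)
qed

text \<open>An algebra of functions that is closed under partial derivatives and contains the bump functions: its
  members are smooth because each derivative is again a member.\<close>

inductive_set bump_algebra :: "real \<Rightarrow> complex \<Rightarrow> (complex \<Rightarrow> complex) set" for a w where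
  const: "(\<lambda>z. c) \<in> bump_algebra a w"
| ident: "(\<lambda>z. z) \<in> bump_algebra a w"
| conj: "(\<lambda>z. cnj z) \<in> bump_algebra a w"
| flat: "(\<lambda>z. of_real (flat j (1 - a * (cmod (z - w))\<^sup>2))) \<in> bump_algebra a w"
| add: "f \<in> bump_algebra a w \<Longrightarrow> g \<in> bump_algebra a w \<Longrightarrow> (\<lambda>z. f z + g z) \<in> bump_algebra a w"
| mult: "f \<in> bump_algebra a w \<Longrightarrow> g \<in> bump_algebra a w \<Longrightarrow> (\<lambda>z. f z * g z) \<in> bump_algebra a w"

lemma has_derivative_flat_norm:
  "((\<lambda>z. of_real (flat j (1 - a * (cmod (z - w))\<^sup>2)) :: complex) has_derivative
     (\<lambda>h. (of_real (flat (j + 2) (1 - a * (cmod (z - w))\<^sup>2)) + of_real (- real j) * of_real (flat (j + 1) (1 - a * (cmod (z - w))\<^sup>2))) *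
        (of_real (- a) * ((z + - w) * cnj h + (cnj z + - cnj w) * h)))) (at z)"
proof -
  have 1: "((\<lambda>z. 1 - a * (cmod (z - w))\<^sup>2) has_derivative (\<lambda>h. - a * (2 * ((z - w) \<bullet> h)))) (at z)"
    unfolding power2_norm_eq_inner
    by (auto intro!: derivative_eq_intros simp: inner_commute algebra_simps)
  have "((\<lambda>z. flat j (1 - a * (cmod (z - w))\<^sup>2)) has_derivative
     (\<lambda>h. - a * (2 * ((z - w) \<bullet> h)) * (flat (j + 2) (1 - a * (cmod (z - w))\<^sup>2) - real j * flat (j + 1) (1 - a * (cmod (z - w))\<^sup>2)))) (at z)"
    by (rule has_derivative_compose[OF 1, THEN has_derivative_eq_rhs])
       (use flat_deriv in \<open>auto simp: has_field_derivative_def fun_eq_iff mult.commute\<close>)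
  from bounded_linear.has_derivative[OF bounded_linear_of_real this] show ?thesis
    by (rule has_derivative_eq_rhs) (auto simp: fun_eq_iff complex_eq_iff inner_complex_def algebra_simps)
qed

lemma bump_algebra_deriv:
  assumes "f \<in> bump_algebra a w"
  shows "(\<forall>z. f differentiable at z) \<and> (\<forall>e. partial e f \<in> bump_algebra a w)"
  using assms
proof induction
  case (const c)
  have "partial e (\<lambda>z. c) = (\<lambda>z. 0)" for e
    by (rule ext, rule partial_eq) auto
  then show ?case by (auto intro: bump_algebra.intros)
next
  case ident
  have "partial e (\<lambda>z. z) = (\<lambda>z. e)" for e
    by (rule ext, rule partial_eq) auto
  then show ?case by (auto intro: bump_algebra.intros)
next
  case conj
  have d: "(cnj has_derivative cnj) (at z)" for z
    by (rule bounded_linear_imp_has_derivative[OF bounded_linear_cnj])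
  then have "partial e cnj = (\<lambda>z. cnj e)" for e
    by (intro ext partial_eq)
  moreover have "cnj differentiable at z" for z using d differentiable_def by blast
  ultimately show ?case by (auto intro: bump_algebra.intros)
next
  case (flat j)
  let ?f = "\<lambda>z. of_real (flat j (1 - a * (cmod (z - w))\<^sup>2)) :: complex"
  have "partial e ?f = (\<lambda>z. (of_real (flat (j + 2) (1 - a * (cmod (z - w))\<^sup>2)) + of_real (- real j) * of_real (flat (j + 1) (1 - a * (cmod (z - w))\<^sup>2))) *
        (of_real (- a) * ((z + - w) * cnj e + (cnj z + - cnj w) * e)))" for e
    by (intro ext partial_eq has_derivative_flat_norm)
  then have "partial e ?f \<in> bump_algebra a w" for e
    by (simp only:) (intro bump_algebra.intros)
  moreover have "?f differentiable at z" for z using has_derivative_flat_norm differentiable_def by blast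
  ultimately show ?case by auto
next
  case (add f g)
  have "partial e (\<lambda>z. f z + g z) = (\<lambda>z. partial e f z + partial e g z)" for e
    by (intro ext partial_eq has_derivative_add has_derivative_partial) (use add in auto)
  moreover have "(\<lambda>z. partial e f z + partial e g z) \<in> bump_algebra a w" for e
    by (intro bump_algebra.add) (use add in auto)
  moreover have "(\<lambda>z. f z + g z) differentiable at z" for z using add by auto
  ultimately show ?case by simp
next
  case (mult f g)
  have "partial e (\<lambda>z. f z * g z) = (\<lambda>z. f z * partial e g z + partial e f z * g z)" for e
    by (intro ext partial_mult) (use mult in auto)
  moreover have "(\<lambda>z. f z * partial e g z + partial e f z * g z) \<in> bump_algebra a w" for e
    by (intro bump_algebra.add bump_algebra.mult) (use mult in auto)
  moreover have "(\<lambda>z. f z * g z) differentiable at z" for z using mult by auto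
  ultimately show ?case by simp
qed

lemma bump_algebra_Ck: "f \<in> bump_algebra a w \<Longrightarrow> Ck k f"
proof (induction k arbitrary: f)
  case 0
  then show ?case
    using bump_algebra_deriv[OF 0] by (auto intro!: continuous_at_imp_continuous_on differentiable_imp_continuous_within)
next
  case (Suc k)
  then show ?case using bump_algebra_deriv[OF Suc.prems] by auto
qed

lemma bump_algebra_test:
  assumes "f \<in> bump_algebra a w" "\<And>z. a * (cmod (z - w))\<^sup>2 \<ge> 1 \<Longrightarrow> f z = 0" "a > 0" "cmod w + 1 / sqrt a < 1"
  shows "f \<in> test_functions"
proof -
  have "f z = 0" if "z \<notin> cball w (1 / sqrt a)" for z
  proof (rule assms(2))
    have "1 / sqrt a < cmod (z - w)" using that by (simp add: dist_norm norm_minus_commute)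
    then have "(1 / sqrt a)\<^sup>2 \<le> (cmod (z - w))\<^sup>2"
      by (intro power_mono) (use assms(3) in auto)
    then show "a * (cmod (z - w))\<^sup>2 \<ge> 1"
      using assms(3) by (simp add: power_divide field_simps)
  qed
  moreover have "cball w (1 / sqrt a) \<subseteq> disc"
  proof
    fix z assume "z \<in> cball w (1 / sqrt a)"
    then have "cmod z \<le> cmod w + 1 / sqrt a"
      using norm_triangle_sub[of z w] by (simp add: dist_norm norm_minus_commute)
    then show "z \<in> disc" using assms(4) by simp
  qed
  ultimately show ?thesis
    using bump_algebra_Ck[OF assms(1)] compact_cball unfolding test_functions_def mem_Collect_eq by meson
qed

text \<open>A smooth bump at \<open>w\<close> whose support is the closed disc of radius \<open>1 / sqrt a\<close>.\<close>

definition bump :: "real \<Rightarrow> complex \<Rightarrow> complex \<Rightarrow> complex" where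
  "bump a w z = of_real (flat 0 (1 - a * (cmod (z - w))\<^sup>2))"

lemma bump_test:
  assumes "a > 0" "cmod w + 1 / sqrt a < 1"
  shows "bump a w \<in> test_functions"
proof (rule bump_algebra_test[OF _ _ assms])
  show "bump a w \<in> bump_algebra a w"
    unfolding bump_def[abs_def] by (rule bump_algebra.flat)
qed (auto simp: bump_def flat_def)

lemma conj_bump_test:
  assumes "a > 0" "cmod w + 1 / sqrt a < 1"
  shows "(\<lambda>z. (cnj z + - cnj w) * bump a w z) \<in> test_functions"
proof (rule bump_algebra_test[OF _ _ assms])
  show "(\<lambda>z. (cnj z + - cnj w) * bump a w z) \<in> bump_algebra a w"
    unfolding bump_def[abs_def] by (intro bump_algebra.intros)
qed (auto simp: bump_def flat_def)

lemma dbar_bump: "dbar (bump a w) z = - of_real a * (z - w) * of_real (flat 2 (1 - a * (cmod (z - w))\<^sup>2))"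
proof -
  have p: "partial e (bump a w) z = of_real (flat 2 (1 - a * (cmod (z - w))\<^sup>2)) * (of_real (- a) * ((z + - w) * cnj e + (cnj z + - cnj w) * e))" for e
    unfolding bump_def[abs_def] using partial_eq[OF has_derivative_flat_norm[of 0 a w z]] by (simp add: numeral_2_eq_2)
  show ?thesis unfolding dbar_def p by (simp add: field_simps)
qed

lemma bump_differentiable: "bump a w differentiable at z"
  unfolding bump_def[abs_def] using has_derivative_flat_norm[of 0 a w z] differentiable_def by blast

lemma dbar_conj_bump: "dbar (\<lambda>z. (cnj z + - cnj w) * bump a w z) z =
    of_real (flat 0 (1 - a * (cmod (z - w))\<^sup>2) - a * (cmod (z - w))\<^sup>2 * flat 2 (1 - a * (cmod (z - w))\<^sup>2))"
proof -
  have d: "((\<lambda>z. cnj z + - cnj w) has_derivative cnj) (at z)"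
    using has_derivative_add[OF bounded_linear_imp_has_derivative[OF bounded_linear_cnj] has_derivative_const[of "- cnj w"]] by simp
  have "dbar (\<lambda>z. cnj z + - cnj w) z = 1"
    unfolding dbar_def partial_eq[OF d] by simp
  moreover have "(\<lambda>z. cnj z + - cnj w) differentiable at z"
    using d differentiable_def by blast
  ultimately have "dbar (\<lambda>z. (cnj z + - cnj w) * bump a w z) z = (cnj z + - cnj w) * dbar (bump a w) z + bump a w z"
    by (subst dbar_mult) (auto simp: bump_differentiable)
  also have "\<dots> = of_real (flat 0 (1 - a * (cmod (z - w))\<^sup>2)) -
      of_real a * ((z - w) * (cnj z - cnj w)) * of_real (flat 2 (1 - a * (cmod (z - w))\<^sup>2))"
    by (simp add: dbar_bump bump_def algebra_simps)
  also have "(z - w) * (cnj z - cnj w) = of_real ((cmod (z - w))\<^sup>2)"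
    by (metis complex_cnj_diff complex_norm_square)
  finally show ?thesis by simp
qed

section \<open>Weyl's lemma\<close>

lemma borel_measurable_cnj [measurable]:
  "f \<in> borel_measurable M \<Longrightarrow> (\<lambda>x. cnj (f x)) \<in> borel_measurable M"
  by (rule measurable_compose[OF _ borel_measurable_continuous_onI]) (auto intro!: continuous_intros)

lemma AE_LD_limit_of_continuous:
  fixes h :: "complex \<Rightarrow> complex"
  assumes h: "h \<in> borel_measurable LD" and B: "\<And>z. z \<in> disc \<Longrightarrow> cmod (h z) \<le> B" "B \<ge> 0"
  obtains g :: "nat \<Rightarrow> complex \<Rightarrow> complex"
  where "\<And>n. continuous_on UNIV (g n)" "\<And>n z. cmod (g n z) \<le> B" "AE z in LD. (\<lambda>n. g n z) \<longlonglongrightarrow> h z"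
proof -
  define h' where "h' = (\<lambda>z. if z \<in> disc then h z else 0)"
  have "h' \<in> borel_measurable lebesgue"
    unfolding h'_def using h by (subst borel_measurable_if) auto
  then have "h' measurable_on UNIV"
    by (intro lebesgue_measurable_imp_measurable_on) auto
  then obtain N g where N: "negligible N" and g: "\<And>n. continuous_on UNIV (g n)"
      and lim: "\<And>z. z \<notin> N \<Longrightarrow> (\<lambda>n. g n z) \<longlonglongrightarrow> h' z"
    unfolding measurable_on_def by auto
  \<comment> \<open>radial truncation at modulus \<open>B\<close>\<close>
  define t :: "complex \<Rightarrow> complex" where "t w = of_real (B / max B (cmod w)) * w" for w
  show ?thesis
  proof (cases "B = 0")
    case True
    have "AE z in LD. (\<lambda>n. 0) \<longlonglongrightarrow> h z"
      using B True by (intro AE_I2) auto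
    then show ?thesis using that[of "\<lambda>_ _. 0"] True by auto
  next
    case False
    then have Bpos: "B > 0" using B(2) by simp
    have contt: "continuous_on UNIV t"
      unfolding t_def using Bpos by (intro continuous_intros) (auto simp: max_def)
    have tid: "t w = w" if "cmod w \<le> B" for w
      using that Bpos by (simp add: t_def max_def)
    have "cmod (t w) = B * (cmod w / max B (cmod w))" for w
      using Bpos by (simp add: t_def norm_mult norm_divide max_def)
    moreover have "cmod w / max B (cmod w) \<le> 1" for w
      using Bpos by (simp add: divide_le_eq max_def)
    ultimately have tle: "cmod (t w) \<le> B" for w
      using Bpos mult_left_mono[of "cmod w / max B (cmod w)" 1 B] by simp
    have "AE z in lebesgue. z \<notin> N"
      using N by (simp add: negligible_iff_null_sets AE_not_in)
    then have "AE z in LD. z \<notin> N"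
      by (rule AE_restrict_space_iff[THEN iffD2, rotated, OF eventually_mono]) auto
    then have "AE z in LD. z \<in> disc \<and> z \<notin> N"
      using AE_space[of LD] by eventually_elim auto
    then have "AE z in LD. (\<lambda>n. t (g n z)) \<longlonglongrightarrow> h z"
    proof eventually_elim
      fix z assume z: "z \<in> disc \<and> z \<notin> N"
      have "isCont t (h' z)"
        using contt by (simp add: continuous_on_eq_continuous_at)
      then have "(\<lambda>n. t (g n z)) \<longlonglongrightarrow> t (h' z)"
        using lim z isCont_tendsto_compose by blast
      then show "(\<lambda>n. t (g n z)) \<longlonglongrightarrow> h z"
        using tid[of "h z"] B z by (simp add: h'_def)
    qed
    moreover have "continuous_on UNIV (\<lambda>z. t (g n z))" for n
      by (rule continuous_on_compose2[OF contt g]) auto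
    ultimately show ?thesis using that[of "\<lambda>n z. t (g n z)"] tle by auto
  qed
qed

definition Cc :: "(complex \<Rightarrow> complex) \<Rightarrow> bool" where
  "Cc \<psi> \<longleftrightarrow> continuous_on UNIV \<psi> \<and> (\<exists>K. compact K \<and> K \<subseteq> disc \<and> (\<forall>z. z \<notin> K \<longrightarrow> \<psi> z = 0))"

lemma cutoff:
  assumes "0 < R" "R < 1"
  obtains \<theta> where "Cc (\<lambda>z. of_real (\<theta> z))" "\<And>z. \<theta> z \<ge> 0" "\<And>z. \<theta> z \<le> 1" "\<And>z. z \<in> ball 0 R \<Longrightarrow> \<theta> z > 0"
     "\<And>z. z \<notin> cball 0 R \<Longrightarrow> \<theta> z = 0"
proof
  let ?\<theta> = "\<lambda>z :: complex. max 0 (min 1 (R - cmod z))"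
  have "compact (cball (0::complex) R)" "cball (0::complex) R \<subseteq> disc" using assms by auto
  moreover have "of_real (?\<theta> z) = (0::complex)" if "z \<notin> cball 0 R" for z
    using that by (auto simp: max_def min_def)
  ultimately show "Cc (\<lambda>z. of_real (?\<theta> z))"
    unfolding Cc_def by (intro conjI continuous_intros exI[of _ "cball 0 R"]) auto
qed (use assms in \<open>auto simp: max_def min_def\<close>)

lemma AE_LD_exhaust:
  assumes "\<And>R. 0 < R \<Longrightarrow> R < 1 \<Longrightarrow> AE z in LD. z \<in> ball 0 R \<longrightarrow> P z"
  shows "AE z in LD. P z"
proof -
  have "AE z in LD. \<forall>n::nat. z \<in> ball 0 (1 - 1 / real (n + 2)) \<longrightarrow> P z"
    unfolding AE_all_countable by (intro allI assms) (auto simp: field_simps)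
  then show ?thesis
    using AE_space[of LD]
  proof eventually_elim
    fix z assume *: "\<forall>n::nat. z \<in> ball 0 (1 - 1 / real (n + 2)) \<longrightarrow> P z" "z \<in> space LD"
    then have "1 - cmod z > 0" by simp
    then obtain n where "n \<noteq> 0" "inverse (real n) < 1 - cmod z"
      using real_arch_inverse by blast
    moreover have "1 / real (n + 2) \<le> inverse (real n)"
      using \<open>n \<noteq> 0\<close> by (simp add: field_simps)
    ultimately have "z \<in> ball 0 (1 - 1 / real (n + 2))" by simp
    with * show "P z" by blast
  qed
qed

text \<open>The conjugate sign of \<open>D\<close> is a bounded pointwise limit of continuous functions. Cut off near the circle, they
  are orthogonal to \<open>D\<close>, and dominated convergence gives that the integral of \<open>\<theta> * cmod D\<close> vanishes.\<close>

lemma Cc_orthogonal_imp_AE_0: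
  assumes D: "D \<in> borel_measurable LD"
    and int: "\<And>R. 0 < R \<Longrightarrow> R < 1 \<Longrightarrow> integrable LD (\<lambda>z. indicator (cball 0 R) z *\<^sub>R D z)"
    and orth: "\<And>\<psi>. Cc \<psi> \<Longrightarrow> (LINT z|LD. D z * \<psi> z) = 0"
  shows "AE z in LD. D z = 0"
proof (rule AE_LD_exhaust)
  fix R :: real assume R: "0 < R" "R < 1"
  obtain \<theta> where \<theta>: "Cc (\<lambda>z. of_real (\<theta> z))" "\<And>z. \<theta> z \<ge> 0" "\<And>z. \<theta> z \<le> 1" "\<And>z. z \<in> ball 0 R \<Longrightarrow> \<theta> z > 0"
     "\<And>z. z \<notin> cball 0 R \<Longrightarrow> \<theta> z = 0" using cutoff[OF R] by blast
  have "(\<lambda>z. of_real (\<theta> z) :: complex) \<in> borel_measurable LD"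
    using \<theta>(1) by (intro continuous_imp_measurable_LD) (auto simp: Cc_def intro: continuous_on_subset)
  from measurable_compose[OF this borel_measurable_Re] have [measurable]: "\<theta> \<in> borel_measurable LD"
    by simp
  note [measurable] = D
  define s where "s z = cnj (sgn (D z))" for z
  have [measurable]: "s \<in> borel_measurable LD"
    unfolding s_def sgn_div_norm by measurable
  have s1: "cmod (s z) \<le> 1" for z by (simp add: s_def norm_sgn)
  then obtain g where g: "\<And>n. continuous_on UNIV (g n)" "\<And>n z. cmod (g n z) \<le> 1" "AE z in LD. (\<lambda>n. g n z) \<longlonglongrightarrow> s z"
    using AE_LD_limit_of_continuous[of s 1] by auto
  have [measurable]: "g n \<in> borel_measurable LD" for n
    by (intro continuous_imp_measurable_LD continuous_on_subset[OF g(1)]) auto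
  have intb: "integrable LD (\<lambda>z. norm (indicator (cball 0 R) z *\<^sub>R D z))"
    by (rule integrable_norm[OF int[OF R]])
  have "(\<lambda>n. LINT z|LD. D z * (of_real (\<theta> z) * g n z)) \<longlonglongrightarrow> (LINT z|LD. D z * (of_real (\<theta> z) * s z))"
  proof (rule integral_dominated_convergence[OF _ _ intb])
    show "AE z in LD. (\<lambda>n. D z * (of_real (\<theta> z) * g n z)) \<longlonglongrightarrow> D z * (of_real (\<theta> z) * s z)"
      using g(3) by eventually_elim (intro tendsto_intros)
    have "cmod (D z * (of_real (\<theta> z) * g n z)) \<le> norm (indicator (cball 0 R) z *\<^sub>R D z)" for n z
    proof (cases "z \<in> cball 0 R")
      case True
      have "\<theta> z * cmod (g n z) \<le> 1"
        using mult_mono[of "\<theta> z" 1 "cmod (g n z)" 1] \<theta>(2,3) g(2) by auto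
      then show ?thesis
        using True \<theta>(2) mult_left_mono[of "\<theta> z * cmod (g n z)" 1 "cmod (D z)"] by (simp add: norm_mult)
    qed (simp add: \<theta>(5))
    then show "AE z in LD. cmod (D z * (of_real (\<theta> z) * g n z)) \<le> norm (indicator (cball 0 R) z *\<^sub>R D z)" for n
      by simp
  qed measurable
  moreover have "(LINT z|LD. D z * (of_real (\<theta> z) * g n z)) = 0" for n
  proof (rule orth)
    show "Cc (\<lambda>z. of_real (\<theta> z) * g n z)"
    proof -
      obtain K where "compact K" "K \<subseteq> disc" "\<And>z. z \<notin> K \<Longrightarrow> of_real (\<theta> z) = (0::complex)"
        using \<theta>(1) by (auto simp: Cc_def)
      then have "\<And>z. z \<notin> K \<Longrightarrow> of_real (\<theta> z) * g n z = 0" by (metis mult_zero_left)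
      moreover have "continuous_on UNIV (\<lambda>z. of_real (\<theta> z) * g n z)"
        using \<theta>(1) g(1) by (intro continuous_on_mult) (auto simp: Cc_def)
      ultimately show ?thesis unfolding Cc_def using \<open>compact K\<close> \<open>K \<subseteq> disc\<close> by blast
    qed
  qed
  ultimately have 0: "(LINT z|LD. D z * (of_real (\<theta> z) * s z)) = 0"
    by (simp add: LIMSEQ_const_iff)
  have eq: "D z * (of_real (\<theta> z) * s z) = of_real (\<theta> z * cmod (D z))" for z
  proof -
    have "s z = cnj (D z) / of_real (cmod (D z))"
      by (simp add: s_def sgn_div_norm scaleR_conv_of_real divide_inverse mult.commute)
    then have "D z * s z = (D z * cnj (D z)) / of_real (cmod (D z))" by simp
    also have "\<dots> = of_real (cmod (D z))"
      by (simp add: complex_norm_square[symmetric] power2_eq_square)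
    finally show ?thesis by (simp add: mult.left_commute)
  qed
  have int2: "integrable LD (\<lambda>z. \<theta> z * cmod (D z))"
  proof (rule Bochner_Integration.integrable_bound[OF intb])
    have "\<theta> z * cmod (D z) \<le> 1 * cmod (D z)" for z
      by (intro mult_right_mono \<theta>) auto
    then show "AE z in LD. norm (\<theta> z * cmod (D z)) \<le> norm (norm (indicator (cball 0 R) z *\<^sub>R D z))"
      using \<theta>(2,5) by (intro AE_I2) (auto simp: indicator_def)
  qed measurable
  have "(LINT z|LD. \<theta> z * cmod (D z)) = 0"
    using 0 unfolding eq by (simp del: of_real_mult)
  then have "AE z in LD. \<theta> z * cmod (D z) = 0"
    using integral_nonneg_eq_0_iff_AE[OF int2] \<theta>(2) by simp
  then show "AE z in LD. z \<in> ball 0 R \<longrightarrow> D z = 0"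
    by eventually_elim (use \<theta>(4) in force)
qed

text \<open>With the factor \<open>a\<close> the kernel has the same mass at every scale, the constant \<open>bump_mass\<close> below, rather
  than \<open>1\<close>.\<close>

definition mollify :: "(complex \<Rightarrow> complex) \<Rightarrow> real \<Rightarrow> complex \<Rightarrow> complex" where
  "mollify F a w = (LINT z|LD. F z * (of_real a * bump a w z))"

lemma continuous_on_flat_norm [continuous_intros]:
  assumes "continuous_on S f" "continuous_on S g"
  shows "continuous_on S (\<lambda>x. of_real (flat j (1 - a * (cmod (f x - g x))\<^sup>2)) :: complex)"
  by (intro continuous_intros continuous_on_compose2[OF continuous_on_flat] assms) auto

lemma continuous_on_bump [continuous_intros]:
  assumes "continuous_on S f" "continuous_on S g"
  shows "continuous_on S (\<lambda>x. bump a (f x) (g x))"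
  unfolding bump_def by (intro continuous_intros assms)

lemma borel_measurable_flat [measurable]: "flat j \<in> borel_measurable borel"
  by (intro borel_measurable_continuous_onI continuous_on_flat)

lemma borel_measurable_bump [measurable]:
  assumes [measurable]: "f \<in> borel_measurable M" "g \<in> borel_measurable M"
  shows "(\<lambda>x. bump a (f x) (g x)) \<in> borel_measurable M"
  unfolding bump_def by measurable

lemma norm_bump_le: "cmod (bump a w z) \<le> 1"
  using flat_bound[of 0] flat_nonneg[of 0] by (simp add: bump_def)

lemma integrable_times_bounded:
  fixes F g :: "complex \<Rightarrow> complex"
  assumes "integrable LD F" "g \<in> borel_measurable LD" "\<And>z. z \<in> disc \<Longrightarrow> cmod (g z) \<le> B"
  shows "integrable LD (\<lambda>z. F z * g z)"
proof (rule Bochner_Integration.integrable_bound)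
  show "integrable LD (\<lambda>z. of_real B * F z)" using assms(1) by simp
  show "AE z in LD. norm (F z * g z) \<le> norm (of_real B * F z)"
  proof (rule AE_I2)
    fix z assume "z \<in> space LD"
    then have "cmod (g z) \<le> \<bar>B\<bar>" using assms(3)[of z] by simp
    then show "norm (F z * g z) \<le> norm (of_real B * F z)"
      using mult_right_mono[of "cmod (g z)" "\<bar>B\<bar>" "cmod (F z)"] by (simp add: norm_mult mult.commute)
  qed
qed (use assms in measurable)

lemma norm_integral_times_le:
  fixes F g :: "complex \<Rightarrow> complex"
  assumes "integrable LD F" "g \<in> borel_measurable LD" "\<And>z. z \<in> disc \<Longrightarrow> cmod (g z) \<le> B"
  shows "cmod (LINT z|LD. F z * g z) \<le> B * (LINT z|LD. cmod (F z))"
proof -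
  have i: "integrable LD (\<lambda>z. F z * g z)"
    by (rule integrable_times_bounded[OF assms])
  have "cmod (LINT z|LD. F z * g z) \<le> (LINT z|LD. cmod (F z * g z))"
    by (rule integral_norm_bound)
  also have "\<dots> \<le> (LINT z|LD. B * cmod (F z))"
  proof (rule integral_mono)
    show "integrable LD (\<lambda>z. cmod (F z * g z))" by (rule integrable_norm[OF i])
    show "integrable LD (\<lambda>z. B * cmod (F z))" using assms(1) by simp
    show "cmod (F z * g z) \<le> B * cmod (F z)" if "z \<in> space LD" for z
      using mult_right_mono[OF assms(3), of z "cmod (F z)"] that by (simp add: norm_mult mult.commute)
  qed
  finally show ?thesis by simp
qed

text \<open>The Taylor remainder of the kernel is quadratic uniformly in the integration variable, so the
  derivative may be taken under the integral for a merely integrable \<open>F\<close>. Its antiholomorphic part pairs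
  \<open>F\<close> with \<open>dbar (bump a w)\<close>.\<close>

lemma mollify_has_field_derivative:
  assumes F: "integrable LD F" and ortho: "(LINT z|LD. F z * dbar (bump a w) z) = 0"
    and a: "a > 0" and w: "cmod w < 1"
  shows "(mollify F a has_field_derivative
    (LINT z|LD. F z * (of_real (a\<^sup>2) * cnj (z - w) * of_real (flat 2 (1 - a * (cmod (z - w))\<^sup>2))))) (at w)"
proof -
  let ?f2 = "\<lambda>z. of_real (flat 2 (1 - a * (cmod (z - w))\<^sup>2)) :: complex"
  define D where "D = (LINT z|LD. F z * (of_real (a\<^sup>2) * cnj (z - w) * ?f2 z))"
  have f2_le: "cmod (?f2 z) \<le> 2" for z
    using flat_bound[of 2] flat_nonneg[of 2] by (simp add: numeral_2_eq_2)
  have f2m [measurable]: "?f2 \<in> borel_measurable borel" by measurable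
  have m [measurable]: "F \<in> borel_measurable LD" using F by auto
  have zw: "cmod (z - w) \<le> 2" if "z \<in> disc" for z
    using that w norm_triangle_ineq4[of z w] by simp
  have int1: "integrable LD (\<lambda>z. F z * (of_real (a\<^sup>2) * cnj (z - w) * ?f2 z))"
  proof (rule integrable_times_bounded[OF F, where B = "a\<^sup>2 * 2 * 2"])
    fix z assume "z \<in> disc"
    then show "cmod (of_real (a\<^sup>2) * cnj (z - w) * ?f2 z) \<le> a\<^sup>2 * 2 * 2"
      unfolding norm_mult using zw[of z] f2_le[of z] by (intro mult_mono) (auto simp: norm_power simp flip: complex_cnj_diff)
  qed (intro borel_measurable_LD, measurable)
  have int2: "integrable LD (\<lambda>z. F z * dbar (bump a w) z)"
  proof (rule integrable_times_bounded[OF F, where B = "a * 2 * 2"])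
    fix z assume "z \<in> disc"
    then show "cmod (dbar (bump a w) z) \<le> a * 2 * 2"
      unfolding dbar_bump norm_mult using zw[of z] f2_le[of z] a by (intro mult_mono) auto
  qed (unfold dbar_bump, intro borel_measurable_LD, measurable)
  have intb: "integrable LD (\<lambda>z. F z * (of_real a * bump a v z))" for v
    by (rule integrable_times_bounded[OF F, where B = a]) (use norm_bump_le[of a v] a in \<open>auto simp: norm_mult intro!: borel_measurable_LD\<close>)
  have Dh: "D * h = (LINT z|LD. F z * (of_real a * (of_real (2 * a * Re (cnj (z - w) * h)) * ?f2 z)))" for h
  proof -
    have "D * h = D * h - of_real a * cnj h * (LINT z|LD. F z * dbar (bump a w) z)"
      by (simp add: ortho)
    also have "\<dots> = (LINT z|LD. F z * (of_real (a\<^sup>2) * cnj (z - w) * ?f2 z) * h - of_real a * cnj h * (F z * dbar (bump a w) z))"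
      unfolding D_def using int1 int2 by simp
    also have "\<dots> = (LINT z|LD. F z * (of_real a * (of_real (2 * a * Re (cnj (z - w) * h)) * ?f2 z)))"
    proof (rule Bochner_Integration.integral_cong[OF refl])
      fix z
      have "of_real (2 * Re (cnj (z - w) * h)) = cnj (z - w) * h + (z - w) * cnj h"
        using complex_add_cnj[of "cnj (z - w) * h"] by simp
      then have "of_real (2 * a * Re (cnj (z - w) * h)) = of_real a * (cnj (z - w) * h + (z - w) * cnj h)"
        by (metis mult.assoc mult.left_commute of_real_mult)
      then show "F z * (of_real (a\<^sup>2) * cnj (z - w) * ?f2 z) * h - of_real a * cnj h * (F z * dbar (bump a w) z) =
         F z * (of_real a * (of_real (2 * a * Re (cnj (z - w) * h)) * ?f2 z))"
        by (simp only: dbar_bump) (simp add: algebra_simps power2_eq_square)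
    qed
    finally show ?thesis .
  qed
  define C where "C = a * (36 * (5 * a)\<^sup>2 + 2 * a)"
  have "(mollify F a has_derivative (\<lambda>h. D * h)) (at w)"
  proof (rule has_derivative_quadratic[where e = 1 and C = "C * (LINT z|LD. cmod (F z))"])
    fix h :: complex assume h: "norm h \<le> 1"
    let ?k = "\<lambda>z. of_real a * (bump a (w + h) z - bump a w z - of_real (2 * a * Re (cnj (z - w) * h)) * ?f2 z)"
    have "mollify F a (w + h) - mollify F a w - D * h = (LINT z|LD. F z * ?k z)"
    proof -
      have "integrable LD (\<lambda>z. F z * (of_real a * (of_real (2 * a * Re (cnj (z - w) * h)) * ?f2 z)))"
      proof (rule integrable_times_bounded[OF F, where B = "a * (2 * a * 2 * 2)"])
        fix z assume z: "z \<in> disc"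
        have "\<bar>Re (cnj (z - w) * h)\<bar> \<le> cmod (cnj (z - w)) * cmod h"
          using abs_Re_le_cmod[of "cnj (z - w) * h"] by (simp only: norm_mult)
        also have "\<dots> \<le> 2 * 1" using zw[OF z] h by (intro mult_mono) (auto simp flip: complex_cnj_diff)
        finally have "2 * a * \<bar>Re (cnj (z - w) * h)\<bar> \<le> 2 * a * 2"
          using a by simp
        then have "cmod (of_real (2 * a * Re (cnj (z - w) * h))) \<le> 2 * a * 2"
          using a by (simp only: norm_of_real abs_mult abs_numeral abs_of_pos)
        then show "cmod (of_real a * (of_real (2 * a * Re (cnj (z - w) * h)) * ?f2 z)) \<le> a * (2 * a * 2 * 2)"
          unfolding norm_mult[of _ "_ * _"] norm_mult[of "of_real (2 * a * Re (cnj (z - w) * h))"]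
          using f2_le[of z] a by (intro mult_mono) auto
      qed (intro borel_measurable_LD, measurable)
      then show ?thesis
        unfolding mollify_def Dh using intb[of w] intb[of "w + h"]
        by (simp add: algebra_simps flip: Bochner_Integration.integral_diff)
    qed
    also have "cmod \<dots> \<le> (C * (cmod h)\<^sup>2) * (LINT z|LD. cmod (F z))"
    proof (rule norm_integral_times_le[OF F])
      fix z assume z: "z \<in> disc"
      define x where "x = 1 - a * (cmod (z - (w + h)))\<^sup>2"
      define y where "y = 1 - a * (cmod (z - w))\<^sup>2"
      have xy: "x - y = a * (2 * Re (cnj (z - w) * h) - (cmod h)\<^sup>2)"
      proof -
        have "(cmod (z - (w + h)))\<^sup>2 = (cmod (z - w))\<^sup>2 - 2 * Re (cnj (z - w) * h) + (cmod h)\<^sup>2"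
          unfolding cmod_power2 by (simp add: power2_eq_square algebra_simps)
        moreover have "1 - a * (A - 2 * R + H) - (1 - a * A) = a * (2 * R - H)" for A R H :: real
          by (simp add: algebra_simps)
        ultimately show ?thesis by (simp only: x_def y_def)
      qed
      have "\<bar>Re (cnj (z - w) * h)\<bar> \<le> cmod (cnj (z - w)) * cmod h"
        using abs_Re_le_cmod[of "cnj (z - w) * h"] by (simp only: norm_mult)
      also have "\<dots> \<le> 2 * cmod h" using zw[OF z] by (intro mult_right_mono) (auto simp flip: complex_cnj_diff)
      finally have 1: "\<bar>Re (cnj (z - w) * h)\<bar> \<le> 2 * cmod h" .
      have 2: "(cmod h)\<^sup>2 \<le> cmod h"
        using h mult_right_mono[of "cmod h" 1 "cmod h"] by (simp add: power2_eq_square)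
      have "\<bar>2 * Re (cnj (z - w) * h) - (cmod h)\<^sup>2\<bar> \<le> 5 * cmod h"
        using 1 2 zero_le_power2[of "cmod h"] by linarith
      then have "\<bar>x - y\<bar> \<le> 5 * a * cmod h"
        unfolding xy abs_mult using a by (simp add: mult.assoc mult_left_mono mult.left_commute)
      then have "(x - y)\<^sup>2 \<le> (5 * a * cmod h)\<^sup>2"
        by (metis abs_ge_zero power2_abs power_mono)
      then have 3: "\<bar>flat 0 x - flat 0 y - (x - y) * flat 2 y\<bar> \<le> 36 * ((5 * a)\<^sup>2 * (cmod h)\<^sup>2)"
        using flat_Taylor[of x y] by (simp add: power_mult_distrib)
      have 4: "\<bar>a * (cmod h)\<^sup>2 * flat 2 y\<bar> \<le> 2 * a * (cmod h)\<^sup>2"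
        using f2_le[of z] a mult_left_mono[of "flat 2 y" 2 "a * (cmod h)\<^sup>2"] flat_nonneg[of 2 y]
        by (simp add: y_def abs_mult)
      have "?k z = of_real (a * ((flat 0 x - flat 0 y - (x - y) * flat 2 y) - a * (cmod h)\<^sup>2 * flat 2 y))"
      proof -
        have "bump a (w + h) z = of_real (flat 0 x)" "bump a w z = of_real (flat 0 y)" "?f2 z = of_real (flat 2 y)"
          by (simp_all only: bump_def x_def y_def)
        then show ?thesis unfolding xy by (simp only:) (simp add: algebra_simps)
      qed
      then have "cmod (?k z) = a * \<bar>(flat 0 x - flat 0 y - (x - y) * flat 2 y) - a * (cmod h)\<^sup>2 * flat 2 y\<bar>"
        using a by (simp only: norm_of_real abs_mult)
      also have "\<dots> \<le> a * (36 * ((5 * a)\<^sup>2 * (cmod h)\<^sup>2) + 2 * a * (cmod h)\<^sup>2)"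
        using 3 4 a by (intro mult_left_mono) linarith+
      also have "\<dots> = C * (cmod h)\<^sup>2" by (simp add: C_def algebra_simps)
      finally show "cmod (?k z) \<le> C * (cmod h)\<^sup>2" .
    qed (intro borel_measurable_LD, measurable)
    finally show "cmod (mollify F a (w + h) - mollify F a w - D * h) \<le> C * (LINT z|LD. cmod (F z)) * (cmod h)\<^sup>2"
      by (simp only: mult_ac)
  qed (auto intro: bounded_linear_mult_right)
  then show ?thesis by (simp only: has_field_derivative_def D_def)
qed

text \<open>The derivative of \<open>a * bump a w\<close> in \<open>a\<close> is itself a \<open>dbar\<close> of a test function. A weakly holomorphic
  function therefore has the same mollification at all scales, just as a holomorphic one.\<close>

lemma mollify_scale_derivative:
  assumes F: "integrable LD F" and ortho: "(LINT z|LD. F z * dbar (\<lambda>z. (cnj z + - cnj w) * bump a w z) z) = 0"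
    and a: "a > 0" and w: "cmod w < 1"
  shows "((\<lambda>a. mollify F a w) has_derivative (\<lambda>h. 0)) (at a)"
proof (rule has_derivative_quadratic[where e = 1 and C = "(8 + a * (36 * 16)) * (LINT z|LD. cmod (F z))"])
  fix b :: real assume "norm b \<le> 1"
  have m [measurable]: "F \<in> borel_measurable LD" using F by auto
  let ?s = "\<lambda>z. (cmod (z - w))\<^sup>2"
  let ?d = "\<lambda>z. of_real (flat 0 (1 - a * ?s z) - a * ?s z * flat 2 (1 - a * ?s z)) :: complex"
  have s4: "?s z \<le> 4" if "z \<in> disc" for z
  proof -
    have "cmod (z - w) \<le> 2" using that w norm_triangle_ineq4[of z w] by simp
    then show ?thesis using power_mono[of "cmod (z - w)" 2 2] by simp
  qed
  have intb: "integrable LD (\<lambda>z. F z * (of_real c * bump c w z))" for c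
    by (rule integrable_times_bounded[OF F, where B = "\<bar>c\<bar>"])
       (use norm_bump_le[of c w] in \<open>auto simp: norm_mult mult_left_le intro!: borel_measurable_LD\<close>)
  have intd: "integrable LD (\<lambda>z. F z * ?d z)"
  proof (rule integrable_times_bounded[OF F, where B = "1 + a * 4 * 2"])
    fix z assume z: "z \<in> disc"
    have "a * ?s z * flat 2 (1 - a * ?s z) \<le> a * 4 * 2"
      using s4[OF z] a flat_bound[of 2 "1 - a * ?s z"] flat_nonneg[of 2] by (intro mult_mono) (auto simp: numeral_2_eq_2)
    moreover have "0 \<le> a * ?s z * flat 2 (1 - a * ?s z)"
      using a flat_nonneg[of 2] by simp
    ultimately show "cmod (?d z) \<le> 1 + a * 4 * 2"
      unfolding norm_of_real using flat_bound[of 0 "1 - a * ?s z"] flat_nonneg[of 0 "1 - a * ?s z"] by simp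
  qed (intro borel_measurable_LD, measurable)
  let ?k = "\<lambda>z. of_real (a + b) * bump (a + b) w z - of_real a * bump a w z - of_real b * ?d z"
  have "mollify F (a + b) w - mollify F a w - 0 = mollify F (a + b) w - mollify F a w - of_real b * (LINT z|LD. F z * ?d z)"
    using ortho unfolding dbar_conj_bump by simp
  also have "\<dots> = (LINT z|LD. F z * (of_real (a + b) * bump (a + b) w z) - F z * (of_real a * bump a w z) - of_real b * (F z * ?d z))"
    unfolding mollify_def using intb[of a] intb[of "a + b"] intd by simp
  also have "\<dots> = (LINT z|LD. F z * ?k z)"
    by (rule Bochner_Integration.integral_cong) (auto simp: algebra_simps)
  finally have eq: "mollify F (a + b) w - mollify F a w - 0 = (LINT z|LD. F z * ?k z)" .
  have "cmod (LINT z|LD. F z * ?k z) \<le> ((8 + a * (36 * 16)) * b\<^sup>2) * (LINT z|LD. cmod (F z))"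
  proof (rule norm_integral_times_le[OF F])
    fix z assume z: "z \<in> disc"
    define s where "s = ?s z"
    have s: "0 \<le> s" "s \<le> 4" using s4[OF z] by (auto simp: s_def)
    define x where "x = 1 - (a + b) * s"
    define y where "y = 1 - a * s"
    have xy: "x - y = - b * s" by (simp add: x_def y_def algebra_simps)
    have "\<bar>flat 0 x - flat 0 y\<bar> \<le> 2 * (\<bar>b\<bar> * s)"
      using flat_Lipschitz[of x y] s(1) by (simp add: xy abs_mult)
    also have "\<dots> \<le> 2 * (\<bar>b\<bar> * 4)" using s by (intro mult_left_mono) auto
    finally have "\<bar>b\<bar> * \<bar>flat 0 x - flat 0 y\<bar> \<le> \<bar>b\<bar> * (2 * (\<bar>b\<bar> * 4))"
      by (rule mult_left_mono) auto
    then have "\<bar>b\<bar> * \<bar>flat 0 x - flat 0 y\<bar> \<le> 8 * \<bar>b\<bar>\<^sup>2"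
      by (simp add: power2_eq_square)
    then have 1: "\<bar>b * (flat 0 x - flat 0 y)\<bar> \<le> 8 * b\<^sup>2" by (simp add: abs_mult)
    have "s\<^sup>2 \<le> 16" using power_mono[of s 4 2] s by simp
    then have "(x - y)\<^sup>2 \<le> 16 * b\<^sup>2"
      unfolding xy using mult_left_mono[of "s\<^sup>2" 16 "b\<^sup>2"] by (simp add: power_mult_distrib)
    then have 2: "\<bar>flat 0 x - flat 0 y - (x - y) * flat 2 y\<bar> \<le> 36 * (16 * b\<^sup>2)"
      using flat_Taylor[of x y] by simp
    have "?k z = of_real (b * (flat 0 x - flat 0 y) + a * (flat 0 x - flat 0 y - (x - y) * flat 2 y))"
    proof -
      have "bump (a + b) w z = of_real (flat 0 x)" "bump a w z = of_real (flat 0 y)"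
        "?d z = of_real (flat 0 y - a * s * flat 2 y)"
        by (simp_all only: bump_def x_def y_def s_def)
      then show ?thesis unfolding xy by (simp only:) (simp add: algebra_simps)
    qed
    then have "cmod (?k z) = \<bar>b * (flat 0 x - flat 0 y) + a * (flat 0 x - flat 0 y - (x - y) * flat 2 y)\<bar>"
      by (simp only: norm_of_real)
    also have "\<dots> \<le> \<bar>b * (flat 0 x - flat 0 y)\<bar> + a * \<bar>flat 0 x - flat 0 y - (x - y) * flat 2 y\<bar>"
      using a abs_triangle_ineq[of "b * (flat 0 x - flat 0 y)" "a * (flat 0 x - flat 0 y - (x - y) * flat 2 y)"]
      by (simp add: abs_mult)
    also have "\<dots> \<le> 8 * b\<^sup>2 + a * (36 * (16 * b\<^sup>2))"
      using 1 2 a by (intro add_mono mult_left_mono) auto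
    finally show "cmod (?k z) \<le> (8 + a * (36 * 16)) * b\<^sup>2" by (simp add: algebra_simps)
  qed (intro borel_measurable_LD, measurable)
  then show "cmod (mollify F (a + b) w - mollify F a w - 0) \<le> (8 + a * (36 * 16)) * (LINT z|LD. cmod (F z)) * (norm b)\<^sup>2"
    unfolding eq by (simp only: real_norm_def power2_abs mult_ac)
qed auto

lemma LD_Fubini:
  fixes f :: "complex \<Rightarrow> complex \<Rightarrow> complex"
  assumes m: "case_prod f \<in> borel_measurable (LD \<Otimes>\<^sub>M LD)"
    and b: "\<And>x. x \<in> disc \<Longrightarrow> (\<integral>\<^sup>+y. ennreal (cmod (f x y)) \<partial>LD) \<le> ennreal C"
  shows "(LINT x|LD. LINT y|LD. f x y) = (LINT y|LD. LINT x|LD. f x y)"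
proof -
  have "integrable (LD \<Otimes>\<^sub>M LD) (case_prod f)"
  proof (rule integrableI_bounded[OF m])
    have "(\<integral>\<^sup>+x. ennreal (cmod (case_prod f x)) \<partial>(LD \<Otimes>\<^sub>M LD)) = (\<integral>\<^sup>+x. \<integral>\<^sup>+y. ennreal (cmod (f x y)) \<partial>LD \<partial>LD)"
      using m by (subst LD.nn_integral_fst[symmetric]) auto
    also have "\<dots> \<le> (\<integral>\<^sup>+x. ennreal C \<partial>LD)"
      by (intro nn_integral_mono b) auto
    also have "\<dots> < \<infinity>"
    proof -
      have "emeasure LD disc < top"
        by (metis LD.emeasure_finite infinity_ennreal_def top.not_eq_extremum)
      then show ?thesis by (simp add: ennreal_mult_less_top)
    qed
    finally show "(\<integral>\<^sup>+x. ennreal (cmod (case_prod f x)) \<partial>(LD \<Otimes>\<^sub>M LD)) < \<infinity>" .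
  qed
  then show ?thesis by (rule LD_pair.Fubini_integral[symmetric])
qed

definition bump_mass :: real where
  "bump_mass = (LINT z|lborel. flat 0 (1 - (cmod z)\<^sup>2))"

lemma integrable_flat_norm: "integrable (lborel :: complex measure) (\<lambda>z. flat 0 (1 - (cmod z)\<^sup>2))"
proof -
  have "integrable (lborel :: complex measure) (\<lambda>z. indicator (cball 0 1) z *\<^sub>R flat 0 (1 - (cmod z)\<^sup>2))"
    by (intro borel_integrable_compact continuous_on_compose2[OF continuous_on_flat] continuous_intros) auto
  moreover have "indicator (cball 0 1) z *\<^sub>R flat 0 (1 - (cmod z)\<^sup>2) = flat 0 (1 - (cmod z)\<^sup>2)" for z
    by (auto simp: indicator_def flat_def abs_square_less_1)
  ultimately show ?thesis by (simp only:)
qed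

lemma bump_mass_pos: "bump_mass > 0"
proof -
  have "bump_mass \<ge> 0" unfolding bump_mass_def by (intro Bochner_Integration.integral_nonneg flat_nonneg)
  moreover have "bump_mass \<noteq> 0"
  proof
    assume "bump_mass = 0"
    then have "AE z in (lborel :: complex measure). flat 0 (1 - (cmod z)\<^sup>2) = 0"
      unfolding bump_mass_def using integral_nonneg_eq_0_iff_AE[OF integrable_flat_norm] flat_nonneg by auto
    then have "AE z in (lebesgue :: complex measure). flat 0 (1 - (cmod z)\<^sup>2) = 0"
      by (rule AE_completion)
    then have "AE z in LD. flat 0 (1 - (cmod z)\<^sup>2) = 0"
      by (subst AE_restrict_space_iff) (auto elim: eventually_mono)
    then have "flat 0 (1 - (cmod 0)\<^sup>2) = 0"
      by (rule AE_LD_continuous_imp[rotated 2]) (auto intro!: continuous_on_compose2[OF continuous_on_flat] continuous_intros)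
    then show False by (simp add: flat_def)
  qed
  ultimately show ?thesis by simp
qed

lemma compact_in_disc:
  fixes K :: "complex set"
  assumes "compact K" "K \<subseteq> disc"
  obtains R where "0 < R" "R < 1" "K \<subseteq> cball 0 R"
proof (cases "K = {}")
  case True
  then show ?thesis using that[of "1/2"] by auto
next
  case False
  then obtain x where x: "x \<in> K" "\<And>y. y \<in> K \<Longrightarrow> cmod y \<le> cmod x"
    using continuous_attains_sup[OF assms(1) False, of cmod] by (auto intro: continuous_intros)
  then have "cmod x < 1" using assms by auto
  have "cmod y \<le> (1 + cmod x) / 2" if "y \<in> K" for y
    using x(2)[OF that] \<open>cmod x < 1\<close> by simp
  then have "K \<subseteq> cball 0 ((1 + cmod x) / 2)" by auto
  moreover have "0 < (1 + cmod x) / 2" "(1 + cmod x) / 2 < 1"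
    using \<open>cmod x < 1\<close> norm_ge_zero[of x] by (auto simp del: norm_ge_zero)
  ultimately show ?thesis by (rule that[rotated 2])
qed

lemma Cc_bounded:
  assumes "Cc \<psi>"
  obtains B where "B > 0" "\<And>z. cmod (\<psi> z) \<le> B"
proof -
  obtain K where K: "compact K" "K \<subseteq> disc" "\<And>z. z \<notin> K \<Longrightarrow> \<psi> z = 0" and c: "continuous_on UNIV \<psi>"
    using assms by (auto simp: Cc_def)
  obtain B where "B > 0" "\<And>z. z \<in> disc \<Longrightarrow> cmod (\<psi> z) \<le> B"
    using compact_support_bounded[of \<psi> K] K c continuous_on_subset by blast
  moreover have "\<psi> z = 0" if "z \<notin> disc" for z using that K(2,3) by blast
  ultimately show ?thesis using that[of B] by (metis less_imp_le norm_zero)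
qed

lemma mollify_dual:
  assumes "Cc \<psi>" "a > 0"
  shows "(LINT w|LD. \<psi> w * (of_real a * bump a w z)) =
     (LINT u|lborel. \<psi> (z + (1 / sqrt a) *\<^sub>R u) * of_real (flat 0 (1 - (cmod u)\<^sup>2)))"
proof -
  have c: "continuous_on UNIV \<psi>" using assms by (auto simp: Cc_def)
  then have [measurable]: "\<psi> \<in> borel_measurable borel" by (rule borel_measurable_continuous_onI)
  have 0: "\<psi> z = 0" if "z \<notin> disc" for z using assms that by (auto simp: Cc_def)
  let ?f = "\<lambda>w. \<psi> w * (of_real a * bump a w z)"
  let ?c = "1 / sqrt a"
  have c0: "?c \<noteq> 0" using assms by simp
  have "(LINT w|LD. ?f w) = (LINT w|lborel. indicator disc w *\<^sub>R ?f w)"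
    by (rule integral_LD) measurable
  also have "\<dots> = (LINT w|lborel. ?f w)"
    using 0 by (intro Bochner_Integration.integral_cong) (auto simp: indicator_def)
  also have "\<dots> = (LINT u|lborel. \<bar>?c\<bar> ^ DIM(complex) *\<^sub>R ?f (z + ?c *\<^sub>R u))"
    by (subst lborel_affine[OF c0, of z], subst integral_density, simp, simp, simp, subst integral_distr) simp_all
  also have "\<dots> = (LINT u|lborel. \<psi> (z + ?c *\<^sub>R u) * of_real (flat 0 (1 - (cmod u)\<^sup>2)))"
  proof (rule Bochner_Integration.integral_cong[OF refl])
    fix u :: complex
    have "a * (cmod (z - (z + ?c *\<^sub>R u)))\<^sup>2 = (cmod u)\<^sup>2"
      using assms(2) by (simp add: power_divide)
    then have "bump a (z + ?c *\<^sub>R u) z = of_real (flat 0 (1 - (cmod u)\<^sup>2))"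
      unfolding bump_def by simp
    moreover have "\<bar>?c\<bar> ^ DIM(complex) * a = 1"
      using assms(2) by (simp add: power_divide)
    then have "complex_of_real (\<bar>?c\<bar> ^ DIM(complex)) * of_real a = 1"
      by (metis of_real_1 of_real_mult)
    ultimately show "\<bar>?c\<bar> ^ DIM(complex) *\<^sub>R ?f (z + ?c *\<^sub>R u) = \<psi> (z + ?c *\<^sub>R u) * of_real (flat 0 (1 - (cmod u)\<^sup>2))"
    proof -
      assume E: "bump a (z + ?c *\<^sub>R u) z = of_real (flat 0 (1 - (cmod u)\<^sup>2))"
        and 1: "complex_of_real (\<bar>?c\<bar> ^ DIM(complex)) * of_real a = 1"
      have "x * (y * (b * e)) = (x * b) * (y * e)" for x y b e :: complex
        by (simp only: mult_ac)
      then show ?thesis unfolding scaleR_conv_of_real[of "\<bar>?c\<bar> ^ DIM(complex)"] E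
        by (simp only: 1 mult_1)
    qed
  qed
  finally show ?thesis .
qed

text \<open>By Fubini the mollification can be moved from the integrable \<open>F\<close> to the continuous \<open>\<psi>\<close>, where it converges
  boundedly.\<close>

lemma mollify_limit:
  assumes F: "integrable LD F" and \<psi>: "Cc \<psi>"
  shows "(\<lambda>n. LINT w|LD. \<psi> w * mollify F (real (Suc n)) w) \<longlonglongrightarrow> of_real bump_mass * (LINT z|LD. F z * \<psi> z)"
proof -
  obtain B where B: "B > 0" "\<And>z. cmod (\<psi> z) \<le> B" using Cc_bounded[OF \<psi>] by blast
  have c: "continuous_on UNIV \<psi>" using \<psi> by (auto simp: Cc_def)
  then have \<psi>m [measurable]: "\<psi> \<in> borel_measurable borel" by (rule borel_measurable_continuous_onI)
  have Fm [measurable]: "F \<in> borel_measurable LD" using F by auto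
  define g where "g n z = (LINT u|lborel. \<psi> (z + (1 / sqrt (real (Suc n))) *\<^sub>R u) * of_real (flat 0 (1 - (cmod u)\<^sup>2)))" for n z
  have bnd: "AE u in lborel. norm (\<psi> (z + (1 / sqrt (real (Suc n))) *\<^sub>R u) * of_real (flat 0 (1 - (cmod u)\<^sup>2)))
       \<le> B * flat 0 (1 - (cmod u)\<^sup>2)" for n z
    using B(2) flat_nonneg by (intro AE_I2) (auto simp: norm_mult intro!: mult_right_mono)
  have intB: "integrable (lborel :: complex measure) (\<lambda>u. B * flat 0 (1 - (cmod u)\<^sup>2))"
    using integrable_flat_norm by simp
  have [measurable]: "(\<lambda>u. \<psi> (z + (1 / sqrt (real (Suc n))) *\<^sub>R u) * of_real (flat 0 (1 - (cmod u)\<^sup>2))) \<in> borel_measurable lborel" for n z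
    by measurable
  have g_lim: "(\<lambda>n. g n z) \<longlonglongrightarrow> \<psi> z * of_real bump_mass" for z
  proof -
    have "(\<lambda>n. g n z) \<longlonglongrightarrow> (LINT u|lborel. \<psi> z * of_real (flat 0 (1 - (cmod u)\<^sup>2)))"
      unfolding g_def
    proof (rule integral_dominated_convergence[OF _ _ intB _ bnd])
      show "AE u in lborel. (\<lambda>n. \<psi> (z + (1 / sqrt (real (Suc n))) *\<^sub>R u) * of_real (flat 0 (1 - (cmod u)\<^sup>2)))
          \<longlonglongrightarrow> \<psi> z * of_real (flat 0 (1 - (cmod u)\<^sup>2))"
      proof (intro AE_I2 tendsto_mult tendsto_const)
        fix u :: complex
        have "(\<lambda>n. 1 / sqrt (real (Suc n))) \<longlonglongrightarrow> 0" by real_asymp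
        then have "(\<lambda>n. z + (1 / sqrt (real (Suc n))) *\<^sub>R u) \<longlonglongrightarrow> z + 0 *\<^sub>R u"
          by (intro tendsto_intros)
        then have "(\<lambda>n. z + (1 / sqrt (real (Suc n))) *\<^sub>R u) \<longlonglongrightarrow> z" by simp
        moreover have "isCont \<psi> z" using c by (simp add: continuous_on_eq_continuous_at)
        ultimately show "(\<lambda>n. \<psi> (z + (1 / sqrt (real (Suc n))) *\<^sub>R u)) \<longlonglongrightarrow> \<psi> z"
          by (rule isCont_tendsto_compose[rotated])
      qed
    qed measurable
    also have "(LINT u|lborel. \<psi> z * of_real (flat 0 (1 - (cmod u)\<^sup>2))) = \<psi> z * of_real bump_mass"
      unfolding bump_mass_def by simp
    finally show ?thesis .
  qed
  have g_bound: "cmod (g n z) \<le> B * bump_mass" for n z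
  proof -
    have "cmod (g n z) \<le> (LINT u|lborel. cmod (\<psi> (z + (1 / sqrt (real (Suc n))) *\<^sub>R u) * of_real (flat 0 (1 - (cmod u)\<^sup>2))))"
      unfolding g_def by (rule integral_norm_bound)
    also have "\<dots> \<le> (LINT u|lborel. B * flat 0 (1 - (cmod (u :: complex))\<^sup>2))"
      by (rule integral_mono'[OF intB]) (use B flat_nonneg in \<open>auto simp: norm_mult intro!: mult_right_mono\<close>)
    finally have "cmod (g n z) \<le> (LINT u|lborel. B * flat 0 (1 - (cmod (u :: complex))\<^sup>2))" .
    then show ?thesis by (simp add: bump_mass_def)
  qed
  have eq: "(LINT w|LD. \<psi> w * mollify F (real (Suc n)) w) = (LINT z|LD. F z * g n z)" for n
  proof -
    let ?a = "real (Suc n)"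
    have "(LINT w|LD. \<psi> w * mollify F ?a w) = (LINT w|LD. LINT z|LD. \<psi> w * (F z * (of_real ?a * bump ?a w z)))"
      by (simp add: mollify_def)
    also have "\<dots> = (LINT z|LD. LINT w|LD. \<psi> w * (F z * (of_real ?a * bump ?a w z)))"
    proof (rule LD_Fubini)
      have [measurable]: "fst \<in> borel_measurable (LD \<Otimes>\<^sub>M LD)" "snd \<in> borel_measurable (LD \<Otimes>\<^sub>M LD)"
        by (auto intro: measurable_compose[OF measurable_fst measurable_ident_LD] measurable_compose[OF measurable_snd measurable_ident_LD])
      have [measurable]: "(\<lambda>x. F (snd x)) \<in> borel_measurable (LD \<Otimes>\<^sub>M LD)"
        by (rule measurable_compose[OF measurable_snd Fm])
      show "(\<lambda>(w, z). \<psi> w * (F z * (of_real ?a * bump ?a w z))) \<in> borel_measurable (LD \<Otimes>\<^sub>M LD)"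
        unfolding case_prod_unfold by measurable
      fix w :: complex
      have "(\<integral>\<^sup>+z. ennreal (cmod (\<psi> w * (F z * (of_real ?a * bump ?a w z)))) \<partial>LD) \<le> (\<integral>\<^sup>+z. ennreal (B * ?a * cmod (F z)) \<partial>LD)"
      proof (intro nn_integral_mono ennreal_leI)
        fix z
        have "cmod (\<psi> w) * (?a * cmod (bump ?a w z)) \<le> B * (?a * 1)"
          using B(1) B(2)[of w] norm_bump_le[of ?a w z] by (intro mult_mono) auto
        then have "cmod (\<psi> w) * (?a * cmod (bump ?a w z)) * cmod (F z) \<le> B * (?a * 1) * cmod (F z)"
          by (rule mult_right_mono) simp
        then show "cmod (\<psi> w * (F z * (of_real ?a * bump ?a w z))) \<le> B * ?a * cmod (F z)"
          by (simp add: norm_mult mult_ac del: of_nat_Suc)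
      qed
      also have "\<dots> = ennreal (LINT z|LD. B * ?a * cmod (F z))"
        using F B(1) by (intro nn_integral_eq_integral) (auto intro: integrable_norm)
      finally show "(\<integral>\<^sup>+z. ennreal (cmod (\<psi> w * (F z * (of_real ?a * bump ?a w z)))) \<partial>LD) \<le> ennreal (LINT z|LD. B * ?a * cmod (F z))" .
    qed
    also have "\<dots> = (LINT z|LD. F z * (LINT w|LD. \<psi> w * (of_real ?a * bump ?a w z)))"
      by (intro Bochner_Integration.integral_cong refl) (simp add: mult.left_commute[of "\<psi> _"])
    also have "\<dots> = (LINT z|LD. F z * g n z)"
      by (simp only: mollify_dual[OF \<psi>] of_nat_0_less_iff zero_less_Suc g_def)
    finally show ?thesis .
  qed
  have gm [measurable]: "g n \<in> borel_measurable LD" for n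
  proof -
    have "(\<lambda>x. \<psi> (fst x + (1 / sqrt (real (Suc n))) *\<^sub>R snd x) * of_real (flat 0 (1 - (cmod (snd x))\<^sup>2))) \<in> borel_measurable (borel \<Otimes>\<^sub>M lborel)"
      by measurable
    then have "g n \<in> borel_measurable borel"
      unfolding g_def using lborel.borel_measurable_lebesgue_integral[of "\<lambda>z u. \<psi> (z + (1 / sqrt (real (Suc n))) *\<^sub>R u) * of_real (flat 0 (1 - (cmod u)\<^sup>2))" borel]
      by (simp add: case_prod_unfold)
    then show ?thesis by (rule borel_measurable_LD)
  qed
  have "(\<lambda>n. LINT z|LD. F z * g n z) \<longlonglongrightarrow> (LINT z|LD. F z * (\<psi> z * of_real bump_mass))"
  proof (rule integral_dominated_convergence[where w = "\<lambda>z. cmod (F z) * (B * bump_mass)"])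
    show "AE z in LD. (\<lambda>n. F z * g n z) \<longlonglongrightarrow> F z * (\<psi> z * of_real bump_mass)"
      by (intro AE_I2 tendsto_intros g_lim)
    show "AE z in LD. norm (F z * g n z) \<le> cmod (F z) * (B * bump_mass)" for n
      by (intro AE_I2) (simp add: norm_mult g_bound mult_left_mono)
    show "integrable LD (\<lambda>z. cmod (F z) * (B * bump_mass))"
      using integrable_norm[OF F] by simp
    show "(\<lambda>z. F z * (\<psi> z * of_real bump_mass)) \<in> borel_measurable LD"
      using borel_measurable_LD[OF \<psi>m] by measurable
  qed measurable
  also have "(LINT z|LD. F z * (\<psi> z * of_real bump_mass)) = of_real bump_mass * (LINT z|LD. F z * \<psi> z)"
    by (subst integral_mult_right_zero[symmetric]) (simp add: mult_ac)
  finally show ?thesis by (simp only: eq)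
qed

text \<open>The threshold on the scale \<open>a\<close> puts the support of the bump at \<open>w\<close> inside the disc.\<close>

lemma scale_condition:
  assumes "cmod w < 1" "a > 1 / (1 - cmod w)\<^sup>2"
  shows "a > 0" "cmod w + 1 / sqrt a < 1"
proof -
  have 1: "1 - cmod w > 0" using assms by simp
  then show a: "a > 0" using assms(2) by (smt (verit) divide_pos_pos zero_less_power)
  have "sqrt (1 / (1 - cmod w)\<^sup>2) < sqrt a" using assms(2) by (rule real_sqrt_less_mono)
  then have "1 / (1 - cmod w) < sqrt a" using 1 by (simp add: real_sqrt_divide)
  then show "cmod w + 1 / sqrt a < 1" using 1 a by (simp add: field_simps)
qed

lemma mollify_scale_invariant:
  assumes F: "integrable LD F" and weak: "\<And>\<psi>. \<psi> \<in> test_functions \<Longrightarrow> (LINT z|LD. F z * dbar \<psi> z) = 0"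
    and w: "cmod w < 1" and a: "a > 1 / (1 - cmod w)\<^sup>2" and b: "b > 1 / (1 - cmod w)\<^sup>2"
  shows "mollify F a w = mollify F b w"
proof -
  let ?A = "{1 / (1 - cmod w)\<^sup>2<..}"
  have "\<exists>c. \<forall>x\<in>?A. mollify F x w = c"
  proof (rule has_derivative_zero_constant)
    show "convex ?A" by simp
    fix x assume "x \<in> ?A"
    then have "x > 1 / (1 - cmod w)\<^sup>2" by simp
    note sc = scale_condition[OF w this]
    show "((\<lambda>a. mollify F a w) has_derivative (\<lambda>h. 0)) (at x within ?A)"
      by (rule has_derivative_at_withinI[OF mollify_scale_derivative[OF F weak[OF conj_bump_test[OF sc]] sc(1) w]])
  qed
  then show ?thesis using a b by auto
qed

lemma norm_le_imp_scale:
  assumes "0 < R" "R < 1" "cmod w \<le> R" "a > 1 / (1 - R)\<^sup>2"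
  shows "a > 1 / (1 - cmod w)\<^sup>2"
proof -
  have "(1 - R)\<^sup>2 \<le> (1 - cmod w)\<^sup>2" using assms by (intro power_mono) auto
  then have "1 / (1 - cmod w)\<^sup>2 \<le> 1 / (1 - R)\<^sup>2"
    using assms by (intro divide_left_mono) (auto intro!: mult_pos_pos)
  then show ?thesis using assms by linarith
qed

lemma eventually_scale:
  assumes "0 < R" "R < 1"
  shows "\<forall>\<^sub>F n in sequentially. \<forall>w. cmod w \<le> R \<longrightarrow> real (Suc n) > 1 / (1 - cmod w)\<^sup>2"
proof -
  obtain N :: nat where N: "1 / (1 - R)\<^sup>2 < real N" using reals_Archimedean2 by blast
  show ?thesis
    using eventually_ge_at_top[of N]
  proof eventually_elim
    fix n assume "N \<le> n"
    then have "real (Suc n) > 1 / (1 - R)\<^sup>2" using N by simp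
    then show "\<forall>w. cmod w \<le> R \<longrightarrow> real (Suc n) > 1 / (1 - cmod w)\<^sup>2"
      using norm_le_imp_scale[OF assms] by blast
  qed
qed

lemma integral_eq_if_mollify_eq:
  assumes F: "integrable LD F" and \<psi>: "Cc \<psi>"
    and H: "\<And>w a. cmod w < 1 \<Longrightarrow> a > 1 / (1 - cmod w)\<^sup>2 \<Longrightarrow> mollify F a w = of_real bump_mass * H w"
  shows "(LINT z|LD. F z * \<psi> z) = (LINT z|LD. H z * \<psi> z)"
proof -
  obtain K where K: "compact K" "K \<subseteq> disc" "\<And>z. z \<notin> K \<Longrightarrow> \<psi> z = 0"
    using \<psi> by (auto simp: Cc_def)
  obtain R where R: "0 < R" "R < 1" "K \<subseteq> cball 0 R"
    using compact_in_disc[OF K(1,2)] .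
  have "\<forall>\<^sub>F n in sequentially. (LINT w|LD. \<psi> w * mollify F (real (Suc n)) w) = of_real bump_mass * (LINT z|LD. H z * \<psi> z)"
    using eventually_scale[OF R(1,2)]
  proof eventually_elim
    fix n assume n: "\<forall>w. cmod w \<le> R \<longrightarrow> real (Suc n) > 1 / (1 - cmod w)\<^sup>2"
    have "\<psi> w * mollify F (real (Suc n)) w = of_real bump_mass * (H w * \<psi> w)" for w
    proof (cases "w \<in> K")
      case True
      then have "cmod w \<le> R" "cmod w < 1" using R by auto
      then show ?thesis using H n by simp
    qed (simp add: K)
    then show "(LINT w|LD. \<psi> w * mollify F (real (Suc n)) w) = of_real bump_mass * (LINT z|LD. H z * \<psi> z)"
      by (simp only: integral_mult_right_zero)
  qed
  then have "(\<lambda>n. LINT w|LD. \<psi> w * mollify F (real (Suc n)) w) \<longlonglongrightarrow> of_real bump_mass * (LINT z|LD. H z * \<psi> z)"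
    by (rule tendsto_eventually)
  from LIMSEQ_unique[OF this mollify_limit[OF F \<psi>]] show ?thesis
    using bump_mass_pos by simp
qed

text \<open>At a fixed scale the mollification of \<open>F\<close> is holomorphic. It is independent of the scale, and it tends
  weakly to a multiple of \<open>F\<close> as the support shrinks; so \<open>F\<close> itself is that holomorphic function. The last clause is a
  smooth form of the mean value property.\<close>

theorem Weyl:
  assumes F: "integrable LD F" and weak: "\<And>\<psi>. \<psi> \<in> test_functions \<Longrightarrow> (LINT z|LD. F z * dbar \<psi> z) = 0"
  obtains H where "H holomorphic_on disc" "AE z in LD. F z = H z"
    "\<And>w a. cmod w < 1 \<Longrightarrow> a > 1 / (1 - cmod w)\<^sup>2 \<Longrightarrow> mollify F a w = of_real bump_mass * H w"
proof -
  define H where "H w = mollify F (2 / (1 - cmod w)\<^sup>2) w / of_real bump_mass" for w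
  have mH: "mollify F a w = of_real bump_mass * H w" if w: "cmod w < 1" and a: "a > 1 / (1 - cmod w)\<^sup>2" for w a
  proof -
    have "2 / (1 - cmod w)\<^sup>2 > 1 / (1 - cmod w)\<^sup>2"
      using w by (intro divide_strict_right_mono) auto
    from mollify_scale_invariant[OF F weak w a this] show ?thesis
      using bump_mass_pos by (simp add: H_def)
  qed
  have hol: "H holomorphic_on disc"
    unfolding holomorphic_on_open[OF open_ball]
  proof
    fix w assume "w \<in> disc"
    then have w: "cmod w < 1" by simp
    define R where "R = (1 + cmod w) / 2"
    have R: "0 < R" "R < 1" "cmod w < R" using w by (auto simp: R_def add_pos_nonneg)
    define a where "a = 2 / (1 - R)\<^sup>2"
    have "1 / (1 - R)\<^sup>2 < a" unfolding a_def using R by (intro divide_strict_right_mono) auto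
    then have aR: "a > 1 / (1 - cmod v)\<^sup>2" if "cmod v \<le> R" for v
      using norm_le_imp_scale[OF R(1,2) that] by simp
    have aw: "a > 1 / (1 - cmod w)\<^sup>2" using aR R(3) by simp
    note sc = scale_condition[OF w aw]
    obtain D where "(mollify F a has_field_derivative D) (at w)"
      using mollify_has_field_derivative[OF F weak[OF bump_test[OF sc]] sc(1) w] by auto
    then have "((\<lambda>v. mollify F a v / of_real bump_mass) has_field_derivative D / of_real bump_mass) (at w)"
      by (rule DERIV_cdivide)
    then have "(H has_field_derivative D / of_real bump_mass) (at w)"
    proof (rule has_field_derivative_transform_within_open)
      show "open (ball (0::complex) R)" "w \<in> ball 0 R" using R by auto
      fix v assume "v \<in> ball (0::complex) R"
      then show "mollify F a v / of_real bump_mass = H v"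
        using mH[of v a] aR[of v] R bump_mass_pos by simp
    qed
    then show "\<exists>f'. (H has_field_derivative f') (at w)" by blast
  qed
  have Hc: "continuous_on disc H" using hol by (rule holomorphic_on_imp_continuous_on)
  then have [measurable]: "H \<in> borel_measurable LD" by (rule continuous_imp_measurable_LD)
  have [measurable]: "F \<in> borel_measurable LD" using F by auto
  have "AE z in LD. F z - H z = 0"
  proof (rule Cc_orthogonal_imp_AE_0)
    fix R :: real assume R: "0 < R" "R < 1"
    obtain B where B: "\<And>z. z \<in> cball 0 R \<Longrightarrow> cmod (H z) \<le> B" "B > 0"
    proof -
      have "compact (H ` cball 0 R)"
        using R by (intro compact_continuous_image continuous_on_subset[OF Hc]) auto
      then show ?thesis using that compact_imp_bounded bounded_pos by (metis imageI)
    qed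
    have [measurable]: "cball (0::complex) R \<in> sets LD"
      using R by (subst sets_restrict_space_iff) auto
    have "integrable LD (\<lambda>z. indicator (cball 0 R) z *\<^sub>R H z)"
    proof (rule integrable_LD_bounded[where B = B])
      show "(\<lambda>z. indicator (cball 0 R) z *\<^sub>R H z) \<in> borel_measurable LD" by measurable
    qed (use B in \<open>auto simp: indicator_def\<close>)
    moreover have "integrable LD (\<lambda>z. indicator (cball 0 R) z *\<^sub>R F z)"
      by (intro integrable_mult_indicator F) measurable
    ultimately show "integrable LD (\<lambda>z. indicator (cball 0 R) z *\<^sub>R (F z - H z))"
      by (simp add: scaleR_diff_right)
  next
    fix \<psi> assume \<psi>: "Cc \<psi>"
    obtain B where B: "B > 0" "\<And>z. cmod (\<psi> z) \<le> B" using Cc_bounded[OF \<psi>] by blast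
    obtain K where K: "compact K" "K \<subseteq> disc" "\<And>z. z \<notin> K \<Longrightarrow> \<psi> z = 0" and c: "continuous_on UNIV \<psi>"
      using \<psi> by (auto simp: Cc_def)
    have cd: "continuous_on disc \<psi>" using c by (rule continuous_on_subset) auto
    have "integrable LD (\<lambda>z. F z * \<psi> z)"
      by (rule integrable_times_bounded[OF F]) (use B cd in \<open>auto intro: continuous_imp_measurable_LD\<close>)
    moreover have "integrable LD (\<lambda>z. H z * \<psi> z)"
      by (rule integrable_LD_compact_support[OF _ K(1,2)]) (use K cd Hc in \<open>auto intro!: continuous_intros\<close>)
    ultimately show "(LINT z|LD. (F z - H z) * \<psi> z) = 0"
      using integral_eq_if_mollify_eq[OF F \<psi> mH] by (simp add: left_diff_distrib)
  qed measurable
  then show ?thesis using hol mH that by auto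
qed

text \<open>Uniqueness of weak derivatives: test functions suffice in the fundamental lemma.\<close>

lemma test_orthogonal_imp_AE_0:
  assumes F: "integrable LD F" and weak: "\<And>\<psi>. \<psi> \<in> test_functions \<Longrightarrow> (LINT z|LD. F z * \<psi> z) = 0"
  shows "AE z in LD. F z = 0"
proof (rule Cc_orthogonal_imp_AE_0)
  show "F \<in> borel_measurable LD" using F by auto
  fix R :: real assume R: "0 < R" "R < 1"
  have "cball (0::complex) R \<in> sets LD"
    using R by (subst sets_restrict_space_iff) auto
  then show "integrable LD (\<lambda>z. indicator (cball 0 R) z *\<^sub>R F z)"
    by (intro integrable_mult_indicator F)
next
  fix \<psi> assume \<psi>: "Cc \<psi>"
  have "mollify F a w = of_real bump_mass * 0" if "cmod w < 1" "a > 1 / (1 - cmod w)\<^sup>2" for w a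
  proof -
    have "mollify F a w = of_real a * (LINT z|LD. F z * bump a w z)"
      unfolding mollify_def by (subst integral_mult_right_zero[symmetric]) (simp add: mult_ac)
    then show ?thesis using weak[OF bump_test[OF scale_condition[OF that]]] by simp
  qed
  from integral_eq_if_mollify_eq[OF F \<psi> this] show "(LINT z|LD. F z * \<psi> z) = 0" by simp
qed

lemma test_function_bounded:
  assumes "\<psi> \<in> test_functions"
  obtains B K where "B > 0" "\<And>z. z \<in> disc \<Longrightarrow> cmod (\<psi> z) \<le> B" "\<And>z. z \<in> disc \<Longrightarrow> cmod (dbar \<psi> z) \<le> B"
    "compact K" "K \<subseteq> disc" "\<And>z. z \<notin> K \<Longrightarrow> \<psi> z = 0" "\<And>z. z \<notin> K \<Longrightarrow> dbar \<psi> z = 0"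
proof -
  have i: "C1c \<psi>" by (rule test_functions_C1c) fact
  then obtain K where K: "compact K" "K \<subseteq> disc" "\<And>z. z \<notin> K \<Longrightarrow> \<psi> z = 0"
    by (auto simp: C1c_def)
  have "partial e \<psi> z = 0" if "z \<notin> K" for z e
    by (rule partial_eq, rule has_derivative_outside_support[OF compact_imp_closed[OF K(1)]]) (use K that in auto)
  then have d: "dbar \<psi> z = 0" if "z \<notin> K" for z
    using that by (simp add: dbar_def)
  have c: "continuous_on disc \<psi>" "continuous_on disc (dbar \<psi>)"
    using C1c_imp_C1_disc[OF i] by (auto intro: C1_disc_continuous C1_disc_dbar_continuous)
  obtain B where B: "B > 0" "\<And>z. z \<in> disc \<Longrightarrow> cmod (\<psi> z) \<le> B"
    using compact_support_bounded[OF c(1) K(1,2)] K(3) by blast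
  obtain B' where B': "B' > 0" "\<And>z. z \<in> disc \<Longrightarrow> cmod (dbar \<psi> z) \<le> B'"
    using compact_support_bounded[OF c(2) K(1,2)] d by blast
  show ?thesis
  proof (rule that[of "max B B'" K])
    show "cmod (\<psi> z) \<le> max B B'" "cmod (dbar \<psi> z) \<le> max B B'" if "z \<in> disc" for z
      using B(2)[OF that] B'(2)[OF that] by auto
  qed (use B(1) K d in auto)
qed

lemma test_function_measurable:
  assumes "\<psi> \<in> test_functions"
  shows "\<psi> \<in> borel_measurable LD" "dbar \<psi> \<in> borel_measurable LD"
  using C1c_imp_C1_disc[OF test_functions_C1c[OF assms]]
  by (auto intro: continuous_imp_measurable_LD C1_disc_continuous C1_disc_dbar_continuous)

lemma integrable_times_test:
  assumes "integrable LD v" "\<psi> \<in> test_functions"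
  shows "integrable LD (\<lambda>z. v z * \<psi> z)" "integrable LD (\<lambda>z. v z * dbar \<psi> z)"
proof -
  obtain B K where "B > 0" and B: "\<And>z. z \<in> disc \<Longrightarrow> cmod (\<psi> z) \<le> B" "\<And>z. z \<in> disc \<Longrightarrow> cmod (dbar \<psi> z) \<le> B"
    and "compact K" "K \<subseteq> disc" "\<And>z. z \<notin> K \<Longrightarrow> \<psi> z = 0" "\<And>z. z \<notin> K \<Longrightarrow> dbar \<psi> z = 0"
    by (rule test_function_bounded[OF assms(2)], rule that)
  show "integrable LD (\<lambda>z. v z * \<psi> z)"
    by (rule integrable_times_bounded[OF assms(1) test_function_measurable(1)[OF assms(2)] B(1)])
  show "integrable LD (\<lambda>z. v z * dbar \<psi> z)"
    by (rule integrable_times_bounded[OF assms(1) test_function_measurable(2)[OF assms(2)] B(2)])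
qed

lemma weak_dbarD:
  "weak_dbar u v \<Longrightarrow> \<psi> \<in> test_functions \<Longrightarrow> (LINT z|LD. u z * dbar \<psi> z) = - (LINT z|LD. v z * \<psi> z)"
  by (simp add: weak_dbar_def)

lemma weak_dbar_unique:
  assumes "weak_dbar u v" "weak_dbar u v'" "integrable LD v" "integrable LD v'"
  shows "AE z in LD. v z = v' z"
proof -
  have "AE z in LD. v z - v' z = 0"
  proof (rule test_orthogonal_imp_AE_0)
    fix \<psi> assume \<psi>: "\<psi> \<in> test_functions"
    have "integrable LD (\<lambda>z. v z * \<psi> z)" "integrable LD (\<lambda>z. v' z * \<psi> z)"
      by (rule integrable_times_test(1)[OF assms(3) \<psi>] integrable_times_test(1)[OF assms(4) \<psi>])+
    moreover have "- (LINT z|LD. v z * \<psi> z) = - (LINT z|LD. v' z * \<psi> z)"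
      by (rule trans[OF weak_dbarD[OF assms(1) \<psi>, symmetric] weak_dbarD[OF assms(2) \<psi>]])
    ultimately show "(LINT z|LD. (v z - v' z) * \<psi> z) = 0"
      by (simp add: left_diff_distrib)
  qed (use assms in auto)
  then show ?thesis by simp
qed

section \<open>Circle means\<close>

lemma AE_LD_iff: "(AE z in LD. P z) \<longleftrightarrow> (AE z in lborel. z \<in> disc \<longrightarrow> P z)"
  by (subst AE_restrict_space_iff) (auto simp: AE_completion_iff)

text \<open>A circle is a null set of the plane, so a Lebesgue measurable function may have a non-measurable restriction to
  it. Borel representatives restrict to measurable functions on all circles and agree with the given function on almost
  every circle.\<close>

lemma borel_representative:
  fixes h :: "complex \<Rightarrow> complex"
  assumes "h \<in> borel_measurable LD"
  obtains h' where "h' \<in> borel_measurable borel" "AE z in LD. h z = h' z"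
proof -
  let ?h = "\<lambda>z. if z \<in> disc then h z else 0"
  have h: "?h \<in> borel_measurable lebesgue"
    using assms by (subst borel_measurable_if) auto
  have "(\<lambda>z. Re (?h z)) \<in> borel_measurable (completion lborel)" "(\<lambda>z. Im (?h z)) \<in> borel_measurable (completion lborel)"
    by (rule measurable_compose[OF h borel_measurable_Re] measurable_compose[OF h borel_measurable_Im])+
  note this[THEN completion_ex_borel_measurable_real]
  then obtain u v where [measurable]: "u \<in> borel_measurable lborel" "v \<in> borel_measurable lborel"
     and uv: "AE z in lborel. Re (?h z) = u z" "AE z in lborel. Im (?h z) = v z"
    by (elim bexE)
  have "AE z in LD. h z = Complex (u z) (v z)"
    unfolding AE_LD_iff using uv by eventually_elim (auto simp: complex_eq_iff)
  moreover have "(\<lambda>z. Complex (u z) (v z)) \<in> borel_measurable lborel" by measurable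
  ultimately show ?thesis using that[of "\<lambda>z. Complex (u z) (v z)"] by simp
qed

lemma circle_mean_eq: "circle_mean p f r =
   ennreal (1 / (2 * pi)) * (\<integral>\<^sup>+t. ennreal (cmod (f (of_real r * cis t)) powr p) * indicator {0..2*pi} t \<partial>lborel)"
  by (simp add: circle_mean_def nn_integral_completion)

lemma AE_circle:
  assumes "AE z in LD. P z"
  shows "AE r in lborel. 0 < r \<and> r < 1 \<longrightarrow> (AE t in lborel. t \<in> {0..2*pi} \<longrightarrow> P (of_real r * cis t))"
proof -
  obtain N where N: "{z. \<not> (z \<in> disc \<longrightarrow> P z)} \<subseteq> N" "emeasure lborel N = 0" "N \<in> sets lborel"
    using assms unfolding AE_LD_iff by (auto elim!: AE_E)
  then have [measurable]: "N \<in> sets borel" by simp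
  have "(\<integral>\<^sup>+r. \<integral>\<^sup>+t. ennreal r * indicator N (of_real r * cis t) * indicator {0..2*pi} t * indicator {0<..} r \<partial>lborel \<partial>lborel) = 0"
    using N(2) by (subst nn_integral_polar[symmetric]) auto
  then have "AE r in lborel. (\<integral>\<^sup>+t. ennreal r * indicator N (of_real r * cis t) * indicator {0..2*pi} t * indicator {0<..} r \<partial>lborel) = 0"
    by (subst (asm) nn_integral_0_iff_AE) auto
  then show ?thesis
  proof eventually_elim
    fix r :: real
    assume "(\<integral>\<^sup>+t. ennreal r * indicator N (of_real r * cis t) * indicator {0..2*pi} t * indicator {0<..} r \<partial>lborel) = 0"
    then have ae: "AE t in lborel. ennreal r * indicator N (of_real r * cis t) * indicator {0..2*pi} t * indicator {0<..} r = 0"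
      by (subst (asm) nn_integral_0_iff_AE) auto
    show "0 < r \<and> r < 1 \<longrightarrow> (AE t in lborel. t \<in> {0..2*pi} \<longrightarrow> P (of_real r * cis t))"
    proof
      assume r: "0 < r \<and> r < 1"
      show "AE t in lborel. t \<in> {0..2*pi} \<longrightarrow> P (of_real r * cis t)"
        using ae
      proof eventually_elim
        fix t assume "ennreal r * indicator N (of_real r * cis t) * indicator {0..2*pi} t * indicator {0<..} r = 0"
        then have "t \<in> {0..2*pi} \<longrightarrow> of_real r * cis t \<notin> N"
          using r by (auto simp: indicator_def split: if_splits)
        moreover have "of_real r * cis t \<in> disc" using r by (simp add: norm_mult)
        ultimately show "t \<in> {0..2*pi} \<longrightarrow> P (of_real r * cis t)" using N(1) by blast
      qed
    qed
  qed
qed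

lemma circle_mean_AE_mono:
  assumes "AE z in LD. cmod (f z) \<le> cmod (g z)" "p > 0"
  shows "AE r in lborel. 0 < r \<and> r < 1 \<longrightarrow> circle_mean p f r \<le> circle_mean p g r"
  using AE_circle[OF assms(1)]
proof eventually_elim
  fix r :: real
  assume *: "0 < r \<and> r < 1 \<longrightarrow> (AE t in lborel. t \<in> {0..2*pi} \<longrightarrow> cmod (f (of_real r * cis t)) \<le> cmod (g (of_real r * cis t)))"
  show "0 < r \<and> r < 1 \<longrightarrow> circle_mean p f r \<le> circle_mean p g r"
  proof
    assume "0 < r \<and> r < 1"
    with * have ae: "AE t in lborel. t \<in> {0..2*pi} \<longrightarrow> cmod (f (of_real r * cis t)) \<le> cmod (g (of_real r * cis t))" by blast
    show "circle_mean p f r \<le> circle_mean p g r"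
      unfolding circle_mean_eq
      by (intro mult_left_mono nn_integral_mono_AE, use ae in eventually_elim)
         (use assms(2) in \<open>auto simp: indicator_def intro!: ennreal_leI powr_mono2\<close>)
  qed
qed

lemma circle_mean_AE_eq:
  assumes "AE z in LD. f z = g z" "p > 0"
  shows "AE r in lborel. 0 < r \<and> r < 1 \<longrightarrow> circle_mean p f r = circle_mean p g r"
proof -
  have "AE z in LD. cmod (f z) \<le> cmod (g z)" "AE z in LD. cmod (g z) \<le> cmod (f z)"
    using assms(1) by (eventually_elim, simp)+
  from this[THEN circle_mean_AE_mono, OF assms(2)] show ?thesis
    by eventually_elim (auto intro: antisym)
qed

lemma circle_mean_borel_measurable:
  assumes [measurable]: "f \<in> borel_measurable borel"
  shows "circle_mean p f \<in> borel_measurable borel"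
  unfolding circle_mean_eq[abs_def] by measurable

lemma AE_unit_iff: "(AE r in lebesgue_on {0<..<1}. P r) \<longleftrightarrow> (AE r in lborel. 0 < r \<and> r < (1::real) \<longrightarrow> P r)"
  by (subst AE_restrict_space_iff) (auto simp: AE_completion_iff)

lemma circle_mean_measurable:
  assumes "f \<in> borel_measurable LD" "p > 0"
  shows "circle_mean p f \<in> borel_measurable (lebesgue_on {0<..<1})"
proof -
  obtain g where g: "g \<in> borel_measurable borel" "AE z in LD. f z = g z"
    using borel_representative[OF assms(1)] .
  have ae: "AE r in lebesgue. 0 < r \<and> r < 1 \<longrightarrow> circle_mean p g r = circle_mean p f r"
    by (rule AE_completion) (use circle_mean_AE_eq[OF g(2) assms(2)] in \<open>eventually_elim, auto\<close>)
  have gm: "circle_mean p g \<in> borel_measurable (lebesgue_on {0<..<1})"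
    by (intro measurable_restrict_space1 measurable_completion) (use circle_mean_borel_measurable[OF g(1)] in simp)
  show ?thesis
  proof (rule measurableI)
    fix X :: "ennreal set" assume X: "X \<in> sets borel"
    have "circle_mean p f -` X \<inter> {0<..<1} \<in> sets lebesgue"
    proof (rule completion.in_sets_AE)
      show "AE r in lebesgue. (r \<in> circle_mean p g -` X \<inter> {0<..<1}) = (r \<in> circle_mean p f -` X \<inter> {0<..<1})"
        using ae by eventually_elim auto
      have "circle_mean p g -` X \<inter> space (lebesgue_on {0<..<1}) \<in> sets (lebesgue_on {0<..<1})"
        using gm X by (rule measurable_sets)
      then show "circle_mean p g -` X \<inter> {0<..<1} \<in> sets lebesgue"
        by (simp add: sets_restrict_space_iff)
    qed simp
    then show "circle_mean p f -` X \<inter> space (lebesgue_on {0<..<1}) \<in> sets (lebesgue_on {0<..<1})"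
      by (simp add: sets_restrict_space_iff)
  qed simp
qed

lemma hardy_sup_le:
  assumes "f \<in> borel_measurable LD" "p > 0" "AE r in lborel. 0 < r \<and> r < 1 \<longrightarrow> circle_mean p f r \<le> C"
  shows "hardy_sup p f \<le> C"
  unfolding hardy_sup_def
  by (rule esssup_I[OF circle_mean_measurable[OF assms(1,2)]]) (use assms(3) in \<open>simp add: AE_unit_iff\<close>)

lemma circle_mean_le_hardy_sup:
  "AE r in lborel. 0 < r \<and> r < 1 \<longrightarrow> circle_mean p f r \<le> hardy_sup p f"
  using esssup_AE[of "circle_mean p f" "lebesgue_on {0<..<1}"] unfolding hardy_sup_def AE_unit_iff .

lemma hardy_sup_mono:
  assumes "f \<in> borel_measurable LD" "p > 0" "AE z in LD. cmod (f z) \<le> cmod (g z)"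
  shows "hardy_sup p f \<le> hardy_sup p g"
  by (rule hardy_sup_le[OF assms(1,2)])
     (use circle_mean_AE_mono[OF assms(3,2)] circle_mean_le_hardy_sup[of p g] in \<open>eventually_elim, auto\<close>)

lemma hardy_sup_cong:
  assumes "f \<in> borel_measurable LD" "g \<in> borel_measurable LD" "p > 0" "AE z in LD. f z = g z"
  shows "hardy_sup p f = hardy_sup p g"
proof (rule antisym)
  show "hardy_sup p f \<le> hardy_sup p g"
    by (rule hardy_sup_mono[OF assms(1,3)]) (use assms(4) in eventually_elim, simp)
  show "hardy_sup p g \<le> hardy_sup p f"
    by (rule hardy_sup_mono[OF assms(2,3)]) (use assms(4) in eventually_elim, simp)
qed

lemma powr_add_le:
  fixes a b p :: real
  assumes "p > 0" "a \<ge> 0" "b \<ge> 0"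
  shows "(a + b) powr p \<le> 2 powr p * (a powr p + b powr p)"
proof -
  have "(a + b) powr p \<le> (2 * max a b) powr p"
    using assms by (intro powr_mono2) auto
  also have "\<dots> = 2 powr p * max a b powr p" using assms by (simp add: powr_mult)
  also have "max a b powr p \<le> a powr p + b powr p" by (simp add: max_def)
  finally show ?thesis by (simp add: mult_left_mono)
qed

lemma circle_mean_const: "c \<ge> 0 \<Longrightarrow> p > 0 \<Longrightarrow> circle_mean p (\<lambda>_. of_real c) r = ennreal (c powr p)"
  by (simp add: circle_mean_eq nn_integral_cmult ennreal_mult[symmetric])

text \<open>The Hardy supremum is a quasi-seminorm raised to the power \<open>p\<close>.\<close>

lemma hardy_sup_triangle:
  assumes u: "u \<in> borel_measurable LD" and f: "f \<in> borel_measurable LD" and g: "g \<in> borel_measurable LD" and p: "p > 0"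
    and le: "AE z in LD. cmod (u z) \<le> cmod (f z) + cmod (g z)"
  shows "hardy_sup p u \<le> ennreal (2 powr p) * (hardy_sup p f + hardy_sup p g)"
proof (rule hardy_sup_le[OF u p])
  obtain f' where f': "f' \<in> borel_measurable borel" "AE z in LD. f z = f' z"
    using borel_representative[OF f] .
  obtain g' where g': "g' \<in> borel_measurable borel" "AE z in LD. g z = g' z"
    using borel_representative[OF g] .
  have le': "AE z in LD. cmod (u z) \<le> cmod (of_real (cmod (f' z) + cmod (g' z)))"
    using le f'(2) g'(2) by eventually_elim (simp del: of_real_add)
  show "AE r in lborel. 0 < r \<and> r < 1 \<longrightarrow> circle_mean p u r \<le> ennreal (2 powr p) * (hardy_sup p f + hardy_sup p g)"
    using circle_mean_AE_mono[OF le' p] circle_mean_AE_eq[OF f'(2) p] circle_mean_AE_eq[OF g'(2) p]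
      circle_mean_le_hardy_sup[of p f] circle_mean_le_hardy_sup[of p g]
  proof (eventually_elim, intro impI)
    fix r :: real
    assume r: "0 < r \<and> r < 1"
    assume a: "0 < r \<and> r < 1 \<longrightarrow> circle_mean p u r \<le> circle_mean p (\<lambda>z. of_real (cmod (f' z) + cmod (g' z))) r"
      "0 < r \<and> r < 1 \<longrightarrow> circle_mean p f r = circle_mean p f' r" "0 < r \<and> r < 1 \<longrightarrow> circle_mean p g r = circle_mean p g' r"
      "0 < r \<and> r < 1 \<longrightarrow> circle_mean p f r \<le> hardy_sup p f" "0 < r \<and> r < 1 \<longrightarrow> circle_mean p g r \<le> hardy_sup p g"
    note [measurable] = f'(1) g'(1)
    let ?f = "\<lambda>t. ennreal (cmod (f' (of_real r * cis t)) powr p) * indicator {0..2*pi} t"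
    let ?g = "\<lambda>t. ennreal (cmod (g' (of_real r * cis t)) powr p) * indicator {0..2*pi} t"
    have "circle_mean p u r \<le> circle_mean p (\<lambda>z. of_real (cmod (f' z) + cmod (g' z))) r" using a r by blast
    also have "\<dots> \<le> ennreal (1 / (2 * pi)) * (\<integral>\<^sup>+t. ennreal (2 powr p) * (?f t + ?g t) \<partial>lborel)"
      unfolding circle_mean_eq
    proof (intro mult_left_mono nn_integral_mono)
      fix t :: real
      let ?z = "of_real r * cis t"
      have "cmod (of_real (cmod (f' ?z) + cmod (g' ?z))) powr p \<le> 2 powr p * (cmod (f' ?z) powr p + cmod (g' ?z) powr p)"
        using powr_add_le[OF p, of "cmod (f' ?z)" "cmod (g' ?z)"] by (simp del: of_real_add)
      then have "ennreal (cmod (of_real (cmod (f' ?z) + cmod (g' ?z))) powr p) \<le> ennreal (2 powr p * (cmod (f' ?z) powr p + cmod (g' ?z) powr p))"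
        by (rule ennreal_leI)
      also have "\<dots> = ennreal (2 powr p) * (ennreal (cmod (f' ?z) powr p) + ennreal (cmod (g' ?z) powr p))"
        by (simp add: ennreal_mult)
      finally show "ennreal (cmod (of_real (cmod (f' ?z) + cmod (g' ?z))) powr p) * indicator {0..2*pi} t \<le> ennreal (2 powr p) * (?f t + ?g t)"
        by (cases "t \<in> {0..2*pi}") simp_all
    qed simp
    also have "\<dots> = ennreal (2 powr p) * (circle_mean p f' r + circle_mean p g' r)"
      unfolding circle_mean_eq by (simp add: nn_integral_cmult nn_integral_add distrib_left mult_ac)
    also have "\<dots> \<le> ennreal (2 powr p) * (hardy_sup p f + hardy_sup p g)"
      using a r by (intro mult_left_mono add_mono) auto
    finally show "circle_mean p u r \<le> ennreal (2 powr p) * (hardy_sup p f + hardy_sup p g)" .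
  qed
qed

lemma hardy_sup_scaled:
  assumes u: "u \<in> borel_measurable LD" and f: "f \<in> borel_measurable LD" and p: "p > 0" and c: "c > 0"
    and le: "AE z in LD. cmod (u z) \<le> c * cmod (f z)"
  shows "hardy_sup p u \<le> ennreal (c powr p) * hardy_sup p f"
proof (rule hardy_sup_le[OF u p])
  obtain f' where f': "f' \<in> borel_measurable borel" "AE z in LD. f z = f' z"
    using borel_representative[OF f] .
  note [measurable] = f'(1)
  have le': "AE z in LD. cmod (u z) \<le> cmod (of_real c * f' z)"
    using le f'(2) by eventually_elim (use c in \<open>simp add: norm_mult\<close>)
  show "AE r in lborel. 0 < r \<and> r < 1 \<longrightarrow> circle_mean p u r \<le> ennreal (c powr p) * hardy_sup p f"
    using circle_mean_AE_mono[OF le' p] circle_mean_AE_eq[OF f'(2) p] circle_mean_le_hardy_sup[of p f]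
  proof (eventually_elim, intro impI)
    fix r :: real
    assume r: "0 < r \<and> r < 1" and a: "0 < r \<and> r < 1 \<longrightarrow> circle_mean p u r \<le> circle_mean p (\<lambda>z. of_real c * f' z) r"
      "0 < r \<and> r < 1 \<longrightarrow> circle_mean p f r = circle_mean p f' r"
      "0 < r \<and> r < 1 \<longrightarrow> circle_mean p f r \<le> hardy_sup p f"
    have "(\<integral>\<^sup>+t. ennreal (cmod (of_real c * f' (of_real r * cis t)) powr p) * indicator {0..2*pi} t \<partial>lborel) =
        (\<integral>\<^sup>+t. ennreal (c powr p) * (ennreal (cmod (f' (of_real r * cis t)) powr p) * indicator {0..2*pi} t) \<partial>lborel)"
      using c by (intro nn_integral_cong) (simp add: norm_mult powr_mult ennreal_mult mult.assoc)
    also have "\<dots> = ennreal (c powr p) * (\<integral>\<^sup>+t. ennreal (cmod (f' (of_real r * cis t)) powr p) * indicator {0..2*pi} t \<partial>lborel)"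
      by (rule nn_integral_cmult) measurable
    finally have "circle_mean p (\<lambda>z. of_real c * f' z) r = ennreal (c powr p) * circle_mean p f' r"
      unfolding circle_mean_eq by (simp only: mult.left_commute)
    then show "circle_mean p u r \<le> ennreal (c powr p) * hardy_sup p f"
      using a r by (metis (no_types, lifting) mult_left_mono order_trans zero_le)
  qed
qed

lemma hardy_sup_bounded:
  assumes u: "u \<in> borel_measurable LD" and p: "p > 0" and c: "c \<ge> 0"
    and le: "AE z in LD. cmod (u z) \<le> c"
  shows "hardy_sup p u \<le> ennreal (c powr p)"
proof (rule hardy_sup_le[OF u p])
  have le': "AE z in LD. cmod (u z) \<le> cmod (of_real c)"
    using le c by simp
  show "AE r in lborel. 0 < r \<and> r < 1 \<longrightarrow> circle_mean p u r \<le> ennreal (c powr p)"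
    using circle_mean_AE_mono[OF le' p] by eventually_elim (use circle_mean_const[OF c p] in auto)
qed

text \<open>Almost everywhere convergence in the disc is almost everywhere convergence on almost every circle, where
  Fatou's lemma applies.\<close>

lemma hardy_sup_Fatou:
  assumes m: "\<And>n. f n \<in> borel_measurable LD" "g \<in> borel_measurable LD" and p: "p > 0"
    and lim: "AE z in LD. (\<lambda>n. f n z) \<longlonglongrightarrow> g z" and b: "\<And>n. hardy_sup p (f n) \<le> C"
  shows "hardy_sup p g \<le> C"
proof (rule hardy_sup_le[OF m(2) p])
  have "\<exists>f'. \<forall>n. f' n \<in> borel_measurable borel \<and> (AE z in LD. f n z = f' n z)"
    using borel_representative[OF m(1)] by (intro choice) metis
  then obtain f' where f': "\<And>n. f' n \<in> borel_measurable borel" "\<And>n. AE z in LD. f n z = f' n z" by auto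
  have "AE z in LD. \<forall>n. f n z = f' n z" unfolding AE_all_countable using f'(2) by auto
  with lim have lim': "AE z in LD. (\<lambda>n. f' n z) \<longlonglongrightarrow> g z"
    by eventually_elim simp
  have "AE r in lborel. \<forall>n. 0 < r \<and> r < 1 \<longrightarrow> circle_mean p (f' n) r \<le> C"
    unfolding AE_all_countable
  proof
    fix n
    show "AE r in lborel. 0 < r \<and> r < 1 \<longrightarrow> circle_mean p (f' n) r \<le> C"
      using circle_mean_AE_eq[OF f'(2)[of n] p] circle_mean_le_hardy_sup[of p "f n"]
      by eventually_elim (use b[of n] in auto)
  qed
  then show "AE r in lborel. 0 < r \<and> r < 1 \<longrightarrow> circle_mean p g r \<le> C"
    using AE_circle[OF lim']
  proof (eventually_elim, intro impI)
    fix r :: real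
    assume r: "0 < r \<and> r < 1" and a: "\<forall>n. 0 < r \<and> r < 1 \<longrightarrow> circle_mean p (f' n) r \<le> C"
      "0 < r \<and> r < 1 \<longrightarrow> (AE t in lborel. t \<in> {0..2*pi} \<longrightarrow> (\<lambda>n. f' n (of_real r * cis t)) \<longlonglongrightarrow> g (of_real r * cis t))"
    note [measurable] = f'(1)
    let ?u = "\<lambda>n t. ennreal (cmod (f' n (of_real r * cis t)) powr p) * indicator {0..2*pi} t"
    let ?v = "\<lambda>t. ennreal (cmod (g (of_real r * cis t)) powr p) * indicator {0..2*pi} t"
    have "AE t in lborel. ?v t = liminf (\<lambda>n. ?u n t)"
      using a(2)[rule_format, OF r]
    proof eventually_elim
      fix t :: real
      assume t: "t \<in> {0..2*pi} \<longrightarrow> (\<lambda>n. f' n (of_real r * cis t)) \<longlonglongrightarrow> g (of_real r * cis t)"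
      have "(\<lambda>n. ?u n t) \<longlonglongrightarrow> ?v t"
      proof (cases "t \<in> {0..2*pi}")
        case True
        with t have "(\<lambda>n. cmod (f' n (of_real r * cis t)) powr p) \<longlonglongrightarrow> cmod (g (of_real r * cis t)) powr p"
          using p by (intro tendsto_powr' tendsto_norm tendsto_const) auto
        then show ?thesis using True by (simp add: tendsto_ennrealI)
      qed simp
      then show "?v t = liminf (\<lambda>n. ?u n t)"
        by (simp add: lim_imp_Liminf)
    qed
    then have "(\<integral>\<^sup>+t. ?v t \<partial>lborel) = (\<integral>\<^sup>+t. liminf (\<lambda>n. ?u n t) \<partial>lborel)"
      by (rule nn_integral_cong_AE)
    also have "\<dots> \<le> liminf (\<lambda>n. \<integral>\<^sup>+t. ?u n t \<partial>lborel)"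
      by (rule nn_integral_liminf) measurable
    also have "\<dots> \<le> ennreal (2 * pi) * C"
    proof (intro Liminf_le always_eventually allI)
      fix n
      have "(\<integral>\<^sup>+t. ?u n t \<partial>lborel) = ennreal (2 * pi) * circle_mean p (f' n) r"
        unfolding circle_mean_eq by (simp add: ennreal_mult[symmetric] flip: mult.assoc)
      also have "\<dots> \<le> ennreal (2 * pi) * C" using a(1) r by (intro mult_left_mono) auto
      finally show "(\<integral>\<^sup>+t. ?u n t \<partial>lborel) \<le> ennreal (2 * pi) * C" .
    qed simp
    finally have "circle_mean p g r \<le> ennreal (1 / (2 * pi)) * (ennreal (2 * pi) * C)"
      unfolding circle_mean_eq by (rule mult_left_mono) simp
    also have "\<dots> = C" by (simp add: ennreal_mult[symmetric] flip: mult.assoc)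
    finally show "circle_mean p g r \<le> C" .
  qed
qed

section \<open>The Cauchy transform on functions with bounded circle means\<close>

lemma pred_ball [measurable]:
  fixes f :: "'b \<Rightarrow> complex"
  shows "f \<in> borel_measurable M \<Longrightarrow> Measurable.pred M (\<lambda>x. f x \<in> ball c d)"
  unfolding mem_ball by measurable

lemma nn_integral_powr_from_0:
  assumes "a > -1" "d \<ge> 0"
  shows "(\<integral>\<^sup>+x. ennreal (x powr a) * indicator {0..d} x \<partial>lborel) = ennreal (d powr (a + 1) / (a + 1))"
proof -
  have "integral\<^sup>N lborel (\<lambda>x. indicator {0..d} x * x powr a) = ennreal (d powr (a + 1) / (a + 1))"
    by (rule nn_integral_has_integral_lebesgue[OF _ has_integral_powr_from_0[OF assms]]) simp
  moreover have "ennreal (indicator {0..d} x * x powr a) = ennreal (x powr a) * indicator {0..d} x" for x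
    by (simp add: indicator_def)
  ultimately show ?thesis by simp
qed

lemma nn_integral_abs_powr_near:
  assumes s: "s < 1" and d: "d \<ge> 0"
  shows "(\<integral>\<^sup>+r. ennreal (\<bar>r - c\<bar> powr (- s)) * indicator {r. \<bar>r - c\<bar> < d} r \<partial>lborel) \<le> ennreal (2 * (d powr (1 - s) / (1 - s)))"
proof -
  let ?g = "\<lambda>x. ennreal (x powr (- s)) * indicator {0..d} x"
  have "(\<integral>\<^sup>+r. ennreal (\<bar>r - c\<bar> powr (- s)) * indicator {r. \<bar>r - c\<bar> < d} r \<partial>lborel) =
      ennreal \<bar>1\<bar> * (\<integral>\<^sup>+x. ennreal (\<bar>c + 1 * x - c\<bar> powr (- s)) * indicator {r. \<bar>r - c\<bar> < d} (c + 1 * x) \<partial>lborel)"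
    by (rule nn_integral_real_affine) measurable
  also have "\<dots> = (\<integral>\<^sup>+x. ennreal (\<bar>x\<bar> powr (- s)) * indicator {r. \<bar>r\<bar> < d} x \<partial>lborel)"
    by (simp, intro nn_integral_cong) (simp add: indicator_def)
  also have "\<dots> \<le> (\<integral>\<^sup>+x. ?g x + ?g (- x) \<partial>lborel)"
    by (intro nn_integral_mono) (auto simp: indicator_def)
  also have "\<dots> = (\<integral>\<^sup>+x. ?g x \<partial>lborel) + (\<integral>\<^sup>+x. ?g (- x) \<partial>lborel)"
    by (rule nn_integral_add) measurable
  also have "(\<integral>\<^sup>+x. ?g (- x) \<partial>lborel) = (\<integral>\<^sup>+x. ?g x \<partial>lborel)"
  proof -
    have "(\<integral>\<^sup>+x. ?g x \<partial>lborel) = ennreal \<bar>-1\<bar> * (\<integral>\<^sup>+x. ?g (0 + (-1) * x) \<partial>lborel)"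
    proof (rule nn_integral_real_affine)
      show "?g \<in> borel_measurable borel" by measurable
    qed simp
    then show ?thesis by simp
  qed
  also have "(\<integral>\<^sup>+x. ?g x \<partial>lborel) = ennreal (d powr (1 - s) / (1 - s))"
    using nn_integral_powr_from_0[of "- s" d] s d by (simp add: add.commute)
  also have "ennreal (d powr (1 - s) / (1 - s)) + ennreal (d powr (1 - s) / (1 - s)) = ennreal (2 * (d powr (1 - s) / (1 - s)))"
    using s by (simp flip: ennreal_plus)
  finally show ?thesis .
qed

lemma nn_integral_norm_powr_ball:
  assumes s: "s < 2" and d: "d \<ge> 0"
  shows "(\<integral>\<^sup>+w. ennreal (cmod w powr (- s)) * indicator (ball 0 d) w \<partial>lborel) \<le> ennreal (2 * pi * (d powr (2 - s) / (2 - s)))"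
proof -
  have "(\<integral>\<^sup>+w. ennreal (cmod w powr (- s)) * indicator (ball 0 d) w \<partial>lborel) =
     (\<integral>\<^sup>+r. \<integral>\<^sup>+t. ennreal r * (ennreal (cmod (of_real r * cis t) powr (- s)) * indicator (ball 0 d) (of_real r * cis t)) *
         indicator {0..2*pi} t * indicator {0<..} r \<partial>lborel \<partial>lborel)"
    by (rule nn_integral_polar) measurable
  also have "\<dots> \<le> (\<integral>\<^sup>+r. ennreal (2 * pi) * (ennreal (r powr (1 - s)) * indicator {0..d} r) \<partial>lborel)"
  proof (rule nn_integral_mono)
    fix r :: real
    have "(\<integral>\<^sup>+t. ennreal r * (ennreal (cmod (of_real r * cis t) powr (- s)) * indicator (ball 0 d) (of_real r * cis t)) *
         indicator {0..2*pi} t * indicator {0<..} r \<partial>lborel) \<le>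
       (\<integral>\<^sup>+t. ennreal (r powr (1 - s)) * indicator {0..d} r * indicator {0..2*pi} t \<partial>lborel)"
    proof (rule nn_integral_mono)
      fix t :: real
      have "r * r powr (- s) = r powr (1 - s)" if "r > 0"
        using that by (simp add: powr_diff powr_minus divide_inverse)
      then show "ennreal r * (ennreal (cmod (of_real r * cis t) powr (- s)) * indicator (ball 0 d) (of_real r * cis t)) *
         indicator {0..2*pi} t * indicator {0<..} r \<le> ennreal (r powr (1 - s)) * indicator {0..d} r * indicator {0..2*pi} t"
        by (auto simp: indicator_def norm_mult simp flip: ennreal_mult)
    qed
    also have "\<dots> = ennreal (2 * pi) * (ennreal (r powr (1 - s)) * indicator {0..d} r)"
      by (simp add: nn_integral_cmult mult_ac)
    finally show "(\<integral>\<^sup>+t. ennreal r * (ennreal (cmod (of_real r * cis t) powr (- s)) * indicator (ball 0 d) (of_real r * cis t)) *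
         indicator {0..2*pi} t * indicator {0<..} r \<partial>lborel) \<le> ennreal (2 * pi) * (ennreal (r powr (1 - s)) * indicator {0..d} r)" .
  qed
  also have "\<dots> = ennreal (2 * pi) * ennreal (d powr (2 - s) / (2 - s))"
    using nn_integral_powr_from_0[of "1 - s" d] s d by (subst nn_integral_cmult) auto
  also have "\<dots> = ennreal (2 * pi * (d powr (2 - s) / (2 - s)))"
    using s by (subst ennreal_mult) auto
  finally show ?thesis .
qed

lemma nn_integral_reflect:
  fixes f :: "complex \<Rightarrow> ennreal"
  assumes [measurable]: "f \<in> borel_measurable borel"
  shows "(\<integral>\<^sup>+\<zeta>. f (z - \<zeta>) \<partial>lborel) = (\<integral>\<^sup>+w. f w \<partial>lborel)"
proof -
  have "(\<integral>\<^sup>+w. f w \<partial>lborel) = (\<integral>\<^sup>+w. f w \<partial>density (distr lborel borel (\<lambda>x. z + (- 1) *\<^sub>R x)) (\<lambda>_. ennreal (\<bar>- 1\<bar> ^ DIM(complex))))"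
    by (subst lborel_affine[of "- 1" z]) auto
  also have "\<dots> = (\<integral>\<^sup>+\<zeta>. f (z - \<zeta>) \<partial>lborel)"
    by (subst nn_integral_density, simp, simp, subst nn_integral_distr) simp_all
  finally show ?thesis ..
qed

text \<open>In polar coordinates a radial weight leaves the circle means of \<open>\<bar>h\<bar>\<^sup>p\<close>; the Jacobian \<open>r\<close> is at most \<open>1\<close>.\<close>

lemma nn_integral_LD_radial:
  fixes \<phi> :: "real \<Rightarrow> ennreal"
  assumes h: "h \<in> borel_measurable LD" and p: "p > 0" and M: "hardy_sup p h \<le> ennreal M"
    and [measurable]: "\<phi> \<in> borel_measurable borel"
  shows "(\<integral>\<^sup>+\<zeta>. ennreal (cmod (h \<zeta>) powr p) * \<phi> (cmod \<zeta>) \<partial>LD) \<le> ennreal (2 * pi) * ennreal M * (\<integral>\<^sup>+r. \<phi> r \<partial>lborel)"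
proof -
  obtain h' where h': "h' \<in> borel_measurable borel" "AE z in LD. h z = h' z"
    using borel_representative[OF h] .
  note [measurable] = h'(1)
  let ?F = "\<lambda>z. ennreal (cmod (h' z) powr p) * \<phi> (cmod z) * indicator disc z"
  have "(\<integral>\<^sup>+\<zeta>. ennreal (cmod (h \<zeta>) powr p) * \<phi> (cmod \<zeta>) \<partial>LD) = (\<integral>\<^sup>+\<zeta>. ennreal (cmod (h' \<zeta>) powr p) * \<phi> (cmod \<zeta>) \<partial>LD)"
    by (rule nn_integral_cong_AE) (use h'(2) in \<open>eventually_elim, simp\<close>)
  also have "\<dots> = (\<integral>\<^sup>+\<zeta>. ?F \<zeta> \<partial>lborel)" by (rule nn_integral_LD)
  also have "\<dots> = (\<integral>\<^sup>+r. \<integral>\<^sup>+t. ennreal r * ?F (of_real r * cis t) * indicator {0..2*pi} t * indicator {0<..} r \<partial>lborel \<partial>lborel)"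
    by (rule nn_integral_polar) measurable
  also have "\<dots> \<le> (\<integral>\<^sup>+r. ennreal (2 * pi) * ennreal M * \<phi> r \<partial>lborel)"
  proof (rule nn_integral_mono_AE)
    show "AE r in lborel. (\<integral>\<^sup>+t. ennreal r * ?F (of_real r * cis t) * indicator {0..2*pi} t * indicator {0<..} r \<partial>lborel)
        \<le> ennreal (2 * pi) * ennreal M * \<phi> r"
      using circle_mean_AE_eq[OF h'(2) p] circle_mean_le_hardy_sup[of p h]
    proof eventually_elim
      fix r :: real
      assume a: "0 < r \<and> r < 1 \<longrightarrow> circle_mean p h r = circle_mean p h' r" "0 < r \<and> r < 1 \<longrightarrow> circle_mean p h r \<le> hardy_sup p h"
      show "(\<integral>\<^sup>+t. ennreal r * ?F (of_real r * cis t) * indicator {0..2*pi} t * indicator {0<..} r \<partial>lborel)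
        \<le> ennreal (2 * pi) * ennreal M * \<phi> r"
      proof (cases "0 < r \<and> r < 1")
        case True
        have "(\<integral>\<^sup>+t. ennreal r * ?F (of_real r * cis t) * indicator {0..2*pi} t * indicator {0<..} r \<partial>lborel) =
          (\<integral>\<^sup>+t. ennreal r * \<phi> r * (ennreal (cmod (h' (of_real r * cis t)) powr p) * indicator {0..2*pi} t) \<partial>lborel)"
          using True by (intro nn_integral_cong) (auto simp: norm_mult mult_ac indicator_def)
        also have "\<dots> = ennreal r * \<phi> r * (\<integral>\<^sup>+t. ennreal (cmod (h' (of_real r * cis t)) powr p) * indicator {0..2*pi} t \<partial>lborel)"
          by (rule nn_integral_cmult) measurable
        also have "(\<integral>\<^sup>+t. ennreal (cmod (h' (of_real r * cis t)) powr p) * indicator {0..2*pi} t \<partial>lborel) = ennreal (2 * pi) * circle_mean p h' r"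
          unfolding circle_mean_eq by (simp add: ennreal_mult[symmetric] flip: mult.assoc)
        also have "ennreal r * \<phi> r * (ennreal (2 * pi) * circle_mean p h' r) \<le> 1 * \<phi> r * (ennreal (2 * pi) * ennreal M)"
          using a True M by (intro mult_mono) (auto intro: order_trans simp: ennreal_le_1)
        finally show ?thesis by (simp add: mult_ac)
      next
        case False
        then have "(\<integral>\<^sup>+t. ennreal r * ?F (of_real r * cis t) * indicator {0..2*pi} t * indicator {0<..} r \<partial>lborel) = (\<integral>\<^sup>+t. 0 \<partial>(lborel :: real measure))"
          by (intro nn_integral_cong) (auto simp: norm_mult indicator_def)
        then show ?thesis by simp
      qed
    qed
  qed
  also have "\<dots> = ennreal (2 * pi) * ennreal M * (\<integral>\<^sup>+r. \<phi> r \<partial>lborel)"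
    by (rule nn_integral_cmult) measurable
  finally show ?thesis .
qed

definition riesz :: "(complex \<Rightarrow> complex) \<Rightarrow> complex set \<Rightarrow> complex \<Rightarrow> ennreal" where
  "riesz h S z = (\<integral>\<^sup>+\<zeta>. ennreal (cmod (h \<zeta>) / cmod (z - \<zeta>)) * indicator S \<zeta> \<partial>LD)"

text \<open>If \<open>g\<close> is at most \<open>k\<^bsup>1/p\<^esup>\<close> the second term dominates the product, otherwise the first one does.\<close>

lemma Young_kernel:
  fixes g k p :: real
  assumes "g \<ge> 0" "k > 0" "p > 1"
  shows "g * k \<le> g powr p * k powr (1 / p) + k powr (1 + 1 / p)"
proof (cases "g \<le> k powr (1 / p)")
  case True
  then have "g * k \<le> k powr (1 / p) * k" using assms by (intro mult_right_mono) auto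
  also have "\<dots> = k powr (1 + 1 / p)" using assms by (simp add: powr_add)
  finally show ?thesis using assms by (smt (verit) mult_nonneg_nonneg powr_ge_zero)
next
  case False
  then have g: "g > 0" using assms by (smt (verit) powr_ge_zero)
  have "k powr (1 - 1 / p) = (k powr (1 / p)) powr (p - 1)"
    using assms by (simp add: powr_powr field_simps)
  also have "\<dots> \<le> g powr (p - 1)" using False assms by (intro powr_mono2) auto
  finally have "k powr (1 - 1 / p) * (g * k powr (1 / p)) \<le> g powr (p - 1) * (g * k powr (1 / p))"
    using assms by (intro mult_right_mono) auto
  moreover have "k powr (1 - 1 / p) * (g * k powr (1 / p)) = g * (k powr (1 - 1 / p) * k powr (1 / p))"
    by (simp only: mult.left_commute)
  moreover have "k powr (1 - 1 / p) * k powr (1 / p) = k" using assms by (simp flip: powr_add)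
  moreover have "g powr (p - 1) * (g * k powr (1 / p)) = (g powr (p - 1) * g) * k powr (1 / p)"
    by (simp only: mult.assoc)
  moreover have "g powr (p - 1) * g = g powr p" using g by (simp add: powr_diff)
  ultimately have "g * k \<le> g powr p * k powr (1 / p)" by simp
  then show ?thesis by (smt (verit) powr_ge_zero)
qed

definition near_const :: "real \<Rightarrow> real \<Rightarrow> real" where
  "near_const p M = (4 * pi * M + 2 * pi) / (1 - 1 / p)"

text \<open>The kernel \<open>k = 1 / \<bar>z - \<zeta>\<bar>\<close> is not square integrable, and \<open>h\<close> may lie in no \<open>L\<^sup>q\<close> with \<open>q > 2\<close>.
  The bound comes from \<open>\<bar>h\<bar> k \<le> \<bar>h\<bar>\<^sup>p k\<^bsup>1/p\<^esup> + k\<^bsup>1+1/p\<^esup>\<close>: in the first term \<open>k\<close> is at most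
  \<open>1 / \<bar>\<bar>z\<bar> - \<bar>\<zeta>\<bar>\<bar>\<close>, which is constant on circles and whose power \<open>1/p\<close> is integrable in the radius, and
  the exponent of the second term is less than \<open>2\<close>.\<close>

lemma riesz_near_bound:
  assumes h: "h \<in> borel_measurable LD" and p: "p > 1" and M: "hardy_sup p h \<le> ennreal M" "M \<ge> 0" and d: "d \<ge> 0"
  shows "riesz h (ball z d) z \<le> ennreal (near_const p M * d powr (1 - 1 / p))"
proof -
  let ?\<phi> = "\<lambda>r. ennreal (\<bar>r - cmod z\<bar> powr (- (1 / p))) * indicator {r. \<bar>r - cmod z\<bar> < d} r"
  let ?k = "\<lambda>w. ennreal (cmod w powr (- (1 + 1 / p))) * indicator (ball 0 d) w"
  note [measurable] = h
  have "(\<lambda>\<zeta>. ?\<phi> (cmod \<zeta>)) \<in> borel_measurable borel" by measurable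
  then have [measurable]: "(\<lambda>\<zeta>. ?\<phi> (cmod \<zeta>)) \<in> borel_measurable LD" by (rule borel_measurable_LD)
  have "(\<lambda>\<zeta>. ?k (z - \<zeta>)) \<in> borel_measurable borel" by measurable
  then have [measurable]: "(\<lambda>\<zeta>. ?k (z - \<zeta>)) \<in> borel_measurable LD" by (rule borel_measurable_LD)
  have p1: "1 / p < 1" "1 / p > 0" using p by auto
  have "AE \<zeta> in LD. cmod \<zeta> \<noteq> cmod z"
  proof -
    have "negligible (sphere (0::complex) (cmod z))" by (rule negligible_sphere)
    then have "AE \<zeta> in (lebesgue :: complex measure). \<zeta> \<notin> sphere 0 (cmod z)"
      unfolding negligible_iff_null_sets by (rule AE_not_in)
    then show ?thesis by (subst AE_restrict_space_iff) (auto elim: eventually_mono)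
  qed
  then have "riesz h (ball z d) z \<le> (\<integral>\<^sup>+\<zeta>. ennreal (cmod (h \<zeta>) powr p) * ?\<phi> (cmod \<zeta>) + ?k (z - \<zeta>) \<partial>LD)"
    unfolding riesz_def
  proof (intro nn_integral_mono_AE, eventually_elim)
    fix \<zeta> assume ne: "cmod \<zeta> \<noteq> cmod z"
    show "ennreal (cmod (h \<zeta>) / cmod (z - \<zeta>)) * indicator (ball z d) \<zeta> \<le> ennreal (cmod (h \<zeta>) powr p) * ?\<phi> (cmod \<zeta>) + ?k (z - \<zeta>)"
    proof (cases "\<zeta> \<in> ball z d")
      case True
      have tri: "\<bar>cmod \<zeta> - cmod z\<bar> \<le> cmod (z - \<zeta>)" by (metis norm_minus_commute norm_triangle_ineq3)
      have pos: "cmod (z - \<zeta>) > 0" "\<bar>cmod \<zeta> - cmod z\<bar> > 0" using ne by auto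
      let ?K = "1 / cmod (z - \<zeta>)"
      have K: "?K powr q = cmod (z - \<zeta>) powr (- q)" for q
        using pos by (simp add: powr_divide powr_minus_divide)
      have "?K powr (1 / p) \<le> \<bar>cmod \<zeta> - cmod z\<bar> powr (- (1 / p))"
        unfolding K using pos tri p1 by (intro powr_mono2') auto
      then have "cmod (h \<zeta>) * ?K \<le> cmod (h \<zeta>) powr p * \<bar>cmod \<zeta> - cmod z\<bar> powr (- (1 / p)) + cmod (z - \<zeta>) powr (- (1 + 1 / p))"
        using Young_kernel[of "cmod (h \<zeta>)" ?K p] p pos mult_left_mono[of "?K powr (1 / p)" "\<bar>cmod \<zeta> - cmod z\<bar> powr (- (1 / p))" "cmod (h \<zeta>) powr p"]
        unfolding K by simp
      then have "ennreal (cmod (h \<zeta>) / cmod (z - \<zeta>)) \<le> ennreal (cmod (h \<zeta>) powr p * \<bar>cmod \<zeta> - cmod z\<bar> powr (- (1 / p)) + cmod (z - \<zeta>) powr (- (1 + 1 / p)))"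
        by (intro ennreal_leI) simp
      also have "\<dots> = ennreal (cmod (h \<zeta>) powr p) * ennreal (\<bar>cmod \<zeta> - cmod z\<bar> powr (- (1 / p))) + ennreal (cmod (z - \<zeta>) powr (- (1 + 1 / p)))"
        by (simp add: ennreal_plus ennreal_mult)
      also have "\<dots> = ennreal (cmod (h \<zeta>) powr p) * ?\<phi> (cmod \<zeta>) + ?k (z - \<zeta>)"
      proof -
        have "indicator (ball 0 d) (z - \<zeta>) = (1::ennreal)" "indicator {r. \<bar>r - cmod z\<bar> < d} (cmod \<zeta>) = (1::ennreal)"
          using True tri norm_minus_commute[of z \<zeta>] by (auto simp: dist_norm indicator_def)
        then show ?thesis by simp
      qed
      finally show ?thesis using True by simp
    qed simp
  qed
  also have "\<dots> = (\<integral>\<^sup>+\<zeta>. ennreal (cmod (h \<zeta>) powr p) * ?\<phi> (cmod \<zeta>) \<partial>LD) + (\<integral>\<^sup>+\<zeta>. ?k (z - \<zeta>) \<partial>LD)"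
    by (rule nn_integral_add) measurable
  also have "\<dots> \<le> ennreal (2 * pi) * ennreal M * ennreal (2 * (d powr (1 - 1 / p) / (1 - 1 / p))) + ennreal (2 * pi * (d powr (1 - 1 / p) / (1 - 1 / p)))"
  proof (rule add_mono)
    have "(\<integral>\<^sup>+\<zeta>. ennreal (cmod (h \<zeta>) powr p) * ?\<phi> (cmod \<zeta>) \<partial>LD) \<le> ennreal (2 * pi) * ennreal M * (\<integral>\<^sup>+r. ?\<phi> r \<partial>lborel)"
      by (rule nn_integral_LD_radial[OF h _ M(1)]) (use p in simp, measurable)
    also have "\<dots> \<le> ennreal (2 * pi) * ennreal M * ennreal (2 * (d powr (1 - 1 / p) / (1 - 1 / p)))"
      by (intro mult_left_mono nn_integral_abs_powr_near) (use p1 d in auto)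
    finally show "(\<integral>\<^sup>+\<zeta>. ennreal (cmod (h \<zeta>) powr p) * ?\<phi> (cmod \<zeta>) \<partial>LD) \<le> \<dots>" .
    have "(\<integral>\<^sup>+\<zeta>. ?k (z - \<zeta>) \<partial>LD) \<le> (\<integral>\<^sup>+\<zeta>. ?k (z - \<zeta>) \<partial>lborel)"
      unfolding nn_integral_LD by (intro nn_integral_mono) (auto simp: indicator_def)
    also have "\<dots> = (\<integral>\<^sup>+w. ?k w \<partial>lborel)" by (rule nn_integral_reflect) measurable
    also have "\<dots> \<le> ennreal (2 * pi * (d powr (2 - (1 + 1 / p)) / (2 - (1 + 1 / p))))"
      by (rule nn_integral_norm_powr_ball) (use p1 d in auto)
    also have "2 - (1 + 1 / p) = 1 - 1 / p" by simp
    finally show "(\<integral>\<^sup>+\<zeta>. ?k (z - \<zeta>) \<partial>LD) \<le> ennreal (2 * pi * (d powr (1 - 1 / p) / (1 - 1 / p)))" .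
  qed
  also have "\<dots> = ennreal (near_const p M * d powr (1 - 1 / p))"
  proof -
    have "2 * pi * M * (2 * (d powr (1 - 1 / p) / (1 - 1 / p))) + 2 * pi * (d powr (1 - 1 / p) / (1 - 1 / p)) = near_const p M * d powr (1 - 1 / p)"
    proof -
      have "2 * pi * M * (2 * (X / q)) + 2 * pi * (X / q) = (4 * pi * M + 2 * pi) / q * X" for X q :: real
        by (cases "q = 0") (simp_all add: field_simps)
      then show ?thesis by (simp only: near_const_def)
    qed
    then show ?thesis
      using M(2) p1 by (simp add: ennreal_mult[symmetric] ennreal_plus[symmetric] del: ennreal_plus)
  qed
  finally show ?thesis .
qed

text \<open>The Cauchy kernel with an exponential factor that is holomorphic in \<open>z\<close> and equal to \<open>1\<close> for \<open>z = \<zeta>\<close>.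
  The modulus of the exponential is the quotient of \<open>exp (l \<bar>z\<bar>\<^sup>2 / 2)\<close> by \<open>exp (l \<bar>\<zeta>\<bar>\<^sup>2 / 2)\<close> times
  \<open>exp (- l \<bar>z - \<zeta>\<bar>\<^sup>2 / 2)\<close>, which concentrates the kernel near the diagonal when \<open>l\<close> is large; \<open>l = 0\<close> gives the usual Cauchy transform.\<close>

definition K :: "real \<Rightarrow> complex \<Rightarrow> complex \<Rightarrow> complex" where
  "K l z \<zeta> = exp (of_real l * cnj \<zeta> * (z - \<zeta>)) / (of_real pi * (z - \<zeta>))"

definition T :: "real \<Rightarrow> (complex \<Rightarrow> complex) \<Rightarrow> complex \<Rightarrow> complex" where
  "T l h z = (LINT \<zeta>|LD. K l z \<zeta> * h \<zeta>)"

text \<open>Absolute convergence of the transform on the closed disc, with a uniform bound.\<close>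

definition admissible :: "(complex \<Rightarrow> complex) \<Rightarrow> real \<Rightarrow> bool" where
  "admissible h C \<longleftrightarrow> h \<in> borel_measurable LD \<and> C \<ge> 0 \<and> (\<forall>z\<in>cball 0 1. riesz h UNIV z \<le> ennreal C)"

lemma norm_K_le:
  assumes "l \<ge> 0" "cmod z \<le> 1" "cmod \<zeta> \<le> 1"
  shows "cmod (K l z \<zeta>) \<le> exp (2 * l) / cmod (z - \<zeta>)"
proof -
  have "cmod (z - \<zeta>) \<le> 2" using assms norm_triangle_ineq4[of z \<zeta>] by simp
  then have "cmod \<zeta> * cmod (z - \<zeta>) \<le> 1 * 2" using assms by (intro mult_mono) auto
  then have "cmod (of_real l * cnj \<zeta> * (z - \<zeta>)) \<le> 2 * l"
    using assms mult_left_mono[of "cmod \<zeta> * cmod (z - \<zeta>)" 2 l] by (simp add: norm_mult mult_ac)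
  then have 1: "cmod (exp (of_real l * cnj \<zeta> * (z - \<zeta>))) \<le> exp (2 * l)"
    using complex_Re_le_cmod[of "of_real l * cnj \<zeta> * (z - \<zeta>)"] by (simp only: norm_exp_eq_Re exp_le_cancel_iff)
  have "exp (2 * l) / (pi * cmod (z - \<zeta>)) \<le> exp (2 * l) / (1 * cmod (z - \<zeta>))"
    using pi_gt3 by (cases "z = \<zeta>") (auto intro!: divide_left_mono mult_right_mono mult_pos_pos)
  moreover have "cmod (K l z \<zeta>) \<le> exp (2 * l) / (pi * cmod (z - \<zeta>))"
    using 1 by (simp add: K_def norm_divide norm_mult divide_right_mono)
  ultimately show ?thesis by simp
qed

lemma K_borel_measurable [measurable]:
  assumes [measurable]: "f \<in> borel_measurable M" "g \<in> borel_measurable M"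
  shows "(\<lambda>x. K l (f x) (g x)) \<in> borel_measurable M"
proof -
  have [measurable]: "(exp :: complex \<Rightarrow> complex) \<in> borel_measurable borel"
    by (intro borel_measurable_continuous_onI continuous_intros)
  show ?thesis unfolding K_def by measurable
qed

lemma K_measurable_LD: "K l z \<in> borel_measurable LD"
proof -
  have "(\<lambda>x. K l z x) \<in> borel_measurable borel" by measurable
  then show ?thesis by (rule borel_measurable_LD)
qed

lemma nn_integral_K_le:
  assumes "l \<ge> 0" "cmod z \<le> 1" and h: "h \<in> borel_measurable LD"
  shows "(\<integral>\<^sup>+\<zeta>. ennreal (cmod (K l z \<zeta> * h \<zeta>)) \<partial>LD) \<le> ennreal (exp (2 * l)) * riesz h UNIV z"
proof -
  have [measurable]: "(\<lambda>\<zeta>. cmod (z - \<zeta>)) \<in> borel_measurable LD"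
    by (rule borel_measurable_LD) measurable
  note [measurable] = h
  have "(\<integral>\<^sup>+\<zeta>. ennreal (cmod (K l z \<zeta> * h \<zeta>)) \<partial>LD) \<le> (\<integral>\<^sup>+\<zeta>. ennreal (exp (2 * l)) * ennreal (cmod (h \<zeta>) / cmod (z - \<zeta>)) \<partial>LD)"
  proof (rule nn_integral_mono)
    fix \<zeta> assume "\<zeta> \<in> space LD"
    then have "cmod (K l z \<zeta>) \<le> exp (2 * l) / cmod (z - \<zeta>)"
      using norm_K_le assms by simp
    then have "cmod (K l z \<zeta>) * cmod (h \<zeta>) \<le> exp (2 * l) / cmod (z - \<zeta>) * cmod (h \<zeta>)"
      by (rule mult_right_mono) simp
    then show "ennreal (cmod (K l z \<zeta> * h \<zeta>)) \<le> ennreal (exp (2 * l)) * ennreal (cmod (h \<zeta>) / cmod (z - \<zeta>))"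
      by (simp add: norm_mult ennreal_mult[symmetric] ennreal_leI)
  qed
  also have "\<dots> = ennreal (exp (2 * l)) * riesz h UNIV z"
    unfolding riesz_def by (subst nn_integral_cmult) auto
  finally show ?thesis .
qed

lemma admissible_integrable_K:
  assumes "admissible h C" "l \<ge> 0" "cmod z \<le> 1"
  shows "integrable LD (\<lambda>\<zeta>. K l z \<zeta> * h \<zeta>)"
proof (rule integrableI_bounded)
  show "(\<lambda>\<zeta>. K l z \<zeta> * h \<zeta>) \<in> borel_measurable LD"
    using assms K_measurable_LD by (auto simp: admissible_def)
  have "(\<integral>\<^sup>+\<zeta>. ennreal (cmod (K l z \<zeta> * h \<zeta>)) \<partial>LD) \<le> ennreal (exp (2 * l)) * riesz h UNIV z"
    using assms by (intro nn_integral_K_le) (auto simp: admissible_def)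
  also have "\<dots> \<le> ennreal (exp (2 * l)) * ennreal C"
    using assms by (intro mult_left_mono) (auto simp: admissible_def)
  also have "\<dots> < \<infinity>" by (simp add: ennreal_mult_less_top)
  finally show "(\<integral>\<^sup>+\<zeta>. ennreal (cmod (K l z \<zeta> * h \<zeta>)) \<partial>LD) < \<infinity>" .
qed

lemma T_bound:
  assumes "admissible h C" "l \<ge> 0" "cmod z \<le> 1"
  shows "cmod (T l h z) \<le> exp (2 * l) * C"
proof -
  have "ennreal (cmod (T l h z)) \<le> (\<integral>\<^sup>+\<zeta>. ennreal (cmod (K l z \<zeta> * h \<zeta>)) \<partial>LD)"
    unfolding T_def by (rule integral_norm_bound_ennreal[OF admissible_integrable_K[OF assms]])
  also have "\<dots> \<le> ennreal (exp (2 * l)) * riesz h UNIV z"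
    using assms by (intro nn_integral_K_le) (auto simp: admissible_def)
  also have "\<dots> \<le> ennreal (exp (2 * l)) * ennreal C"
    using assms by (intro mult_left_mono) (auto simp: admissible_def)
  also have "\<dots> = ennreal (exp (2 * l) * C)" using assms by (subst ennreal_mult) (auto simp: admissible_def)
  finally show ?thesis
    using assms by (subst (asm) ennreal_le_iff) (auto simp: admissible_def)
qed

lemma admissible_L1:
  assumes "admissible h C"
  shows "integrable LD h" "(\<integral>\<^sup>+\<zeta>. ennreal (cmod (h \<zeta>)) \<partial>LD) \<le> ennreal C"
proof -
  have ae: "AE \<zeta> in LD. \<zeta> \<noteq> 0 \<and> cmod \<zeta> < 1"
    unfolding AE_LD_iff using AE_lborel_singleton[of "0::complex"] by eventually_elim auto
  have "(\<integral>\<^sup>+\<zeta>. ennreal (cmod (h \<zeta>)) \<partial>LD) \<le> riesz h UNIV 0"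
    unfolding riesz_def
  proof (rule nn_integral_mono_AE, use ae in eventually_elim)
    fix \<zeta> :: complex assume \<zeta>: "\<zeta> \<noteq> 0 \<and> cmod \<zeta> < 1"
    then have "cmod (h \<zeta>) * cmod \<zeta> \<le> cmod (h \<zeta>) * 1" by (intro mult_left_mono) auto
    then have "cmod (h \<zeta>) \<le> cmod (h \<zeta>) / cmod (0 - \<zeta>)"
      using \<zeta> by (simp add: field_simps)
    then show "ennreal (cmod (h \<zeta>)) \<le> ennreal (cmod (h \<zeta>) / cmod (0 - \<zeta>)) * indicator UNIV \<zeta>"
      by (simp add: ennreal_leI)
  qed
  also have "\<dots> \<le> ennreal C" using assms by (auto simp: admissible_def)
  finally show 1: "(\<integral>\<^sup>+\<zeta>. ennreal (cmod (h \<zeta>)) \<partial>LD) \<le> ennreal C" .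
  show "integrable LD h"
    using assms 1 by (intro integrableI_bounded) (auto simp: admissible_def intro: le_less_trans)
qed

lemma admissible_hardy:
  assumes "h \<in> borel_measurable LD" "p > 1" "hardy_sup p h \<le> ennreal M" "M \<ge> 0"
  shows "admissible h (near_const p M * 3 powr (1 - 1 / p))"
  unfolding admissible_def
proof (intro conjI ballI)
  show "0 \<le> near_const p M * 3 powr (1 - 1 / p)"
    using assms by (auto simp: near_const_def intro!: mult_nonneg_nonneg divide_nonneg_pos add_nonneg_nonneg)
  fix z :: complex assume z: "z \<in> cball 0 1"
  \<comment> \<open>the disc lies within distance \<open>3\<close> of each point of its closure\<close>
  have "riesz h UNIV z = riesz h (ball z 3) z"
    unfolding riesz_def
  proof (rule nn_integral_cong)
    fix \<zeta> assume "\<zeta> \<in> space LD"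
    then have "cmod (z - \<zeta>) < 3" using z norm_triangle_ineq4[of z \<zeta>] by simp
    then show "ennreal (cmod (h \<zeta>) / cmod (z - \<zeta>)) * indicator UNIV \<zeta> = ennreal (cmod (h \<zeta>) / cmod (z - \<zeta>)) * indicator (ball z 3) \<zeta>"
      by (simp add: dist_norm)
  qed
  also have "\<dots> \<le> ennreal (near_const p M * 3 powr (1 - 1 / p))"
    by (rule riesz_near_bound) (use assms in auto)
  finally show "riesz h UNIV z \<le> ennreal (near_const p M * 3 powr (1 - 1 / p))" .
qed fact

lemma measurable_pair_LD [measurable]:
  "fst \<in> borel_measurable (LD \<Otimes>\<^sub>M LD)" "snd \<in> borel_measurable (LD \<Otimes>\<^sub>M LD)"
  by (rule measurable_compose[OF measurable_fst measurable_ident_LD] measurable_compose[OF measurable_snd measurable_ident_LD])+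

lemma T_measurable:
  assumes h: "h \<in> borel_measurable LD"
  shows "T l h \<in> borel_measurable LD"
proof -
  have [measurable]: "(\<lambda>x. h (snd x)) \<in> borel_measurable (LD \<Otimes>\<^sub>M LD)"
    by (rule measurable_compose[OF measurable_snd h])
  have "(\<lambda>(z, \<zeta>). K l z \<zeta> * h \<zeta>) \<in> borel_measurable (LD \<Otimes>\<^sub>M LD)"
    unfolding case_prod_unfold by measurable
  then show ?thesis
    unfolding T_def[abs_def] by (rule LD.borel_measurable_lebesgue_integral)
qed

text \<open>As a function of \<open>z\<close> the kernel is the Cauchy kernel with pole at \<open>\<zeta>\<close> plus a holomorphic function,
  whatever \<open>l\<close> is.\<close>

lemma weak_dbar_T:
  assumes h: "admissible h C" and l: "l \<ge> 0"
  shows "weak_dbar (T l h) h"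
  unfolding weak_dbar_def
proof
  fix \<psi> assume \<psi>: "\<psi> \<in> test_functions"
  obtain B k where B: "B > 0" "\<And>z. z \<in> disc \<Longrightarrow> cmod (\<psi> z) \<le> B" "\<And>z. z \<in> disc \<Longrightarrow> cmod (dbar \<psi> z) \<le> B"
    "compact k" "k \<subseteq> disc" "\<And>z. z \<notin> k \<Longrightarrow> \<psi> z = 0" "\<And>z. z \<notin> k \<Longrightarrow> dbar \<psi> z = 0"
    by (rule test_function_bounded[OF \<psi>], rule that)
  have hm [measurable]: "h \<in> borel_measurable LD" using h by (simp add: admissible_def)
  have dm [measurable]: "dbar \<psi> \<in> borel_measurable LD" by (rule test_function_measurable[OF \<psi>])
  have "(LINT z|LD. T l h z * dbar \<psi> z) = (LINT z|LD. LINT \<zeta>|LD. K l z \<zeta> * h \<zeta> * dbar \<psi> z)"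
    unfolding T_def by simp
  also have "\<dots> = (LINT \<zeta>|LD. LINT z|LD. K l z \<zeta> * h \<zeta> * dbar \<psi> z)"
  proof (rule LD_Fubini)
    have [measurable]: "(\<lambda>x. h (snd x)) \<in> borel_measurable (LD \<Otimes>\<^sub>M LD)" "(\<lambda>x. dbar \<psi> (fst x)) \<in> borel_measurable (LD \<Otimes>\<^sub>M LD)"
      by (rule measurable_compose[OF measurable_snd hm] measurable_compose[OF measurable_fst dm])+
    show "(\<lambda>(z, \<zeta>). K l z \<zeta> * h \<zeta> * dbar \<psi> z) \<in> borel_measurable (LD \<Otimes>\<^sub>M LD)"
      unfolding case_prod_unfold by measurable
    fix z :: complex assume z: "z \<in> disc"
    have Km: "(\<lambda>\<zeta>. K l z \<zeta> * h \<zeta>) \<in> borel_measurable LD"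
      by (intro borel_measurable_times K_measurable_LD hm)
    have "(\<integral>\<^sup>+\<zeta>. ennreal (cmod (K l z \<zeta> * h \<zeta> * dbar \<psi> z)) \<partial>LD) = ennreal (cmod (dbar \<psi> z)) * (\<integral>\<^sup>+\<zeta>. ennreal (cmod (K l z \<zeta> * h \<zeta>)) \<partial>LD)"
    proof (subst nn_integral_cmult[symmetric])
      show "(\<lambda>\<zeta>. ennreal (cmod (K l z \<zeta> * h \<zeta>))) \<in> borel_measurable LD" using Km by measurable
    qed (auto simp: norm_mult ennreal_mult mult_ac intro!: nn_integral_cong)
    also have "\<dots> \<le> ennreal B * (ennreal (exp (2 * l)) * ennreal C)"
    proof (intro mult_mono)
      have "(\<integral>\<^sup>+\<zeta>. ennreal (cmod (K l z \<zeta> * h \<zeta>)) \<partial>LD) \<le> ennreal (exp (2 * l)) * riesz h UNIV z"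
        using h l z by (intro nn_integral_K_le) (auto simp: admissible_def)
      also have "\<dots> \<le> ennreal (exp (2 * l)) * ennreal C"
        using h z by (intro mult_left_mono) (auto simp: admissible_def)
      finally show "(\<integral>\<^sup>+\<zeta>. ennreal (cmod (K l z \<zeta> * h \<zeta>)) \<partial>LD) \<le> ennreal (exp (2 * l)) * ennreal C" .
    qed (use B z in \<open>auto intro: ennreal_leI\<close>)
    also have "\<dots> = ennreal (B * (exp (2 * l) * C))"
      using B(1) h by (simp add: ennreal_mult admissible_def)
    finally show "(\<integral>\<^sup>+\<zeta>. ennreal (cmod (K l z \<zeta> * h \<zeta> * dbar \<psi> z)) \<partial>LD) \<le> ennreal (B * (exp (2 * l) * C))" .
  qed
  also have "\<dots> = (LINT \<zeta>|LD. - (h \<zeta> * \<psi> \<zeta>))"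
  proof (rule Bochner_Integration.integral_cong[OF refl])
    fix \<zeta> :: complex
    let ?e = "\<lambda>z. exp (of_real l * cnj \<zeta> * (z - \<zeta>))"
    have eU: "?e holomorphic_on UNIV" by (intro holomorphic_intros)
    then have e: "?e holomorphic_on disc" "?e field_differentiable at z" for z
      by (auto intro: holomorphic_on_subset holomorphic_on_imp_differentiable_at)
    have c: "C1c (\<lambda>z. ?e z * \<psi> z)"
      by (intro C1c_mult C1_disc_holomorphic e test_functions_C1c \<psi>)
    have d: "dbar (\<lambda>z. ?e z * \<psi> z) z = ?e z * dbar \<psi> z" for z
      using test_functions_C1c[OF \<psi>] field_differentiable_imp_differentiable[OF e(2)]
      by (subst dbar_mult) (auto simp: C1c_def dbar_holomorphic[OF e(2)])
    have "(LINT z|LD. K l z \<zeta> * h \<zeta> * dbar \<psi> z) = (LINT z|LD. (h \<zeta> / of_real pi) * (dbar (\<lambda>z. ?e z * \<psi> z) z / (z - \<zeta>)))"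
      by (intro Bochner_Integration.integral_cong refl) (simp only: d, simp add: K_def mult_ac)
    also have "\<dots> = (h \<zeta> / of_real pi) * - (of_real pi * (?e \<zeta> * \<psi> \<zeta>))"
      by (simp only: integral_mult_right_zero Cauchy_Pompeiu[OF c])
    finally show "(LINT z|LD. K l z \<zeta> * h \<zeta> * dbar \<psi> z) = - (h \<zeta> * \<psi> \<zeta>)" by simp
  qed
  finally show "(LINT z|LD. T l h z * dbar \<psi> z) = - (LINT z|LD. h z * \<psi> z)" by simp
qed

lemma T_dominated_convergence:
  assumes m: "\<And>n. h n \<in> borel_measurable LD" "h' \<in> borel_measurable LD" and g: "admissible g C"
    and lim: "AE \<zeta> in LD. (\<lambda>n. h n \<zeta>) \<longlonglongrightarrow> h' \<zeta>" and le: "\<And>n. AE \<zeta> in LD. cmod (h n \<zeta>) \<le> cmod (g \<zeta>)"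
    and l: "l \<ge> 0" and z: "cmod z \<le> 1"
  shows "(\<lambda>n. T l (h n) z) \<longlonglongrightarrow> T l h' z"
  unfolding T_def
proof (rule integral_dominated_convergence[OF _ _ integrable_norm[OF admissible_integrable_K[OF g l z]]])
  show "AE \<zeta> in LD. (\<lambda>n. K l z \<zeta> * h n \<zeta>) \<longlonglongrightarrow> K l z \<zeta> * h' \<zeta>"
    using lim by eventually_elim (intro tendsto_intros)
  show "AE \<zeta> in LD. norm (K l z \<zeta> * h n \<zeta>) \<le> norm (K l z \<zeta> * g \<zeta>)" for n
    using le[of n] by eventually_elim (simp add: norm_mult mult_left_mono)
qed (use m K_measurable_LD in auto)

text \<open>Within a small distance \<open>\<delta>\<close> of the pole the integral is small uniformly in \<open>h\<close>, by the bound for small discs; away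
  from the pole the kernel is uniformly continuous.\<close>

lemma T_equicontinuous:
  assumes p: "p > 1" and l: "l \<ge> 0" and M: "M \<ge> 0" and e: "e > 0"
  obtains d where "d > 0" "\<And>h z z'. h \<in> borel_measurable LD \<Longrightarrow> hardy_sup p h \<le> ennreal M \<Longrightarrow>
     cmod z \<le> 1 \<Longrightarrow> cmod z' \<le> 1 \<Longrightarrow> cmod (z - z') < d \<Longrightarrow> cmod (T l h z - T l h z') < e"
proof -
  define E where "E = exp (2 * l)"
  define N where "N = near_const p M"
  define C where "C = N * 3 powr (1 - 1 / p)"
  define s where "s = 1 - 1 / p"
  have s: "s > 0" using p by (simp add: s_def)
  have E: "E > 0" by (simp add: E_def)
  have N: "N \<ge> 0" using p M by (auto simp: N_def near_const_def intro!: divide_nonneg_pos add_nonneg_nonneg)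
  have C: "C \<ge> 0" using N by (simp add: C_def)
  define b where "b = e / (8 * E * (N + 1))"
  have b: "b > 0" using e E N by (simp add: b_def)
  define \<delta> where "\<delta> = b powr (1 / s) / 2"
  have \<delta>: "\<delta> > 0" using b by (simp add: \<delta>_def)
  have "(2 * \<delta>) powr s = b" using b s by (simp add: \<delta>_def powr_powr)
  then have "N * (2 * \<delta>) powr s \<le> (N + 1) * b" using b by (simp add: algebra_simps)
  also have "(N + 1) * b = e / (8 * E)"
  proof -
    have "X * (e / (8 * E * X)) = e / (8 * E)" if "X \<noteq> 0" for X using that by simp
    from this[of "N + 1"] show ?thesis using N by (simp add: b_def)
  qed
  finally have near2: "N * (2 * \<delta>) powr s \<le> e / (8 * E)" .
  moreover have "N * \<delta> powr s \<le> N * (2 * \<delta>) powr s"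
    using N \<delta> s by (intro mult_left_mono powr_mono2) auto
  ultimately have near1: "N * \<delta> powr s \<le> e / (8 * E)" by linarith
  define \<eta> where "\<eta> = e / (4 * (C + 1))"
  have \<eta>: "\<eta> > 0" using e C by (simp add: \<eta>_def)
  let ?S = "(cball 0 1 \<times> cball 0 1) \<inter> {x :: complex \<times> complex. \<delta> / 2 \<le> cmod (fst x - snd x)}"
  have "compact ?S"
    by (intro compact_Int_closed compact_Times compact_cball closed_Collect_le continuous_intros)
  moreover have "continuous_on ?S (\<lambda>x. K l (fst x) (snd x))"
    unfolding K_def using \<delta> by (intro continuous_intros) auto
  ultimately have uc: "uniformly_continuous_on ?S (\<lambda>x. K l (fst x) (snd x))"
    by (rule compact_uniformly_continuous[rotated])
  obtain d where d: "d > 0" "\<And>x x'. x \<in> ?S \<Longrightarrow> x' \<in> ?S \<Longrightarrow> dist x' x < d \<Longrightarrow> dist (K l (fst x') (snd x')) (K l (fst x) (snd x)) < \<eta>"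
    using uc[unfolded uniformly_continuous_on_def, rule_format, OF \<eta>] by blast
  show ?thesis
  proof (rule that[of "min d (\<delta> / 2)"])
    show "min d (\<delta> / 2) > 0" using d \<delta> by simp
    fix h z z'
    assume h: "h \<in> borel_measurable LD" "hardy_sup p h \<le> ennreal M" and z: "cmod z \<le> 1" "cmod z' \<le> 1" and zz: "cmod (z - z') < min d (\<delta> / 2)"
    have adm: "admissible h C" unfolding C_def N_def by (rule admissible_hardy[OF h(1) p h(2) M])
    note int = admissible_integrable_K[OF adm l z(1)] admissible_integrable_K[OF adm l z(2)]
    let ?r = "\<lambda>z d \<zeta>. ennreal (cmod (h \<zeta>) / cmod (z - \<zeta>)) * indicator (ball z d) \<zeta>"
    note [measurable] = h(1)
    have "(\<lambda>\<zeta>. cmod (z - \<zeta>)) \<in> borel_measurable borel" "(\<lambda>\<zeta>. indicator (ball z d) \<zeta> :: ennreal) \<in> borel_measurable borel" for z d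
      by measurable
    then have [measurable]: "(\<lambda>\<zeta>. cmod (z - \<zeta>)) \<in> borel_measurable LD" "(\<lambda>\<zeta>. indicator (ball z d) \<zeta> :: ennreal) \<in> borel_measurable LD" for z d
      by (auto intro: borel_measurable_LD)
    have "T l h z - T l h z' = (LINT \<zeta>|LD. K l z \<zeta> * h \<zeta> - K l z' \<zeta> * h \<zeta>)"
      unfolding T_def using int by simp
    then have "ennreal (cmod (T l h z - T l h z')) \<le> (\<integral>\<^sup>+\<zeta>. ennreal (cmod (K l z \<zeta> * h \<zeta> - K l z' \<zeta> * h \<zeta>)) \<partial>LD)"
      by (simp only: integral_norm_bound_ennreal Bochner_Integration.integrable_diff int)
    also have "\<dots> \<le> (\<integral>\<^sup>+\<zeta>. ennreal \<eta> * ennreal (cmod (h \<zeta>)) + (ennreal E * ?r z \<delta> \<zeta> + ennreal E * ?r z' (2 * \<delta>) \<zeta>) \<partial>LD)"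
    proof (rule nn_integral_mono)
      fix \<zeta> assume "\<zeta> \<in> space LD"
      then have \<zeta>: "cmod \<zeta> \<le> 1" by simp
      have tri: "\<bar>cmod (z - \<zeta>) - cmod (z' - \<zeta>)\<bar> < \<delta> / 2"
        using norm_triangle_ineq3[of "z - \<zeta>" "z' - \<zeta>"] zz by simp
      show "ennreal (cmod (K l z \<zeta> * h \<zeta> - K l z' \<zeta> * h \<zeta>)) \<le> ennreal \<eta> * ennreal (cmod (h \<zeta>)) + (ennreal E * ?r z \<delta> \<zeta> + ennreal E * ?r z' (2 * \<delta>) \<zeta>)"
      proof (cases "cmod (z - \<zeta>) \<ge> \<delta>")
        case True
        moreover have "\<delta> / 2 \<le> cmod (z' - \<zeta>)" using True tri by linarith
        ultimately have "(z, \<zeta>) \<in> ?S" "(z', \<zeta>) \<in> ?S" using z \<zeta> \<delta> by auto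
        moreover have "dist (z, \<zeta>) (z', \<zeta>) < d" using zz by (simp add: dist_Pair_Pair dist_norm)
        ultimately have "cmod (K l z \<zeta> - K l z' \<zeta>) < \<eta>"
          using d(2)[of "(z', \<zeta>)" "(z, \<zeta>)"] by (simp add: dist_norm)
        then have "cmod (K l z \<zeta> - K l z' \<zeta>) * cmod (h \<zeta>) \<le> \<eta> * cmod (h \<zeta>)"
          by (intro mult_right_mono) auto
        then have "ennreal (cmod (K l z \<zeta> * h \<zeta> - K l z' \<zeta> * h \<zeta>)) \<le> ennreal \<eta> * ennreal (cmod (h \<zeta>))"
          by (simp add: ennreal_mult''[symmetric] left_diff_distrib[symmetric] norm_mult ennreal_leI)
        then show ?thesis by (rule order_trans) simp
      next
        case False
        moreover have "cmod (z' - \<zeta>) < 2 * \<delta>" using False tri \<delta> by linarith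
        ultimately have ind: "\<zeta> \<in> ball z \<delta>" "\<zeta> \<in> ball z' (2 * \<delta>)" by (auto simp: dist_norm)
        have "cmod (K l z \<zeta> * h \<zeta> - K l z' \<zeta> * h \<zeta>) \<le> cmod (K l z \<zeta>) * cmod (h \<zeta>) + cmod (K l z' \<zeta>) * cmod (h \<zeta>)"
          by (metis norm_mult norm_triangle_ineq4)
        also have "\<dots> \<le> E / cmod (z - \<zeta>) * cmod (h \<zeta>) + E / cmod (z' - \<zeta>) * cmod (h \<zeta>)"
          unfolding E_def using norm_K_le[OF l z(1) \<zeta>] norm_K_le[OF l z(2) \<zeta>] by (intro add_mono mult_right_mono) auto
        finally have "ennreal (cmod (K l z \<zeta> * h \<zeta> - K l z' \<zeta> * h \<zeta>)) \<le> ennreal (E * (cmod (h \<zeta>) / cmod (z - \<zeta>)) + E * (cmod (h \<zeta>) / cmod (z' - \<zeta>)))"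
          by (intro ennreal_leI) simp
        also have "\<dots> = ennreal (E * (cmod (h \<zeta>) / cmod (z - \<zeta>))) + ennreal (E * (cmod (h \<zeta>) / cmod (z' - \<zeta>)))"
          using E by (intro ennreal_plus) auto
        also have "\<dots> = ennreal E * ?r z \<delta> \<zeta> + ennreal E * ?r z' (2 * \<delta>) \<zeta>"
        proof -
          have "ennreal (E * (cmod (h \<zeta>) / cmod w)) = ennreal E * ennreal (cmod (h \<zeta>) / cmod w)" for w
            using E by (intro ennreal_mult) auto
          then show ?thesis using ind by (simp only:) simp
        qed
        finally show ?thesis by (rule order_trans) simp
      qed
    qed
    also have "\<dots> = ennreal \<eta> * (\<integral>\<^sup>+\<zeta>. ennreal (cmod (h \<zeta>)) \<partial>LD) + (ennreal E * riesz h (ball z \<delta>) z + ennreal E * riesz h (ball z' (2 * \<delta>)) z')"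
      unfolding riesz_def by (simp add: nn_integral_add nn_integral_cmult)
    also have "\<dots> \<le> ennreal \<eta> * ennreal C + (ennreal E * ennreal (e / (8 * E)) + ennreal E * ennreal (e / (8 * E)))"
    proof (intro add_mono mult_left_mono)
      show "(\<integral>\<^sup>+\<zeta>. ennreal (cmod (h \<zeta>)) \<partial>LD) \<le> ennreal C" by (rule admissible_L1[OF adm])
      show "riesz h (ball z \<delta>) z \<le> ennreal (e / (8 * E))"
        using riesz_near_bound[OF h(1) p h(2) M, of \<delta> z] near1 \<delta> by (auto simp: N_def s_def intro: order_trans ennreal_leI)
      show "riesz h (ball z' (2 * \<delta>)) z' \<le> ennreal (e / (8 * E))"
        using riesz_near_bound[OF h(1) p h(2) M, of "2 * \<delta>" z'] near2 \<delta> by (auto simp: N_def s_def intro: order_trans ennreal_leI)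
    qed auto
    also have "\<dots> = ennreal (\<eta> * C + (e / 8 + e / 8))"
      using \<eta> C E e by (simp add: ennreal_mult[symmetric] ennreal_plus[symmetric] del: ennreal_plus)
    finally have "cmod (T l h z - T l h z') \<le> \<eta> * C + (e / 8 + e / 8)"
      using \<eta> C e by (subst (asm) ennreal_le_iff) auto
    also have "\<eta> * C \<le> e / 4" using e C by (simp add: \<eta>_def field_simps)
    finally show "cmod (T l h z - T l h z') < e" using e by simp
  qed
qed

lemma T_continuous:
  assumes "h \<in> borel_measurable LD" "p > 1" "hardy_sup p h \<le> ennreal M" "M \<ge> 0" "l \<ge> 0"
  shows "continuous_on (cball 0 1) (T l h)"
  unfolding continuous_on_iff
proof (intro ballI allI impI)
  fix z :: complex and e :: real assume z: "z \<in> cball 0 1" and e: "e > 0"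
  obtain d where d: "d > 0" "\<And>h z z'. h \<in> borel_measurable LD \<Longrightarrow> hardy_sup p h \<le> ennreal M \<Longrightarrow>
     cmod z \<le> 1 \<Longrightarrow> cmod z' \<le> 1 \<Longrightarrow> cmod (z - z') < d \<Longrightarrow> cmod (T l h z - T l h z') < e"
    by (rule T_equicontinuous[OF assms(2,5,4) e], rule that)
  then show "\<exists>d>0. \<forall>x'\<in>cball 0 1. dist x' z < d \<longrightarrow> dist (T l h x') (T l h z) < e"
    using z assms by (intro exI[of _ d]) (auto simp: dist_norm)
qed

section \<open>The chain rule for weak derivatives along a holomorphic map\<close>

text \<open>Every polynomial in \<open>z\<close> and \<open>cnj z\<close> is the \<open>dbar\<close> of another one, since
  \<open>z\<^sup>a (cnj z)\<^sup>b\<close> has the primitive \<open>z\<^sup>a (cnj z)\<^bsup>b+1\<^esup> / (b + 1)\<close>.\<close>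

inductive zpoly :: "(complex \<Rightarrow> complex) \<Rightarrow> bool" where
  monom: "zpoly (\<lambda>z. c * z ^ a * cnj z ^ b)"
| add: "zpoly f \<Longrightarrow> zpoly g \<Longrightarrow> zpoly (\<lambda>z. f z + g z)"

lemma zpoly_mult_monom:
  assumes "zpoly f"
  shows "zpoly (\<lambda>z. f z * (c * z ^ a * cnj z ^ b))"
  using assms
proof induction
  case (monom c' a' b')
  have "(\<lambda>z. c' * z ^ a' * cnj z ^ b' * (c * z ^ a * cnj z ^ b)) = (\<lambda>z. (c' * c) * z ^ (a' + a) * cnj z ^ (b' + b))"
    by (simp add: power_add mult_ac)
  then show ?case using zpoly.monom by simp
next
  case (add f g)
  then show ?case using zpoly.add by (simp add: distrib_right)
qed

lemma zpoly_mult: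
  assumes "zpoly f" "zpoly g"
  shows "zpoly (\<lambda>z. f z * g z)"
  using assms(2)
proof induction
  case (monom c a b)
  then show ?case by (rule zpoly_mult_monom[OF assms(1)])
next
  case (add g h)
  then show ?case using zpoly.add by (simp add: distrib_left)
qed

lemma zpoly_const: "zpoly (\<lambda>z. c)"
  using zpoly.monom[of c 0 0] by simp

lemma zpoly_Re_Im: "zpoly (\<lambda>z. of_real (Re z))" "zpoly (\<lambda>z. of_real (Im z))"
proof -
  have "(\<lambda>z. (1/2) * z ^ 1 * cnj z ^ 0 + (1/2) * z ^ 0 * cnj z ^ 1) = (\<lambda>z. complex_of_real (Re z))"
    "(\<lambda>z. (1/(2*\<i>)) * z ^ 1 * cnj z ^ 0 + (-1/(2*\<i>)) * z ^ 0 * cnj z ^ 1) = (\<lambda>z. complex_of_real (Im z))"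
    by (auto simp: complex_eq_iff)
  then show "zpoly (\<lambda>z. of_real (Re z))" "zpoly (\<lambda>z. of_real (Im z))"
    using zpoly.add[OF zpoly.monom[of "1/2" 1 0] zpoly.monom[of "1/2" 0 1]]
      zpoly.add[OF zpoly.monom[of "1/(2*\<i>)" 1 0] zpoly.monom[of "-1/(2*\<i>)" 0 1]] by (simp_all only:)
qed

lemma zpoly_real_polynomial:
  assumes "real_polynomial_function q"
  shows "zpoly (\<lambda>z. of_real (q z))"
  using assms
proof induction
  case (linear f)
  interpret bounded_linear f by fact
  have eq: "f z = Re z * f 1 + Im z * f \<i>" for z
  proof -
    have "z = Re z *\<^sub>R 1 + Im z *\<^sub>R \<i>" by (simp add: complex_eq_iff)
    then have "f z = f (Re z *\<^sub>R 1 + Im z *\<^sub>R \<i>)" by simp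
    then show ?thesis by (simp add: add scaleR)
  qed
  have "complex_of_real (f z) = of_real (Re z) * of_real (f 1) + of_real (Im z) * of_real (f \<i>)" for z
    by (subst eq[of z]) (simp only: of_real_add of_real_mult)
  then have "(\<lambda>z. complex_of_real (f z)) = (\<lambda>z. of_real (Re z) * of_real (f 1) + of_real (Im z) * of_real (f \<i>))"
    by (rule ext)
  moreover have "zpoly (\<lambda>z. of_real (Re z) * of_real (f 1) + of_real (Im z) * of_real (f \<i>))"
    by (rule zpoly.add[OF zpoly_mult[OF zpoly_Re_Im(1) zpoly_const] zpoly_mult[OF zpoly_Re_Im(2) zpoly_const]])
  ultimately show ?case by (simp only:)
next
  case (const c)
  then show ?case by (rule zpoly_const)
next
  case (add f g)
  then show ?case using zpoly.add[of "\<lambda>z. of_real (f z)" "\<lambda>z. of_real (g z)"] by simp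
next
  case (mult f g)
  then show ?case using zpoly_mult[of "\<lambda>z. of_real (f z)" "\<lambda>z. of_real (g z)"] by simp
qed

text \<open>The Stone-Weierstrass theorem, for the real and imaginary parts.\<close>

lemma zpoly_approx:
  assumes "continuous_on UNIV g" "e > 0"
  obtains q where "zpoly q" "\<And>z. z \<in> cball 0 1 \<Longrightarrow> cmod (g z - q z) < e"
proof -
  have c: "continuous_on (cball 0 1) (\<lambda>z. Re (g z))" "continuous_on (cball 0 1) (\<lambda>z. Im (g z))"
    by (intro continuous_intros continuous_on_subset[OF assms(1)] subset_UNIV)+
  obtain u where u: "real_polynomial_function u" "\<And>z. z \<in> cball 0 1 \<Longrightarrow> \<bar>Re (g z) - u z\<bar> < e / 2"
    using Stone_Weierstrass_real_polynomial_function[OF compact_cball c(1), of "e/2"] assms(2) by auto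
  obtain v where v: "real_polynomial_function v" "\<And>z. z \<in> cball 0 1 \<Longrightarrow> \<bar>Im (g z) - v z\<bar> < e / 2"
    using Stone_Weierstrass_real_polynomial_function[OF compact_cball c(2), of "e/2"] assms(2) by auto
  show ?thesis
  proof (rule that[of "\<lambda>z. of_real (u z) + \<i> * of_real (v z)"])
    show "zpoly (\<lambda>z. of_real (u z) + \<i> * of_real (v z))"
      by (rule zpoly.add[OF zpoly_real_polynomial[OF u(1)] zpoly_mult[OF zpoly_const zpoly_real_polynomial[OF v(1)]]])
    fix z :: complex assume "z \<in> cball 0 1"
    then have "\<bar>Re (g z) - u z\<bar> < e / 2" "\<bar>Im (g z) - v z\<bar> < e / 2" using u v by auto
    then show "cmod (g z - (of_real (u z) + \<i> * of_real (v z))) < e"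
      using cmod_le[of "g z - (of_real (u z) + \<i> * of_real (v z))"] by simp
  qed
qed

lemma zpoly_continuous: "zpoly q \<Longrightarrow> continuous_on S q"
  by (induction rule: zpoly.induct) (auto intro!: continuous_intros)

text \<open>A pair \<open>(v, w)\<close> with \<open>w = dbar v\<close> classically, in a form suited to composition: the derivative of
  \<open>v\<close> is \<open>h \<mapsto> A h + w cnj h\<close>.\<close>

definition classical_dbar :: "(complex \<Rightarrow> complex) \<Rightarrow> (complex \<Rightarrow> complex) \<Rightarrow> bool" where
  "classical_dbar v w \<longleftrightarrow> (\<exists>A. continuous_on disc A \<and> continuous_on disc w \<and>
     (\<forall>z\<in>disc. (v has_derivative (\<lambda>h. A z * h + w z * cnj h)) (at z)))"

lemma classical_dbar_weak:
  assumes "classical_dbar v w"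
  shows "continuous_on disc v" "weak_dbar v w"
proof -
  obtain A where A: "continuous_on disc A" "continuous_on disc w"
    "\<And>z. z \<in> disc \<Longrightarrow> (v has_derivative (\<lambda>h. A z * h + w z * cnj h)) (at z)"
    using assms by (auto simp: classical_dbar_def)
  have p: "partial e v z = A z * e + w z * cnj e" if "z \<in> disc" for e z
    by (rule partial_eq[OF A(3)[OF that]])
  have "continuous_on disc (partial e v)" for e
    by (subst continuous_on_cong[OF refl p]) (auto intro!: continuous_intros A)
  then have C1: "C1_disc v"
    using A(3) unfolding C1_disc_def differentiable_def by blast
  then show "continuous_on disc v" by (rule C1_disc_continuous)
  have d: "dbar v z = w z" if "z \<in> disc" for z
    unfolding dbar_def p[OF that] by (simp add: field_simps)
  have eq: "(LINT z|LD. dbar v z * \<psi> z) = (LINT z|LD. w z * \<psi> z)" for \<psi>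
    by (intro Bochner_Integration.integral_cong refl) (simp add: d)
  show "weak_dbar v w"
    using weak_dbar_C1[OF C1] unfolding weak_dbar_def eq .
qed

lemma classical_dbar_add:
  assumes "classical_dbar v w" "classical_dbar v' w'"
  shows "classical_dbar (\<lambda>z. v z + v' z) (\<lambda>z. w z + w' z)"
proof -
  obtain A where A: "continuous_on disc A" "continuous_on disc w"
    "\<And>z. z \<in> disc \<Longrightarrow> (v has_derivative (\<lambda>h. A z * h + w z * cnj h)) (at z)"
    using assms by (auto simp: classical_dbar_def)
  obtain A' where A': "continuous_on disc A'" "continuous_on disc w'"
    "\<And>z. z \<in> disc \<Longrightarrow> (v' has_derivative (\<lambda>h. A' z * h + w' z * cnj h)) (at z)"
    using assms by (auto simp: classical_dbar_def)
  show ?thesis unfolding classical_dbar_def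
  proof (intro exI[of _ "\<lambda>z. A z + A' z"] conjI ballI)
    fix z :: complex assume z: "z \<in> disc"
    show "((\<lambda>z. v z + v' z) has_derivative (\<lambda>h. (A z + A' z) * h + (w z + w' z) * cnj h)) (at z)"
      by (rule has_derivative_eq_rhs[OF has_derivative_add[OF A(3)[OF z] A'(3)[OF z]]]) (simp add: algebra_simps)
  qed (intro continuous_intros A A')+
qed

lemma classical_dbar_holomorphic:
  assumes "G holomorphic_on disc"
  shows "classical_dbar G (\<lambda>_. 0)"
  unfolding classical_dbar_def
proof (intro exI[of _ "deriv G"] conjI ballI)
  show "continuous_on disc (deriv G)"
    by (intro holomorphic_on_imp_continuous_on holomorphic_deriv assms) auto
  fix z :: complex assume "z \<in> disc"
  then have "(G has_field_derivative deriv G z) (at z)"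
    using assms by (intro holomorphic_derivI) auto
  then show "(G has_derivative (\<lambda>h. deriv G z * h + 0 * cnj h)) (at z)"
    by (simp add: has_field_derivative_def)
qed auto

lemma classical_dbar_compose:
  assumes "classical_dbar v w" and \<phi>: "\<phi> holomorphic_on disc" "\<phi> ` disc \<subseteq> disc"
  shows "classical_dbar (\<lambda>z. v (\<phi> z)) (\<lambda>z. w (\<phi> z) * cnj (deriv \<phi> z))"
proof -
  obtain A where A: "continuous_on disc A" "continuous_on disc w"
    "\<And>z. z \<in> disc \<Longrightarrow> (v has_derivative (\<lambda>h. A z * h + w z * cnj h)) (at z)"
    using assms by (auto simp: classical_dbar_def)
  have c: "continuous_on disc \<phi>" "continuous_on disc (deriv \<phi>)"
    by (intro holomorphic_on_imp_continuous_on holomorphic_deriv \<phi>; simp)+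
  show ?thesis unfolding classical_dbar_def
  proof (intro exI[of _ "\<lambda>z. A (\<phi> z) * deriv \<phi> z"] conjI ballI)
    fix z :: complex assume z: "z \<in> disc"
    then have "(\<phi> has_derivative (\<lambda>h. deriv \<phi> z * h)) (at z)"
      using holomorphic_derivI[OF \<phi>(1) open_ball z] by (simp add: has_field_derivative_def)
    moreover have "(v has_derivative (\<lambda>h. A (\<phi> z) * h + w (\<phi> z) * cnj h)) (at (\<phi> z))"
      using A(3) \<phi>(2) z by blast
    ultimately have "((\<lambda>z. v (\<phi> z)) has_derivative (\<lambda>h. A (\<phi> z) * (deriv \<phi> z * h) + w (\<phi> z) * cnj (deriv \<phi> z * h))) (at z)"
      by (rule has_derivative_compose)
    then show "((\<lambda>z. v (\<phi> z)) has_derivative (\<lambda>h. A (\<phi> z) * deriv \<phi> z * h + w (\<phi> z) * cnj (deriv \<phi> z) * cnj h)) (at z)"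
      by (simp add: mult.assoc)
  qed (intro continuous_intros continuous_on_compose2[OF A(1)] continuous_on_compose2[OF A(2)] c \<phi>(2))+
qed

lemma zpoly_primitive: "zpoly q \<Longrightarrow> \<exists>Q. classical_dbar Q q \<and> continuous_on UNIV Q"
proof (induction rule: zpoly.induct)
  case (monom c a b)
  let ?Q = "\<lambda>z. (c / of_nat (Suc b)) * (z ^ a * cnj z ^ Suc b)"
  have "(?Q has_derivative (\<lambda>h. (c / of_nat (Suc b)) * (of_nat a * z ^ (a - 1) * cnj z ^ Suc b) * h + c * z ^ a * cnj z ^ b * cnj h)) (at z)" for z
  proof -
    have 1: "((\<lambda>z. z ^ a) has_derivative (\<lambda>h. of_nat a * z ^ (a - 1) * h)) (at z)"
    proof -
      have "((\<lambda>z. z ^ a) has_field_derivative of_nat a * z ^ (a - 1)) (at z)"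
        by (auto intro!: derivative_eq_intros)
      then show ?thesis by (simp add: has_field_derivative_def)
    qed
    have 2: "((\<lambda>z. cnj z ^ Suc b) has_derivative (\<lambda>h. of_nat (Suc b) * cnj z ^ b * cnj h)) (at z)"
    proof -
      have "((\<lambda>w. w ^ Suc b) has_derivative (\<lambda>h. of_nat (Suc b) * cnj z ^ b * h)) (at (cnj z))"
      proof -
        have "((\<lambda>w. w ^ Suc b) has_field_derivative of_nat (Suc b) * cnj z ^ b) (at (cnj z))"
          by (rule derivative_eq_intros refl)+ simp
        then show ?thesis by (simp only: has_field_derivative_def)
      qed
      from has_derivative_compose[OF bounded_linear_imp_has_derivative[OF bounded_linear_cnj] this] show ?thesis .
    qed
    have nz: "of_nat (Suc b) \<noteq> (0 :: complex)" by (simp del: of_nat_Suc)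
    have "(\<lambda>h. (c / of_nat (Suc b)) * (z ^ a * (of_nat (Suc b) * cnj z ^ b * cnj h) + of_nat a * z ^ (a - 1) * h * cnj z ^ Suc b)) =
       (\<lambda>h. (c / of_nat (Suc b)) * (of_nat a * z ^ (a - 1) * cnj z ^ Suc b) * h + c * z ^ a * cnj z ^ b * cnj h)"
      using nz by (simp add: fun_eq_iff field_simps del: of_nat_Suc)
    then show ?thesis
      using has_derivative_mult_right[OF has_derivative_mult[OF 1 2], of "c / of_nat (Suc b)"] by simp
  qed
  then have "classical_dbar ?Q (\<lambda>z. c * z ^ a * cnj z ^ b)"
    unfolding classical_dbar_def
    by (intro exI[of _ "\<lambda>z. (c / of_nat (Suc b)) * (of_nat a * z ^ (a - 1) * cnj z ^ Suc b)"] conjI ballI)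
       (auto intro!: continuous_intros simp del: of_nat_Suc)
  moreover have "continuous_on UNIV ?Q" by (intro continuous_intros) (simp del: of_nat_Suc)
  ultimately show ?case by blast
next
  case (add f g)
  then show ?case using classical_dbar_add continuous_on_add by blast
qed

lemma bounded_hardy:
  assumes "h \<in> borel_measurable LD" "B \<ge> 0" "\<And>z. z \<in> disc \<Longrightarrow> cmod (h z) \<le> B"
  shows "hardy_sup 2 h \<le> ennreal (B powr 2)"
  by (rule hardy_sup_bounded) (use assms in auto)

lemma bounded_admissible:
  assumes "h \<in> borel_measurable LD" "B \<ge> 0" "\<And>z. z \<in> disc \<Longrightarrow> cmod (h z) \<le> B"
  shows "admissible h (near_const 2 (B powr 2) * 3 powr (1 - 1 / 2))"
  by (rule admissible_hardy[OF assms(1) _ bounded_hardy[OF assms]]) auto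

lemma bounded_T_continuous:
  assumes "h \<in> borel_measurable LD" "B \<ge> 0" "\<And>z. z \<in> disc \<Longrightarrow> cmod (h z) \<le> B" "l \<ge> 0"
  shows "continuous_on (cball 0 1) (T l h)"
  by (rule T_continuous[OF assms(1) _ bounded_hardy[OF assms(1-3)] _ assms(4)]) auto

lemma weak_dbar_cong:
  assumes "weak_dbar u v" "\<And>z. z \<in> disc \<Longrightarrow> u z = u' z" "\<And>z. z \<in> disc \<Longrightarrow> v z = v' z"
  shows "weak_dbar u' v'"
proof -
  have "(LINT z|LD. u' z * dbar \<psi> z) = (LINT z|LD. u z * dbar \<psi> z)" "(LINT z|LD. v' z * \<psi> z) = (LINT z|LD. v z * \<psi> z)" for \<psi>
    using assms(2,3) by (auto intro!: Bochner_Integration.integral_cong)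
  then show ?thesis using assms(1) by (simp add: weak_dbar_def)
qed

lemma weak_dbar_cong_AE:
  assumes "weak_dbar u v" "AE z in LD. u z = u' z" "AE z in LD. v z = v' z"
    and [measurable]: "u \<in> borel_measurable LD" "u' \<in> borel_measurable LD" "v \<in> borel_measurable LD" "v' \<in> borel_measurable LD"
  shows "weak_dbar u' v'"
  unfolding weak_dbar_def
proof
  fix \<psi> assume \<psi>: "\<psi> \<in> test_functions"
  note [measurable] = test_function_measurable[OF \<psi>]
  have "(LINT z|LD. u' z * dbar \<psi> z) = (LINT z|LD. u z * dbar \<psi> z)"
    by (rule Bochner_Integration.integral_cong_AE) (measurable, use assms(2) in \<open>eventually_elim, simp\<close>)
  moreover have "(LINT z|LD. v' z * \<psi> z) = (LINT z|LD. v z * \<psi> z)"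
    by (rule Bochner_Integration.integral_cong_AE) (measurable, use assms(3) in \<open>eventually_elim, simp\<close>)
  ultimately show "(LINT z|LD. u' z * dbar \<psi> z) = - (LINT z|LD. v' z * \<psi> z)"
    using weak_dbarD[OF assms(1) \<psi>] by simp
qed

lemma weak_dbar_add_holomorphic:
  assumes u: "continuous_on disc u" "weak_dbar u v" and G: "G holomorphic_on disc"
  shows "weak_dbar (\<lambda>z. G z + u z) v"
  unfolding weak_dbar_def
proof
  fix \<psi> assume \<psi>: "\<psi> \<in> test_functions"
  have "integrable LD (\<lambda>z. G z * dbar \<psi> z)" "integrable LD (\<lambda>z. u z * dbar \<psi> z)"
    by (intro C1c_integrable(3) test_functions_C1c \<psi> holomorphic_on_imp_continuous_on G u)+
  moreover have "(LINT z|LD. G z * dbar \<psi> z) = 0"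
    using weak_dbarD[OF classical_dbar_weak(2)[OF classical_dbar_holomorphic[OF G]] \<psi>] by simp
  ultimately show "(LINT z|LD. (G z + u z) * dbar \<psi> z) = - (LINT z|LD. v z * \<psi> z)"
    using weak_dbarD[OF u(2) \<psi>] by (simp add: distrib_right)
qed

lemma T_integrable:
  assumes "admissible h C" "l \<ge> 0"
  shows "integrable LD (T l h)"
proof (rule integrable_LD_bounded)
  show "T l h \<in> borel_measurable LD" using assms by (intro T_measurable) (simp add: admissible_def)
  show "cmod (T l h z) \<le> exp (2 * l) * C" if "z \<in> disc" for z
    using T_bound[OF assms, of z] that by simp
qed

text \<open>The Cauchy transform solves the inhomogeneous equation up to a holomorphic function.\<close>

lemma weak_dbar_representation:
  assumes u: "integrable LD u" "weak_dbar u h" and h: "admissible h C" and l: "l \<ge> 0"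
  obtains G where "G holomorphic_on disc" "AE z in LD. u z = G z + T l h z"
proof -
  have Ti: "integrable LD (T l h)" by (rule T_integrable[OF h l])
  have Fi: "integrable LD (\<lambda>z. u z - T l h z)" using u(1) Ti by simp
  have key: "(LINT z|LD. (u z - T l h z) * dbar \<psi> z) = 0" if \<psi>: "\<psi> \<in> test_functions" for \<psi>
    using weak_dbarD[OF u(2) \<psi>] weak_dbarD[OF weak_dbar_T[OF h l] \<psi>]
      integrable_times_test(2)[OF u(1) \<psi>] integrable_times_test(2)[OF Ti \<psi>]
    by (simp add: left_diff_distrib)
  obtain G where G: "G holomorphic_on disc" "AE z in LD. u z - T l h z = G z"
    by (rule Weyl[OF Fi key], assumption, rule that)
  from G(2) have "AE z in LD. u z = G z + T l h z" by eventually_elim (simp add: diff_eq_eq)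
  with G(1) show ?thesis by (rule that)
qed

text \<open>For polynomial \<open>q\<close> the transform differs from a polynomial primitive by a holomorphic function, and
  both can be composed with \<open>\<phi>\<close> by the classical chain rule.\<close>

lemma chain_zpoly:
  assumes q: "zpoly q" and \<phi>: "\<phi> holomorphic_on disc" "\<phi> ` disc \<subseteq> disc" and l: "l \<ge> 0"
  shows "weak_dbar (\<lambda>z. T l q (\<phi> z)) (\<lambda>z. q (\<phi> z) * cnj (deriv \<phi> z))"
proof -
  obtain Q where Q: "classical_dbar Q q" "continuous_on UNIV Q" using zpoly_primitive[OF q] by blast
  have bdd: "\<exists>B\<ge>0. \<forall>z\<in>disc. cmod (f z) \<le> B" if "continuous_on UNIV f" for f :: "complex \<Rightarrow> complex"
  proof -
    have "compact (f ` cball 0 1)"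
      by (intro compact_continuous_image continuous_on_subset[OF that]) auto
    then obtain B where "B > 0" "\<And>x. x \<in> f ` cball 0 1 \<Longrightarrow> norm x \<le> B"
      using compact_imp_bounded bounded_pos by metis
    then show ?thesis by (intro exI[of _ B]) auto
  qed
  have qm: "q \<in> borel_measurable LD" "Q \<in> borel_measurable LD"
    using zpoly_continuous[OF q] continuous_on_subset[OF Q(2)] by (auto intro!: continuous_imp_measurable_LD)
  obtain B where B: "B \<ge> 0" "\<And>z. z \<in> disc \<Longrightarrow> cmod (q z) \<le> B"
    using bdd[OF zpoly_continuous[OF q]] by blast
  obtain B' where B': "B' \<ge> 0" "\<And>z. z \<in> disc \<Longrightarrow> cmod (Q z) \<le> B'"
    using bdd[OF Q(2)] by blast
  have "integrable LD Q" using B' qm by (intro integrable_LD_bounded)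
  then obtain G where G: "G holomorphic_on disc" "AE z in LD. Q z = G z + T l q z"
    using weak_dbar_representation[OF _ classical_dbar_weak(2)[OF Q(1)] bounded_admissible[OF qm(1) B] l] by blast
  have Tc: "continuous_on disc (T l q)"
    by (rule continuous_on_subset[OF bounded_T_continuous[OF qm(1) B l]]) auto
  have eq: "Q z = G z + T l q z" if "z \<in> disc" for z
    by (rule AE_LD_continuous_imp[OF _ _ G(2) that])
       (intro continuous_on_subset[OF Q(2)] continuous_intros Tc holomorphic_on_imp_continuous_on[OF G(1)] subset_UNIV)+
  have "classical_dbar (\<lambda>z. Q z + - G z) (\<lambda>z. q z + 0)"
    by (intro classical_dbar_add Q(1) classical_dbar_holomorphic holomorphic_intros G(1))
  from classical_dbar_weak(2)[OF classical_dbar_compose[OF this \<phi>]] show ?thesis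
  proof (rule weak_dbar_cong)
    fix z :: complex assume "z \<in> disc"
    then have "\<phi> z \<in> disc" using \<phi>(2) by blast
    then show "Q (\<phi> z) + - G (\<phi> z) = T l q (\<phi> z)" using eq by simp
  qed simp
qed

text \<open>A nonconstant holomorphic map pulls null sets back to null sets: it is a local diffeomorphism off the
  countable zero set of its derivative.\<close>

lemma AE_LD_compose:
  assumes \<phi>: "\<phi> holomorphic_on disc" "\<phi> ` disc \<subseteq> disc" and nc: "\<not> \<phi> constant_on disc" and P: "AE z in LD. P z"
  shows "AE z in LD. P (\<phi> z)"
proof -
  let ?N = "{z. \<not> (z \<in> disc \<longrightarrow> P z)}"
  have "AE z in lebesgue. z \<in> disc \<longrightarrow> P z"
    using P by (subst (asm) AE_restrict_space_iff) auto
  then have N: "negligible ?N"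
    by (subst (asm) completion.AE_iff_null_sets) (simp add: negligible_iff_null_sets)
  let ?S = "{z \<in> disc. deriv \<phi> z \<noteq> 0}"
  have "negligible {z \<in> ?S. \<phi> z \<in> ?N}"
  proof (rule negligible_differentiable_vimage[OF N])
    fix z assume z: "z \<in> ?S"
    show "inj ((*) (deriv \<phi> z))" using z by (auto simp: inj_on_def)
    show "(\<phi> has_derivative (*) (deriv \<phi> z)) (at z within ?S)"
      using holomorphic_derivI[OF \<phi>(1) open_ball, of z] z by (auto simp: has_field_derivative_def intro: has_derivative_at_withinI)
  qed
  moreover have "countable {z \<in> disc. deriv \<phi> z = 0}"
  proof (cases "deriv \<phi> constant_on disc")
    case True
    then obtain c where c: "\<And>z. z \<in> disc \<Longrightarrow> deriv \<phi> z = c" by (auto simp: constant_on_def)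
    have "c \<noteq> 0"
    proof
      assume "c = 0"
      then have "\<exists>d. \<forall>z\<in>disc. \<phi> z = d"
        using c holomorphic_derivI[OF \<phi>(1) open_ball]
        by (intro has_field_derivative_zero_constant) (auto intro: has_field_derivative_at_within simp: convex_ball)
      then show False using nc by (auto simp: constant_on_def)
    qed
    then have "{z \<in> disc. deriv \<phi> z = 0} = {}" using c by auto
    then show ?thesis by (metis countable_empty)
  next
    case False
    moreover have "fsigma disc"
    proof -
      obtain F :: "nat \<Rightarrow> complex set" where "\<And>n. compact (F n)" "\<And>n. F n \<subseteq> disc" "\<And>n. F n \<subseteq> interior (F (Suc n))" "\<Union> (range F) = disc"
        using open_Union_compact_subsets[OF open_ball[of "0::complex" 1]] by metis
      then show ?thesis unfolding fsigma_Union_compact by (intro exI[of _ F]) auto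
    qed
    ultimately show ?thesis
      by (intro holomorphic_countable_zeros holomorphic_deriv \<phi>) auto
  qed
  then have "negligible {z \<in> disc. deriv \<phi> z = 0}" by (simp add: negligible_iff_null_sets null_sets_completionI countable_imp_null_set_lborel)
  ultimately have neg: "negligible ({z \<in> ?S. \<phi> z \<in> ?N} \<union> {z \<in> disc. deriv \<phi> z = 0})" by (rule negligible_Un)
  have "AE z in lebesgue. z \<notin> {z \<in> ?S. \<phi> z \<in> ?N} \<union> {z \<in> disc. deriv \<phi> z = 0}"
    using neg unfolding negligible_iff_null_sets by (rule AE_not_in)
  moreover have "\<phi> z \<in> disc" if "z \<in> disc" for z using \<phi>(2) that by blast
  ultimately have "AE z in lebesgue. z \<in> disc \<longrightarrow> P (\<phi> z)"
    by (elim eventually_mono) auto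
  then show ?thesis by (subst AE_restrict_space_iff) auto
qed

text \<open>Polynomials converge boundedly and almost everywhere to \<open>h\<close>. As \<open>\<phi>\<close> pulls null sets back to null sets,
  they do so along \<open>\<phi>\<close> as well, and the weak identity passes to the limit.\<close>

lemma chain_bounded:
  assumes h: "h \<in> borel_measurable LD" "\<And>z. z \<in> disc \<Longrightarrow> cmod (h z) \<le> B" "B \<ge> 0"
    and \<phi>: "\<phi> holomorphic_on disc" "\<phi> ` disc \<subseteq> disc" "\<not> \<phi> constant_on disc"
    and hm: "(\<lambda>z. h (\<phi> z)) \<in> borel_measurable LD" and l: "l \<ge> 0"
  shows "weak_dbar (\<lambda>z. T l h (\<phi> z)) (\<lambda>z. h (\<phi> z) * cnj (deriv \<phi> z))"
  unfolding weak_dbar_def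
proof
  fix \<psi> assume \<psi>: "\<psi> \<in> test_functions"
  note [measurable] = test_function_measurable[OF \<psi>] hm
  obtain g where g: "\<And>n. continuous_on UNIV (g n)" "\<And>n z. cmod (g n z) \<le> B" "AE z in LD. (\<lambda>n. g n z) \<longlonglongrightarrow> h z"
    using AE_LD_limit_of_continuous[OF h(1) h(2) h(3)] by blast
  have "\<exists>q. zpoly q \<and> (\<forall>z\<in>cball 0 1. cmod (g n z - q z) < 1 / real (Suc n))" for n
    using zpoly_approx[OF g(1)[of n], of "1 / real (Suc n)"] by (metis of_nat_0_less_iff zero_less_Suc zero_less_divide_1_iff)
  then obtain q where q: "\<And>n. zpoly (q n)" "\<And>n z. z \<in> cball 0 1 \<Longrightarrow> cmod (g n z - q n z) < 1 / real (Suc n)"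
    by metis
  have qB: "cmod (q n z) \<le> B + 1" if "z \<in> disc" for n z
  proof -
    have "cmod (g n z - q n z) \<le> 1" using q(2)[of z n] that by (smt (verit) divide_le_eq_1 mem_ball mem_cball of_nat_0_less_iff of_nat_1 of_nat_le_iff zero_less_Suc Suc_leI One_nat_def)
    then show ?thesis using g(2)[of n z] norm_triangle_sub[of "q n z" "g n z"] by (simp add: norm_minus_commute)
  qed
  have lim: "AE z in LD. (\<lambda>n. q n z) \<longlonglongrightarrow> h z"
    using g(3) AE_space[of LD]
  proof eventually_elim
    fix z assume a: "(\<lambda>n. g n z) \<longlonglongrightarrow> h z" "z \<in> space LD"
    have "(\<lambda>n. g n z - q n z) \<longlonglongrightarrow> 0"
    proof (rule Lim_null_comparison)
      show "\<forall>\<^sub>F n in sequentially. norm (g n z - q n z) \<le> 1 / real (Suc n)"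
        using q(2)[of z] a(2) by (intro always_eventually allI less_imp_le) auto
      show "(\<lambda>n. 1 / real (Suc n)) \<longlonglongrightarrow> 0" by real_asymp
    qed
    from tendsto_diff[OF a(1) this] show "(\<lambda>n. q n z) \<longlonglongrightarrow> h z" by simp
  qed
  have qm [measurable]: "q n \<in> borel_measurable LD" for n
    by (intro continuous_imp_measurable_LD zpoly_continuous q)
  have cm: "(\<lambda>_. of_real (B + 1) :: complex) \<in> borel_measurable LD" by simp
  have adm: "admissible (\<lambda>_. of_real (B + 1)) (near_const 2 ((B + 1) powr 2) * 3 powr (1 - 1 / 2))"
    by (rule bounded_admissible) (use h(3) in \<open>auto simp del: of_real_add\<close>)
  have le: "AE z in LD. cmod (q n z) \<le> cmod (of_real (B + 1))" for n
    using qB h(3) by (intro AE_I2) (auto simp del: of_real_add)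
  have Tlim: "(\<lambda>n. T l (q n) z) \<longlonglongrightarrow> T l h z" if "cmod z \<le> 1" for z
    by (rule T_dominated_convergence[OF qm h(1) adm lim le l that])
  have \<phi>d: "\<phi> z \<in> disc" if "z \<in> disc" for z using \<phi>(2) that by blast
  have \<phi>c: "continuous_on disc \<phi>" by (intro holomorphic_on_imp_continuous_on \<phi>)
  define C where "C = exp (2 * l) * (near_const 2 ((B + 1) powr 2) * 3 powr (1 - 1 / 2))"
  have TC: "cmod (T l (q n) z) \<le> C" if "z \<in> disc" for n z
    unfolding C_def by (rule T_bound[OF bounded_admissible[OF qm] l]) (use qB h(3) that in auto)
  have Tc: "continuous_on disc (\<lambda>z. T l f (\<phi> z))" if "f \<in> borel_measurable LD" "\<And>z. z \<in> disc \<Longrightarrow> cmod (f z) \<le> B + 1" for f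
    by (rule continuous_on_compose2[OF bounded_T_continuous[OF that(1) _ that(2) l] \<phi>c]) (use \<phi>d h(3) in \<open>force+\<close>)
  have hB: "cmod (h z) \<le> B + 1" if "z \<in> disc" for z using h(2)[OF that] by simp
  have [measurable]: "(\<lambda>z. T l (q n) (\<phi> z)) \<in> borel_measurable LD" "(\<lambda>z. T l h (\<phi> z)) \<in> borel_measurable LD" for n
    by (intro continuous_imp_measurable_LD Tc qm qB h hB; assumption)+
  have dc: "continuous_on disc (deriv \<phi>)"
    by (intro holomorphic_on_imp_continuous_on holomorphic_deriv \<phi>) auto
  have [measurable]: "(\<lambda>z. q n (\<phi> z)) \<in> borel_measurable LD" "deriv \<phi> \<in> borel_measurable LD" for n
    by (rule continuous_imp_measurable_LD[OF continuous_on_compose2[OF zpoly_continuous[OF q(1), of UNIV] \<phi>c subset_UNIV]]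
         continuous_imp_measurable_LD[OF dc])+
  have L: "(\<lambda>n. LINT z|LD. T l (q n) (\<phi> z) * dbar \<psi> z) \<longlonglongrightarrow> (LINT z|LD. T l h (\<phi> z) * dbar \<psi> z)"
  proof (rule integral_dominated_convergence[where w = "\<lambda>z. C * cmod (dbar \<psi> z)"])
    show "integrable LD (\<lambda>z. C * cmod (dbar \<psi> z))"
      using integrable_norm[OF C1c_integrable(1)[OF test_functions_C1c[OF \<psi>]]] by simp
    show "AE z in LD. (\<lambda>n. T l (q n) (\<phi> z) * dbar \<psi> z) \<longlonglongrightarrow> T l h (\<phi> z) * dbar \<psi> z"
      using \<phi>d by (intro AE_I2 tendsto_intros Tlim) (auto intro: less_imp_le)
    show "AE z in LD. norm (T l (q n) (\<phi> z) * dbar \<psi> z) \<le> C * cmod (dbar \<psi> z)" for n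
      using TC \<phi>d by (intro AE_I2) (auto simp: norm_mult intro!: mult_right_mono)
  qed measurable
  have lim\<phi>: "AE z in LD. (\<lambda>n. q n (\<phi> z)) \<longlonglongrightarrow> h (\<phi> z)"
    by (rule AE_LD_compose[OF \<phi> lim])
  have R: "(\<lambda>n. - (LINT z|LD. q n (\<phi> z) * cnj (deriv \<phi> z) * \<psi> z)) \<longlonglongrightarrow> - (LINT z|LD. h (\<phi> z) * cnj (deriv \<phi> z) * \<psi> z)"
  proof (intro tendsto_minus integral_dominated_convergence[where w = "\<lambda>z. (B + 1) * cmod (cnj (deriv \<phi> z) * \<psi> z)"])
    have "continuous_on disc (\<lambda>z. cnj (deriv \<phi> z))" by (intro continuous_intros dc)
    from integrable_norm[OF C1c_integrable(2)[OF test_functions_C1c[OF \<psi>] this]]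
    show "integrable LD (\<lambda>z. (B + 1) * cmod (cnj (deriv \<phi> z) * \<psi> z))" by simp
    show "AE z in LD. (\<lambda>n. q n (\<phi> z) * cnj (deriv \<phi> z) * \<psi> z) \<longlonglongrightarrow> h (\<phi> z) * cnj (deriv \<phi> z) * \<psi> z"
      using lim\<phi> by eventually_elim (intro tendsto_intros)
    show "AE z in LD. norm (q n (\<phi> z) * cnj (deriv \<phi> z) * \<psi> z) \<le> (B + 1) * cmod (cnj (deriv \<phi> z) * \<psi> z)" for n
      using qB \<phi>d by (intro AE_I2) (auto simp: norm_mult mult.assoc intro!: mult_right_mono)
  qed measurable
  have "(LINT z|LD. T l (q n) (\<phi> z) * dbar \<psi> z) = - (LINT z|LD. q n (\<phi> z) * cnj (deriv \<phi> z) * \<psi> z)" for n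
    by (rule weak_dbarD[OF chain_zpoly[OF q(1) \<phi>(1,2) l] \<psi>])
  with L R show "(LINT z|LD. T l h (\<phi> z) * dbar \<psi> z) = - (LINT z|LD. h (\<phi> z) * cnj (deriv \<phi> z) * \<psi> z)"
    using LIMSEQ_unique by force
qed

lemma riesz_mono:
  assumes "\<And>z. z \<in> disc \<Longrightarrow> cmod (h z) \<le> cmod (h' z)"
  shows "riesz h UNIV z \<le> riesz h' UNIV z"
  unfolding riesz_def
proof (rule nn_integral_mono)
  fix \<zeta> assume "\<zeta> \<in> space LD"
  then show "ennreal (cmod (h \<zeta>) / cmod (z - \<zeta>)) * indicator UNIV \<zeta> \<le> ennreal (cmod (h' \<zeta>) / cmod (z - \<zeta>)) * indicator UNIV \<zeta>"
    using assms[of \<zeta>] by (auto intro!: ennreal_leI divide_right_mono)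
qed

lemma admissible_mono:
  assumes "admissible h' C" "h \<in> borel_measurable LD" "\<And>z. z \<in> disc \<Longrightarrow> cmod (h z) \<le> cmod (h' z)"
  shows "admissible h C"
  using assms riesz_mono[OF assms(3)] unfolding admissible_def by (meson order_trans)

definition locally_bounded :: "(complex \<Rightarrow> complex) \<Rightarrow> bool" where
  "locally_bounded h \<longleftrightarrow> (\<forall>R. 0 < R \<and> R < 1 \<longrightarrow> (\<exists>B\<ge>0. \<forall>z\<in>cball 0 R. cmod (h z) \<le> B))"

text \<open>Truncations of \<open>h\<close> to discs of radius less than \<open>1\<close> are bounded. On the support of a fixed test function they
  eventually agree with \<open>h\<close> along \<open>\<phi>\<close>, because \<open>\<phi>\<close> maps that support into a smaller disc.\<close>

lemma chain_admissible:
  assumes h: "admissible h C" "locally_bounded h"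
    and \<phi>: "\<phi> holomorphic_on disc" "\<phi> ` disc \<subseteq> disc" "\<not> \<phi> constant_on disc"
    and hm: "(\<lambda>z. h (\<phi> z)) \<in> borel_measurable LD" and l: "l \<ge> 0"
    and Tc: "continuous_on disc (T l h)"
  shows "weak_dbar (\<lambda>z. T l h (\<phi> z)) (\<lambda>z. h (\<phi> z) * cnj (deriv \<phi> z))"
  unfolding weak_dbar_def
proof
  fix \<psi> assume \<psi>: "\<psi> \<in> test_functions"
  obtain B k where Bk: "B > 0" "\<And>z. z \<in> disc \<Longrightarrow> cmod (\<psi> z) \<le> B" "\<And>z. z \<in> disc \<Longrightarrow> cmod (dbar \<psi> z) \<le> B"
    "compact k" "k \<subseteq> disc" "\<And>z. z \<notin> k \<Longrightarrow> \<psi> z = 0" "\<And>z. z \<notin> k \<Longrightarrow> dbar \<psi> z = 0"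
    by (rule test_function_bounded[OF \<psi>], rule that)
  have hmeas: "h \<in> borel_measurable LD" using h(1) by (simp add: admissible_def)
  have \<phi>d: "\<phi> z \<in> disc" if "z \<in> disc" for z using \<phi>(2) that by blast
  have \<phi>c: "continuous_on disc \<phi>" by (intro holomorphic_on_imp_continuous_on \<phi>)
  have "compact (\<phi> ` k)" by (intro compact_continuous_image continuous_on_subset[OF \<phi>c] Bk)
  moreover have "\<phi> ` k \<subseteq> disc" using \<phi>d Bk(5) by blast
  ultimately obtain R where R: "0 < R" "R < 1" "\<phi> ` k \<subseteq> cball 0 R" by (rule compact_in_disc)
  define r where "r n = 1 - 1 / real (n + 2)" for n
  have r: "0 < r n" "r n < 1" for n by (auto simp: r_def field_simps)
  have rlim: "r \<longlonglongrightarrow> 1" unfolding r_def by real_asymp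
  define g where "g n z = (if z \<in> cball 0 (r n) then h z else 0)" for n z
  have gle: "cmod (g n z) \<le> cmod (h z)" for n z by (simp add: g_def)
  have gm: "g n \<in> borel_measurable LD" for n
  proof -
    note [measurable] = hmeas measurable_ident_LD
    have "(\<lambda>z. if cmod z \<le> r n then h z else 0) \<in> borel_measurable LD" by measurable
    then show ?thesis by (simp add: g_def[abs_def])
  qed
  have gm\<phi>: "(\<lambda>z. g n (\<phi> z)) \<in> borel_measurable LD" for n
  proof -
    have [measurable]: "\<phi> \<in> borel_measurable LD" by (rule continuous_imp_measurable_LD[OF \<phi>c])
    note [measurable] = hm
    have "(\<lambda>z. if cmod (\<phi> z) \<le> r n then h (\<phi> z) else 0) \<in> borel_measurable LD" by measurable
    then show ?thesis by (simp add: g_def)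
  qed
  have chain: "weak_dbar (\<lambda>z. T l (g n) (\<phi> z)) (\<lambda>z. g n (\<phi> z) * cnj (deriv \<phi> z))" for n
  proof -
    obtain B' where B': "B' \<ge> 0" "\<And>z. z \<in> cball 0 (r n) \<Longrightarrow> cmod (h z) \<le> B'"
      using h(2) r[of n] unfolding locally_bounded_def by blast
    show ?thesis
      by (rule chain_bounded[OF gm _ B'(1) \<phi> gm\<phi> l]) (use B' in \<open>auto simp: g_def\<close>)
  qed
  have near1: "\<forall>\<^sub>F n in sequentially. R' < r n" if "R' < 1" for R'
    using order_tendstoD(1)[OF rlim that] .
  have "\<forall>\<^sub>F n in sequentially. g n z = h z" if "z \<in> disc" for z
  proof -
    have "cmod z < 1" using that by simp
    from near1[OF this] show ?thesis by eventually_elim (simp add: g_def)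
  qed
  then have glim: "AE z in LD. (\<lambda>n. g n z) \<longlonglongrightarrow> h z"
    by (intro AE_I2) (auto intro!: tendsto_eventually)
  have Tlim: "(\<lambda>n. T l (g n) z) \<longlonglongrightarrow> T l h z" if "cmod z \<le> 1" for z
    by (rule T_dominated_convergence[OF gm hmeas h(1) glim AE_I2[OF gle] l that])
  note [measurable] = test_function_measurable[OF \<psi>]
  have [measurable]: "(\<lambda>z. T l h (\<phi> z)) \<in> borel_measurable LD"
    by (rule continuous_imp_measurable_LD[OF continuous_on_compose2[OF Tc \<phi>c \<phi>(2)]])
  have [measurable]: "(\<lambda>z. T l (g n) (\<phi> z)) \<in> borel_measurable LD" for n
  proof -
    obtain B' where B': "B' \<ge> 0" "\<And>z. z \<in> cball 0 (r n) \<Longrightarrow> cmod (h z) \<le> B'"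
      using h(2) r[of n] unfolding locally_bounded_def by blast
    have "continuous_on disc (T l (g n))"
      by (rule continuous_on_subset[OF bounded_T_continuous[OF gm B'(1) _ l]]) (use B' in \<open>auto simp: g_def\<close>)
    from continuous_imp_measurable_LD[OF continuous_on_compose2[OF this \<phi>c \<phi>(2)]] show ?thesis .
  qed
  have L: "(\<lambda>n. LINT z|LD. T l (g n) (\<phi> z) * dbar \<psi> z) \<longlonglongrightarrow> (LINT z|LD. T l h (\<phi> z) * dbar \<psi> z)"
  proof (rule integral_dominated_convergence[where w = "\<lambda>z. (exp (2 * l) * C) * cmod (dbar \<psi> z)"])
    show "integrable LD (\<lambda>z. (exp (2 * l) * C) * cmod (dbar \<psi> z))"
      using integrable_norm[OF C1c_integrable(1)[OF test_functions_C1c[OF \<psi>]]] by simp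
    show "AE z in LD. (\<lambda>n. T l (g n) (\<phi> z) * dbar \<psi> z) \<longlonglongrightarrow> T l h (\<phi> z) * dbar \<psi> z"
      using \<phi>d by (intro AE_I2 tendsto_intros Tlim) (auto intro: less_imp_le)
    show "AE z in LD. norm (T l (g n) (\<phi> z) * dbar \<psi> z) \<le> (exp (2 * l) * C) * cmod (dbar \<psi> z)" for n
    proof (rule AE_I2)
      fix z assume "z \<in> space LD"
      then have "cmod (\<phi> z) \<le> 1" using \<phi>d[of z] by simp
      from T_bound[OF admissible_mono[OF h(1) gm gle] l this]
      show "norm (T l (g n) (\<phi> z) * dbar \<psi> z) \<le> (exp (2 * l) * C) * cmod (dbar \<psi> z)"
        unfolding norm_mult by (intro mult_right_mono) auto
    qed
  qed measurable
  have "\<forall>\<^sub>F n in sequentially. (LINT z|LD. T l (g n) (\<phi> z) * dbar \<psi> z) = - (LINT z|LD. h (\<phi> z) * cnj (deriv \<phi> z) * \<psi> z)"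
    using near1[OF R(2)]
  proof eventually_elim
    fix n assume n: "R < r n"
    have "g n (\<phi> z) * cnj (deriv \<phi> z) * \<psi> z = h (\<phi> z) * cnj (deriv \<phi> z) * \<psi> z" for z
    proof (cases "z \<in> k")
      case True
      then have "\<phi> z \<in> cball 0 R" using R(3) by blast
      then have "\<phi> z \<in> cball 0 (r n)" using n by simp
      then show ?thesis by (simp only: g_def if_True)
    qed (simp add: Bk)
    then show "(LINT z|LD. T l (g n) (\<phi> z) * dbar \<psi> z) = - (LINT z|LD. h (\<phi> z) * cnj (deriv \<phi> z) * \<psi> z)"
      using weak_dbarD[OF chain[of n] \<psi>] by (simp only:)
  qed
  then have "(\<lambda>n. LINT z|LD. T l (g n) (\<phi> z) * dbar \<psi> z) \<longlonglongrightarrow> - (LINT z|LD. h (\<phi> z) * cnj (deriv \<phi> z) * \<psi> z)"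
    by (rule tendsto_eventually)
  from LIMSEQ_unique[OF L this]
  show "(LINT z|LD. T l h (\<phi> z) * dbar \<psi> z) = - (LINT z|LD. h (\<phi> z) * cnj (deriv \<phi> z) * \<psi> z)" .
qed

text \<open>Constant maps are separate: they do not respect null sets, but the composition is then constant and \<open>deriv \<phi>\<close>
  vanishes.\<close>

theorem weak_chain_rule:
  assumes u: "\<And>z. z \<in> disc \<Longrightarrow> u z = G z + T l h z" and G: "G holomorphic_on disc"
    and h: "admissible h C" "locally_bounded h" and Tc: "continuous_on disc (T l h)" and l: "l \<ge> 0"
    and \<phi>: "\<phi> holomorphic_on disc" "\<phi> ` disc \<subseteq> disc"
    and hm: "(\<lambda>z. h (\<phi> z)) \<in> borel_measurable LD"
  shows "weak_dbar (\<lambda>z. u (\<phi> z)) (\<lambda>z. h (\<phi> z) * cnj (deriv \<phi> z))"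
proof (cases "\<phi> constant_on disc")
  case True
  then obtain c where c: "\<And>z. z \<in> disc \<Longrightarrow> \<phi> z = c" by (auto simp: constant_on_def)
  have d: "deriv \<phi> z = 0" if z: "z \<in> disc" for z
  proof -
    have "((\<lambda>_. c) has_field_derivative 0) (at z)" by simp
    then have "(\<phi> has_field_derivative 0) (at z)"
      by (rule has_field_derivative_transform_within_open[OF _ open_ball z]) (simp add: c)
    then show ?thesis by (rule DERIV_imp_deriv)
  qed
  have "weak_dbar (\<lambda>_. u c) (\<lambda>_. 0)"
    by (rule classical_dbar_weak(2)[OF classical_dbar_holomorphic]) simp
  then show ?thesis by (rule weak_dbar_cong) (auto simp: c d)
next
  case False
  have \<phi>c: "continuous_on disc \<phi>" by (intro holomorphic_on_imp_continuous_on \<phi>)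
  have "weak_dbar (\<lambda>z. T l h (\<phi> z)) (\<lambda>z. h (\<phi> z) * cnj (deriv \<phi> z))"
    by (rule chain_admissible[OF h \<phi> False hm l Tc])
  then have "weak_dbar (\<lambda>z. G (\<phi> z) + T l h (\<phi> z)) (\<lambda>z. h (\<phi> z) * cnj (deriv \<phi> z))"
  proof (rule weak_dbar_add_holomorphic[rotated])
    show "(\<lambda>z. G (\<phi> z)) holomorphic_on disc"
      using holomorphic_on_compose_gen[OF \<phi>(1) G \<phi>(2)] by (simp add: o_def)
    show "continuous_on disc (\<lambda>z. T l h (\<phi> z))" by (rule continuous_on_compose2[OF Tc \<phi>c \<phi>(2)])
  qed
  then show ?thesis
  proof (rule weak_dbar_cong)
    fix z :: complex assume "z \<in> disc"
    then have "\<phi> z \<in> disc" using \<phi>(2) by blast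
    then show "G (\<phi> z) + T l h (\<phi> z) = u (\<phi> z)" using u by simp
  qed simp
qed

section \<open>Coefficients\<close>

lemma Linf_bounded_representative:
  assumes "v \<in> Linf"
  obtains N B where "N \<in> borel_measurable borel" "B > 0" "\<And>z. cmod (N z) \<le> B" "AE z in LD. v z = N z"
proof -
  have m: "v \<in> borel_measurable LD" and fin: "Linf_norm v < \<infinity>" using assms by (auto simp: Linf_def)
  obtain v' where v': "v' \<in> borel_measurable borel" "AE z in LD. v z = v' z" using borel_representative[OF m] .
  obtain c where c: "c \<ge> 0" "Linf_norm v = ennreal c"
    using fin by (cases "Linf_norm v") auto
  define B where "B = c + 1"
  have B: "B > 0" using c by (simp add: B_def)
  have "AE z in LD. ennreal (cmod (v z)) \<le> Linf_norm v"
    unfolding Linf_norm_def by (rule esssup_AE)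
  then have le: "AE z in LD. cmod (v z) \<le> B"
    unfolding c(2) by eventually_elim (use c in \<open>simp add: ennreal_le_iff B_def\<close>)
  note [measurable] = v'(1)
  show ?thesis
  proof (rule that[of "\<lambda>z. if cmod (v' z) \<le> B then v' z else 0" B])
    show "AE z in LD. v z = (if cmod (v' z) \<le> B then v' z else 0)"
      using le v'(2) by eventually_elim auto
  qed (use B in auto)
qed

lemma bounded_imp_Linf:
  assumes "v \<in> borel_measurable LD" "AE z in LD. cmod (v z) \<le> B"
  shows "v \<in> Linf"
proof -
  have "Linf_norm v \<le> ennreal B"
    unfolding Linf_norm_def by (rule esssup_I) (use assms in \<open>auto elim!: eventually_mono intro: ennreal_leI\<close>)
  then show ?thesis using assms(1) by (auto simp: Linf_def intro: le_less_trans)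
qed

lemma Linf_integrable: "v \<in> Linf \<Longrightarrow> integrable LD v"
proof -
  assume v: "v \<in> Linf"
  obtain N B where N: "N \<in> borel_measurable borel" "B > 0" "\<And>z. cmod (N z) \<le> B" "AE z in LD. v z = N z"
    by (rule Linf_bounded_representative[OF v], rule that)
  have "AE z in LD. norm (v z) \<le> B" using N(4) by eventually_elim (simp add: N(3))
  then show ?thesis
    using v by (intro LD.integrable_const_bound) (auto simp: Linf_def)
qed

lemma weak_partial_imp_weak_dbar:
  assumes v: "v \<in> Linf" "w \<in> Linf" and u: "u \<in> Linf" and p: "weak_partial 1 u v" "weak_partial \<i> u w"
  shows "weak_dbar u (\<lambda>z. (v z + \<i> * w z) / 2)"
  unfolding weak_dbar_def
proof
  fix \<psi> assume \<psi>: "\<psi> \<in> test_functions"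
  note i = integrable_times_test(1)[OF Linf_integrable[OF v(1)] \<psi>] integrable_times_test(1)[OF Linf_integrable[OF v(2)] \<psi>]
  have bd: "integrable LD (\<lambda>z. u z * partial e \<psi> z)" if e: "e = 1 \<or> e = \<i>" for e
  proof -
    have c: "C1c \<psi>" by (rule test_functions_C1c[OF \<psi>])
    then obtain K where K: "compact K" "K \<subseteq> disc" "\<And>z. z \<notin> K \<Longrightarrow> \<psi> z = 0" by (auto simp: C1c_def)
    have p0: "partial e \<psi> z = 0" if "z \<notin> K" for z
      by (rule partial_eq, rule has_derivative_outside_support[OF compact_imp_closed[OF K(1)]]) (use K that in auto)
    have cp: "continuous_on disc (partial e \<psi>)" using c e by (auto simp: C1c_def intro: continuous_on_subset)
    obtain B where "\<And>z. z \<in> disc \<Longrightarrow> cmod (partial e \<psi> z) \<le> B"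
      using compact_support_bounded[OF cp K(1,2)] p0 by metis
    then show ?thesis
      by (intro integrable_times_bounded[OF Linf_integrable[OF u]] continuous_imp_measurable_LD[OF cp])
  qed
  have "(LINT z|LD. u z * dbar \<psi> z) = (LINT z|LD. (u z * partial 1 \<psi> z + \<i> * (u z * partial \<i> \<psi> z)) / 2)"
    by (intro Bochner_Integration.integral_cong refl) (simp add: dbar_def algebra_simps)
  also have "\<dots> = ((LINT z|LD. u z * partial 1 \<psi> z) + \<i> * (LINT z|LD. u z * partial \<i> \<psi> z)) / 2"
    using bd by simp
  also have "\<dots> = - (((LINT z|LD. v z * \<psi> z) + \<i> * (LINT z|LD. w z * \<psi> z)) / 2)"
    using p \<psi> unfolding weak_partial_def by (simp add: algebra_simps)
  also have "((LINT z|LD. v z * \<psi> z) + \<i> * (LINT z|LD. w z * \<psi> z)) / 2 = (LINT z|LD. (v z * \<psi> z + \<i> * (w z * \<psi> z)) / 2)"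
    using i by simp
  also have "\<dots> = (LINT z|LD. (v z + \<i> * w z) / 2 * \<psi> z)"
    by (intro Bochner_Integration.integral_cong refl) (simp add: algebra_simps)
  finally show "(LINT z|LD. u z * dbar \<psi> z) = - (LINT z|LD. (v z + \<i> * w z) / 2 * \<psi> z)" .
qed

section \<open>The contraction\<close>

definition wt :: "real \<Rightarrow> complex \<Rightarrow> real" where
  "wt l z = exp (l * (cmod z)\<^sup>2 / 2)"

lemma norm_K_weighted:
  "cmod (K l z \<zeta>) * wt l \<zeta> = wt l z * (exp (- (l * (cmod (z - \<zeta>))\<^sup>2 / 2)) / (pi * cmod (z - \<zeta>)))"
proof -
  have 1: "Re (of_real l * cnj \<zeta> * (z - \<zeta>)) + l * (cmod \<zeta>)\<^sup>2 / 2 = l * (cmod z)\<^sup>2 / 2 + (- (l * (cmod (z - \<zeta>))\<^sup>2 / 2))"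
    unfolding cmod_power2 by (simp add: power2_eq_square field_simps)
  have "cmod (exp (of_real l * cnj \<zeta> * (z - \<zeta>))) * wt l \<zeta> = exp (Re (of_real l * cnj \<zeta> * (z - \<zeta>)) + l * (cmod \<zeta>)\<^sup>2 / 2)"
    unfolding norm_exp_eq_Re wt_def exp_add ..
  also have "\<dots> = wt l z * exp (- (l * (cmod (z - \<zeta>))\<^sup>2 / 2))"
    unfolding 1 wt_def exp_add ..
  finally show ?thesis
    unfolding K_def by (simp add: norm_divide norm_mult)
qed

text \<open>At distance less than \<open>d\<close> the kernel \<open>1 / \<bar>w\<bar>\<close> has a small integral, and farther out the Gaussian
  factor is small.\<close>

lemma weighted_kernel_integral:
  assumes e: "e > 0"
  obtains l where "l > 0" "\<And>z. (\<integral>\<^sup>+\<zeta>. ennreal (exp (- (l * (cmod (z - \<zeta>))\<^sup>2 / 2)) / cmod (z - \<zeta>)) * indicator (ball z 2) \<zeta> \<partial>lborel) \<le> ennreal e"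
proof -
  define d where "d = min 2 (e / (4 * pi))"
  have d: "d > 0" "d \<le> 2" using e by (auto simp: d_def)
  define l where "l = 16 * pi / (e * d\<^sup>2)"
  have l: "l > 0" using e d by (simp add: l_def)
  let ?E = "exp (- (l * d\<^sup>2 / 2))"
  have "x * exp (- x) \<le> 1" for x :: real
  proof -
    have "x \<le> exp x" using exp_ge_add_one_self[of x] by linarith
    from mult_right_mono[OF this, of "exp (- x)"] show ?thesis by (simp add: exp_minus_inverse)
  qed
  from this[of "l * d\<^sup>2 / 2"] have "?E \<le> 1 / (l * d\<^sup>2 / 2)"
    using l d by (simp add: field_simps)
  also have "1 / (l * d\<^sup>2 / 2) = e / (8 * pi)" using e d by (simp add: l_def field_simps)
  finally have E: "?E \<le> e / (8 * pi)" .
  let ?k = "\<lambda>w. ennreal (exp (- (l * (cmod w)\<^sup>2 / 2)) / cmod w) * indicator (ball 0 2) w"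
  have b1: "(\<integral>\<^sup>+w. ennreal (cmod w powr (- 1)) * indicator (ball 0 r) w \<partial>lborel) \<le> ennreal (2 * pi * r)" if "r > 0" for r
    using nn_integral_norm_powr_ball[of 1 r] that by simp
  have "(\<integral>\<^sup>+w. ?k w \<partial>lborel) \<le> (\<integral>\<^sup>+w. ennreal (cmod w powr (- 1)) * indicator (ball 0 d) w + ennreal ?E * (ennreal (cmod w powr (- 1)) * indicator (ball 0 2) w) \<partial>lborel)"
  proof (rule nn_integral_mono)
    fix w :: complex
    show "?k w \<le> ennreal (cmod w powr (- 1)) * indicator (ball 0 d) w + ennreal ?E * (ennreal (cmod w powr (- 1)) * indicator (ball 0 2) w)"
    proof (cases "w = 0 \<or> cmod w \<ge> 2")
      case False
      then have pw: "cmod w powr (- 1) = 1 / cmod w" by (simp add: powr_minus_divide)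
      show ?thesis
      proof (cases "cmod w < d")
        case True
        have "exp (- (l * (cmod w)\<^sup>2 / 2)) / cmod w \<le> 1 / cmod w"
          using l by (intro divide_right_mono) auto
        then have "?k w \<le> ennreal (cmod w powr (- 1)) * indicator (ball 0 d) w"
          using True False by (auto simp: pw intro: ennreal_leI)
        then show ?thesis by (rule order_trans) simp
      next
        case far: False
        have "l * d\<^sup>2 / 2 \<le> l * (cmod w)\<^sup>2 / 2"
          using far d l by (intro divide_right_mono mult_left_mono power_mono) auto
        then have "exp (- (l * (cmod w)\<^sup>2 / 2)) / cmod w \<le> ?E * (1 / cmod w)"
          by (simp add: divide_right_mono)
        then have "?k w \<le> ennreal (?E * (1 / cmod w))" using False by (auto intro: ennreal_leI)
        also have "\<dots> = ennreal ?E * (ennreal (cmod w powr (- 1)) * indicator (ball 0 2) w)"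
          using False unfolding pw by (subst ennreal_mult) auto
        finally show ?thesis by (rule order_trans) simp
      qed
    qed auto
  qed
  also have "\<dots> = (\<integral>\<^sup>+w. ennreal (cmod w powr (- 1)) * indicator (ball 0 d) w \<partial>lborel) + ennreal ?E * (\<integral>\<^sup>+w. ennreal (cmod w powr (- 1)) * indicator (ball 0 2) w \<partial>lborel)"
    by (subst nn_integral_add) (auto simp: nn_integral_cmult)
  also have "\<dots> \<le> ennreal (2 * pi * d) + ennreal (e / (8 * pi)) * ennreal (2 * pi * 2)"
    using E d by (intro add_mono mult_mono b1 ennreal_leI) auto
  also have "\<dots> = ennreal (2 * pi * d + e / 2)"
    using e d by (simp add: ennreal_mult[symmetric] ennreal_plus[symmetric] del: ennreal_plus)
  also have "\<dots> \<le> ennreal e"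
  proof (rule ennreal_leI)
    have "2 * pi * d \<le> 2 * pi * (e / (4 * pi))" by (intro mult_left_mono) (auto simp: d_def)
    then show "2 * pi * d + e / 2 \<le> e" by simp
  qed
  finally have k: "(\<integral>\<^sup>+w. ?k w \<partial>lborel) \<le> ennreal e" .
  show ?thesis
  proof (rule that[OF l])
    fix z :: complex
    have "(\<integral>\<^sup>+\<zeta>. ennreal (exp (- (l * (cmod (z - \<zeta>))\<^sup>2 / 2)) / cmod (z - \<zeta>)) * indicator (ball z 2) \<zeta> \<partial>lborel) = (\<integral>\<^sup>+\<zeta>. ?k (z - \<zeta>) \<partial>lborel)"
      by (intro nn_integral_cong) (auto simp: indicator_def dist_norm norm_minus_commute)
    also have "\<dots> = (\<integral>\<^sup>+w. ?k w \<partial>lborel)" by (rule nn_integral_reflect) measurable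
    finally show "(\<integral>\<^sup>+\<zeta>. ennreal (exp (- (l * (cmod (z - \<zeta>))\<^sup>2 / 2)) / cmod (z - \<zeta>)) * indicator (ball z 2) \<zeta> \<partial>lborel) \<le> ennreal e"
      using k by simp
  qed
qed

text \<open>In the sup norm weighted by \<open>exp (- l \<bar>z\<bar>\<^sup>2 / 2)\<close> the kernel becomes
  \<open>exp (- l \<bar>z - \<zeta>\<bar>\<^sup>2 / 2) / (\<pi> \<bar>z - \<zeta>\<bar>)\<close>, whose integral tends to zero as \<open>l\<close> grows.\<close>

lemma T_weighted_small:
  assumes e: "e > 0"
  shows "\<exists>l>0. \<forall>g s z. g \<in> borel_measurable LD \<longrightarrow> s \<ge> 0 \<longrightarrow> (\<forall>\<zeta>\<in>disc. cmod (g \<zeta>) \<le> s * wt l \<zeta>) \<longrightarrow>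
     cmod z \<le> 1 \<longrightarrow> cmod (T l g z) \<le> e * s * wt l z"
proof -
  obtain l where l: "l > 0" "\<And>z. (\<integral>\<^sup>+\<zeta>. ennreal (exp (- (l * (cmod (z - \<zeta>))\<^sup>2 / 2)) / cmod (z - \<zeta>)) * indicator (ball z 2) \<zeta> \<partial>lborel) \<le> ennreal e"
    by (rule weighted_kernel_integral[OF e], rule that)
  show ?thesis
  proof (intro exI[of _ l] conjI allI impI l(1))
    fix g s z
    assume gm: "g \<in> borel_measurable LD" and s: "s \<ge> 0" and gs: "\<forall>\<zeta>\<in>disc. cmod (g \<zeta>) \<le> s * wt l \<zeta>" and z: "cmod z \<le> 1"
    have g: "g \<in> borel_measurable LD" "\<And>\<zeta>. \<zeta> \<in> disc \<Longrightarrow> cmod (g \<zeta>) \<le> s * wt l \<zeta>" using gm gs by blast+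
    let ?k = "\<lambda>\<zeta>. ennreal (exp (- (l * (cmod (z - \<zeta>))\<^sup>2 / 2)) / cmod (z - \<zeta>)) * indicator (ball z 2) \<zeta>"
    have wt: "wt l z > 0" by (simp add: wt_def)
    have gb: "cmod (g \<zeta>) \<le> s * exp l" if "\<zeta> \<in> disc" for \<zeta>
    proof -
      have "(cmod \<zeta>)\<^sup>2 \<le> 1" using that power_mono[of "cmod \<zeta>" 1 2] by simp
      then have "l * (cmod \<zeta>)\<^sup>2 / 2 \<le> l" using l(1) mult_left_mono[of "(cmod \<zeta>)\<^sup>2" 1 l] by simp
      then have "s * wt l \<zeta> \<le> s * exp l" using s by (intro mult_left_mono) (auto simp: wt_def)
      then show ?thesis using g(2)[OF that] by linarith
    qed
    have adm: "admissible g (near_const 2 ((s * exp l) powr 2) * 3 powr (1 - 1 / 2))"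
      by (rule bounded_admissible[OF g(1)]) (use gb s in auto)
    have "ennreal (cmod (T l g z)) \<le> (\<integral>\<^sup>+\<zeta>. ennreal (cmod (K l z \<zeta> * g \<zeta>)) \<partial>LD)"
      unfolding T_def by (rule integral_norm_bound_ennreal[OF admissible_integrable_K[OF adm less_imp_le[OF l(1)] z]])
    also have "\<dots> \<le> (\<integral>\<^sup>+\<zeta>. ennreal (s * wt l z) * ?k \<zeta> \<partial>LD)"
    proof (rule nn_integral_mono)
      fix \<zeta> assume "\<zeta> \<in> space LD"
      then have \<zeta>: "\<zeta> \<in> disc" by simp
      then have near: "\<zeta> \<in> ball z 2" using z norm_triangle_ineq4[of z \<zeta>] by (simp add: dist_norm)
      have "cmod (K l z \<zeta> * g \<zeta>) \<le> cmod (K l z \<zeta>) * (s * wt l \<zeta>)"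
        unfolding norm_mult by (intro mult_left_mono g \<zeta>) auto
      also have "\<dots> = s * (cmod (K l z \<zeta>) * wt l \<zeta>)" by simp
      also have "\<dots> = (s * wt l z) * (exp (- (l * (cmod (z - \<zeta>))\<^sup>2 / 2)) / (pi * cmod (z - \<zeta>)))"
        unfolding norm_K_weighted by simp
      also have "\<dots> \<le> (s * wt l z) * (exp (- (l * (cmod (z - \<zeta>))\<^sup>2 / 2)) / (1 * cmod (z - \<zeta>)))"
        using s wt pi_gt3 by (cases "z = \<zeta>") (auto intro!: mult_left_mono divide_left_mono mult_right_mono mult_pos_pos)
      finally have "ennreal (cmod (K l z \<zeta> * g \<zeta>)) \<le> ennreal ((s * wt l z) * (exp (- (l * (cmod (z - \<zeta>))\<^sup>2 / 2)) / cmod (z - \<zeta>)))"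
        by (intro ennreal_leI) simp
      also have "\<dots> = ennreal (s * wt l z) * ?k \<zeta>"
        using near s wt by (subst ennreal_mult) auto
      finally show "ennreal (cmod (K l z \<zeta> * g \<zeta>)) \<le> ennreal (s * wt l z) * ?k \<zeta>" .
    qed
    also have "\<dots> \<le> (\<integral>\<^sup>+\<zeta>. ennreal (s * wt l z) * ?k \<zeta> \<partial>lborel)"
      unfolding nn_integral_LD by (intro nn_integral_mono) (auto simp: indicator_def)
    also have "\<dots> = ennreal (s * wt l z) * (\<integral>\<^sup>+\<zeta>. ?k \<zeta> \<partial>lborel)"
      by (rule nn_integral_cmult) measurable
    also have "\<dots> \<le> ennreal (s * wt l z) * ennreal e" by (intro mult_left_mono l(2)) simp
    also have "\<dots> = ennreal (e * s * wt l z)" using s wt e by (simp add: ennreal_mult[symmetric] mult_ac)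
    finally show "cmod (T l g z) \<le> e * s * wt l z"
      using s wt e by (subst (asm) ennreal_le_iff) auto
  qed
qed

section \<open>The generalized Hardy space as a perturbation of the classical one\<close>

text \<open>The coefficient is continuous, and its weak derivative \<open>N\<close> is a Borel function bounded everywhere. The case
  \<open>\<nu> = 0\<close>, \<open>N = 0\<close> is the classical Hardy space.\<close>

locale beltrami =
  fixes p \<kappa> B :: real and \<nu> :: "complex \<Rightarrow> real" and N :: "complex \<Rightarrow> complex"
  assumes p: "p > 1" and kappa: "0 \<le> \<kappa>" "\<kappa> < 1"
    and nu_cont: "continuous_on disc \<nu>" and nu_le: "\<And>z. z \<in> disc \<Longrightarrow> \<bar>\<nu> z\<bar> \<le> \<kappa>"
    and N_meas: "N \<in> borel_measurable borel" and N_le: "\<And>z. cmod (N z) \<le> B" and B_pos: "B > 0"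
    and weak_nu: "weak_dbar (\<lambda>z. of_real (\<nu> z)) N"
begin

text \<open>As \<open>\<bar>\<nu>\<bar> \<le> \<kappa> < 1\<close>, the real linear map \<open>f \<mapsto> f - \<nu> cnj f\<close> is invertible at every point of the disc,
  with inverse \<open>untwist\<close>.\<close>

definition twist :: "(complex \<Rightarrow> complex) \<Rightarrow> complex \<Rightarrow> complex" where
  "twist f z = f z - of_real (\<nu> z) * cnj (f z)"

definition untwist :: "(complex \<Rightarrow> complex) \<Rightarrow> complex \<Rightarrow> complex" where
  "untwist g z = (g z + of_real (\<nu> z) * cnj (g z)) / of_real (1 - (\<nu> z)\<^sup>2)"

text \<open>The \<open>dbar\<close> derivative of \<open>twist f\<close> for a solution \<open>f\<close>.\<close>

definition source :: "(complex \<Rightarrow> complex) \<Rightarrow> complex \<Rightarrow> complex" where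
  "source f z = - N z * cnj (f z)"

lemma nu_sq: "z \<in> disc \<Longrightarrow> 1 - (\<nu> z)\<^sup>2 > 0"
  using nu_le[of z] kappa abs_square_less_1[of "\<nu> z"] by simp

lemma twist_untwist: "z \<in> disc \<Longrightarrow> twist (untwist g) z = g z"
proof -
  assume "z \<in> disc"
  then have d: "of_real (1 - (\<nu> z)\<^sup>2) \<noteq> (0::complex)" using nu_sq by (metis less_irrefl of_real_eq_0_iff)
  have c: "cnj (untwist g z) = (cnj (g z) + of_real (\<nu> z) * g z) / of_real (1 - (\<nu> z)\<^sup>2)"
    by (simp add: untwist_def)
  have "twist (untwist g) z = ((g z + of_real (\<nu> z) * cnj (g z)) - of_real (\<nu> z) * (cnj (g z) + of_real (\<nu> z) * g z)) / of_real (1 - (\<nu> z)\<^sup>2)"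
    unfolding twist_def c unfolding untwist_def by (simp add: diff_divide_distrib)
  also have "\<dots> = (g z * of_real (1 - (\<nu> z)\<^sup>2)) / of_real (1 - (\<nu> z)\<^sup>2)"
    by (simp add: algebra_simps power2_eq_square)
  finally show ?thesis using d by simp
qed

lemma untwist_unique: "z \<in> disc \<Longrightarrow> twist f z = g z \<Longrightarrow> f z = untwist g z"
proof -
  assume z: "z \<in> disc" and "twist f z = g z"
  then have g: "g z = f z - of_real (\<nu> z) * cnj (f z)" by (simp add: twist_def)
  have d: "of_real (1 - (\<nu> z)\<^sup>2) \<noteq> (0::complex)" using nu_sq[OF z] by (metis less_irrefl of_real_eq_0_iff)
  have "g z + of_real (\<nu> z) * cnj (g z) = f z * of_real (1 - (\<nu> z)\<^sup>2)"
    unfolding g by (simp add: algebra_simps power2_eq_square)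
  then show ?thesis using d by (simp add: untwist_def)
qed

lemma untwist_diff: "untwist (\<lambda>z. f z - g z) z = untwist f z - untwist g z"
  by (simp add: untwist_def diff_divide_distrib[symmetric] algebra_simps)

lemma norm_twist_le: "z \<in> disc \<Longrightarrow> cmod (twist f z) \<le> 2 * cmod (f z)"
proof -
  assume "z \<in> disc"
  then have "\<bar>\<nu> z\<bar> * cmod (f z) \<le> 1 * cmod (f z)" using nu_le[of z] kappa by (intro mult_right_mono) auto
  then show ?thesis
    using norm_triangle_ineq4[of "f z" "of_real (\<nu> z) * cnj (f z)"] by (simp add: twist_def norm_mult)
qed

lemma norm_untwist_le: "z \<in> disc \<Longrightarrow> cmod (untwist g z) \<le> cmod (g z) / (1 - \<kappa>)"
proof -
  assume z: "z \<in> disc"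
  let ?f = "untwist g"
  have "cmod (?f z) \<le> cmod (g z) + \<kappa> * cmod (?f z)"
  proof -
    have "?f z = g z + of_real (\<nu> z) * cnj (?f z)" using twist_untwist[OF z, of g] by (simp add: twist_def algebra_simps)
    then have "cmod (?f z) \<le> cmod (g z) + cmod (of_real (\<nu> z) * cnj (?f z))" by (metis norm_triangle_ineq)
    also have "cmod (of_real (\<nu> z) * cnj (?f z)) \<le> \<kappa> * cmod (?f z)"
      using nu_le[OF z] by (simp add: norm_mult mult_right_mono)
    finally show ?thesis by simp
  qed
  then have "(1 - \<kappa>) * cmod (?f z) \<le> cmod (g z)" by (simp add: algebra_simps)
  then show ?thesis using kappa by (simp add: field_simps)
qed

lemma nu_measurable [measurable]: "\<nu> \<in> borel_measurable LD"
  by (rule continuous_imp_measurable_LD[OF nu_cont])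

lemma N_measurable [measurable]: "N \<in> borel_measurable LD"
  by (rule borel_measurable_LD[OF N_meas])

lemma of_real_nu_measurable:
  "(\<lambda>z. complex_of_real (\<nu> z)) \<in> borel_measurable LD" "(\<lambda>z. complex_of_real (1 - (\<nu> z)\<^sup>2)) \<in> borel_measurable LD"
  by (intro continuous_imp_measurable_LD continuous_intros nu_cont)+

lemma twist_measurable [measurable]: "f \<in> borel_measurable LD \<Longrightarrow> twist f \<in> borel_measurable LD"
  unfolding twist_def[abs_def]
  by (intro borel_measurable_diff borel_measurable_times borel_measurable_cnj of_real_nu_measurable)

lemma untwist_measurable [measurable]: "f \<in> borel_measurable LD \<Longrightarrow> untwist f \<in> borel_measurable LD"
  unfolding untwist_def[abs_def]
  by (intro borel_measurable_divide borel_measurable_add borel_measurable_times borel_measurable_cnj of_real_nu_measurable)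

lemma source_measurable [measurable]: "f \<in> borel_measurable LD \<Longrightarrow> source f \<in> borel_measurable LD"
  unfolding source_def[abs_def] using nu_measurable N_measurable by measurable

lemma untwist_continuous:
  assumes "continuous_on disc g"
  shows "continuous_on disc (untwist g)"
  unfolding untwist_def[abs_def]
proof (intro continuous_intros assms nu_cont ballI)
  show "of_real (1 - (\<nu> z)\<^sup>2) \<noteq> (0::complex)" if "z \<in> disc" for z using nu_sq[OF that] by (metis less_irrefl of_real_eq_0_iff)
qed

lemma norm_source_le: "cmod (source f z) \<le> B * cmod (f z)"
  using N_le[of z] by (simp add: source_def norm_mult mult_right_mono)

lemma hardy_source:
  assumes "f \<in> borel_measurable LD" "hardy_sup p f \<le> ennreal M" "M \<ge> 0"
  shows "hardy_sup p (source f) \<le> ennreal (B powr p * M)"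
proof -
  have "hardy_sup p (source f) \<le> ennreal (B powr p) * hardy_sup p f"
    by (rule hardy_sup_scaled) (use assms norm_source_le B_pos p in auto)
  also have "\<dots> \<le> ennreal (B powr p) * ennreal M" using assms by (intro mult_left_mono) auto
  also have "\<dots> = ennreal (B powr p * M)" using assms by (simp add: ennreal_mult)
  finally show ?thesis .
qed

text \<open>An admissibility constant for \<open>source f\<close> when \<open>hardy_sup p f \<le> M\<close>.\<close>

definition cadm :: "real \<Rightarrow> real" where
  "cadm M = near_const p (B powr p * M) * 3 powr (1 - 1 / p)"

lemma source_admissible:
  assumes "f \<in> borel_measurable LD" "hardy_sup p f \<le> ennreal M" "M \<ge> 0"
  shows "admissible (source f) (cadm M)"
  unfolding cadm_def by (rule admissible_hardy[OF _ p hardy_source[OF assms]]) (use assms in auto)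

lemma T_source_continuous:
  assumes "f \<in> borel_measurable LD" "hardy_sup p f \<le> ennreal M" "M \<ge> 0" "l \<ge> 0"
  shows "continuous_on (cball 0 1) (T l (source f))"
  by (rule T_continuous[OF _ p hardy_source[OF assms(1-3)] _ assms(4)]) (use assms in auto)

end

context beltrami
begin

lemma Linf_N: "N \<in> Linf"
  by (rule bounded_imp_Linf[OF N_measurable]) (use N_le in auto)

text \<open>The equation \<open>dbar f = \<nu> cnj (d f)\<close> says that \<open>f - \<nu> cnj f\<close> has the bounded multiple
  \<open>- N cnj f\<close> of \<open>cnj f\<close> as its \<open>dbar\<close>: the derivative falls on \<open>\<nu>\<close> alone.\<close>

lemma conj_beltrami_iff:
  assumes f: "integrable LD f"
  shows "conj_beltrami \<nu> f \<longleftrightarrow> weak_dbar (twist f) (source f)"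
proof -
  have fm: "f \<in> borel_measurable LD" using f by auto
  have cf: "integrable LD (\<lambda>z. cnj (f z))" using f by simp
  have nuf: "integrable LD (\<lambda>z. cnj (f z) * of_real (\<nu> z))"
    by (rule integrable_times_bounded[OF cf, where B = 1]) (use nu_le kappa of_real_nu_measurable in force)+
  have Nf: "integrable LD (\<lambda>z. cnj (f z) * N z)"
    by (rule integrable_times_bounded[OF cf N_measurable N_le])
  have key: "(LINT z|LD. f z * dbar \<psi> z) = (LINT z|LD. cnj (f z) * (of_real (\<nu> z) * dbar \<psi> z + N' z * \<psi> z)) \<longleftrightarrow>
      (LINT z|LD. twist f z * dbar \<psi> z) = - (LINT z|LD. source f z * \<psi> z)"
    if \<psi>: "\<psi> \<in> test_functions" and N': "AE z in LD. N' z = N z" "N' \<in> borel_measurable LD" for \<psi> N'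
  proof -
    note i = integrable_times_test(2)[OF f \<psi>] integrable_times_test(2)[OF nuf \<psi>] integrable_times_test(1)[OF Nf \<psi>]
    note [measurable] = fm of_real_nu_measurable N_measurable test_function_measurable[OF \<psi>] N'(2)
    have "(LINT z|LD. cnj (f z) * (of_real (\<nu> z) * dbar \<psi> z + N' z * \<psi> z)) =
       (LINT z|LD. cnj (f z) * of_real (\<nu> z) * dbar \<psi> z + cnj (f z) * N z * \<psi> z)"
    proof (rule Bochner_Integration.integral_cong_AE)
      show "AE z in LD. cnj (f z) * (of_real (\<nu> z) * dbar \<psi> z + N' z * \<psi> z) = cnj (f z) * of_real (\<nu> z) * dbar \<psi> z + cnj (f z) * N z * \<psi> z"
        using N'(1) by eventually_elim (simp add: algebra_simps)
    qed measurable
    also have "\<dots> = (LINT z|LD. cnj (f z) * of_real (\<nu> z) * dbar \<psi> z) + (LINT z|LD. cnj (f z) * N z * \<psi> z)"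
      using i by simp
    finally have 1: "(LINT z|LD. cnj (f z) * (of_real (\<nu> z) * dbar \<psi> z + N' z * \<psi> z)) =
      (LINT z|LD. cnj (f z) * of_real (\<nu> z) * dbar \<psi> z) + (LINT z|LD. cnj (f z) * N z * \<psi> z)" .
    have "(LINT z|LD. twist f z * dbar \<psi> z) = (LINT z|LD. f z * dbar \<psi> z - cnj (f z) * of_real (\<nu> z) * dbar \<psi> z)"
      by (intro Bochner_Integration.integral_cong refl) (simp add: twist_def algebra_simps)
    also have "\<dots> = (LINT z|LD. f z * dbar \<psi> z) - (LINT z|LD. cnj (f z) * of_real (\<nu> z) * dbar \<psi> z)"
      using i by simp
    finally have 2: "(LINT z|LD. twist f z * dbar \<psi> z) = (LINT z|LD. f z * dbar \<psi> z) - (LINT z|LD. cnj (f z) * of_real (\<nu> z) * dbar \<psi> z)" .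
    have "(LINT z|LD. source f z * \<psi> z) = (LINT z|LD. - (cnj (f z) * N z * \<psi> z))"
      by (intro Bochner_Integration.integral_cong refl) (simp add: source_def)
    then have 3: "(LINT z|LD. source f z * \<psi> z) = - (LINT z|LD. cnj (f z) * N z * \<psi> z)" by simp
    show ?thesis unfolding 1 2 3 by (auto simp: algebra_simps)
  qed
  show ?thesis
  proof
    assume "conj_beltrami \<nu> f"
    then obtain N' where N': "N' \<in> Linf" "weak_dbar (\<lambda>z. of_real (\<nu> z)) N'"
      and eq: "\<And>\<psi>. \<psi> \<in> test_functions \<Longrightarrow> (LINT z|LD. f z * dbar \<psi> z) = (LINT z|LD. cnj (f z) * (of_real (\<nu> z) * dbar \<psi> z + N' z * \<psi> z))"
      unfolding conj_beltrami_def by auto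
    have ae: "AE z in LD. N' z = N z"
      by (rule weak_dbar_unique[OF N'(2) weak_nu Linf_integrable[OF N'(1)] Linf_integrable[OF Linf_N]])
    have m: "N' \<in> borel_measurable LD" using N'(1) by (simp add: Linf_def)
    show "weak_dbar (twist f) (source f)"
      unfolding weak_dbar_def using key[OF _ ae m] eq by blast
  next
    assume w: "weak_dbar (twist f) (source f)"
    have ae: "AE z in LD. N z = N z" by simp
    show "conj_beltrami \<nu> f"
      unfolding conj_beltrami_def
      by (rule bexI[OF _ Linf_N], rule conjI[OF weak_nu]) (use key[OF _ ae N_measurable] weak_dbarD[OF w] in blast)
  qed
qed

lemma hardy_integrable:
  assumes "f \<in> borel_measurable LD" "hardy_sup p f < \<infinity>"
  shows "integrable LD f"
proof -
  obtain M where "M \<ge> 0" "hardy_sup p f = ennreal M" using assms(2) by (cases "hardy_sup p f") auto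
  then show ?thesis using admissible_L1(1)[OF admissible_hardy[OF assms(1) p]] by auto
qed

lemma hardy_space_iff:
  "f \<in> hardy_space p \<nu> \<longleftrightarrow> f \<in> borel_measurable LD \<and> hardy_sup p f < \<infinity> \<and> weak_dbar (twist f) (source f)"
  using conj_beltrami_iff hardy_integrable unfolding hardy_space_def by blast

text \<open>A generalized analytic function \<open>f\<close> and its analytic part \<open>G\<close>, linked through the Cauchy transform.\<close>

definition linked :: "real \<Rightarrow> (complex \<Rightarrow> complex) \<Rightarrow> (complex \<Rightarrow> complex) \<Rightarrow> bool" where
  "linked l f G \<longleftrightarrow> G holomorphic_on disc \<and> continuous_on disc f \<and> hardy_sup p f < \<infinity> \<and>
     (\<forall>z\<in>disc. twist f z = G z + T l (source f) z)"

lemma linkedD: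
  assumes "linked l f G"
  shows "G holomorphic_on disc" "continuous_on disc f" "hardy_sup p f < \<infinity>" "continuous_on disc G"
    "\<And>z. z \<in> disc \<Longrightarrow> twist f z = G z + T l (source f) z" "f \<in> borel_measurable LD" "G \<in> borel_measurable LD"
  using assms unfolding linked_def by (auto intro: holomorphic_on_imp_continuous_on continuous_imp_measurable_LD)

text \<open>A continuous solution is recovered as the \<open>untwist\<close> of its analytic part plus a Cauchy transform.\<close>

lemma hardy_space_imp_linked:
  assumes f: "f \<in> hardy_space p \<nu>" and l: "l \<ge> 0"
  obtains g G where "linked l g G" "AE z in LD. f z = g z"
proof -
  have fm: "f \<in> borel_measurable LD" and fin: "hardy_sup p f < \<infinity>" and w: "weak_dbar (twist f) (source f)"
    using f by (auto simp: hardy_space_iff)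
  obtain M where M: "M \<ge> 0" "hardy_sup p f = ennreal M" using fin by (cases "hardy_sup p f") auto
  have sup: "hardy_sup p f \<le> ennreal M" by (simp add: M)
  have adm: "admissible (source f) (cadm M)" by (rule source_admissible[OF fm sup M(1)])
  have "integrable LD (twist f)"
  proof (rule Bochner_Integration.integrable_bound)
    show "integrable LD (\<lambda>z. 2 * cmod (f z))" using integrable_norm[OF hardy_integrable[OF fm fin]] by simp
    show "AE z in LD. norm (twist f z) \<le> norm (2 * cmod (f z))" using norm_twist_le by (intro AE_I2) simp
  qed (rule twist_measurable[OF fm])
  then obtain G where G: "G holomorphic_on disc" "AE z in LD. twist f z = G z + T l (source f) z"
    using weak_dbar_representation[OF _ w adm l] by blast
  define g where "g = untwist (\<lambda>z. G z + T l (source f) z)"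
  have Tc: "continuous_on disc (T l (source f))"
    by (rule continuous_on_subset[OF T_source_continuous[OF fm sup M(1) l]]) auto
  have gc: "continuous_on disc g"
    unfolding g_def by (intro untwist_continuous continuous_intros Tc holomorphic_on_imp_continuous_on[OF G(1)])
  have ae: "AE z in LD. f z = g z"
    using G(2) AE_space[of LD] by eventually_elim (auto simp: g_def intro!: untwist_unique)
  have gm: "g \<in> borel_measurable LD" by (rule continuous_imp_measurable_LD[OF gc])
  have "T l (source g) z = T l (source f) z" for z
    unfolding T_def
  proof (rule Bochner_Integration.integral_cong_AE)
    show "AE \<zeta> in LD. K l z \<zeta> * source g \<zeta> = K l z \<zeta> * source f \<zeta>"
      using ae by eventually_elim (simp add: source_def)
  qed (intro borel_measurable_times K_measurable_LD source_measurable gm fm)+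
  moreover have "hardy_sup p g = hardy_sup p f"
    using p by (intro hardy_sup_cong[OF fm gm _ ae, symmetric]) simp
  ultimately have "linked l g G"
    unfolding linked_def using G(1) gc fin by (auto simp: g_def twist_untwist)
  then show ?thesis using ae that by blast
qed

lemma linked_imp_hardy_space:
  assumes lk: "linked l f G" and l: "l \<ge> 0"
  shows "f \<in> hardy_space p \<nu>"
proof -
  note f = linkedD[OF lk]
  obtain M where M: "M \<ge> 0" "hardy_sup p f = ennreal M" using f(3) by (cases "hardy_sup p f") auto
  have sup: "hardy_sup p f \<le> ennreal M" by (simp add: M)
  have Tc: "continuous_on disc (T l (source f))"
    by (rule continuous_on_subset[OF T_source_continuous[OF f(6) sup M(1) l]]) auto
  have "weak_dbar (\<lambda>z. G z + T l (source f) z) (source f)"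
    by (rule weak_dbar_add_holomorphic[OF Tc weak_dbar_T[OF source_admissible[OF f(6) sup M(1)] l] f(1)])
  then have "weak_dbar (twist f) (source f)" by (rule weak_dbar_cong) (simp_all add: f(5))
  then show ?thesis using f by (simp add: hardy_space_iff)
qed

lemma linked_T_bound:
  assumes lk: "linked l f G" and l: "l \<ge> 0" and M: "hardy_sup p f \<le> ennreal M" "M \<ge> 0" and z: "cmod z \<le> 1"
  shows "cmod (T l (source f) z) \<le> exp (2 * l) * cadm M"
  by (rule T_bound[OF source_admissible[OF linkedD(6)[OF lk] M] l z])

text \<open>This estimate and the next one compare a solution with its analytic part up to a bounded error.\<close>

lemma norm_analytic_part_le:
  assumes lk: "linked l f G" and z: "z \<in> disc"
  shows "cmod (G z) \<le> 2 * cmod (f z) + cmod (T l (source f) z)"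
proof -
  have "G z = twist f z - T l (source f) z" using linkedD(5)[OF lk z] by simp
  then show ?thesis using norm_triangle_ineq4[of "twist f z" "T l (source f) z"] norm_twist_le[OF z, of f] by simp
qed

lemma norm_le_analytic_part:
  assumes lk: "linked l f G" and z: "z \<in> disc"
  shows "cmod (f z) \<le> (cmod (G z) + cmod (T l (source f) z)) / (1 - \<kappa>)"
proof -
  have "f z = untwist (\<lambda>z. G z + T l (source f) z) z" by (rule untwist_unique[where g = "\<lambda>z. G z + T l (source f) z", OF z linkedD(5)[OF lk z]])
  then have "cmod (f z) \<le> cmod (G z + T l (source f) z) / (1 - \<kappa>)" using norm_untwist_le[OF z] by metis
  also have "\<dots> \<le> (cmod (G z) + cmod (T l (source f) z)) / (1 - \<kappa>)"
    using kappa by (intro divide_right_mono norm_triangle_ineq) auto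
  finally show ?thesis .
qed

lemma cadm_nonneg: "M \<ge> 0 \<Longrightarrow> cadm M \<ge> 0"
  using p unfolding cadm_def near_const_def
  by (intro mult_nonneg_nonneg divide_nonneg_nonneg add_nonneg_nonneg) auto

lemma analytic_part_hardy:
  assumes lk: "linked l f G" and l: "l \<ge> 0" and M: "hardy_sup p f \<le> ennreal M" "M \<ge> 0"
  shows "hardy_sup p G \<le> ennreal (2 powr p * (2 powr p * M + (exp (2 * l) * cadm M) powr p))"
proof -
  note f = linkedD[OF lk]
  let ?C = "exp (2 * l) * cadm M"
  have C: "?C \<ge> 0" using cadm_nonneg[OF M(2)] by simp
  have m: "(\<lambda>_. of_real ?C :: complex) \<in> borel_measurable LD" "(\<lambda>z. 2 * f z) \<in> borel_measurable LD" using f(6) by simp_all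
  have "hardy_sup p G \<le> ennreal (2 powr p) * (hardy_sup p (\<lambda>z. 2 * f z) + hardy_sup p (\<lambda>_. of_real ?C))"
  proof (rule hardy_sup_triangle[OF f(7) m(2,1)])
    show "AE z in LD. cmod (G z) \<le> cmod (2 * f z) + cmod (of_real ?C)"
    proof (rule AE_I2)
      fix z assume "z \<in> space LD"
      then have "z \<in> disc" by simp
      then show "cmod (G z) \<le> cmod (2 * f z) + cmod (of_real ?C)"
      proof -
        assume z: "z \<in> disc"
        have "cmod (of_real ?C :: complex) = ?C" using C by (simp only: norm_of_real abs_of_nonneg)
        moreover have "cmod (2 * f z) = 2 * cmod (f z)" by (simp add: norm_mult)
        moreover have "cmod (T l (source f) z) \<le> ?C" using linked_T_bound[OF lk l M, of z] z by simp
        ultimately show ?thesis using norm_analytic_part_le[OF lk z] by linarith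
      qed
    qed
  qed (use p in simp)
  also have "\<dots> \<le> ennreal (2 powr p) * (ennreal (2 powr p) * ennreal M + ennreal (?C powr p))"
  proof (intro mult_left_mono add_mono)
    have "hardy_sup p (\<lambda>z. 2 * f z) \<le> ennreal (2 powr p) * hardy_sup p f"
      by (rule hardy_sup_scaled[OF m(2) f(6)]) (use p in \<open>auto simp: norm_mult\<close>)
    also have "\<dots> \<le> ennreal (2 powr p) * ennreal M" using M by (intro mult_left_mono) auto
    finally show "hardy_sup p (\<lambda>z. 2 * f z) \<le> ennreal (2 powr p) * ennreal M" .
    show "hardy_sup p (\<lambda>_. of_real ?C) \<le> ennreal (?C powr p)"
    proof (rule hardy_sup_bounded[OF m(1) _ C])
      have "cmod (of_real ?C :: complex) = ?C" using C by (simp only: norm_of_real abs_of_nonneg)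
      then show "AE z in LD. cmod (of_real ?C :: complex) \<le> ?C" by (intro AE_I2) (simp only: order_refl)
    qed (use p in simp)
  qed simp
  also have "\<dots> = ennreal (2 powr p * (2 powr p * M + ?C powr p))"
  proof -
    have "0 \<le> 2 powr p * M" "0 \<le> ?C powr p" "0 \<le> 2 powr p" using M(2) by auto
    then show ?thesis by (simp only: ennreal_mult ennreal_plus add_nonneg_nonneg M(2))
  qed
  finally show ?thesis .
qed

lemma T_diff:
  assumes "admissible h C" "admissible h' C'" "l \<ge> 0" "cmod z \<le> 1"
  shows "T l h z - T l h' z = T l (\<lambda>z. h z - h' z) z"
  unfolding T_def right_diff_distrib
  by (rule Bochner_Integration.integral_diff[symmetric]) (rule admissible_integrable_K; fact)+

text \<open>Conversely every analytic function in the Hardy space is the analytic part of a solution: the equation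
  for \<open>T l (source f)\<close> is a contraction when the weight is steep enough.\<close>

lemma solution_with_analytic_part:
  obtains l where "l > 0" "\<And>M. M \<ge> 0 \<Longrightarrow> \<exists>M'\<ge>0. \<forall>G. G holomorphic_on disc \<and> hardy_sup p G \<le> ennreal M \<longrightarrow> (\<exists>f. linked l f G \<and> hardy_sup p f \<le> ennreal M')"
proof -
  \<comment> \<open>a Lipschitz constant of \<open>u \<mapsto> source (untwist (G + u))\<close>; the weight is chosen to halve weighted distances\<close>
  define b where "b = B / (1 - \<kappa>)"
  have b: "b > 0" using B_pos kappa by (simp add: b_def)
  have eb: "1 / (2 * b) > 0" using b by simp
  obtain l where l: "l > 0" and small': "\<forall>g s z. g \<in> borel_measurable LD \<longrightarrow> s \<ge> 0 \<longrightarrow> (\<forall>\<zeta>\<in>disc. cmod (g \<zeta>) \<le> s * wt l \<zeta>) \<longrightarrow>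
     cmod z \<le> 1 \<longrightarrow> cmod (T l g z) \<le> 1 / (2 * b) * s * wt l z"
    using T_weighted_small[OF eb] by blast
  have small: "\<And>g s z. g \<in> borel_measurable LD \<Longrightarrow> s \<ge> 0 \<Longrightarrow> (\<And>\<zeta>. \<zeta> \<in> disc \<Longrightarrow> cmod (g \<zeta>) \<le> s * wt l \<zeta>) \<Longrightarrow>
     cmod z \<le> 1 \<Longrightarrow> cmod (T l g z) \<le> 1 / (2 * b) * s * wt l z"
    using small' by blast
  have l0: "l \<ge> 0" using l by simp
  have wt1: "1 \<le> wt l z" for z using l by (simp add: wt_def)
  have wtE: "wt l z \<le> exp l" if "cmod z \<le> 1" for z
  proof -
    have "(cmod z)\<^sup>2 \<le> 1" using that power_mono[of "cmod z" 1 2] by simp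
    then have "l * (cmod z)\<^sup>2 / 2 \<le> l" using l mult_left_mono[of "(cmod z)\<^sup>2" 1 l] by simp
    then show ?thesis by (simp add: wt_def)
  qed
  show ?thesis
  proof (rule that[OF l])
    fix M :: real assume M: "M \<ge> 0"
    \<comment> \<open>\<open>D\<close> bounds the first iterate, so the geometric series of the increments is bounded by \<open>2 * D\<close> times the weight, which is at most \<open>E\<close>\<close>
    define D where "D = exp (2 * l) * cadm (M / (1 - \<kappa>) powr p)"
    have Mk: "M / (1 - \<kappa>) powr p \<ge> 0" using M by simp
    have D: "D \<ge> 0" using cadm_nonneg[OF Mk] by (simp add: D_def)
    define E where "E = 2 * D * exp l"
    have E: "E \<ge> 0" using D by (simp add: E_def)
    define M1 where "M1 = 2 powr p * (M + E powr p)"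
    have M1: "M1 \<ge> 0" using M by (simp add: M1_def)
    define M' where "M' = (1 / (1 - \<kappa>)) powr p * M1"
    have M': "M' \<ge> 0" using M1 by (simp add: M'_def)
    have "\<exists>f. linked l f G \<and> hardy_sup p f \<le> ennreal M'" if G: "G holomorphic_on disc" "hardy_sup p G \<le> ennreal M" for G
    proof -
      have Gc: "continuous_on disc G" using G(1) by (rule holomorphic_on_imp_continuous_on)
      have Gm: "G \<in> borel_measurable LD" by (rule continuous_imp_measurable_LD[OF Gc])
      define S where "S u = T l (source (untwist (\<lambda>z. G z + u z)))" for u
      define s where "s n = (S ^^ n) (\<lambda>_. 0)" for n
      have s0: "s 0 = (\<lambda>_. 0)" and sS: "s (Suc n) = S (s n)" for n by (simp_all add: s_def)
      have sS': "s (Suc n) z = T l (source (untwist (\<lambda>z. G z + s n z))) z" for n z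
        by (simp only: sS S_def)
      have hb: "hardy_sup p (untwist (\<lambda>z. G z + u z)) \<le> ennreal M'"
        if um: "u \<in> borel_measurable LD" and ub: "\<And>z. z \<in> disc \<Longrightarrow> cmod (u z) \<le> E" for u
      proof -
        have m: "(\<lambda>z. G z + u z) \<in> borel_measurable LD" using Gm um by simp
        have "hardy_sup p (\<lambda>z. G z + u z) \<le> ennreal (2 powr p) * (hardy_sup p G + hardy_sup p u)"
          by (rule hardy_sup_triangle[OF m Gm um]) (use p in \<open>auto intro: norm_triangle_ineq\<close>)
        also have "\<dots> \<le> ennreal (2 powr p) * (ennreal M + ennreal (E powr p))"
          by (intro mult_left_mono add_mono G(2) hardy_sup_bounded[OF um _ E]) (use p ub in auto)
        also have "\<dots> = ennreal M1" unfolding M1_def using M by (simp add: ennreal_mult ennreal_plus)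
        finally have 1: "hardy_sup p (\<lambda>z. G z + u z) \<le> ennreal M1" .
        have "hardy_sup p (untwist (\<lambda>z. G z + u z)) \<le> ennreal ((1 / (1 - \<kappa>)) powr p) * hardy_sup p (\<lambda>z. G z + u z)"
          by (rule hardy_sup_scaled[OF untwist_measurable[OF m] m]) (use p kappa norm_untwist_le in \<open>auto intro!: AE_I2\<close>)
        also have "\<dots> \<le> ennreal ((1 / (1 - \<kappa>)) powr p) * ennreal M1" using 1 by (intro mult_left_mono) auto
        also have "\<dots> = ennreal M'" unfolding M'_def using M1 by (simp add: ennreal_mult)
        finally show ?thesis .
      qed
      have sm: "s n \<in> borel_measurable LD" for n
      proof (induction n)
        case (Suc n)
        then show ?case unfolding sS S_def by (intro T_measurable source_measurable untwist_measurable borel_measurable_add Gm)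
      qed (simp add: s0)
      let ?h = "\<lambda>u. source (untwist (\<lambda>z. G z + u z))"
      have hm: "?h u \<in> borel_measurable LD" if "u \<in> borel_measurable LD" for u
        by (intro source_measurable untwist_measurable borel_measurable_add Gm that)
      have adm: "admissible (?h u) (cadm M')" if "u \<in> borel_measurable LD" "\<And>z. z \<in> disc \<Longrightarrow> cmod (u z) \<le> E" for u
        by (rule source_admissible[OF untwist_measurable hb[OF that] M']) (intro borel_measurable_add Gm that)
      have hdiff: "cmod (?h u z - ?h v z) \<le> b * cmod (u z - v z)" if "z \<in> disc" for u v z
      proof -
        have "?h u z - ?h v z = - N z * cnj (untwist (\<lambda>z. (G z + u z) - (G z + v z)) z)"
          unfolding untwist_diff by (simp add: source_def algebra_simps)
        also have "cmod \<dots> \<le> B * (cmod ((G z + u z) - (G z + v z)) / (1 - \<kappa>))"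
          unfolding norm_mult norm_minus_cancel complex_mod_cnj
          using N_le[of z] norm_untwist_le[OF that, of "\<lambda>z. (G z + u z) - (G z + v z)"] B_pos by (intro mult_mono) auto
        finally show ?thesis by (simp add: b_def)
      qed
      have step: "\<forall>z. cmod z \<le> 1 \<longrightarrow> cmod (s n z) \<le> 2 * D * (1 - (1/2) ^ n) * wt l z \<and> cmod (s (Suc n) z - s n z) \<le> D * (1/2) ^ n * wt l z" for n
      proof (induction n)
        case 0
        have m: "(\<lambda>z. G z + 0) \<in> borel_measurable LD" using Gm by simp
        have "hardy_sup p (untwist (\<lambda>z. G z + 0)) \<le> ennreal ((1 / (1 - \<kappa>)) powr p) * hardy_sup p G"
          by (rule hardy_sup_scaled[OF untwist_measurable[OF m] Gm]) (use p kappa norm_untwist_le in \<open>auto intro!: AE_I2\<close>)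
        also have "\<dots> \<le> ennreal ((1 / (1 - \<kappa>)) powr p) * ennreal M" using G(2) by (intro mult_left_mono) auto
        also have "\<dots> = ennreal (M / (1 - \<kappa>) powr p)"
          using M kappa by (simp add: ennreal_mult[symmetric] powr_divide)
        finally have hs: "hardy_sup p (untwist (\<lambda>z. G z + 0)) \<le> ennreal (M / (1 - \<kappa>) powr p)" .
        have "cmod (s (Suc 0) z) \<le> D * wt l z" if "cmod z \<le> 1" for z
        proof -
          have "cmod (s (Suc 0) z) \<le> D"
            unfolding sS S_def s0 D_def by (rule T_bound[OF source_admissible[OF untwist_measurable[OF m] hs Mk] l0 that])
          also have "D * 1 \<le> D * wt l z" using D wt1 by (intro mult_left_mono)
          finally show ?thesis by simp
        qed
        then show ?case by (simp add: s0)
      next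
        case (Suc n)
        have 1: "cmod (s (Suc n) z) \<le> 2 * D * (1 - (1/2) ^ Suc n) * wt l z" if z: "cmod z \<le> 1" for z
        proof -
          have "cmod (s (Suc n) z) \<le> cmod (s n z) + cmod (s (Suc n) z - s n z)"
            using norm_triangle_sub[of "s (Suc n) z" "s n z"] .
          also have "\<dots> \<le> 2 * D * (1 - (1/2) ^ n) * wt l z + D * (1/2) ^ n * wt l z"
            using Suc z by (intro add_mono) auto
          also have "\<dots> = 2 * D * (1 - (1/2) ^ Suc n) * wt l z" by (simp add: algebra_simps)
          finally show ?thesis .
        qed
        have bd: "2 * D * (1 - (1/2) ^ k) * wt l z \<le> E" if "cmod z \<le> 1" for k z
        proof -
          have "2 * D * (1 - (1/2) ^ k) * wt l z \<le> 2 * D * 1 * exp l"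
            using D wtE[OF that] wt1[of z] by (intro mult_mono) (auto simp: power_le_one)
          then show ?thesis by (simp add: E_def)
        qed
        have E1: "cmod (s (Suc n) z) \<le> E" "cmod (s n z) \<le> E" if "z \<in> disc" for z
        proof -
          have z: "cmod z \<le> 1" using that by simp
          show "cmod (s (Suc n) z) \<le> E" by (rule order_trans[OF 1[OF z] bd[OF z]])
          have "cmod (s n z) \<le> 2 * D * (1 - (1/2) ^ n) * wt l z" using Suc z by blast
          then show "cmod (s n z) \<le> E" by (rule order_trans[OF _ bd[OF z]])
        qed
        have 2: "cmod (s (Suc (Suc n)) z - s (Suc n) z) \<le> D * (1/2) ^ Suc n * wt l z" if z: "cmod z \<le> 1" for z
        proof -
          have "s (Suc (Suc n)) z - s (Suc n) z = T l (?h (s (Suc n))) z - T l (?h (s n)) z"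
            by (rule arg_cong2[where f = "(-)", OF sS' sS'])
          also have "\<dots> = T l (\<lambda>z. ?h (s (Suc n)) z - ?h (s n) z) z"
            by (rule T_diff[OF adm[OF sm E1(1)] adm[OF sm E1(2)] l0 z])
          also have "cmod \<dots> \<le> 1 / (2 * b) * (b * (D * (1/2) ^ n)) * wt l z"
          proof (rule small[OF _ _ _ z])
            show "(\<lambda>z. ?h (s (Suc n)) z - ?h (s n) z) \<in> borel_measurable LD"
              by (intro borel_measurable_diff hm sm)
            fix \<zeta> :: complex assume \<zeta>: "\<zeta> \<in> disc"
            have "cmod (?h (s (Suc n)) \<zeta> - ?h (s n) \<zeta>) \<le> b * cmod (s (Suc n) \<zeta> - s n \<zeta>)" by (rule hdiff[OF \<zeta>])
            also have "\<dots> \<le> b * (D * (1/2) ^ n * wt l \<zeta>)" using Suc \<zeta> b by (intro mult_left_mono) auto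
            finally show "cmod (?h (s (Suc n)) \<zeta> - ?h (s n) \<zeta>) \<le> b * (D * (1/2) ^ n) * wt l \<zeta>" by (simp add: mult.assoc)
          qed (use b D in auto)
          also have "\<dots> = D * (1/2) ^ Suc n * wt l z" using b by simp
          finally show ?thesis .
        qed
        show ?case using 1 2 by blast
      qed
      have sE: "cmod (s n z) \<le> E" if "cmod z \<le> 1" for n z
      proof -
        have "2 * D * (1 - (1/2) ^ n) * wt l z \<le> 2 * D * 1 * exp l"
          using D wtE[OF that] wt1[of z] by (intro mult_mono) (auto simp: power_le_one)
        then show ?thesis using step[of n] that by (force simp: E_def)
      qed
      define u where "u z = (\<Sum>k. s (Suc k) z - s k z)" for z
      have lim: "(\<lambda>n. s n z) \<longlonglongrightarrow> u z" if z: "cmod z \<le> 1" for z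
      proof -
        have "summable (\<lambda>k. D * (1/2) ^ k * wt l z)"
          by (intro summable_mult summable_mult2 summable_geometric) simp
        then have "summable (\<lambda>k. s (Suc k) z - s k z)"
          by (rule summable_comparison_test'[where N = 0]) (use step z in auto)
        then have "(\<lambda>n. \<Sum>k<n. s (Suc k) z - s k z) \<longlonglongrightarrow> u z"
          unfolding u_def by (rule summable_LIMSEQ)
        moreover have "(\<Sum>k<n. s (Suc k) z - s k z) = s n z" for n
          using sum_lessThan_telescope[of "\<lambda>k. s k z" n] by (simp add: s0)
        ultimately show ?thesis by (simp only:)
      qed
      have um: "u \<in> borel_measurable LD"
        by (rule borel_measurable_LIMSEQ_metric[where f = s, OF sm]) (use lim in auto)
      have uE: "cmod (u z) \<le> E" if "cmod z \<le> 1" for z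
        by (rule LIMSEQ_le_const2[OF tendsto_norm[OF lim[OF that]]]) (use sE[OF that] in auto)
      define g where "g z = complex_of_real (b * (cmod (G z) + E))" for z
      have gm: "g \<in> borel_measurable LD"
        unfolding g_def by (intro continuous_imp_measurable_LD continuous_intros Gc)
      have gadm: "admissible g (near_const p (b powr p * M1) * 3 powr (1 - 1 / p))"
      proof (rule admissible_hardy[OF gm p])
        let ?g = "\<lambda>z. complex_of_real (cmod (G z) + E)"
        have g1: "?g \<in> borel_measurable LD" by (intro continuous_imp_measurable_LD continuous_intros Gc)
        have "hardy_sup p ?g \<le> ennreal (2 powr p) * (hardy_sup p G + hardy_sup p (\<lambda>_. of_real E))"
          by (rule hardy_sup_triangle[OF g1 Gm]) (use p E in \<open>auto simp del: of_real_add\<close>)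
        also have "\<dots> \<le> ennreal (2 powr p) * (ennreal M + ennreal (E powr p))"
          by (intro mult_left_mono add_mono G(2) hardy_sup_bounded[OF _ _ E]) (use p E in auto)
        also have "\<dots> = ennreal M1" unfolding M1_def using M by (simp add: ennreal_mult ennreal_plus)
        finally have 1: "hardy_sup p ?g \<le> ennreal M1" .
        have "hardy_sup p g \<le> ennreal (b powr p) * hardy_sup p ?g"
          by (rule hardy_sup_scaled[OF gm g1 _ b]) (use p b E in \<open>auto simp: g_def norm_mult simp del: of_real_add\<close>)
        also have "\<dots> \<le> ennreal (b powr p) * ennreal M1" using 1 by (intro mult_left_mono) auto
        also have "\<dots> = ennreal (b powr p * M1)" using M1 by (simp add: ennreal_mult)
        finally show "hardy_sup p g \<le> ennreal (b powr p * M1)" .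
      qed (use M1 in simp)
      have hg: "cmod (?h v z) \<le> cmod (g z)" if z: "z \<in> disc" and v: "cmod (v z) \<le> E" for v z
      proof -
        have "cmod (?h v z) \<le> B * cmod (untwist (\<lambda>z. G z + v z) z)" by (rule norm_source_le)
        also have "\<dots> \<le> B * ((cmod (G z) + E) / (1 - \<kappa>))"
        proof (rule mult_left_mono)
          have "cmod (untwist (\<lambda>z. G z + v z) z) \<le> cmod (G z + v z) / (1 - \<kappa>)" by (rule norm_untwist_le[OF z])
          also have "\<dots> \<le> (cmod (G z) + E) / (1 - \<kappa>)"
            using norm_triangle_ineq[of "G z" "v z"] v kappa by (intro divide_right_mono) auto
          finally show "cmod (untwist (\<lambda>z. G z + v z) z) \<le> (cmod (G z) + E) / (1 - \<kappa>)" .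
        qed (use B_pos in simp)
        also have "\<dots> = cmod (g z)"
        proof -
          have "b * (cmod (G z) + E) \<ge> 0" using b E by simp
          then have "cmod (g z) = b * (cmod (G z) + E)" unfolding g_def norm_of_real by simp
          then show ?thesis by (simp add: b_def)
        qed
        finally show ?thesis .
      qed
      have ut: "u z = T l (?h u) z" if z: "cmod z \<le> 1" for z
      proof -
        have "(\<lambda>n. T l (?h (s n)) z) \<longlonglongrightarrow> T l (?h u) z"
        proof (rule T_dominated_convergence[OF hm[OF sm] hm[OF um] gadm _ _ l0 z])
          show "AE \<zeta> in LD. (\<lambda>n. ?h (s n) \<zeta>) \<longlonglongrightarrow> ?h u \<zeta>"
          proof (rule AE_I2)
            fix \<zeta> assume "\<zeta> \<in> space LD"
            then have \<zeta>: "\<zeta> \<in> disc" "cmod \<zeta> \<le> 1" by auto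
            have "of_real (1 - (\<nu> \<zeta>)\<^sup>2) \<noteq> (0::complex)" using nu_sq[OF \<zeta>(1)] by (metis less_irrefl of_real_eq_0_iff)
            then show "(\<lambda>n. ?h (s n) \<zeta>) \<longlonglongrightarrow> ?h u \<zeta>"
              unfolding source_def untwist_def by (intro tendsto_intros lim \<zeta>)
          qed
          show "AE \<zeta> in LD. cmod (?h (s n) \<zeta>) \<le> cmod (g \<zeta>)" for n
            by (intro AE_I2 hg sE) auto
        qed
        moreover have "(\<lambda>n. T l (?h (s n)) z) \<longlonglongrightarrow> u z"
          using LIMSEQ_Suc[OF lim[OF z]] unfolding sS S_def .
        ultimately show ?thesis using LIMSEQ_unique by blast
      qed
      define f where "f = untwist (\<lambda>z. G z + u z)"
      have fm: "f \<in> borel_measurable LD" unfolding f_def by (intro untwist_measurable borel_measurable_add Gm um)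
      have fb: "hardy_sup p f \<le> ennreal M'" unfolding f_def by (rule hb[OF um]) (use uE in auto)
      have "continuous_on disc (T l (source f))"
        by (rule continuous_on_subset[OF T_source_continuous[OF fm fb M' l0]]) auto
      then have uc: "continuous_on disc u"
        by (subst continuous_on_cong[OF refl, where g = "T l (source f)"]) (auto simp: ut f_def)
      have "continuous_on disc f" unfolding f_def by (intro untwist_continuous continuous_intros Gc uc)
      moreover have "twist f z = G z + T l (source f) z" if "z \<in> disc" for z
        using twist_untwist[OF that, of "\<lambda>z. G z + u z"] ut[of z] that by (simp add: f_def)
      ultimately have "linked l f G"
        unfolding linked_def using G(1) fb by (auto intro: le_less_trans)
      then show ?thesis using fb by blast
    qed
    then show "\<exists>M'\<ge>0. \<forall>G. G holomorphic_on disc \<and> hardy_sup p G \<le> ennreal M \<longrightarrow> (\<exists>f. linked l f G \<and> hardy_sup p f \<le> ennreal M')"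
      using M' by blast
  qed
qed

end

section \<open>Representatives and local bounds\<close>

lemma cont_rep_eq:
  fixes f g :: "complex \<Rightarrow> 'a::euclidean_space"
  assumes g: "continuous_on disc g" and ae: "AE z in LD. f z = g z" and z: "z \<in> disc"
  shows "cont_rep f z = g z"
proof -
  have "\<exists>g. continuous_on disc g \<and> (AE z in LD. g z = f z)"
    using g ae by (intro exI[of _ g]) (auto elim: eventually_mono)
  from someI_ex[OF this]
  have c: "continuous_on disc (cont_rep f)" "AE z in LD. cont_rep f z = f z"
    unfolding cont_rep_def by auto
  from c(2) ae have "AE z in LD. cont_rep f z = g z" by eventually_elim simp
  from AE_LD_continuous_imp[OF c(1) g this z] show ?thesis .
qed

lemma weakly_holomorphic:
  assumes "f holomorphic_on disc" "\<psi> \<in> test_functions"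
  shows "(LINT z|LD. f z * dbar \<psi> z) = 0"
  using weak_dbarD[OF classical_dbar_weak(2)[OF classical_dbar_holomorphic[OF assms(1)]] assms(2)] by simp

lemma mollify_holomorphic:
  assumes f: "f holomorphic_on disc" "integrable LD f" and w: "cmod w < 1" "a > 1 / (1 - cmod w)\<^sup>2"
  shows "mollify f a w = of_real bump_mass * f w"
proof -
  obtain H where H: "H holomorphic_on disc" "AE z in LD. f z = H z"
    "\<And>w a. cmod w < 1 \<Longrightarrow> a > 1 / (1 - cmod w)\<^sup>2 \<Longrightarrow> mollify f a w = of_real bump_mass * H w"
    using Weyl[OF f(2) weakly_holomorphic[OF f(1)]] by blast
  have "f w = H w"
    by (rule AE_LD_continuous_imp[OF _ _ H(2)]) (use f H w in \<open>auto intro: holomorphic_on_imp_continuous_on\<close>)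
  then show ?thesis using H(3)[OF w] by simp
qed

text \<open>Differentiating the smooth mean value property expresses the derivative at a point as an average of
  the weak derivative, so an essential bound becomes a bound at every point.\<close>

lemma holomorphic_deriv_bound:
  assumes f: "f holomorphic_on disc" "integrable LD f" and v: "weak_partial 1 f v" "v \<in> Linf"
  obtains C where "C > 0" "\<And>w. w \<in> disc \<Longrightarrow> cmod (deriv f w) \<le> C"
proof -
  obtain N B where N: "N \<in> borel_measurable borel" "B > 0" "\<And>z. cmod (N z) \<le> B" "AE z in LD. v z = N z"
    by (rule Linf_bounded_representative[OF v(2)], rule that)
  show ?thesis
  proof (rule that[OF N(2)])
    fix w :: complex assume "w \<in> disc"
    then have w: "cmod w < 1" by simp
    define R where "R = (1 + cmod w) / 2"
    have R: "0 < R" "R < 1" "cmod w < R" using w by (auto simp: R_def add_pos_nonneg)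
    define a where "a = 2 / (1 - R)\<^sup>2"
    have "1 / (1 - R)\<^sup>2 < a" unfolding a_def using R by (intro divide_strict_right_mono) auto
    then have aR: "a > 1 / (1 - cmod u)\<^sup>2" if "cmod u \<le> R" for u
      using norm_le_imp_scale[OF R(1,2) that] by simp
    have aw: "a > 1 / (1 - cmod w)\<^sup>2" using aR R(3) by simp
    note sc = scale_condition[OF w aw]
    have bt: "bump a w \<in> test_functions" by (rule bump_test[OF sc])
    let ?f2 = "\<lambda>z. of_real (flat 2 (1 - a * (cmod (z - w))\<^sup>2)) :: complex"
    define D where "D = (LINT z|LD. f z * (of_real (a\<^sup>2) * cnj (z - w) * ?f2 z))"
    have der: "(mollify f a has_field_derivative D) (at w)"
      unfolding D_def by (rule mollify_has_field_derivative[OF f(2) weakly_holomorphic[OF f(1) bt] sc(1) w])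
    have "((\<lambda>u. of_real bump_mass * f u) has_field_derivative D) (at w)"
    proof (rule has_field_derivative_transform_within_open[OF der])
      show "open (ball (0::complex) R)" "w \<in> ball 0 R" using R by auto
      fix u assume u: "u \<in> ball (0::complex) R"
      show "mollify f a u = of_real bump_mass * f u"
        by (rule mollify_holomorphic[OF f _ aR]) (use u R in auto)
    qed
    moreover have "((\<lambda>u. of_real bump_mass * f u) has_field_derivative of_real bump_mass * deriv f w) (at w)"
      using holomorphic_derivI[OF f(1) open_ball \<open>w \<in> disc\<close>] by (intro DERIV_cmult) 
    ultimately have Deq: "D = of_real bump_mass * deriv f w" by (rule DERIV_unique)
    have p1: "partial 1 (bump a w) z = - of_real a * ((z - w) + cnj (z - w)) * ?f2 z" for z
    proof -
      have "partial 1 (bump a w) z = (of_real (flat 2 (1 - a * (cmod (z - w))\<^sup>2))) * (of_real (- a) * ((z + - w) * cnj 1 + (cnj z + - cnj w) * 1))"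
        unfolding bump_def[abs_def] using partial_eq[OF has_derivative_flat_norm[of 0 a w z], of 1] by (simp add: numeral_2_eq_2)
      then show ?thesis by (simp add: algebra_simps)
    qed
    have C1: "C1c (bump a w)" by (rule test_functions_C1c[OF bt])
    have fc: "continuous_on disc f" using f(1) by (rule holomorphic_on_imp_continuous_on)
    have i1: "integrable LD (\<lambda>z. f z * dbar (bump a w) z)" by (rule integrable_times_test(2)[OF f(2) bt])
    have i2: "integrable LD (\<lambda>z. f z * partial 1 (bump a w) z)"
    proof -
      have "cmod (partial 1 (bump a w) z) \<le> a * 4 * 2" if "z \<in> disc" for z
      proof -
        have "cmod (z - w) \<le> 2" using that w norm_triangle_ineq4[of z w] by simp
        then have "cmod ((z - w) + cnj (z - w)) \<le> 4" using norm_triangle_ineq[of "z - w" "cnj (z - w)"] by (simp only: complex_mod_cnj)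
        moreover have "cmod (?f2 z) \<le> 2" using flat_bound[of 2] flat_nonneg[of 2] by (simp add: numeral_2_eq_2)
        ultimately show ?thesis unfolding p1 norm_mult norm_minus_cancel using sc(1) by (intro mult_mono) auto
      qed
      then show ?thesis
        by (intro integrable_times_bounded[OF f(2)] continuous_imp_measurable_LD continuous_on_subset[of UNIV "partial 1 (bump a w)" disc])
           (use C1 in \<open>auto simp: C1c_def\<close>)
    qed
    have vm: "v \<in> borel_measurable LD" using v(2) by (simp add: Linf_def)
    have "D = (LINT z|LD. of_real a * (f z * dbar (bump a w) z) - of_real a * (f z * partial 1 (bump a w) z))"
      unfolding D_def
      by (intro Bochner_Integration.integral_cong refl) (simp add: p1 dbar_bump algebra_simps power2_eq_square)
    also have "\<dots> = of_real a * 0 - of_real a * (LINT z|LD. f z * partial 1 (bump a w) z)"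
      using i1 i2 weakly_holomorphic[OF f(1) bt] by simp
    also have "\<dots> = of_real a * (LINT z|LD. v z * bump a w z)"
      using v(1) bt unfolding weak_partial_def by simp
    also have "(LINT z|LD. v z * bump a w z) = (LINT z|LD. bump a w z * N z)"
    proof (rule Bochner_Integration.integral_cong_AE)
      show "AE z in LD. v z * bump a w z = bump a w z * N z" using N(4) by eventually_elim simp
    qed (intro borel_measurable_times borel_measurable_LD[OF N(1)] test_function_measurable[OF bt] vm)+
    finally have D2: "D = of_real a * (LINT z|LD. bump a w z * N z)" .
    have bi: "integrable LD (bump a w)"
      by (rule integrable_LD_bounded[OF test_function_measurable(1)[OF bt] norm_bump_le])
    have "cmod (LINT z|LD. bump a w z * N z) \<le> B * (LINT z|LD. cmod (bump a w z))"
      by (rule norm_integral_times_le[OF bi borel_measurable_LD[OF N(1)] N(3)])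
    then have "cmod D \<le> a * (B * (LINT z|LD. cmod (bump a w z)))"
      unfolding D2 norm_mult using sc(1) by (intro mult_mono) auto
    moreover have "a * (LINT z|LD. cmod (bump a w z)) = bump_mass"
    proof -
      have "mollify (\<lambda>_. 1) a w = of_real bump_mass * 1"
        by (rule mollify_holomorphic[OF _ _ w aw]) auto
      moreover have "mollify (\<lambda>_. 1) a w = of_real (LINT z|LD. a * cmod (bump a w z))"
        unfolding mollify_def
        by (subst integral_complex_of_real[symmetric], intro Bochner_Integration.integral_cong refl) (simp add: bump_def flat_nonneg)
      ultimately show ?thesis by (metis integral_mult_right_zero mult_1_right of_real_eq_iff)
    qed
    ultimately have "bump_mass * cmod (deriv f w) \<le> bump_mass * B"
      unfolding Deq norm_mult using bump_mass_pos by (simp add: mult_ac)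
    then show "cmod (deriv f w) \<le> B" using bump_mass_pos by simp
  qed
qed

text \<open>The smooth mean value property at one scale that suits all points of the smaller disc.\<close>

lemma holomorphic_local_bound:
  assumes R: "0 < R" "R < 1"
  shows "\<exists>c\<ge>0. \<forall>G w. G holomorphic_on disc \<longrightarrow> integrable LD G \<longrightarrow> cmod w \<le> R \<longrightarrow> cmod (G w) \<le> c * (LINT z|LD. cmod (G z))"
proof -
  define a where "a = 2 / (1 - R)\<^sup>2"
  have a: "a > 0" using R by (simp add: a_def)
  have a1: "1 / (1 - R)\<^sup>2 < a" unfolding a_def using R by (intro divide_strict_right_mono) auto
  show ?thesis
  proof (intro exI[of _ "a / bump_mass"] conjI allI impI)
    show "0 \<le> a / bump_mass" using a bump_mass_pos by simp
    fix G w assume G: "G holomorphic_on disc" "integrable LD G" and w: "cmod w \<le> R"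
    have w1: "cmod w < 1" using w R by simp
    have "of_real bump_mass * G w = mollify G a w"
      by (rule mollify_holomorphic[OF G w1 norm_le_imp_scale[OF R w a1], symmetric])
    then have "bump_mass * cmod (G w) = cmod (mollify G a w)"
      using bump_mass_pos by (metis abs_of_pos norm_mult norm_of_real)
    also have "\<dots> \<le> a * (LINT z|LD. cmod (G z))"
      unfolding mollify_def
    proof (rule norm_integral_times_le[OF G(2)])
      show "(\<lambda>z. of_real a * bump a w z) \<in> borel_measurable LD" by (intro borel_measurable_LD) measurable
      show "cmod (of_real a * bump a w z) \<le> a" for z
        using norm_bump_le[of a w z] a by (simp add: norm_mult)
    qed
    finally show "cmod (G w) \<le> a / bump_mass * (LINT z|LD. cmod (G z))"
      using bump_mass_pos by (simp add: field_simps)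
  qed
qed

lemma hardy_L1_bound:
  assumes "G \<in> borel_measurable LD" "p > 1" "hardy_sup p G \<le> ennreal M" "M \<ge> 0"
  shows "integrable LD G" "(LINT z|LD. cmod (G z)) \<le> near_const p M * 3 powr (1 - 1 / p)"
proof -
  have adm: "admissible G (near_const p M * 3 powr (1 - 1 / p))" by (rule admissible_hardy[OF assms])
  then show i: "integrable LD G" by (rule admissible_L1)
  have "ennreal (LINT z|LD. cmod (G z)) = (\<integral>\<^sup>+z. ennreal (cmod (G z)) \<partial>LD)"
    by (rule nn_integral_eq_integral[symmetric]) (use integrable_norm[OF i] in auto)
  also have "\<dots> \<le> ennreal (near_const p M * 3 powr (1 - 1 / p))" by (rule admissible_L1(2)[OF adm])
  finally show "(LINT z|LD. cmod (G z)) \<le> near_const p M * 3 powr (1 - 1 / p)"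
    using adm by (subst (asm) ennreal_le_iff) (auto simp: admissible_def)
qed

section \<open>Convergence in the Hardy norm\<close>

definition vanishing :: "(nat \<Rightarrow> ennreal) \<Rightarrow> bool" where
  "vanishing x \<longleftrightarrow> (\<forall>e>0. \<forall>\<^sub>F n in sequentially. x n \<le> ennreal e)"

lemma hardy_norm_tendsto_imp_vanishing:
  assumes p: "p > 0" and fin: "\<And>n. hardy_sup p (u n) < \<infinity>" and lim: "(\<lambda>n. hardy_norm p (u n)) \<longlonglongrightarrow> 0"
  shows "vanishing (\<lambda>n. hardy_sup p (u n))"
  unfolding vanishing_def
proof (intro allI impI)
  fix e :: real assume e: "e > 0"
  have "e powr (1 / p) > 0" using e by simp
  from order_tendstoD(2)[OF lim this] show "\<forall>\<^sub>F n in sequentially. hardy_sup p (u n) \<le> ennreal e"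
  proof eventually_elim
    fix n assume "hardy_norm p (u n) < e powr (1 / p)"
    then have "enn2real (hardy_sup p (u n)) powr (1 / p) < e powr (1 / p)" by (simp add: hardy_norm_def)
    then have "enn2real (hardy_sup p (u n)) < e"
      by (metis e enn2real_nonneg less_imp_le not_less p powr_mono2 zero_less_divide_1_iff)
    then show "hardy_sup p (u n) \<le> ennreal e"
      using fin[of n] e by (metis ennreal_enn2real ennreal_leI infinity_ennreal_def less_imp_le)
  qed
qed

lemma vanishing_imp_hardy_norm_tendsto:
  assumes p: "p > 0" and v: "vanishing (\<lambda>n. hardy_sup p (u n))"
  shows "(\<lambda>n. hardy_norm p (u n)) \<longlonglongrightarrow> 0"
proof (rule order_tendstoI)
  fix a :: real assume "a < 0"
  then show "\<forall>\<^sub>F n in sequentially. a < hardy_norm p (u n)"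
    by (intro always_eventually allI) (simp add: hardy_norm_def less_le_trans[OF _ powr_ge_zero])
next
  fix a :: real assume a: "0 < a"
  define e where "e = (a / 2) powr p"
  have e: "e > 0" using a by (simp add: e_def)
  have "\<forall>\<^sub>F n in sequentially. hardy_sup p (u n) \<le> ennreal e" using v e by (simp add: vanishing_def)
  then show "\<forall>\<^sub>F n in sequentially. hardy_norm p (u n) < a"
  proof eventually_elim
    fix n assume "hardy_sup p (u n) \<le> ennreal e"
    then have "enn2real (hardy_sup p (u n)) \<le> e"
      using e by (metis enn2real_ennreal enn2real_mono ennreal_less_top less_imp_le)
    then have "hardy_norm p (u n) \<le> e powr (1 / p)"
      unfolding hardy_norm_def using p by (intro powr_mono2) auto
    also have "\<dots> = a / 2" using a p by (simp add: e_def powr_powr)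
    finally show "hardy_norm p (u n) < a" using a by simp
  qed
qed

text \<open>A norm limit must be the pointwise limit: the sequence is Cauchy, and Fatou's lemma passes to the limit
  in one index.\<close>

lemma vanishing_pointwise_limit:
  assumes p: "p > 0" and m: "\<And>n. u n \<in> borel_measurable LD" "y \<in> borel_measurable LD" "v \<in> borel_measurable LD"
    and lim: "\<And>z. z \<in> disc \<Longrightarrow> (\<lambda>n. u n z) \<longlonglongrightarrow> v z" and van: "vanishing (\<lambda>n. hardy_sup p (\<lambda>z. u n z - y z))"
  shows "vanishing (\<lambda>n. hardy_sup p (\<lambda>z. u n z - v z))"
  unfolding vanishing_def
proof (intro allI impI)
  fix e :: real assume e: "e > 0"
  define d where "d = e / (2 * 2 powr p)"
  have d: "d > 0" using e by (simp add: d_def)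
  obtain n0 where n0: "\<And>n. n \<ge> n0 \<Longrightarrow> hardy_sup p (\<lambda>z. u n z - y z) \<le> ennreal d"
    using van d unfolding vanishing_def eventually_sequentially by blast
  show "\<forall>\<^sub>F n in sequentially. hardy_sup p (\<lambda>z. u n z - v z) \<le> ennreal e"
    using eventually_ge_at_top[of n0]
  proof eventually_elim
    fix n assume n: "n \<ge> n0"
    show "hardy_sup p (\<lambda>z. u n z - v z) \<le> ennreal e"
    proof (rule hardy_sup_Fatou[where f = "\<lambda>k z. u n z - u (k + n0) z", OF _ _ p])
      show "(\<lambda>z. u n z - u (k + n0) z) \<in> borel_measurable LD" "(\<lambda>z. u n z - v z) \<in> borel_measurable LD" for k
        using m by measurable
      show "AE z in LD. (\<lambda>k. u n z - u (k + n0) z) \<longlonglongrightarrow> u n z - v z"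
        by (intro AE_I2 tendsto_diff tendsto_const LIMSEQ_ignore_initial_segment lim) simp
      fix k
      have "hardy_sup p (\<lambda>z. u n z - u (k + n0) z) \<le> ennreal (2 powr p) * (hardy_sup p (\<lambda>z. u n z - y z) + hardy_sup p (\<lambda>z. u (k + n0) z - y z))"
      proof (rule hardy_sup_triangle[OF _ _ _ p])
        show "AE z in LD. cmod (u n z - u (k + n0) z) \<le> cmod (u n z - y z) + cmod (u (k + n0) z - y z)"
          using norm_triangle_ineq4[of "u n z - y z" "u (k + n0) z - y z" for z] by (intro AE_I2) simp
      qed (use m in measurable)
      also have "\<dots> \<le> ennreal (2 powr p) * (ennreal d + ennreal d)"
        by (intro mult_left_mono add_mono n0 n) auto
      also have "\<dots> = ennreal (2 powr p * (d + d))" using d by (simp add: ennreal_mult[symmetric] ennreal_plus[symmetric] del: ennreal_plus)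
      also have "2 powr p * (d + d) = e" by (simp add: d_def)
      finally show "hardy_sup p (\<lambda>z. u n z - u (k + n0) z) \<le> ennreal e" .
    qed
  qed
qed

text \<open>Convergence in norm is inherited from \<open>v\<close> by a sequence that it controls up to uniformly small errors.\<close>

lemma vanishing_dominated:
  assumes p: "p > 0" and c: "c > 0" and m: "\<And>n. u n \<in> borel_measurable LD" "\<And>n. v n \<in> borel_measurable LD"
    and h: "\<And>e. e > 0 \<Longrightarrow> \<forall>\<^sub>F n in sequentially. \<forall>z\<in>disc. cmod (h n z) \<le> e"
    and le: "\<And>n z. z \<in> disc \<Longrightarrow> cmod (u n z) \<le> c * (cmod (v n z) + cmod (h n z :: complex))"
    and van: "vanishing (\<lambda>n. hardy_sup p (v n))"
  shows "vanishing (\<lambda>n. hardy_sup p (u n))"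
  unfolding vanishing_def
proof (intro allI impI)
  fix e :: real assume e: "e > 0"
  define d where "d = e / (2 * 2 powr p * c powr p)"
  have d: "d > 0" using e c by (simp add: d_def)
  define \<delta> where "\<delta> = d powr (1 / p)"
  have \<delta>: "\<delta> > 0" using d by (simp add: \<delta>_def)
  have "\<forall>\<^sub>F n in sequentially. hardy_sup p (v n) \<le> ennreal d" using van d by (simp add: vanishing_def)
  with h[OF \<delta>] show "\<forall>\<^sub>F n in sequentially. hardy_sup p (u n) \<le> ennreal e"
  proof eventually_elim
    fix n assume hn: "\<forall>z\<in>disc. cmod (h n z) \<le> \<delta>" and vn: "hardy_sup p (v n) \<le> ennreal d"
    let ?w = "\<lambda>z. complex_of_real (c * (cmod (v n z) + \<delta>))"
    have [measurable]: "(\<lambda>z. cmod (v n z)) \<in> borel_measurable LD" using m(2)[of n] by measurable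
    have wm: "(\<lambda>z. complex_of_real (cmod (v n z) + \<delta>)) \<in> borel_measurable LD"
    proof (rule measurable_compose[of "\<lambda>z. cmod (v n z) + \<delta>" LD borel complex_of_real borel])
      show "(\<lambda>z. cmod (v n z) + \<delta>) \<in> borel_measurable LD" by measurable
      show "complex_of_real \<in> borel_measurable borel"
        by (intro borel_measurable_continuous_onI continuous_intros)
    qed
    have "hardy_sup p (u n) \<le> ennreal (c powr p) * hardy_sup p (\<lambda>z. complex_of_real (cmod (v n z) + \<delta>))"
    proof (rule hardy_sup_scaled[OF m(1) wm p c], rule AE_I2)
      fix z assume "z \<in> space LD"
      then have z: "z \<in> disc" by simp
      have "cmod (u n z) \<le> c * (cmod (v n z) + cmod (h n z))" by (rule le[OF z])
      also have "\<dots> \<le> c * (cmod (v n z) + \<delta>)" using hn z c by (intro mult_left_mono add_left_mono) auto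
      also have "cmod (v n z) + \<delta> = cmod (complex_of_real (cmod (v n z) + \<delta>))"
        using \<delta> by (simp only: norm_of_real) simp
      finally show "cmod (u n z) \<le> c * cmod (complex_of_real (cmod (v n z) + \<delta>))" .
    qed
    also have "\<dots> \<le> ennreal (c powr p) * (ennreal (2 powr p) * (hardy_sup p (v n) + hardy_sup p (\<lambda>_. of_real \<delta>)))"
    proof (intro mult_left_mono hardy_sup_triangle[OF wm m(2) _ p])
      show "AE z in LD. cmod (complex_of_real (cmod (v n z) + \<delta>)) \<le> cmod (v n z) + cmod (complex_of_real \<delta>)"
        using \<delta> by (intro AE_I2) (simp only: norm_of_real, simp)
    qed auto
    also have "\<dots> \<le> ennreal (c powr p) * (ennreal (2 powr p) * (ennreal d + ennreal (\<delta> powr p)))"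
      by (intro mult_left_mono add_mono vn hardy_sup_bounded[OF _ p]) (use \<delta> in auto)
    also have "\<delta> powr p = d" using d p by (simp add: \<delta>_def powr_powr)
    also have "ennreal (c powr p) * (ennreal (2 powr p) * (ennreal d + ennreal d)) = ennreal (c powr p * (2 powr p * (d + d)))"
      using d by (simp add: ennreal_mult[symmetric] ennreal_plus[symmetric] del: ennreal_plus)
    also have "c powr p * (2 powr p * (d + d)) = e" using c by (simp add: d_def)
    finally show "hardy_sup p (u n) \<le> ennreal e" .
  qed
qed

section \<open>Normal families and composition\<close>

context beltrami
begin

lemma continuous_hardy_linked:
  assumes f: "f \<in> hardy_space p \<nu>" "continuous_on disc f" and l: "l \<ge> 0"
  shows "\<exists>G. linked l f G"
proof -
  obtain g G where lk: "linked l g G" and ae: "AE z in LD. f z = g z"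
    by (rule hardy_space_imp_linked[OF f(1) l], rule that)
  have eq: "f z = g z" if "z \<in> disc" for z
    by (rule AE_LD_continuous_imp[OF f(2) linkedD(2)[OF lk] ae that])
  have "T l (source f) z = T l (source g) z" for z
    unfolding T_def by (intro Bochner_Integration.integral_cong refl) (simp add: source_def eq)
  moreover have "twist f z = twist g z" if "z \<in> disc" for z using eq[OF that] by (simp add: twist_def)
  moreover have "hardy_sup p f < \<infinity>" using f(1) by (simp add: hardy_space_def)
  ultimately have "linked l f G"
    using lk f(2) unfolding linked_def by simp
  then show ?thesis by blast
qed

text \<open>On the support of a test function the convergence is dominated by a constant.\<close>

lemma weak_dbar_limit:
  assumes f: "\<And>n. f n \<in> borel_measurable LD" "f' \<in> borel_measurable LD" "\<And>n. weak_dbar (twist (f n)) (source (f n))"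
    and lim: "\<And>z. z \<in> disc \<Longrightarrow> (\<lambda>n. f n z) \<longlonglongrightarrow> f' z"
    and bd: "\<And>K. compact K \<Longrightarrow> K \<subseteq> disc \<Longrightarrow> \<exists>b\<ge>0. \<forall>n. \<forall>z\<in>K. cmod (f n z) \<le> b"
  shows "weak_dbar (twist f') (source f')"
  unfolding weak_dbar_def
proof
  fix \<psi> assume \<psi>: "\<psi> \<in> test_functions"
  obtain A K where A: "A > 0" "\<And>z. z \<in> disc \<Longrightarrow> cmod (\<psi> z) \<le> A" "\<And>z. z \<in> disc \<Longrightarrow> cmod (dbar \<psi> z) \<le> A"
    "compact K" "K \<subseteq> disc" "\<And>z. z \<notin> K \<Longrightarrow> \<psi> z = 0" "\<And>z. z \<notin> K \<Longrightarrow> dbar \<psi> z = 0"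
    by (rule test_function_bounded[OF \<psi>], rule that)
  obtain b where b: "b \<ge> 0" "\<forall>n. \<forall>z\<in>K. cmod (f n z) \<le> b" using bd[OF A(4,5)] by blast
  note m = test_function_measurable[OF \<psi>]
  have 1: "(\<lambda>n. LINT z|LD. twist (f n) z * dbar \<psi> z) \<longlonglongrightarrow> (LINT z|LD. twist f' z * dbar \<psi> z)"
  proof (rule integral_dominated_convergence[where w = "\<lambda>_. 2 * b * A"])
    show "(\<lambda>z. twist f' z * dbar \<psi> z) \<in> borel_measurable LD" "(\<lambda>z. twist (f n) z * dbar \<psi> z) \<in> borel_measurable LD" for n
      by (intro borel_measurable_times twist_measurable f m)+
    show "AE z in LD. (\<lambda>n. twist (f n) z * dbar \<psi> z) \<longlonglongrightarrow> twist f' z * dbar \<psi> z"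
      unfolding twist_def by (intro AE_I2 tendsto_intros lim) simp_all
    show "AE z in LD. norm (twist (f n) z * dbar \<psi> z) \<le> 2 * b * A" for n
    proof (rule AE_I2)
      fix z assume "z \<in> space LD"
      then have z: "z \<in> disc" by simp
      show "norm (twist (f n) z * dbar \<psi> z) \<le> 2 * b * A"
      proof (cases "z \<in> K")
        case True
        then have "cmod (f n z) \<le> b" using b(2) by blast
        then have "cmod (twist (f n) z) \<le> 2 * b" using norm_twist_le[OF z, of "f n"] by linarith
        then show ?thesis unfolding norm_mult using A(3)[OF z] b(1) by (intro mult_mono) auto
      qed (use A b in simp)
    qed
  qed simp
  have 2: "(\<lambda>n. LINT z|LD. source (f n) z * \<psi> z) \<longlonglongrightarrow> (LINT z|LD. source f' z * \<psi> z)"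
  proof (rule integral_dominated_convergence[where w = "\<lambda>_. B * b * A"])
    show "(\<lambda>z. source f' z * \<psi> z) \<in> borel_measurable LD" "(\<lambda>z. source (f n) z * \<psi> z) \<in> borel_measurable LD" for n
      by (intro borel_measurable_times source_measurable f m)+
    show "AE z in LD. (\<lambda>n. source (f n) z * \<psi> z) \<longlonglongrightarrow> source f' z * \<psi> z"
      unfolding source_def by (intro AE_I2 tendsto_intros lim) simp_all
    show "AE z in LD. norm (source (f n) z * \<psi> z) \<le> B * b * A" for n
    proof (rule AE_I2)
      fix z assume "z \<in> space LD"
      then have z: "z \<in> disc" by simp
      show "norm (source (f n) z * \<psi> z) \<le> B * b * A"
      proof (cases "z \<in> K")
        case True
        then have "B * cmod (f n z) \<le> B * b" using b(2) B_pos by (intro mult_left_mono) auto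
        then have "cmod (source (f n) z) \<le> B * b" using norm_source_le[of "f n" z] by linarith
        then show ?thesis unfolding norm_mult using A(2)[OF z] b(1) B_pos by (intro mult_mono) auto
      qed (use A b B_pos in simp)
    qed
  qed simp
  have "(\<lambda>n. LINT z|LD. twist (f n) z * dbar \<psi> z) \<longlonglongrightarrow> - (LINT z|LD. source f' z * \<psi> z)"
    using tendsto_minus[OF 2] weak_dbarD[OF f(3) \<psi>] by simp
  with 1 show "(LINT z|LD. twist f' z * dbar \<psi> z) = - (LINT z|LD. source f' z * \<psi> z)"
    by (rule LIMSEQ_unique)
qed

text \<open>The Cauchy transform maps bounded sets of the Hardy space to bounded equicontinuous families on the closed disc,
  so the Arzela-Ascoli theorem applies.\<close>

lemma linked_T_limit:
  assumes l: "l \<ge> 0" and lk: "\<And>n. linked l (f n) (G n)" and M: "\<And>n. hardy_sup p (f n) \<le> ennreal M" "M \<ge> 0"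
  shows "\<exists>r h. strict_mono (r :: nat \<Rightarrow> nat) \<and> continuous_on disc h \<and>
    (\<forall>z\<in>disc. cmod (h z) \<le> exp (2 * l) * cadm M) \<and>
    (\<forall>e>0. \<forall>\<^sub>F n in sequentially. \<forall>z\<in>disc. cmod (T l (source (f (r n))) z - h z) \<le> e)"
proof -
  have Mb: "B powr p * M \<ge> 0" using M by simp
  have eq: "\<exists>d>0. \<forall>n y. y \<in> cball 0 1 \<and> norm (x - y) < d \<longrightarrow> norm (T l (source (f n)) x - T l (source (f n)) y) < e"
    if x: "x \<in> cball 0 1" and e: "0 < e" for x e
  proof -
    obtain d where d: "d > 0" "\<And>h z z'. h \<in> borel_measurable LD \<Longrightarrow> hardy_sup p h \<le> ennreal (B powr p * M) \<Longrightarrow>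
     cmod z \<le> 1 \<Longrightarrow> cmod z' \<le> 1 \<Longrightarrow> cmod (z - z') < d \<Longrightarrow> cmod (T l h z - T l h z') < e"
      by (rule T_equicontinuous[OF p l Mb e], rule that)
    have s: "source (f n) \<in> borel_measurable LD" "hardy_sup p (source (f n)) \<le> ennreal (B powr p * M)" for n
      using source_measurable[OF linkedD(6)[OF lk]] hardy_source[OF linkedD(6)[OF lk] M] by simp_all
    show ?thesis
    proof (intro exI[of _ d] conjI d(1) allI impI)
      fix n y assume "y \<in> cball 0 1 \<and> norm (x - y) < d"
      then show "norm (T l (source (f n)) x - T l (source (f n)) y) < e"
        using d(2)[OF s(1)[of n] s(2)[of n], of x y] x by simp
    qed
  qed
  have bd: "norm (T l (source (f n)) x) \<le> exp (2 * l) * cadm M" if "x \<in> cball 0 1" for n x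
    using linked_T_bound[OF lk l M, of x n] that by simp
  obtain h and r :: "nat \<Rightarrow> nat" where h: "continuous_on (cball 0 1) h" "strict_mono r"
    "\<And>e. 0 < e \<Longrightarrow> \<exists>N. \<forall>n x. n \<ge> N \<and> x \<in> cball 0 1 \<longrightarrow> norm (T l (source (f (r n))) x - h x) < e"
    by (rule Arzela_Ascoli[of "cball 0 1" "\<lambda>n. T l (source (f n))", OF compact_cball bd eq], assumption, assumption, assumption, rule that)
  have u: "\<forall>\<^sub>F n in sequentially. \<forall>z\<in>disc. cmod (T l (source (f (r n))) z - h z) \<le> e" if "e > 0" for e
  proof -
    obtain n0 where "\<forall>n x. n \<ge> n0 \<and> x \<in> cball 0 1 \<longrightarrow> norm (T l (source (f (r n))) x - h x) < e" using h(3)[OF \<open>e > 0\<close>] by blast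
    then show ?thesis unfolding eventually_sequentially by (intro exI[of _ n0]) (auto intro!: less_imp_le)
  qed
  have "cmod (h z) \<le> exp (2 * l) * cadm M" if z: "z \<in> disc" for z
  proof (rule Lim_norm_ubound[OF trivial_limit_sequentially, of "\<lambda>n. T l (source (f (r n))) z"])
    show "(\<lambda>n. T l (source (f (r n))) z) \<longlonglongrightarrow> h z"
    proof (rule LIMSEQ_I)
      fix e :: real assume "0 < e"
      from h(3)[OF this] show "\<exists>no. \<forall>n\<ge>no. norm (T l (source (f (r n))) z - h z) < e" using z by force
    qed
    show "\<forall>\<^sub>F n in sequentially. norm (T l (source (f (r n))) z) \<le> exp (2 * l) * cadm M"
      using bd z by (intro always_eventually) simp
  qed
  moreover have "continuous_on disc h" by (rule continuous_on_subset[OF h(1)]) auto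
  ultimately show ?thesis using h(2) u by blast
qed

text \<open>Montel's theorem for the analytic parts, together with uniform convergence of the Cauchy transforms, gives
  pointwise convergence of the solutions; Fatou's lemma keeps the limits in the Hardy spaces.\<close>

lemma linked_subsequence:
  assumes l: "l \<ge> 0" and lk: "\<And>n. linked l (f n) (G n)" and M: "\<And>n. hardy_sup p (f n) \<le> ennreal M" "M \<ge> 0"
  shows "\<exists>r h G' f'. strict_mono (r :: nat \<Rightarrow> nat) \<and> continuous_on disc h \<and>
    (\<forall>z\<in>disc. cmod (h z) \<le> exp (2 * l) * cadm M) \<and>
    (\<forall>e>0. \<forall>\<^sub>F n in sequentially. \<forall>z\<in>disc. cmod (T l (source (f (r n))) z - h z) \<le> e) \<and>
    G' holomorphic_on disc \<and> hardy_sup p G' < \<infinity> \<and> (\<forall>z\<in>disc. (\<lambda>n. G (r n) z) \<longlonglongrightarrow> G' z) \<and>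
    f' \<in> hardy_space p \<nu> \<and> continuous_on disc f' \<and> (\<forall>z\<in>disc. (\<lambda>n. f (r n) z) \<longlonglongrightarrow> f' z) \<and>
    (\<forall>z\<in>disc. twist f' z = G' z + h z)"
proof -
  let ?C = "exp (2 * l) * cadm M"
  let ?M = "2 powr p * (2 powr p * M + ?C powr p)"
  have M0: "?M \<ge> 0" using M(2) by simp
  have GM: "hardy_sup p (G n) \<le> ennreal ?M" for n by (rule analytic_part_hardy[OF lk l M])
  let ?L = "near_const p ?M * 3 powr (1 - 1 / p)"
  have Gb: "\<exists>b\<ge>0. \<forall>n. \<forall>z\<in>K. cmod (G n z) \<le> b" if K: "compact K" "K \<subseteq> disc" for K
  proof -
    obtain R where R: "0 < R" "R < 1" "K \<subseteq> cball 0 R"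
      by (rule compact_in_disc[OF K], rule that) 
    obtain c where c: "c \<ge> 0" "\<forall>G w. G holomorphic_on disc \<longrightarrow> integrable LD G \<longrightarrow> cmod w \<le> R \<longrightarrow> cmod (G w) \<le> c * (LINT z|LD. cmod (G z))"
      using holomorphic_local_bound[OF R(1,2)] by blast
    have "cmod (G n z) \<le> c * \<bar>?L\<bar>" if "z \<in> K" for n z
    proof -
      note L = hardy_L1_bound[OF linkedD(7)[OF lk[of n]] p GM M0]
      have "cmod z \<le> R" using that R(3) by auto
      then have "cmod (G n z) \<le> c * (LINT z|LD. cmod (G n z))" using c(2) linkedD(1)[OF lk] L(1) by blast
      also have "\<dots> \<le> c * \<bar>?L\<bar>" using c(1) order_trans[OF L(2) abs_ge_self] by (intro mult_left_mono)
      finally show ?thesis .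
    qed
    moreover have "c * \<bar>?L\<bar> \<ge> 0" using c(1) by simp
    ultimately show ?thesis by blast
  qed
  obtain r1 h where r1: "strict_mono (r1 :: nat \<Rightarrow> nat)" "continuous_on disc h" "\<forall>z\<in>disc. cmod (h z) \<le> ?C"
    "\<forall>e>0. \<forall>\<^sub>F n in sequentially. \<forall>z\<in>disc. cmod (T l (source (f (r1 n))) z - h z) \<le> e"
    using linked_T_limit[where f = f and G = G, OF l lk M] by blast
  obtain G' and r2 :: "nat \<Rightarrow> nat" where G': "G' holomorphic_on disc" "strict_mono r2" "\<And>z. z \<in> disc \<Longrightarrow> (\<lambda>n. G (r1 (r2 n)) z) \<longlonglongrightarrow> G' z"
  proof (rule Montel[of disc "range G" "\<lambda>n. G (r1 n)"])
    show "\<exists>B. \<forall>h\<in>range G. \<forall>z\<in>K. norm (h z) \<le> B" if "compact K" "K \<subseteq> disc" for K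
      using Gb[OF that] by blast
    show "h holomorphic_on disc" if "h \<in> range G" for h using that linkedD(1)[OF lk] by auto
  qed (auto intro: that)
  define r where "r = r1 \<circ> r2"
  have r: "strict_mono r" unfolding r_def by (rule strict_mono_o[OF r1(1) G'(2)])
  have rG: "(\<lambda>n. G (r n) z) \<longlonglongrightarrow> G' z" if "z \<in> disc" for z using G'(3)[OF that] by (simp add: r_def)
  have ru: "\<forall>\<^sub>F n in sequentially. \<forall>z\<in>disc. cmod (T l (source (f (r n))) z - h z) \<le> e" if "e > 0" for e
    using eventually_subseq[OF G'(2) r1(4)[rule_format, OF that]] by (simp add: r_def)
  have rT: "(\<lambda>n. T l (source (f (r n))) z) \<longlonglongrightarrow> h z" if z: "z \<in> disc" for z
  proof (rule tendstoI)
    fix e :: real assume "e > 0"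
    then have "\<forall>\<^sub>F n in sequentially. \<forall>z\<in>disc. cmod (T l (source (f (r n))) z - h z) \<le> e / 2" by (intro ru) simp
    then show "\<forall>\<^sub>F n in sequentially. dist (T l (source (f (r n))) z) (h z) < e"
      by eventually_elim (use z \<open>e > 0\<close> in \<open>force simp: dist_norm\<close>)
  qed
  define f' where "f' = untwist (\<lambda>z. G' z + h z)"
  have f'c: "continuous_on disc f'"
    unfolding f'_def by (intro untwist_continuous continuous_intros r1(2) holomorphic_on_imp_continuous_on[OF G'(1)])
  have f'm: "f' \<in> borel_measurable LD" by (rule continuous_imp_measurable_LD[OF f'c])
  have fu: "f n z = untwist (\<lambda>z. G n z + T l (source (f n)) z) z" if "z \<in> disc" for n z
    by (rule untwist_unique[where g = "\<lambda>z. G n z + T l (source (f n)) z", OF that linkedD(5)[OF lk that]])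
  have rf: "(\<lambda>n. f (r n) z) \<longlonglongrightarrow> f' z" if z: "z \<in> disc" for z
  proof -
    have "of_real (1 - (\<nu> z)\<^sup>2) \<noteq> (0::complex)" using nu_sq[OF z] by (metis less_irrefl of_real_eq_0_iff)
    then show ?thesis
      unfolding fu[OF z] f'_def untwist_def by (intro tendsto_intros rG rT z)
  qed
  have f'M: "hardy_sup p f' \<le> ennreal M"
    by (rule hardy_sup_Fatou[where f = "\<lambda>n. f (r n)", OF linkedD(6)[OF lk] f'm]) (use p M rf in \<open>auto intro!: AE_I2\<close>)
  have G'M: "hardy_sup p G' \<le> ennreal ?M"
    by (rule hardy_sup_Fatou[where f = "\<lambda>n. G (r n)", OF linkedD(7)[OF lk] continuous_imp_measurable_LD[OF holomorphic_on_imp_continuous_on[OF G'(1)]]])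
       (use p GM rG in \<open>auto intro!: AE_I2\<close>)
  have "weak_dbar (twist f') (source f')"
  proof (rule weak_dbar_limit[where f = "\<lambda>n. f (r n)"])
    show "weak_dbar (twist (f (r n))) (source (f (r n)))" for n
      using linked_imp_hardy_space[OF lk l] by (simp add: hardy_space_iff)
    fix K :: "complex set" assume K: "compact K" "K \<subseteq> disc"
    obtain b where b: "b \<ge> 0" "\<forall>n. \<forall>z\<in>K. cmod (G n z) \<le> b" using Gb[OF K] by blast
    show "\<exists>b\<ge>0. \<forall>n. \<forall>z\<in>K. cmod (f (r n) z) \<le> b"
    proof (intro exI[of _ "(b + ?C) / (1 - \<kappa>)"] conjI allI ballI)
      show "0 \<le> (b + ?C) / (1 - \<kappa>)" using b(1) kappa cadm_nonneg[OF M(2)] by simp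
      fix n z assume z: "z \<in> K"
      have zd: "z \<in> disc" using K(2) z by blast
      have "cmod (f (r n) z) \<le> (cmod (G (r n) z) + cmod (T l (source (f (r n))) z)) / (1 - \<kappa>)"
        by (rule norm_le_analytic_part[OF lk zd])
      also have "\<dots> \<le> (b + ?C) / (1 - \<kappa>)"
        using kappa b(2) z zd by (intro divide_right_mono add_mono linked_T_bound[OF lk l M]) auto
      finally show "cmod (f (r n) z) \<le> (b + ?C) / (1 - \<kappa>)" .
    qed
  qed (use linkedD(6)[OF lk] f'm rf in auto)
  then have "f' \<in> hardy_space p \<nu>"
    using f'm f'M by (auto simp: hardy_space_iff intro: le_less_trans)
  moreover have "\<forall>z\<in>disc. twist f' z = G' z + h z"
    unfolding f'_def by (simp add: twist_untwist)
  moreover have "hardy_sup p G' < \<infinity>" using G'M by (auto intro: le_less_trans)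
  ultimately show ?thesis
    using r r1(2,3) ru G'(1) rG f'c rf by blast
qed

text \<open>Both \<open>\<nu>\<close> and \<open>twist f\<close> are the sum of a holomorphic function and a Cauchy transform. The chain rule multiplies
  their \<open>dbar\<close> derivatives by the same factor \<open>cnj (deriv \<phi>)\<close>, which the derivative of the new coefficient absorbs.\<close>

lemma hardy_space_compose:
  assumes \<phi>: "\<phi> holomorphic_on disc" "\<phi> ` disc \<subseteq> disc" and C: "C > 0" "\<And>z. z \<in> disc \<Longrightarrow> cmod (deriv \<phi> z) \<le> C"
    and f: "f \<in> hardy_space p \<nu>" "continuous_on disc f" and fin: "hardy_sup p (\<lambda>z. f (\<phi> z)) < \<infinity>"
  shows "(\<lambda>z. f (\<phi> z)) \<in> hardy_space p (\<lambda>z. \<nu> (\<phi> z))"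
proof -
  have \<phi>d: "\<phi> z \<in> disc" if "z \<in> disc" for z using \<phi>(2) that by blast
  have \<phi>c: "continuous_on disc \<phi>" by (rule holomorphic_on_imp_continuous_on[OF \<phi>(1)])
  have dc: "continuous_on disc (deriv \<phi>)"
    by (intro holomorphic_on_imp_continuous_on holomorphic_deriv \<phi>(1)) simp
  have comp: "continuous_on disc (\<lambda>z. g (\<phi> z))" if "continuous_on disc g" for g :: "complex \<Rightarrow> 'b::topological_space"
    by (rule continuous_on_compose2[OF that \<phi>c \<phi>(2)])
  \<comment> \<open>extension by zero turns continuous functions on the disc into Borel functions on the plane\<close>
  define \<phi>' where "\<phi>' = (\<lambda>z. if z \<in> disc then \<phi> z else 0)"
  define D where "D = (\<lambda>z. if z \<in> disc then deriv \<phi> z else 0)"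
  define N' where "N' = (\<lambda>z. N (\<phi>' z) * cnj (D z))"
  have m: "\<phi>' \<in> borel_measurable borel" "D \<in> borel_measurable borel"
    unfolding \<phi>'_def D_def by (intro borel_measurable_continuous_on_if \<phi>c dc continuous_intros; simp)+
  have N'm: "N' \<in> borel_measurable borel"
    unfolding N'_def by (intro borel_measurable_times borel_measurable_cnj m measurable_compose[OF m(1) N_meas])
  have N'le: "cmod (N' z) \<le> B * C" for z
    unfolding N'_def norm_mult using N_le C B_pos by (intro mult_mono) (auto simp: D_def)
  have N'eq: "N' z = N (\<phi> z) * cnj (deriv \<phi> z)" if "z \<in> disc" for z using that by (simp add: N'_def \<phi>'_def D_def)
  have \<phi>m: "\<phi> \<in> borel_measurable LD" by (rule continuous_imp_measurable_LD[OF \<phi>c])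
  have N\<phi>: "(\<lambda>z. N (\<phi> z)) \<in> borel_measurable LD" by (rule measurable_compose[OF \<phi>m N_meas])
  have weak': "weak_dbar (\<lambda>z. of_real (\<nu> (\<phi> z))) N'"
  proof -
    have nui: "integrable LD (\<lambda>z. complex_of_real (\<nu> z))"
      by (rule integrable_LD_bounded[OF of_real_nu_measurable(1), of \<kappa>]) (use nu_le in simp)
    have B0: "B \<ge> 0" using B_pos by simp
    have adm: "admissible N (near_const 2 (B powr 2) * 3 powr (1 - 1 / 2))"
      by (rule bounded_admissible[OF N_measurable B0 N_le])
    obtain G where G: "G holomorphic_on disc" "AE z in LD. complex_of_real (\<nu> z) = G z + T 0 N z"
      by (rule weak_dbar_representation[OF nui weak_nu adm order_refl], rule that)
    have Tc: "continuous_on disc (T 0 N)"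
      by (rule continuous_on_subset[OF bounded_T_continuous[OF N_measurable B0 N_le order_refl]]) auto
    have eq: "complex_of_real (\<nu> z) = G z + T 0 N z" if "z \<in> disc" for z
      by (rule AE_LD_continuous_imp[OF _ _ G(2) that])
         (intro continuous_intros nu_cont Tc holomorphic_on_imp_continuous_on[OF G(1)])+
    have lb: "locally_bounded N" unfolding locally_bounded_def using B0 N_le by blast
    have "weak_dbar (\<lambda>z. complex_of_real (\<nu> (\<phi> z))) (\<lambda>z. N (\<phi> z) * cnj (deriv \<phi> z))"
      by (rule weak_chain_rule[where u = "\<lambda>z. complex_of_real (\<nu> z)", OF eq G(1) adm lb Tc order_refl \<phi> N\<phi>])
    then show ?thesis by (rule weak_dbar_cong) (simp_all add: N'eq)
  qed
  interpret C: beltrami p \<kappa> "B * C" "\<lambda>z. \<nu> (\<phi> z)" N'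
    by unfold_locales (use p kappa comp[OF nu_cont] nu_le \<phi>d N'm N'le B_pos C(1) weak' in auto)
  have fc: "continuous_on disc (\<lambda>z. f (\<phi> z))" by (rule comp[OF f(2)])
  have fm: "(\<lambda>z. f (\<phi> z)) \<in> borel_measurable LD" by (rule continuous_imp_measurable_LD[OF fc])
  have l0: "(0::real) \<le> 0" by simp
  obtain G where lk: "linked 0 f G" using continuous_hardy_linked[OF f l0] by blast
  obtain M where M: "M \<ge> 0" "hardy_sup p f = ennreal M" using linkedD(3)[OF lk] by (cases "hardy_sup p f") auto
  have sup: "hardy_sup p f \<le> ennreal M" by (simp add: M)
  have Tc: "continuous_on disc (T 0 (source f))"
    by (rule continuous_on_subset[OF T_source_continuous[OF linkedD(6)[OF lk] sup M(1) l0]]) auto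
  have lb: "locally_bounded (source f)"
    unfolding locally_bounded_def
  proof (intro allI impI)
    fix R :: real assume R: "0 < R \<and> R < 1"
    have "compact (f ` cball 0 R)"
      by (intro compact_continuous_image continuous_on_subset[OF f(2)]) (use R in auto)
    then obtain b where b: "b > 0" "\<And>y. y \<in> f ` cball 0 R \<Longrightarrow> cmod y \<le> b"
      using compact_imp_bounded bounded_pos by metis
    have "cmod (source f z) \<le> B * b" if "z \<in> cball 0 R" for z
      using order_trans[OF norm_source_le[of f z] mult_left_mono[OF b(2)[OF imageI[OF that]] less_imp_le[OF B_pos]]] .
    then show "\<exists>B\<ge>0. \<forall>z\<in>cball 0 R. cmod (source f z) \<le> B"
      using B_pos b(1) by (intro exI[of _ "B * b"]) auto
  qed
  have sm: "(\<lambda>z. source f (\<phi> z)) \<in> borel_measurable LD"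
    unfolding source_def by (intro borel_measurable_times borel_measurable_uminus borel_measurable_cnj N\<phi> fm)
  have "weak_dbar (\<lambda>z. twist f (\<phi> z)) (\<lambda>z. source f (\<phi> z) * cnj (deriv \<phi> z))"
    by (rule weak_chain_rule[where u = "twist f", OF linkedD(5)[OF lk] linkedD(1)[OF lk] source_admissible[OF linkedD(6)[OF lk] sup M(1)] lb Tc l0 \<phi> sm])
  then have "weak_dbar (C.twist (\<lambda>z. f (\<phi> z))) (C.source (\<lambda>z. f (\<phi> z)))"
    by (rule weak_dbar_cong) (simp_all add: twist_def C.twist_def source_def C.source_def N'eq)
  then show ?thesis using fm fin by (simp add: C.hardy_space_iff)
qed

end

section \<open>Compactness\<close>

lemma hardy_space_cong:
  assumes f: "f \<in> hardy_space p \<nu>" and p: "p > 0" and f': "f' \<in> borel_measurable LD" "AE z in LD. f z = f' z"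
    and \<nu>: "(\<lambda>z. complex_of_real (\<nu> z)) \<in> borel_measurable LD" "(\<lambda>z. complex_of_real (\<nu>' z)) \<in> borel_measurable LD"
      "AE z in LD. \<nu> z = \<nu>' z"
  shows "f' \<in> hardy_space p \<nu>'"
proof -
  have fm: "f \<in> borel_measurable LD" and fin: "hardy_sup p f < \<infinity>" and cb: "conj_beltrami \<nu> f"
    using f by (auto simp: hardy_space_def)
  obtain N where N: "N \<in> Linf" "weak_dbar (\<lambda>z. of_real (\<nu> z)) N"
    and eq: "\<forall>\<psi>\<in>test_functions. (LINT z|LD. f z * dbar \<psi> z) = (LINT z|LD. cnj (f z) * (of_real (\<nu> z) * dbar \<psi> z + N z * \<psi> z))"
    using cb unfolding conj_beltrami_def by blast
  have Nm: "N \<in> borel_measurable LD" using N(1) by (simp add: Linf_def)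
  have w: "weak_dbar (\<lambda>z. of_real (\<nu>' z)) N"
  proof (rule weak_dbar_cong_AE[OF N(2) _ _ \<nu>(1,2) Nm Nm])
    show "AE z in LD. complex_of_real (\<nu> z) = of_real (\<nu>' z)" using \<nu>(3) by eventually_elim simp
  qed simp
  have "(LINT z|LD. f' z * dbar \<psi> z) = (LINT z|LD. cnj (f' z) * (of_real (\<nu>' z) * dbar \<psi> z + N z * \<psi> z))"
    if \<psi>: "\<psi> \<in> test_functions" for \<psi>
  proof -
    note m = test_function_measurable[OF \<psi>]
    have "(LINT z|LD. f' z * dbar \<psi> z) = (LINT z|LD. f z * dbar \<psi> z)"
    proof (rule Bochner_Integration.integral_cong_AE)
      show "AE z in LD. f' z * dbar \<psi> z = f z * dbar \<psi> z" using f'(2) by eventually_elim simp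
    qed (intro borel_measurable_times fm f'(1) m)+
    moreover have "(LINT z|LD. cnj (f z) * (of_real (\<nu> z) * dbar \<psi> z + N z * \<psi> z)) = (LINT z|LD. cnj (f' z) * (of_real (\<nu>' z) * dbar \<psi> z + N z * \<psi> z))"
    proof (rule Bochner_Integration.integral_cong_AE)
      show "AE z in LD. cnj (f z) * (of_real (\<nu> z) * dbar \<psi> z + N z * \<psi> z) = cnj (f' z) * (of_real (\<nu>' z) * dbar \<psi> z + N z * \<psi> z)"
        using f'(2) \<nu>(3) by eventually_elim simp
    qed (intro borel_measurable_times borel_measurable_add borel_measurable_cnj fm f'(1) m \<nu> Nm)+
    ultimately show ?thesis using eq \<psi> by simp
  qed
  then have "conj_beltrami \<nu>' f'" unfolding conj_beltrami_def using N(1) w by blast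
  moreover have "hardy_sup p f' < \<infinity>" using fin hardy_sup_cong[OF fm f'(1) p f'(2)] by simp
  ultimately show ?thesis using f'(1) by (simp add: hardy_space_def)
qed

text \<open>Compactness of \<open>f \<mapsto> f \<circ> \<phi>\<close> on a set of functions with pointwise values. It is phrased through \<open>hardy_sup\<close>,
  the \<open>p\<close>-th power of the norm, since \<open>hardy_norm\<close> does not distinguish an infinite value from zero, and the limit is required to be
  a composition as well.\<close>

definition compact_composition :: "real \<Rightarrow> (complex \<Rightarrow> complex) \<Rightarrow> (complex \<Rightarrow> complex) set \<Rightarrow> bool" where
  "compact_composition p \<phi> X \<longleftrightarrow> (\<forall>f\<in>X. hardy_sup p (\<lambda>z. f (\<phi> z)) < \<infinity>) \<and>
    (\<forall>f M. (\<forall>n::nat. f n \<in> X) \<longrightarrow> (\<forall>n. hardy_sup p (f n) \<le> ennreal M) \<longrightarrow> M \<ge> 0 \<longrightarrow>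
      (\<exists>g\<in>X. \<exists>r::nat \<Rightarrow> nat. strict_mono r \<and> vanishing (\<lambda>n. hardy_sup p (\<lambda>z. f (r n) (\<phi> z) - g (\<phi> z)))))"

definition normal_family :: "real \<Rightarrow> (complex \<Rightarrow> complex) set \<Rightarrow> bool" where
  "normal_family p X \<longleftrightarrow> (\<forall>f M. (\<forall>n::nat. f n \<in> X) \<longrightarrow> (\<forall>n. hardy_sup p (f n) \<le> ennreal M) \<longrightarrow> M \<ge> 0 \<longrightarrow>
      (\<exists>g\<in>X. \<exists>r::nat \<Rightarrow> nat. strict_mono r \<and> (\<forall>z\<in>disc. (\<lambda>n. f (r n) z) \<longlonglongrightarrow> g z)))"

lemma compact_compositionD:
  assumes "compact_composition p \<phi> X"
  shows "f \<in> X \<Longrightarrow> hardy_sup p (\<lambda>z. f (\<phi> z)) < \<infinity>"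
    "(\<And>n. u n \<in> X) \<Longrightarrow> (\<And>n. hardy_sup p (u n) \<le> ennreal M) \<Longrightarrow> M \<ge> 0 \<Longrightarrow>
      \<exists>g\<in>X. \<exists>r::nat \<Rightarrow> nat. strict_mono r \<and> vanishing (\<lambda>n. hardy_sup p (\<lambda>z. u (r n) (\<phi> z) - g (\<phi> z)))"
  using assms unfolding compact_composition_def by blast+

lemma hardy_norm_le_imp_hardy_sup_le:
  assumes p: "p > 0" and fin: "hardy_sup p f < \<infinity>" and le: "hardy_norm p f \<le> b"
  shows "hardy_sup p f \<le> ennreal (b powr p)"
proof -
  let ?x = "enn2real (hardy_sup p f)"
  have eq: "ennreal ?x = hardy_sup p f" using fin by (intro ennreal_enn2real) simp
  have "?x = (?x powr (1 / p)) powr p" using p by (simp add: powr_powr)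
  also have "\<dots> \<le> b powr p" using le p unfolding hardy_norm_def by (intro powr_mono2) auto
  finally have "ennreal ?x \<le> ennreal (b powr p)" by (rule ennreal_leI)
  then show ?thesis unfolding eq .
qed

lemma hardy_sup_le_imp_hardy_norm_le:
  assumes p: "p > 0" and le: "hardy_sup p f \<le> ennreal M" "M \<ge> 0"
  shows "hardy_norm p f \<le> M powr (1 / p)"
proof -
  have "enn2real (hardy_sup p f) \<le> M" using enn2real_mono[OF le(1)] le(2) by simp
  then show ?thesis unfolding hardy_norm_def using p by (intro powr_mono2) auto
qed

lemma hardy_sup_diff_finite:
  assumes "u \<in> borel_measurable LD" "v \<in> borel_measurable LD" "p > 0" "hardy_sup p u < \<infinity>" "hardy_sup p v < \<infinity>"
  shows "hardy_sup p (\<lambda>z. u z - v z) < \<infinity>"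
proof -
  have "hardy_sup p (\<lambda>z. u z - v z) \<le> ennreal (2 powr p) * (hardy_sup p u + hardy_sup p v)"
    by (rule hardy_sup_triangle[OF borel_measurable_diff[OF assms(1,2)] assms(1,2,3)])
       (auto intro: AE_I2 norm_triangle_ineq4)
  also have "\<dots> < \<infinity>" using assms by (simp add: ennreal_mult_less_top)
  finally show ?thesis .
qed

text \<open>Every class in the Hardy space has one continuous representative, for which the abstract composition
  operator is composition of functions. By normality the norm limit of a sequence of compositions is itself
  a composition.\<close>

lemma compact_operator_comp_op_iff:
  fixes \<nu> \<mu> :: "complex \<Rightarrow> real" and \<phi> :: "complex \<Rightarrow> complex"
  assumes p: "p > 0" and \<phi>: "continuous_on disc \<phi>" "\<phi> ` disc \<subseteq> disc"
    and X: "X = {f \<in> hardy_space p \<nu>. continuous_on disc f}"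
    and rep: "\<And>f. f \<in> hardy_space p \<nu> \<Longrightarrow> \<exists>g\<in>X. AE z in LD. f z = g z"
    and normal: "normal_family p X"
    and comp: "\<And>f. f \<in> X \<Longrightarrow> hardy_sup p (\<lambda>z. f (\<phi> z)) < \<infinity> \<Longrightarrow> (\<lambda>z. f (\<phi> z)) \<in> hardy_space p \<mu>"
    and \<mu>: "(\<lambda>z. complex_of_real (\<mu> z)) \<in> borel_measurable LD"
  shows "compact_operator (hardy_space p \<nu>) (hardy_norm p) (hardy_space p \<mu>) (hardy_norm p) (comp_op \<phi>)
    \<longleftrightarrow> compact_composition p \<phi> X"
proof -
  have \<phi>d: "\<phi> z \<in> disc" if "z \<in> disc" for z using \<phi>(2) that by blast
  have cop: "comp_op \<phi> f z = g (\<phi> z)" if "g \<in> X" "AE z in LD. f z = g z" "z \<in> disc" for f g z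
    using cont_rep_eq[OF _ that(2) \<phi>d[OF that(3)]] that(1) by (simp add: comp_op_def X)
  have gm: "(\<lambda>z. g (\<phi> z)) \<in> borel_measurable LD" if "g \<in> X" for g
  proof -
    have "continuous_on disc g" using that X by auto
    then show ?thesis by (intro continuous_imp_measurable_LD continuous_on_compose2[OF _ \<phi>])
  qed
  have cm: "comp_op \<phi> f \<in> borel_measurable LD" if "g \<in> X" "AE z in LD. f z = g z" for f g
    using measurable_cong[of LD "comp_op \<phi> f" "\<lambda>z. g (\<phi> z)" borel] gm[OF that(1)] cop[OF that] by simp
  have Ym: "y \<in> borel_measurable LD" "hardy_sup p y < \<infinity>" if "y \<in> hardy_space p \<mu>" for y
    using that by (auto simp: hardy_space_def)
  have Xf: "hardy_sup p g < \<infinity>" "g \<in> hardy_space p \<nu>" if "g \<in> X" for g using that by (auto simp: X hardy_space_def)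
  have sup_eq: "hardy_sup p (comp_op \<phi> f) = hardy_sup p (\<lambda>z. g (\<phi> z))" if "g \<in> X" "AE z in LD. f z = g z" for f g
    by (rule hardy_sup_cong[OF cm[OF that] gm[OF that(1)] p]) (auto intro!: AE_I2 cop[OF that])
  have sup_diff: "hardy_sup p (comp_op \<phi> f - y) = hardy_sup p (\<lambda>z. g (\<phi> z) - y z)"
    if "g \<in> X" "AE z in LD. f z = g z" "y \<in> borel_measurable LD" for f g y
    unfolding fun_diff_def
    by (rule hardy_sup_cong[OF borel_measurable_diff[OF cm[OF that(1,2)] that(3)] borel_measurable_diff[OF gm[OF that(1)] that(3)] p])
       (auto intro!: AE_I2 cop[OF that(1,2)])
  show ?thesis
  proof
    assume L: "compact_operator (hardy_space p \<nu>) (hardy_norm p) (hardy_space p \<mu>) (hardy_norm p) (comp_op \<phi>)"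
    have fin: "hardy_sup p (\<lambda>z. f (\<phi> z)) < \<infinity>" if f: "f \<in> X" for f
    proof -
      have "comp_op \<phi> f \<in> hardy_space p \<mu>" using L Xf(2)[OF f] unfolding compact_operator_def by blast
      from Ym(2)[OF this] show ?thesis using sup_eq[OF f, of f] by simp
    qed
    show "compact_composition p \<phi> X"
      unfolding compact_composition_def
    proof (intro conjI ballI allI impI fin)
      fix f :: "nat \<Rightarrow> complex \<Rightarrow> complex" and M :: real
      assume f: "\<forall>n. f n \<in> X" and b: "\<forall>n. hardy_sup p (f n) \<le> ennreal M" "M \<ge> 0"
      obtain g s where g: "g \<in> X" "strict_mono (s :: nat \<Rightarrow> nat)" "\<forall>z\<in>disc. (\<lambda>n. f (s n) z) \<longlonglongrightarrow> g z"
        using normal f b unfolding normal_family_def by blast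
      have "\<forall>n. f (s n) \<in> hardy_space p \<nu>" using f Xf(2) by blast
      moreover have "\<exists>B. \<forall>n. hardy_norm p (f (s n)) \<le> B"
        using hardy_sup_le_imp_hardy_norm_le[OF p _ b(2)] b(1) by blast
      ultimately obtain y r where y: "y \<in> hardy_space p \<mu>" "strict_mono (r :: nat \<Rightarrow> nat)"
        "(\<lambda>n. hardy_norm p (comp_op \<phi> (f (s (r n))) - y)) \<longlonglongrightarrow> 0"
        using L[unfolded compact_operator_def, THEN conjunct2, rule_format, of "\<lambda>n. f (s n)"] by blast
      let ?u = "\<lambda>n z. f (s (r n)) (\<phi> z)"
      have um: "?u n \<in> borel_measurable LD" for n by (rule gm) (use f in blast)
      have uf: "hardy_sup p (?u n) < \<infinity>" for n by (rule fin) (use f in blast)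
      have e: "hardy_sup p (comp_op \<phi> (f (s (r n))) - y) = hardy_sup p (\<lambda>z. ?u n z - y z)" for n
        by (rule sup_diff[OF _ _ Ym(1)[OF y(1)]]) (use f in auto)
      have "vanishing (\<lambda>n. hardy_sup p (\<lambda>z. ?u n z - y z))"
      proof (rule hardy_norm_tendsto_imp_vanishing[OF p])
        show "hardy_sup p (\<lambda>z. ?u n z - y z) < \<infinity>" for n
          by (rule hardy_sup_diff_finite[OF um Ym(1)[OF y(1)] p uf Ym(2)[OF y(1)]])
        show "(\<lambda>n. hardy_norm p (\<lambda>z. ?u n z - y z)) \<longlonglongrightarrow> 0" using y(3) unfolding hardy_norm_def e .
      qed
      then have "vanishing (\<lambda>n. hardy_sup p (\<lambda>z. ?u n z - g (\<phi> z)))"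
      proof (rule vanishing_pointwise_limit[OF p um Ym(1)[OF y(1)] gm[OF g(1)], rotated])
        show "(\<lambda>n. ?u n z) \<longlonglongrightarrow> g (\<phi> z)" if "z \<in> disc" for z
          using LIMSEQ_subseq_LIMSEQ[OF g(3)[rule_format, OF \<phi>d[OF that]] y(2)] by (simp add: o_def)
      qed
      then have "vanishing (\<lambda>n. hardy_sup p (\<lambda>z. f ((s \<circ> r) n) (\<phi> z) - g (\<phi> z)))" by simp
      then show "\<exists>g\<in>X. \<exists>r. strict_mono r \<and> vanishing (\<lambda>n. hardy_sup p (\<lambda>z. f (r n) (\<phi> z) - g (\<phi> z)))"
        using g(1) strict_mono_o[OF g(2) y(2)] by blast
    qed
  next
    assume R: "compact_composition p \<phi> X"
    have inY: "comp_op \<phi> f \<in> hardy_space p \<mu>" if f: "f \<in> hardy_space p \<nu>" for f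
    proof -
      obtain g where g: "g \<in> X" "AE z in LD. f z = g z" using rep[OF f] by blast
      show ?thesis
        by (rule hardy_space_cong[OF comp[OF g(1) compact_compositionD(1)[OF R g(1)]] p cm[OF g] _ \<mu> \<mu>])
           (auto intro!: AE_I2 simp: cop[OF g])
    qed
    show "compact_operator (hardy_space p \<nu>) (hardy_norm p) (hardy_space p \<mu>) (hardy_norm p) (comp_op \<phi>)"
      unfolding compact_operator_def
    proof (intro conjI ballI allI impI inY)
      fix x :: "nat \<Rightarrow> complex \<Rightarrow> complex"
      assume x: "(\<forall>n. x n \<in> hardy_space p \<nu>) \<and> (\<exists>B. \<forall>n. hardy_norm p (x n) \<le> B)"
      then obtain b where b: "\<And>n. hardy_norm p (x n) \<le> b" by blast
      have "\<forall>n. \<exists>g. g \<in> X \<and> (AE z in LD. x n z = g z)" using rep x by blast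
      then have "\<exists>f. \<forall>n. f n \<in> X \<and> (AE z in LD. x n z = f n z)" by (rule choice)
      then obtain f where f: "\<And>n. f n \<in> X" "\<And>n. AE z in LD. x n z = f n z" by auto
      have fM: "hardy_sup p (f n) \<le> ennreal (b powr p)" for n
      proof -
        have h: "x n \<in> hardy_space p \<nu>" using x by blast
        have "hardy_sup p (x n) = hardy_sup p (f n)"
          by (rule hardy_sup_cong[OF _ _ p f(2)]) (use h Xf(2)[OF f(1)] in \<open>auto simp: hardy_space_def\<close>)
        moreover have "hardy_sup p (x n) \<le> ennreal (b powr p)"
          by (rule hardy_norm_le_imp_hardy_sup_le[OF p _ b]) (use h in \<open>simp add: hardy_space_def\<close>)
        ultimately show ?thesis by simp
      qed
      have "b powr p \<ge> 0" by simp
      obtain g r where g: "g \<in> X" "strict_mono (r :: nat \<Rightarrow> nat)" "vanishing (\<lambda>n. hardy_sup p (\<lambda>z. f (r n) (\<phi> z) - g (\<phi> z)))"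
        using compact_compositionD(2)[where u = f, OF R f(1) fM \<open>b powr p \<ge> 0\<close>] by blast
      have "(\<lambda>n. hardy_norm p (\<lambda>z. f (r n) (\<phi> z) - g (\<phi> z))) \<longlonglongrightarrow> 0"
        by (rule vanishing_imp_hardy_norm_tendsto[OF p g(3)])
      then have "(\<lambda>n. hardy_norm p (comp_op \<phi> (x (r n)) - (\<lambda>z. g (\<phi> z)))) \<longlonglongrightarrow> 0"
        unfolding hardy_norm_def sup_diff[OF f(1) f(2) gm[OF g(1)]] .
      moreover have "(\<lambda>z. g (\<phi> z)) \<in> hardy_space p \<mu>" by (rule comp[OF g(1) compact_compositionD(1)[OF R g(1)]])
      ultimately show "\<exists>y\<in>hardy_space p \<mu>. \<exists>r. strict_mono r \<and> (\<lambda>n. hardy_norm p (comp_op \<phi> (x (r n)) - y)) \<longlonglongrightarrow> 0"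
        using g(2) by blast
    qed
  qed
qed

lemma hardy_sup_finite_dominated:
  assumes m: "u \<in> borel_measurable LD" "v \<in> borel_measurable LD" and p: "p > 0" and c: "c > 0" "C \<ge> 0"
    and le: "\<And>z. z \<in> disc \<Longrightarrow> cmod (u z) \<le> c * cmod (v z) + C" and fin: "hardy_sup p v < \<infinity>"
  shows "hardy_sup p u < \<infinity>"
proof -
  have m': "(\<lambda>z. of_real c * v z) \<in> borel_measurable LD" "(\<lambda>_. of_real C :: complex) \<in> borel_measurable LD" using m by simp_all
  have "hardy_sup p u \<le> ennreal (2 powr p) * (hardy_sup p (\<lambda>z. of_real c * v z) + hardy_sup p (\<lambda>_. of_real C))"
    by (rule hardy_sup_triangle[OF m(1) m' p]) (use le c in \<open>auto simp: norm_mult intro!: AE_I2\<close>)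
  also have "\<dots> \<le> ennreal (2 powr p) * (ennreal (c powr p) * hardy_sup p v + ennreal (C powr p))"
    by (intro mult_left_mono add_mono hardy_sup_scaled[OF m'(1) m(2) p c(1)] hardy_sup_bounded[OF m'(2) p c(2)])
       (use c in \<open>auto simp: norm_mult\<close>)
  also have "\<dots> < \<infinity>" using fin by (simp add: ennreal_mult_less_top)
  finally show ?thesis .
qed

lemma classical_beltrami: "p > 1 \<Longrightarrow> beltrami p 0 1 (\<lambda>_. 0) (\<lambda>_. 0)"
  by unfold_locales (auto simp: weak_dbar_def)

context beltrami
begin

text \<open>The generalized and the classical Hardy space, each through its unique continuous representatives.\<close>

definition X where "X = {f \<in> hardy_space p \<nu>. continuous_on disc f}"

definition X0 where "X0 = {G. G holomorphic_on disc \<and> hardy_sup p G < \<infinity>}"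

lemma linked_in: "linked l f G \<Longrightarrow> l \<ge> 0 \<Longrightarrow> f \<in> X"
  using linked_imp_hardy_space linkedD(2) by (auto simp: X_def)

lemma linked_in0: assumes "linked l f G" "l \<ge> 0" shows "G \<in> X0"
proof -
  obtain M where M: "M \<ge> 0" "hardy_sup p f = ennreal M" using linkedD(3)[OF assms(1)] by (cases "hardy_sup p f") auto
  have "hardy_sup p f \<le> ennreal M" by (simp add: M)
  from analytic_part_hardy[OF assms this M(1)] show ?thesis
    using linkedD(1)[OF assms(1)] by (auto simp: X0_def intro: le_less_trans)
qed

lemma X_rep: "f \<in> hardy_space p \<nu> \<Longrightarrow> \<exists>g\<in>X. AE z in LD. f z = g z"
  using hardy_space_imp_linked[of f 0] linked_in[of 0] by (metis order_refl)

lemma normal_family_X: "normal_family p X"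
  unfolding normal_family_def
proof (intro allI impI)
  fix f :: "nat \<Rightarrow> complex \<Rightarrow> complex" and M :: real
  assume f: "\<forall>n. f n \<in> X" and b: "\<forall>n. hardy_sup p (f n) \<le> ennreal M" "M \<ge> 0"
  have "\<forall>n. \<exists>G. linked 0 (f n) G" using continuous_hardy_linked f by (auto simp: X_def)
  then obtain G where G: "\<And>n. linked 0 (f n) (G n)" by metis
  show "\<exists>g\<in>X. \<exists>r. strict_mono r \<and> (\<forall>z\<in>disc. (\<lambda>n. f (r n) z) \<longlonglongrightarrow> g z)"
    using linked_subsequence[where f = f and G = G and M = M, OF order_refl G] b unfolding X_def by blast
qed

text \<open>Along a subsequence the two families differ, up to constant factors, by a uniformly convergent term, so
  their compositions with \<open>\<phi>\<close> converge in norm together.\<close>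

lemma compact_composition_iff_classical:
  assumes \<phi>: "continuous_on disc \<phi>" "\<phi> ` disc \<subseteq> disc"
  shows "compact_composition p \<phi> X \<longleftrightarrow> compact_composition p \<phi> X0"
proof -
  have p0: "p > 0" using p by simp
  have \<phi>d: "\<phi> z \<in> disc" if "z \<in> disc" for z using \<phi>(2) that by blast
  have cm: "(\<lambda>z. g (\<phi> z)) \<in> borel_measurable LD" if "continuous_on disc g" for g :: "complex \<Rightarrow> complex"
    by (intro continuous_imp_measurable_LD continuous_on_compose2[OF that \<phi>])
  have Xm: "(\<lambda>z. f (\<phi> z)) \<in> borel_measurable LD" if "f \<in> X" for f using that by (intro cm) (simp add: X_def)
  have X0m: "(\<lambda>z. f (\<phi> z)) \<in> borel_measurable LD" if "f \<in> X0" for f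
    using that by (intro cm holomorphic_on_imp_continuous_on) (simp add: X0_def)
  have linked_ex: "\<exists>G. linked l f G" if "f \<in> X" "l \<ge> 0" for f l
    using continuous_hardy_linked that by (simp add: X_def)
  have T_le: "\<exists>C\<ge>0. \<forall>z\<in>disc. cmod (T l (source f) z) \<le> C" if lk: "linked l f G" and l: "l \<ge> 0" for l f G
  proof -
    obtain M where M: "M \<ge> 0" "hardy_sup p f = ennreal M" using linkedD(3)[OF lk] by (cases "hardy_sup p f") auto
    have "hardy_sup p f \<le> ennreal M" by (simp add: M)
    then show ?thesis
      using linked_T_bound[OF lk l _ M(1)] cadm_nonneg[OF M(1)] by (intro exI[of _ "exp (2 * l) * cadm M"]) auto
  qed
  show ?thesis
  proof
    assume R: "compact_composition p \<phi> X0"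
    show "compact_composition p \<phi> X"
      unfolding compact_composition_def
    proof (intro conjI ballI allI impI)
      fix f assume f: "f \<in> X"
      obtain G where lk: "linked 0 f G" using linked_ex[OF f order_refl] by blast
      obtain C where C: "C \<ge> 0" "\<forall>z\<in>disc. cmod (T 0 (source f) z) \<le> C" using T_le[OF lk order_refl] by blast
      show "hardy_sup p (\<lambda>z. f (\<phi> z)) < \<infinity>"
      proof (rule hardy_sup_finite_dominated[OF Xm[OF f] X0m[OF linked_in0[OF lk order_refl]] p0, of "1 / (1 - \<kappa>)" "C / (1 - \<kappa>)"])
        fix z :: complex assume z: "z \<in> disc"
        have "cmod (f (\<phi> z)) \<le> (cmod (G (\<phi> z)) + cmod (T 0 (source f) (\<phi> z))) / (1 - \<kappa>)"
          by (rule norm_le_analytic_part[OF lk \<phi>d[OF z]])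
        also have "\<dots> \<le> (cmod (G (\<phi> z)) + C) / (1 - \<kappa>)"
          using C(2) \<phi>d[OF z] kappa by (intro divide_right_mono add_left_mono) auto
        finally show "cmod (f (\<phi> z)) \<le> 1 / (1 - \<kappa>) * cmod (G (\<phi> z)) + C / (1 - \<kappa>)" by (simp add: add_divide_distrib)
      qed (use kappa C(1) compact_compositionD(1)[OF R linked_in0[OF lk order_refl]] in auto)
    next
      fix f :: "nat \<Rightarrow> complex \<Rightarrow> complex" and M :: real
      assume f: "\<forall>n. f n \<in> X" and b': "\<forall>n. hardy_sup p (f n) \<le> ennreal M" and M: "M \<ge> 0"
      have b: "hardy_sup p (f n) \<le> ennreal M" for n using b' by blast
      have "\<forall>n. \<exists>G. linked 0 (f n) G" using linked_ex f by blast
      then obtain G where lk: "\<And>n. linked 0 (f n) (G n)" by metis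
      obtain r h G' f' where r: "strict_mono (r :: nat \<Rightarrow> nat)" "continuous_on disc h"
        and u: "\<forall>e>0. \<forall>\<^sub>F n in sequentially. \<forall>z\<in>disc. cmod (T 0 (source (f (r n))) z - h z) \<le> e"
        and G': "G' holomorphic_on disc" "hardy_sup p G' < \<infinity>" "\<forall>z\<in>disc. (\<lambda>n. G (r n) z) \<longlonglongrightarrow> G' z"
        and f': "f' \<in> hardy_space p \<nu>" "continuous_on disc f'" "\<forall>z\<in>disc. twist f' z = G' z + h z"
        using linked_subsequence[where f = f and G = G and M = M, OF order_refl lk b M] by blast
      have f'X: "f' \<in> X" and G'X: "G' \<in> X0" using f' G' by (simp_all add: X_def X0_def)
      let ?M = "2 powr p * (2 powr p * M + (exp (2 * 0) * cadm M) powr p)"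
      have GM: "hardy_sup p (G n) \<le> ennreal ?M" for n by (rule analytic_part_hardy[OF lk order_refl b M])
      have M2: "?M \<ge> 0" using M by simp
      obtain g s where g: "g \<in> X0" "strict_mono (s :: nat \<Rightarrow> nat)"
        "vanishing (\<lambda>n. hardy_sup p (\<lambda>z. G (r (s n)) (\<phi> z) - g (\<phi> z)))"
        using compact_compositionD(2)[where u = "\<lambda>n. G (r n)", OF R linked_in0[OF lk order_refl] GM M2] by blast
      have Gm: "(\<lambda>z. G (r (s n)) (\<phi> z)) \<in> borel_measurable LD" for n by (rule X0m[OF linked_in0[OF lk order_refl]])
      have fm: "(\<lambda>z. f (r (s n)) (\<phi> z)) \<in> borel_measurable LD" for n by (rule Xm) (use f in blast)
      have van: "vanishing (\<lambda>n. hardy_sup p (\<lambda>z. G (r (s n)) (\<phi> z) - G' (\<phi> z)))"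
      proof (rule vanishing_pointwise_limit[OF p0 Gm X0m[OF g(1)] X0m[OF G'X] _ g(3)])
        show "(\<lambda>n. G (r (s n)) (\<phi> z)) \<longlonglongrightarrow> G' (\<phi> z)" if "z \<in> disc" for z
          using LIMSEQ_subseq_LIMSEQ[OF G'(3)[rule_format, OF \<phi>d[OF that]] g(2)] by (simp add: o_def)
      qed
      let ?h = "\<lambda>n z. T 0 (source (f (r (s n)))) (\<phi> z) - h (\<phi> z)"
      have "vanishing (\<lambda>n. hardy_sup p (\<lambda>z. f (r (s n)) (\<phi> z) - f' (\<phi> z)))"
      proof (rule vanishing_dominated[OF p0 _ _ _ _ _ van, where h = ?h])
        show "1 / (1 - \<kappa>) > 0" using kappa by simp
        show "\<forall>\<^sub>F n in sequentially. \<forall>z\<in>disc. cmod (?h n z) \<le> e" if "e > 0" for e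
          using eventually_subseq[OF g(2) u[rule_format, OF that]] by eventually_elim (use \<phi>d in blast)
        show "(\<lambda>z. f (r (s n)) (\<phi> z) - f' (\<phi> z)) \<in> borel_measurable LD"
          "(\<lambda>z. G (r (s n)) (\<phi> z) - G' (\<phi> z)) \<in> borel_measurable LD" for n
          by (intro borel_measurable_diff fm Gm Xm[OF f'X] X0m[OF G'X])+
        fix n z assume z: "z \<in> disc"
        let ?d = "\<lambda>w. f (r (s n)) w - f' w"
        let ?w = "\<phi> z"
        have tw: "twist ?d ?w = (G (r (s n)) ?w - G' ?w) + ?h n z"
        proof -
          have "twist ?d ?w = twist (f (r (s n))) ?w - twist f' ?w" by (simp add: twist_def algebra_simps)
          also have "\<dots> = (G (r (s n)) ?w + T 0 (source (f (r (s n)))) ?w) - (G' ?w + h ?w)"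
            using linkedD(5)[OF lk \<phi>d[OF z]] f'(3) \<phi>d[OF z] by simp
          finally show ?thesis by simp
        qed
        have "?d ?w = untwist (twist ?d) ?w" by (rule untwist_unique[where f = ?d and g = "twist ?d", OF \<phi>d[OF z] refl])
        then have "cmod (?d ?w) \<le> cmod (twist ?d ?w) / (1 - \<kappa>)" using norm_untwist_le[OF \<phi>d[OF z], of "twist ?d"] by simp
        also have "\<dots> \<le> (cmod (G (r (s n)) ?w - G' ?w) + cmod (?h n z)) / (1 - \<kappa>)"
          unfolding tw using kappa by (intro divide_right_mono norm_triangle_ineq) simp
        finally show "cmod (f (r (s n)) (\<phi> z) - f' (\<phi> z)) \<le> 1 / (1 - \<kappa>) * (cmod (G (r (s n)) (\<phi> z) - G' (\<phi> z)) + cmod (?h n z))"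
          by simp
      qed
      then have "vanishing (\<lambda>n. hardy_sup p (\<lambda>z. f ((r \<circ> s) n) (\<phi> z) - f' (\<phi> z)))" by simp
      then show "\<exists>g\<in>X. \<exists>r. strict_mono r \<and> vanishing (\<lambda>n. hardy_sup p (\<lambda>z. f (r n) (\<phi> z) - g (\<phi> z)))"
        using f'X strict_mono_o[OF r(1) g(2)] by blast
    qed
  next
    assume R: "compact_composition p \<phi> X"
    obtain l where l: "l > 0" and solve: "\<And>M. M \<ge> 0 \<Longrightarrow> \<exists>M'\<ge>0. \<forall>G. G holomorphic_on disc \<and> hardy_sup p G \<le> ennreal M \<longrightarrow> (\<exists>f. linked l f G \<and> hardy_sup p f \<le> ennreal M')"
      by (rule solution_with_analytic_part, rule that)
    have l0: "l \<ge> 0" using l by simp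
    show "compact_composition p \<phi> X0"
      unfolding compact_composition_def
    proof (intro conjI ballI allI impI)
      fix G assume G: "G \<in> X0"
      obtain M where M: "M \<ge> 0" "hardy_sup p G = ennreal M" using G by (cases "hardy_sup p G") (auto simp: X0_def)
      obtain f where lk: "linked l f G" using solve[OF M(1)] G M(2) unfolding X0_def by fastforce
      obtain C where C: "C \<ge> 0" "\<forall>z\<in>disc. cmod (T l (source f) z) \<le> C" using T_le[OF lk l0] by blast
      show "hardy_sup p (\<lambda>z. G (\<phi> z)) < \<infinity>"
      proof (rule hardy_sup_finite_dominated[OF X0m[OF G] Xm[OF linked_in[OF lk l0]] p0, of 2 C])
        fix z :: complex assume z: "z \<in> disc"
        have "cmod (T l (source f) (\<phi> z)) \<le> C" using C(2) \<phi>d[OF z] by blast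
        then show "cmod (G (\<phi> z)) \<le> 2 * cmod (f (\<phi> z)) + C" using norm_analytic_part_le[OF lk \<phi>d[OF z]] by simp
      qed (use C(1) compact_compositionD(1)[OF R linked_in[OF lk l0]] in auto)
    next
      fix G :: "nat \<Rightarrow> complex \<Rightarrow> complex" and M :: real
      assume G: "\<forall>n. G n \<in> X0" and b': "\<forall>n. hardy_sup p (G n) \<le> ennreal M" and M: "M \<ge> 0"
      obtain M' where M': "M' \<ge> 0" "\<forall>G. G holomorphic_on disc \<and> hardy_sup p G \<le> ennreal M \<longrightarrow> (\<exists>f. linked l f G \<and> hardy_sup p f \<le> ennreal M')"
        using solve[OF M] by blast
      have "\<forall>n. \<exists>f. linked l f (G n) \<and> hardy_sup p f \<le> ennreal M'" using G b' M'(2) by (simp add: X0_def)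
      then obtain f where lk: "\<And>n. linked l (f n) (G n)" and b: "\<And>n. hardy_sup p (f n) \<le> ennreal M'" by metis
      obtain r h G' f' where r: "strict_mono (r :: nat \<Rightarrow> nat)" "continuous_on disc h"
        and u: "\<forall>e>0. \<forall>\<^sub>F n in sequentially. \<forall>z\<in>disc. cmod (T l (source (f (r n))) z - h z) \<le> e"
        and G': "G' holomorphic_on disc" "hardy_sup p G' < \<infinity>"
        and f': "f' \<in> hardy_space p \<nu>" "continuous_on disc f'" "\<forall>z\<in>disc. (\<lambda>n. f (r n) z) \<longlonglongrightarrow> f' z" "\<forall>z\<in>disc. twist f' z = G' z + h z"
        using linked_subsequence[where f = f and G = G and M = M', OF l0 lk b M'(1)] by blast
      have f'X: "f' \<in> X" and G'X: "G' \<in> X0" using f' G' by (simp_all add: X_def X0_def)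
      obtain g s where g: "g \<in> X" "strict_mono (s :: nat \<Rightarrow> nat)"
        "vanishing (\<lambda>n. hardy_sup p (\<lambda>z. f (r (s n)) (\<phi> z) - g (\<phi> z)))"
        using compact_compositionD(2)[where u = "\<lambda>n. f (r n)", OF R linked_in[OF lk l0] b M'(1)] by blast
      have Gm: "(\<lambda>z. G (r (s n)) (\<phi> z)) \<in> borel_measurable LD" for n by (rule X0m) (use G in blast)
      have fm: "(\<lambda>z. f (r (s n)) (\<phi> z)) \<in> borel_measurable LD" for n by (rule Xm[OF linked_in[OF lk l0]])
      have van: "vanishing (\<lambda>n. hardy_sup p (\<lambda>z. f (r (s n)) (\<phi> z) - f' (\<phi> z)))"
      proof (rule vanishing_pointwise_limit[OF p0 fm Xm[OF g(1)] Xm[OF f'X] _ g(3)])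
        show "(\<lambda>n. f (r (s n)) (\<phi> z)) \<longlonglongrightarrow> f' (\<phi> z)" if "z \<in> disc" for z
          using LIMSEQ_subseq_LIMSEQ[OF f'(3)[rule_format, OF \<phi>d[OF that]] g(2)] by (simp add: o_def)
      qed
      let ?h = "\<lambda>n z. T l (source (f (r (s n)))) (\<phi> z) - h (\<phi> z)"
      have "vanishing (\<lambda>n. hardy_sup p (\<lambda>z. G (r (s n)) (\<phi> z) - G' (\<phi> z)))"
      proof (rule vanishing_dominated[OF p0 _ _ _ _ _ van, where h = ?h and c = 2])
        show "\<forall>\<^sub>F n in sequentially. \<forall>z\<in>disc. cmod (?h n z) \<le> e" if "e > 0" for e
          using eventually_subseq[OF g(2) u[rule_format, OF that]] by eventually_elim (use \<phi>d in blast)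
        show "(\<lambda>z. f (r (s n)) (\<phi> z) - f' (\<phi> z)) \<in> borel_measurable LD"
          "(\<lambda>z. G (r (s n)) (\<phi> z) - G' (\<phi> z)) \<in> borel_measurable LD" for n
          by (intro borel_measurable_diff fm Gm Xm[OF f'X] X0m[OF G'X])+
        fix n z assume z: "z \<in> disc"
        let ?d = "\<lambda>w. f (r (s n)) w - f' w"
        let ?w = "\<phi> z"
        have "twist ?d ?w = twist (f (r (s n))) ?w - twist f' ?w" by (simp add: twist_def algebra_simps)
        also have "\<dots> = (G (r (s n)) ?w + T l (source (f (r (s n)))) ?w) - (G' ?w + h ?w)"
          using linkedD(5)[OF lk \<phi>d[OF z]] f'(4) \<phi>d[OF z] by simp
        finally have "G (r (s n)) ?w - G' ?w = twist ?d ?w - ?h n z" by simp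
        then have 1: "cmod (G (r (s n)) ?w - G' ?w) \<le> cmod (twist ?d ?w) + cmod (?h n z)" by (simp only: norm_triangle_ineq4)
        have 2: "x \<le> 2 * (d + e)" if "x \<le> t + e" "t \<le> 2 * d" "0 \<le> e" for x t d e :: real using that by simp
        show "cmod (G (r (s n)) (\<phi> z) - G' (\<phi> z)) \<le> 2 * (cmod (f (r (s n)) (\<phi> z) - f' (\<phi> z)) + cmod (?h n z))"
          by (rule 2[OF 1 norm_twist_le[OF \<phi>d[OF z], of ?d] norm_ge_zero])
      qed simp
      then have "vanishing (\<lambda>n. hardy_sup p (\<lambda>z. G ((r \<circ> s) n) (\<phi> z) - G' (\<phi> z)))" by simp
      then show "\<exists>g\<in>X0. \<exists>r. strict_mono r \<and> vanishing (\<lambda>n. hardy_sup p (\<lambda>z. G (r n) (\<phi> z) - g (\<phi> z)))"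
        using G'X strict_mono_o[OF r(1) g(2)] by blast
    qed
  qed
qed

text \<open>The right-hand side does not mention \<open>\<nu>\<close>: it is the same for all coefficients, and in particular for
  \<open>\<nu> = 0\<close>.\<close>

lemma compact_operator_iff:
  assumes \<phi>: "\<phi> holomorphic_on disc" "\<phi> ` disc \<subseteq> disc" and C: "C > 0" "\<And>z. z \<in> disc \<Longrightarrow> cmod (deriv \<phi> z) \<le> C"
  shows "compact_operator (hardy_space p \<nu>) (hardy_norm p) (hardy_space p (\<lambda>z. \<nu> (\<phi> z))) (hardy_norm p) (comp_op \<phi>)
    \<longleftrightarrow> compact_composition p \<phi> X0"
proof -
  have c: "continuous_on disc \<phi>" by (rule holomorphic_on_imp_continuous_on[OF \<phi>(1)])
  have "compact_operator (hardy_space p \<nu>) (hardy_norm p) (hardy_space p (\<lambda>z. \<nu> (\<phi> z))) (hardy_norm p) (comp_op \<phi>)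
    \<longleftrightarrow> compact_composition p \<phi> X"
  proof (rule compact_operator_comp_op_iff[OF _ c \<phi>(2) X_def X_rep normal_family_X])
    show "(\<lambda>z. f (\<phi> z)) \<in> hardy_space p (\<lambda>z. \<nu> (\<phi> z))" if "f \<in> X" "hardy_sup p (\<lambda>z. f (\<phi> z)) < \<infinity>" for f
      by (rule hardy_space_compose[OF \<phi> C]) (use that in \<open>auto simp: X_def\<close>)
    show "(\<lambda>z. complex_of_real (\<nu> (\<phi> z))) \<in> borel_measurable LD"
      by (intro continuous_imp_measurable_LD continuous_intros continuous_on_compose2[OF nu_cont c \<phi>(2)])
  qed (use p in simp)
  then show ?thesis using compact_composition_iff_classical[OF c \<phi>(2)] by simp
qed

end

text \<open>Almost everywhere \<open>\<nu>\<close> is the sum of a holomorphic function and the Cauchy transform of its bounded derivative,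
  and this sum is continuous. By continuity the essential bound holds everywhere.\<close>

lemma continuous_representative_W1inf:
  assumes \<nu>: "(\<lambda>z. complex_of_real (\<nu> z)) \<in> W1inf" and k: "0 \<le> \<kappa>" "Linf_norm \<nu> \<le> ennreal \<kappa>"
  obtains \<nu>' N B where "continuous_on disc \<nu>'" "\<And>z. z \<in> disc \<Longrightarrow> \<bar>\<nu>' z\<bar> \<le> \<kappa>" "AE z in LD. \<nu> z = \<nu>' z"
    "N \<in> borel_measurable borel" "\<And>z. cmod (N z) \<le> B" "B > 0" "weak_dbar (\<lambda>z. of_real (\<nu>' z)) N"
proof -
  let ?n = "\<lambda>z. complex_of_real (\<nu> z)"
  obtain v w where vw: "?n \<in> Linf" "v \<in> Linf" "weak_partial 1 ?n v" "w \<in> Linf" "weak_partial \<i> ?n w"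
    using \<nu> by (auto simp: W1inf_def)
  let ?v = "\<lambda>z. (v z + \<i> * w z) / 2"
  have wd: "weak_dbar ?n ?v" by (rule weak_partial_imp_weak_dbar[OF vw(2,4,1,3,5)])
  obtain N1 B1 where N1: "N1 \<in> borel_measurable borel" "B1 > 0" "\<And>z. cmod (N1 z) \<le> B1" "AE z in LD. v z = N1 z"
    by (rule Linf_bounded_representative[OF vw(2)], rule that)
  obtain N2 B2 where N2: "N2 \<in> borel_measurable borel" "B2 > 0" "\<And>z. cmod (N2 z) \<le> B2" "AE z in LD. w z = N2 z"
    by (rule Linf_bounded_representative[OF vw(4)], rule that)
  define N where "N = (\<lambda>z. (N1 z + \<i> * N2 z) / 2)"
  define B where "B = B1 + B2"
  have B: "B > 0" using N1 N2 by (simp add: B_def)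
  have Nm: "N \<in> borel_measurable borel" unfolding N_def using N1(1) N2(1) by measurable
  have Nle: "cmod (N z) \<le> B" for z
  proof -
    have "cmod (N1 z + \<i> * N2 z) \<le> cmod (N1 z) + cmod (N2 z)" using norm_triangle_ineq[of "N1 z" "\<i> * N2 z"] by (simp add: norm_mult)
    also have "\<dots> \<le> B" using N1(3)[of z] N2(3)[of z] by (simp add: B_def)
    finally show ?thesis using B by (simp add: N_def norm_divide)
  qed
  have nm: "?n \<in> borel_measurable LD" "v \<in> borel_measurable LD" "w \<in> borel_measurable LD" using vw by (auto simp: Linf_def)
  have NLD: "N \<in> borel_measurable LD" by (rule borel_measurable_LD[OF Nm])
  have vm: "?v \<in> borel_measurable LD" using nm by measurable
  have wdN: "weak_dbar ?n N"
  proof (rule weak_dbar_cong_AE[OF wd _ _ nm(1) nm(1) vm NLD])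
    show "AE z in LD. ?v z = N z" using N1(4) N2(4) by eventually_elim (simp add: N_def)
  qed simp
  have B0: "B \<ge> 0" using B by simp
  have l0: "(0::real) \<le> 0" by simp
  obtain G where G: "G holomorphic_on disc" "AE z in LD. ?n z = G z + T 0 N z"
    by (rule weak_dbar_representation[OF Linf_integrable[OF vw(1)] wdN bounded_admissible[OF NLD B0 Nle] l0], rule that)
  define \<nu>' where "\<nu>' = (\<lambda>z. Re (G z + T 0 N z))"
  have Tc: "continuous_on disc (T 0 N)"
    by (rule continuous_on_subset[OF bounded_T_continuous[OF NLD B0 Nle l0]]) auto
  have c: "continuous_on disc \<nu>'"
    unfolding \<nu>'_def by (intro continuous_intros Tc holomorphic_on_imp_continuous_on[OF G(1)])
  have ae: "AE z in LD. \<nu> z = \<nu>' z"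
    using G(2) by eventually_elim (metis Re_complex_of_real \<nu>'_def)
  have le: "\<bar>\<nu>' z\<bar> \<le> \<kappa>" if z: "z \<in> disc" for z
  proof -
    have "AE z in LD. ennreal (norm (\<nu> z)) \<le> Linf_norm \<nu>"
      unfolding Linf_norm_def by (rule esssup_AE)
    with ae have ae2: "AE z in LD. max \<bar>\<nu>' z\<bar> \<kappa> = \<kappa>"
    proof eventually_elim
      fix z assume "\<nu> z = \<nu>' z" "ennreal (norm (\<nu> z)) \<le> Linf_norm \<nu>"
      then have "ennreal \<bar>\<nu>' z\<bar> \<le> ennreal \<kappa>" using k(2) order_trans by fastforce
      then show "max \<bar>\<nu>' z\<bar> \<kappa> = \<kappa>" using k(1) by simp
    qed
    have "max \<bar>\<nu>' z\<bar> \<kappa> = \<kappa>"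
      by (rule AE_LD_continuous_imp[OF _ _ ae2 z]) (intro continuous_intros c)+
    then show ?thesis by (simp add: max_def split: if_splits)
  qed
  have "weak_dbar (\<lambda>z. of_real (\<nu>' z)) N"
  proof (rule weak_dbar_cong_AE[OF wdN _ _ nm(1) _ NLD NLD])
    show "AE z in LD. ?n z = of_real (\<nu>' z)" using ae by eventually_elim simp
    show "(\<lambda>z. complex_of_real (\<nu>' z)) \<in> borel_measurable LD" by (intro continuous_imp_measurable_LD continuous_intros c)
  qed simp
  from that[OF c le ae Nm Nle B this] show ?thesis .
qed

theorem corollary4:
  fixes p \<kappa> :: real and \<phi> :: "complex \<Rightarrow> complex" and \<nu> :: "complex \<Rightarrow> real"
  assumes "1 < p"
    and "\<phi> holomorphic_on disc" and "\<phi> ` disc \<subseteq> disc" and "\<phi> \<in> W1inf"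
    and "(\<lambda>z. complex_of_real (\<nu> z)) \<in> W1inf"
    and "0 < \<kappa>" and "\<kappa> < 1" and "Linf_norm \<nu> \<le> ennreal \<kappa>"
  shows "compact_operator (hardy_space p \<nu>) (hardy_norm p)
           (hardy_space p (comp_op \<phi> \<nu>)) (hardy_norm p) (comp_op \<phi>)
     \<longleftrightarrow> compact_operator (hardy_space p (\<lambda>_. 0)) (hardy_norm p)
           (hardy_space p (\<lambda>_. 0)) (hardy_norm p) (comp_op \<phi>)"
proof -
  note \<phi> = assms(2,3)
  have p0: "p > 0" using assms(1) by simp
  have k0: "0 \<le> \<kappa>" using assms(6) by simp
  have c: "continuous_on disc \<phi>" by (rule holomorphic_on_imp_continuous_on[OF \<phi>(1)])
  have \<phi>d: "\<phi> z \<in> disc" if "z \<in> disc" for z using \<phi>(2) that by blast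
  obtain v where v: "v \<in> Linf" "weak_partial 1 \<phi> v" and "\<phi> \<in> Linf" using assms(4) by (auto simp: W1inf_def)
  obtain C where C: "C > 0" "\<And>z. z \<in> disc \<Longrightarrow> cmod (deriv \<phi> z) \<le> C"
    by (rule holomorphic_deriv_bound[OF \<phi>(1) Linf_integrable[OF \<open>\<phi> \<in> Linf\<close>] v(2,1)], rule that)
  obtain \<nu>' N B where n: "continuous_on disc \<nu>'" "\<And>z. z \<in> disc \<Longrightarrow> \<bar>\<nu>' z\<bar> \<le> \<kappa>" "AE z in LD. \<nu> z = \<nu>' z"
    "N \<in> borel_measurable borel" "\<And>z. cmod (N z) \<le> B" "B > 0" "weak_dbar (\<lambda>z. of_real (\<nu>' z)) N"
    by (rule continuous_representative_W1inf[OF assms(5) k0 assms(8)], rule that)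
  interpret beltrami p \<kappa> B \<nu>' N
    by unfold_locales (use assms(1,7) k0 n in auto)
  interpret Z: beltrami p 0 1 "\<lambda>_. 0" "\<lambda>_. 0" by (rule classical_beltrami[OF assms(1)])
  have m: "(\<lambda>z. complex_of_real (\<nu> z)) \<in> borel_measurable LD" using assms(5) by (simp add: W1inf_def Linf_def)
  have c\<phi>: "continuous_on disc (\<lambda>z. \<nu>' (\<phi> z))" by (rule continuous_on_compose2[OF n(1) c \<phi>(2)])
  have m\<phi>: "(\<lambda>z. complex_of_real (\<nu>' (\<phi> z))) \<in> borel_measurable LD"
    by (intro continuous_imp_measurable_LD continuous_intros c\<phi>)
  have eq: "comp_op \<phi> \<nu> z = \<nu>' (\<phi> z)" if "z \<in> disc" for z
    using cont_rep_eq[OF n(1,3) \<phi>d[OF that]] by (simp add: comp_op_def)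
  have mc: "(\<lambda>z. complex_of_real (comp_op \<phi> \<nu> z)) \<in> borel_measurable LD"
    using m\<phi> measurable_cong[of LD "\<lambda>z. complex_of_real (comp_op \<phi> \<nu> z)" "\<lambda>z. complex_of_real (\<nu>' (\<phi> z))" borel] eq by simp
  have sub: "hardy_space p \<alpha> \<subseteq> hardy_space p \<beta>"
    if "(\<lambda>z. complex_of_real (\<alpha> z)) \<in> borel_measurable LD" "(\<lambda>z. complex_of_real (\<beta> z)) \<in> borel_measurable LD" "AE z in LD. \<alpha> z = \<beta> z" for \<alpha> \<beta>
  proof
    fix f assume f: "f \<in> hardy_space p \<alpha>"
    show "f \<in> hardy_space p \<beta>"
      by (rule hardy_space_cong[OF f p0 _ _ that]) (use f in \<open>auto simp: hardy_space_def\<close>)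
  qed
  have aesym: "AE z in LD. \<nu>' z = \<nu> z" using n(3) by eventually_elim simp
  have "hardy_space p \<nu> = hardy_space p \<nu>'"
    by (intro Set.equalityI sub m of_real_nu_measurable(1) n(3) aesym)
  moreover have "hardy_space p (comp_op \<phi> \<nu>) = hardy_space p (\<lambda>z. \<nu>' (\<phi> z))"
    by (intro Set.equalityI sub mc m\<phi>) (auto intro!: AE_I2 simp: eq)
  ultimately show ?thesis
    using compact_operator_iff[OF \<phi> C] Z.compact_operator_iff[OF \<phi> C] by (simp add: X0_def Z.X0_def)
qed

end
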